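(* Let $f\in C(\overline{\mathbb{D}^{2}})$, let $T_{f}:A^{2}(\mathbb{D}^{2})\rightarrow A^{2}(\mathbb{D}^{2})$ be the Toeplitz operator with symbol $f$, and let $\sigma_{e}(T_{f})$ be the essential spectrum of $T_{f}$. Then $$\sigma_{e}(T_{f})=\bigg(\bigcup_{e^{i\theta_{1}}\in\mathbb{T}}\sigma(T_{f_{\theta_{1}}})\bigg)\cup\bigg(\bigcup_{e^{i\theta_{2}}\in\mathbb{T}}\sigma(T_{f_{\theta_{2}}})\bigg),$$ where, for $e^{i\theta_1},e^{i\theta_2}\in\mathbb{T}$, $f_{\theta_{1}}(w):=f(e^{i\theta_{1}},w)$ and $f_{\theta_{2}}(z):=f(z,e^{i\theta_{2}})$ for $z,w\in\overline{\mathbb{D}}$, and $T_{f_{\theta_{1}}}$, $T_{f_{\theta_{2}}}$ are the Toeplitz operators on $A^{2}(\mathbb{D})$ with symbols $f_{\theta_{1}}$, $f_{\theta_{2}}\in C(\overline{\mathbb{D}})$ respectively.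
   Context: $\mathbb{D}$ is the open unit disc in $\mathbb{C}$, $\mathbb{T}$ the unit circle, and $C(X)$ denotes the continuous complex-valued functions on $X$. $A^{2}(\mathbb{D})$ is the Bergman space of analytic $g:\mathbb{D}\to\mathbb{C}$ with $\iint_{\mathbb{D}}|g(z)|^{2}\,dA(z)<\infty$ ($dA$ is area measure), a Hilbert space with inner product $\langle g,h\rangle=\iint_{\mathbb{D}}g\overline{h}\,dA$. $A^{2}(\mathbb{D}^{2})$ is the Bergman space of analytic $g:\mathbb{D}^{2}\to\mathbb{C}$ with $\iiiint_{\mathbb{D}^{2}}|g(z,w)|^{2}\,dA(z)\,dA(w)<\infty$, a Hilbert space with the $L^{2}(\mathbb{D}^2, dA\times dA)$ inner product. Toeplitz operators: for $\varphi\in C(\overline{\mathbb{D}})$, $T_{\varphi}:=PM_{\varphi}$ on $A^{2}(\mathbb{D})$, where $P:L^{2}(\mathbb{D})\to A^{2}(\mathbb{D})$ is the orthogonal projection and $M_\varphi g=\varphi g$; for $f\in C(\overline{\mathbb{D}^{2}})$, $T_{f}:=P_{2}M_{f}$ on $A^{2}(\mathbb{D}^{2})$, where $P_{2}:L^{2}(\mathbb{D}^{2})\to A^{2}(\mathbb{D}^{2})$ is the orthogonal projection and $M_f g=fg$. $\sigma(T)$ is the spectrum of a bounded operator $T$. The essential spectrum $\sigma_e(T)$ of a bounded operator $T$ on a Hilbert space $H$ is the spectrum of the coset $T+K(H)$ in the Calkin algebra $B(H)/K(H)$, where $B(H)$ is the algebra of bounded operators and $K(H)$ the ideal of compact operators.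 *)

theory Defs
  imports "HOL-Complex_Analysis.Complex_Analysis" "HOL-Algebra.QuotRing"
begin

section \<open>Square-integrable functions\<close>

text \<open>Elements of \<open>L\<^sup>2\<close> are represented by functions; no quotient by null sets is taken.\<close>

definition L2_space :: "'a measure \<Rightarrow> ('a \<Rightarrow> complex) set" where
  "L2_space M = {g \<in> borel_measurable M. integrable M (\<lambda>x. (cmod (g x))\<^sup>2)}"

definition L2_inner :: "'a measure \<Rightarrow> ('a \<Rightarrow> complex) \<Rightarrow> ('a \<Rightarrow> complex) \<Rightarrow> complex" where
  "L2_inner M g h = (LINT x|M. g x * cnj (h x))"

definition L2_norm :: "'a measure \<Rightarrow> ('a \<Rightarrow> complex) \<Rightarrow> real" where
  "L2_norm M g = sqrt (LINT x|M. (cmod (g x))\<^sup>2)"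

definition L2_dist :: "'a measure \<Rightarrow> ('a \<Rightarrow> complex) \<Rightarrow> ('a \<Rightarrow> complex) \<Rightarrow> real" where
  "L2_dist M g h = L2_norm M (\<lambda>x. g x - h x)"


section \<open>Operators on a space of square-integrable functions\<close>

text \<open>
  Below, \<open>H\<close> is a complex Hilbert space whose elements are functions in \<open>L2_space M\<close>, with the
  inner product of \<open>L2_space M\<close>, and such that distinct members of \<open>H\<close> are not almost everywhere
  equal. Operators on \<open>H\<close> are extensional functions, so that equality of operators is equality
  on \<open>H\<close>.
\<close>

definition bounded_operators ::
    "'a measure \<Rightarrow> ('a \<Rightarrow> complex) set \<Rightarrow> (('a \<Rightarrow> complex) \<Rightarrow> ('a \<Rightarrow> complex)) set" where
  "bounded_operators M H = {T \<in> H \<rightarrow>\<^sub>E H.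
     (\<forall>g\<in>H. \<forall>h\<in>H. \<forall>a b. T (\<lambda>x. a * g x + b * h x) = (\<lambda>x. a * T g x + b * T h x)) \<and>
     (\<exists>C. \<forall>g\<in>H. L2_norm M (T g) \<le> C * L2_norm M g)}"

definition compact_operators ::
    "'a measure \<Rightarrow> ('a \<Rightarrow> complex) set \<Rightarrow> (('a \<Rightarrow> complex) \<Rightarrow> ('a \<Rightarrow> complex)) set" where
  "compact_operators M H = {T \<in> bounded_operators M H.
     compactin (Metric_space.mtopology H (L2_dist M))
       (Metric_space.mtopology H (L2_dist M) closure_of (T ` {g \<in> H. L2_norm M g \<le> 1}))}"

definition scalar_operator ::
    "('a \<Rightarrow> complex) set \<Rightarrow> complex \<Rightarrow> ('a \<Rightarrow> complex) \<Rightarrow> ('a \<Rightarrow> complex)" where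
  "scalar_operator H c = (\<lambda>g\<in>H. \<lambda>x. c * g x)"

definition operator_algebra ::
    "'a measure \<Rightarrow> ('a \<Rightarrow> complex) set \<Rightarrow> (('a \<Rightarrow> complex) \<Rightarrow> ('a \<Rightarrow> complex)) ring" where
  "operator_algebra M H =
     \<lparr>carrier = bounded_operators M H,
      mult = (\<lambda>S T. compose H S T),
      one = scalar_operator H 1,
      zero = scalar_operator H 0,
      add = (\<lambda>S T. \<lambda>g\<in>H. \<lambda>x. S g x + T g x)\<rparr>"

definition calkin_algebra ::
    "'a measure \<Rightarrow> ('a \<Rightarrow> complex) set \<Rightarrow> (('a \<Rightarrow> complex) \<Rightarrow> ('a \<Rightarrow> complex)) set ring" where
  "calkin_algebra M H = operator_algebra M H Quot compact_operators M H"

definition calkin_coset ::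
    "'a measure \<Rightarrow> ('a \<Rightarrow> complex) set \<Rightarrow> (('a \<Rightarrow> complex) \<Rightarrow> ('a \<Rightarrow> complex)) \<Rightarrow>
     (('a \<Rightarrow> complex) \<Rightarrow> ('a \<Rightarrow> complex)) set" where
  "calkin_coset M H T = compact_operators M H +>\<^bsub>operator_algebra M H\<^esub> T"

text \<open>The complex algebra structure of \<open>A\<close> is given by the map \<open>\<iota>\<close> taking \<open>c\<close> to \<open>c\<close> times the unit.\<close>

definition algebra_spectrum :: "'b ring \<Rightarrow> (complex \<Rightarrow> 'b) \<Rightarrow> 'b \<Rightarrow> complex set" where
  "algebra_spectrum A \<iota> a = {c. a \<ominus>\<^bsub>A\<^esub> \<iota> c \<notin> Units A}"

definition op_spectrum ::
    "'a measure \<Rightarrow> ('a \<Rightarrow> complex) set \<Rightarrow> (('a \<Rightarrow> complex) \<Rightarrow> ('a \<Rightarrow> complex)) \<Rightarrow> complex set" where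
  "op_spectrum M H T = algebra_spectrum (operator_algebra M H) (scalar_operator H) T"

definition essential_spectrum ::
    "'a measure \<Rightarrow> ('a \<Rightarrow> complex) set \<Rightarrow> (('a \<Rightarrow> complex) \<Rightarrow> ('a \<Rightarrow> complex)) \<Rightarrow> complex set" where
  "essential_spectrum M H T =
     algebra_spectrum (calkin_algebra M H) (\<lambda>c. calkin_coset M H (scalar_operator H c))
       (calkin_coset M H T)"

definition orthogonal_projection ::
    "'a measure \<Rightarrow> ('a \<Rightarrow> complex) set \<Rightarrow> ('a \<Rightarrow> complex) \<Rightarrow> ('a \<Rightarrow> complex)" where
  "orthogonal_projection M H =
     (\<lambda>g\<in>L2_space M. THE h. h \<in> H \<and> (\<forall>k\<in>H. L2_inner M (\<lambda>x. g x - h x) k = 0))"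

definition toeplitz ::
    "'a measure \<Rightarrow> ('a \<Rightarrow> complex) set \<Rightarrow> ('a \<Rightarrow> complex) \<Rightarrow> ('a \<Rightarrow> complex) \<Rightarrow> ('a \<Rightarrow> complex)" where
  "toeplitz M H \<phi> = (\<lambda>g\<in>H. orthogonal_projection M H (\<lambda>x. \<phi> x * g x))"


section \<open>Bergman spaces of the disc and the bidisc\<close>

definition disc :: "complex set" where
  "disc = ball 0 1"

definition bidisc :: "(complex \<times> complex) set" where
  "bidisc = disc \<times> disc"

definition area_disc :: "complex measure" where
  "area_disc = restrict_space lborel disc"

text \<open>Lebesgue measure on the product is the product measure, see \<open>lborel_prod\<close>.\<close>

definition area_bidisc :: "(complex \<times> complex) measure" where
  "area_bidisc = restrict_space lborel bidisc"

text \<open>Analyticity in two variables: complex (Frechet) differentiability at each point.\<close>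

definition holomorphic2_on :: "(complex \<times> complex \<Rightarrow> complex) \<Rightarrow> (complex \<times> complex) set \<Rightarrow> bool" where
  "holomorphic2_on g S \<longleftrightarrow>
     (\<forall>p\<in>S. \<exists>a b. (g has_derivative (\<lambda>(u, v). a * u + b * v)) (at p within S))"

text \<open>
  A function on the disc (bidisc) is represented by its extension by zero, so that
  each element of the Bergman space has exactly one representative.
\<close>

definition bergman_disc :: "(complex \<Rightarrow> complex) set" where
  "bergman_disc = {g \<in> L2_space area_disc. g holomorphic_on disc \<and> (\<forall>z. z \<notin> disc \<longrightarrow> g z = 0)}"

definition bergman_bidisc :: "(complex \<times> complex \<Rightarrow> complex) set" where
  "bergman_bidisc =
     {g \<in> L2_space area_bidisc. holomorphic2_on g bidisc \<and> (\<forall>p. p \<notin> bidisc \<longrightarrow> g p = 0)}"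

abbreviation toeplitz_disc :: "(complex \<Rightarrow> complex) \<Rightarrow> (complex \<Rightarrow> complex) \<Rightarrow> (complex \<Rightarrow> complex)" where
  "toeplitz_disc \<equiv> toeplitz area_disc bergman_disc"

abbreviation toeplitz_bidisc ::
    "(complex \<times> complex \<Rightarrow> complex) \<Rightarrow> (complex \<times> complex \<Rightarrow> complex) \<Rightarrow> (complex \<times> complex \<Rightarrow> complex)" where
  "toeplitz_bidisc \<equiv> toeplitz area_bidisc bergman_bidisc"

end

theory Submission
  imports Defs
begin

text \<open>
  By passing to adjoints, both \<open>c \<notin> \<sigma>(T\<^sub>\<phi>)\<close> and \<open>c \<notin> \<sigma>\<^sub>e(T\<^sub>f)\<close> become lower bounds for the operators with
  symbols \<open>f - c\<close> and its conjugate: \<open>\<parallel>g\<parallel> \<le> C \<parallel>T g\<parallel>\<close> in one variable, \<open>\<parallel>x\<parallel> \<le> C \<parallel>T x\<parallel> + \<parallel>K x\<parallel>\<close> with \<open>K\<close>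
  compact in two.

  If the latter holds, test it on \<open>h\<^sub>n \<otimes> g\<close>, where the unit vectors \<open>h\<^sub>n\<close> peak at \<open>\<zeta>\<close>: since
  \<open>T\<^sub>f (h\<^sub>n \<otimes> g)\<close> is close to \<open>h\<^sub>n \<otimes> T g\<close> with \<open>T\<close> the operator of the slice at \<open>\<zeta>\<close>, that slice operator
  is bounded below.

  Conversely, lower bounds for the slices in \<open>w\<close> at all \<open>\<zeta>\<close> persist for \<open>z\<close> in a collar of the
  circle. There \<open>T\<^sub>f\<close> acts slicewise up to Hankel operators in \<open>z\<close>, which are compact because the
  symbols are continuous. Hence \<open>x\<close> is controlled by \<open>T\<^sub>f x\<close> and its part over a smaller disc in \<open>z\<close>;
  likewise in \<open>w\<close>. Because Toeplitz operators are local up to small errors, the two estimates combine to control \<open>x\<close> by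
  \<open>T\<^sub>f x\<close> and its restriction to a smaller closed bidisc, and that restriction is a compact operator.
\<close>

text \<open>A nonzero compact operator, made to act in \<open>z\<close> alone, is no longer compact
  on the bidisc. What does survive is an inequality: \<open>\<parallel>A g\<parallel> \<le> e
  \<parallel>g\<parallel> + C \<parallel>cut s g\<parallel>\<close> with \<open>e\<close>
  arbitrarily small holds on every slice and can be integrated over the other variable, so it takes
  the place of compactness in the one-variable arguments.

  The two one-sided estimates cannot be chained directly: \<open>zcut s x\<close> is not
  holomorphic, so the estimate in \<open>w\<close> does not apply to it. Instead, a coercive
  operator built from the estimate in \<open>w\<close> is inverted by a Neumann series, all of whose
  terms respect cuts in \<open>z\<close> up to small errors.

  Operators in one variable combine cleanly for product symbols acting on finite sums of tensors.
  Symbols are therefore approximated uniformly by sums of products and functions in norm by sums of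
  tensors, and each estimate is extended by density.

  Pointwise control rests on an averaged form of Cauchy's formula; the reproducing kernels come from
  the Riesz theorem.\<close>

abbreviation dnorm :: "(complex \<Rightarrow> complex) \<Rightarrow> real" where
  "dnorm \<equiv> L2_norm area_disc"

abbreviation bnorm :: "(complex \<times> complex \<Rightarrow> complex) \<Rightarrow> real" where
  "bnorm \<equiv> L2_norm area_bidisc"

section \<open>Square-integrable functions\<close>

lemma L2_spaceI:
  "g \<in> borel_measurable M \<Longrightarrow> integrable M (\<lambda>x. (cmod (g x))\<^sup>2) \<Longrightarrow> g \<in> L2_space M"
  by (simp add: L2_space_def)

lemma L2_space_measurable: "g \<in> L2_space M \<Longrightarrow> g \<in> borel_measurable M"
  by (simp add: L2_space_def)

lemma L2_space_integrable: "g \<in> L2_space M \<Longrightarrow> integrable M (\<lambda>x. (cmod (g x))\<^sup>2)"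
  by (simp add: L2_space_def)

lemma L2_space_dominated:
  assumes "g \<in> borel_measurable M" "h \<in> L2_space M" "\<And>x. x \<in> space M \<Longrightarrow> cmod (g x) \<le> c * cmod (h x)"
  shows "g \<in> L2_space M"
proof (rule L2_spaceI[OF assms(1)])
  have [measurable]: "g \<in> borel_measurable M" by fact
  show "integrable M (\<lambda>x. (cmod (g x))\<^sup>2)"
  proof (rule Bochner_Integration.integrable_bound[where f="\<lambda>x. c\<^sup>2 * (cmod (h x))\<^sup>2"])
    show "integrable M (\<lambda>x. c\<^sup>2 * (cmod (h x))\<^sup>2)" using L2_space_integrable[OF assms(2)] by simp
    have "(cmod (g x))\<^sup>2 \<le> (c * cmod (h x))\<^sup>2" if "x \<in> space M" for x
      using assms(3)[OF that] by (intro power_mono) auto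
    then show "AE x in M. norm ((cmod (g x))\<^sup>2) \<le> norm (c\<^sup>2 * (cmod (h x))\<^sup>2)"
      by (auto simp: power_mult_distrib)
  qed measurable
qed

lemma sum_power2_le: "(a + b)\<^sup>2 \<le> 2 * a\<^sup>2 + 2 * (b::real)\<^sup>2"
  using sum_squares_ge_zero[of "a - b" 0] by (simp add: power2_eq_square algebra_simps)

lemma L2_space_lin:
  assumes "g \<in> L2_space M" "h \<in> L2_space M"
  shows "(\<lambda>x. a * g x + b * h x) \<in> L2_space M"
proof (rule L2_spaceI)
  note [measurable] = assms[THEN L2_space_measurable]
  show "(\<lambda>x. a * g x + b * h x) \<in> borel_measurable M" by measurable
  show "integrable M (\<lambda>x. (cmod (a * g x + b * h x))\<^sup>2)"
  proof (rule Bochner_Integration.integrable_bound)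
    show "integrable M (\<lambda>x. 2 * (cmod a)\<^sup>2 * (cmod (g x))\<^sup>2 + 2 * (cmod b)\<^sup>2 * (cmod (h x))\<^sup>2)"
      using assms[THEN L2_space_integrable] by simp
    have "(cmod (a * g x + b * h x))\<^sup>2 \<le> 2 * (cmod a)\<^sup>2 * (cmod (g x))\<^sup>2 + 2 * (cmod b)\<^sup>2 * (cmod (h x))\<^sup>2" for x
    proof -
      have "(cmod (a * g x + b * h x))\<^sup>2 \<le> (cmod (a * g x) + cmod (b * h x))\<^sup>2"
        by (intro power_mono norm_triangle_ineq) auto
      also have "\<dots> \<le> 2 * (cmod (a * g x))\<^sup>2 + 2 * (cmod (b * h x))\<^sup>2" by (rule sum_power2_le)
      finally show ?thesis by (simp add: norm_mult power_mult_distrib mult.assoc)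
    qed
    then show "AE x in M. norm ((cmod (a * g x + b * h x))\<^sup>2)
        \<le> norm (2 * (cmod a)\<^sup>2 * (cmod (g x))\<^sup>2 + 2 * (cmod b)\<^sup>2 * (cmod (h x))\<^sup>2)"
      by auto
  qed measurable
qed

lemma L2_space_zero: "(\<lambda>x. 0) \<in> L2_space M"
  by (simp add: L2_space_def)

lemma L2_space_add: "g \<in> L2_space M \<Longrightarrow> h \<in> L2_space M \<Longrightarrow> (\<lambda>x. g x + h x) \<in> L2_space M"
  using L2_space_lin[of g M h 1 1] by simp

lemma L2_space_diff: "g \<in> L2_space M \<Longrightarrow> h \<in> L2_space M \<Longrightarrow> (\<lambda>x. g x - h x) \<in> L2_space M"
  using L2_space_lin[of g M h 1 "-1"] by simp

lemma L2_space_scale: "g \<in> L2_space M \<Longrightarrow> (\<lambda>x. c * g x) \<in> L2_space M"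
  using L2_space_lin[of g M g c 0] by simp

section \<open>Multiplication by bounded measurable symbols\<close>

definition bounded_symbol :: "'a measure \<Rightarrow> real \<Rightarrow> ('a \<Rightarrow> complex) \<Rightarrow> bool" where
  "bounded_symbol M B \<phi> \<longleftrightarrow> \<phi> \<in> borel_measurable M \<and> (\<forall>x\<in>space M. cmod (\<phi> x) \<le> B) \<and> 0 \<le> B"

lemma borel_measurable_cnj [measurable (raw)]:
  "g \<in> borel_measurable M \<Longrightarrow> (\<lambda>x. cnj (g x)) \<in> borel_measurable M"
  by (rule borel_measurable_continuous_on[OF continuous_on_cnj[OF continuous_on_id]])

lemma bounded_symbol_cnj: "bounded_symbol M B \<phi> \<Longrightarrow> bounded_symbol M B (\<lambda>x. cnj (\<phi> x))"
  by (auto simp: bounded_symbol_def)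

lemma bounded_symbol_indicator: "S \<in> sets M \<Longrightarrow> bounded_symbol M 1 (indicator S)"
  by (auto simp: bounded_symbol_def indicator_def)

lemma bounded_symbol_diff:
  "bounded_symbol M B \<phi> \<Longrightarrow> bounded_symbol M C \<psi> \<Longrightarrow> bounded_symbol M (B + C) (\<lambda>x. \<phi> x - \<psi> x)"
  unfolding bounded_symbol_def by (auto intro: norm_triangle_le_diff add_mono)

lemma bounded_symbol_add:
  "bounded_symbol M B \<phi> \<Longrightarrow> bounded_symbol M C \<psi> \<Longrightarrow> bounded_symbol M (B + C) (\<lambda>x. \<phi> x + \<psi> x)"
  unfolding bounded_symbol_def by (auto intro: norm_triangle_le add_mono)

lemma bounded_symbol_mult:
  "bounded_symbol M B \<phi> \<Longrightarrow> bounded_symbol M C \<psi> \<Longrightarrow> bounded_symbol M (B * C) (\<lambda>x. \<phi> x * \<psi> x)"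
  unfolding bounded_symbol_def by (auto simp: norm_mult intro: mult_mono)

lemma bounded_symbol_const: "bounded_symbol M (cmod c) (\<lambda>x. c)"
  by (auto simp: bounded_symbol_def)

lemma L2_space_mult:
  assumes "bounded_symbol M B \<phi>" "g \<in> L2_space M"
  shows "(\<lambda>x. \<phi> x * g x) \<in> L2_space M"
proof (rule L2_space_dominated[OF _ assms(2)])
  note [measurable] = L2_space_measurable[OF assms(2)]
  have [measurable]: "\<phi> \<in> borel_measurable M" using assms(1) by (simp add: bounded_symbol_def)
  show "(\<lambda>x. \<phi> x * g x) \<in> borel_measurable M" by measurable
  show "cmod (\<phi> x * g x) \<le> B * cmod (g x)" if "x \<in> space M" for x
    using assms(1) that by (auto simp: bounded_symbol_def norm_mult intro: mult_right_mono)
qed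

lemma integrable_L2_inner:
  assumes "g \<in> L2_space M" "h \<in> L2_space M"
  shows "integrable M (\<lambda>x. g x * cnj (h x))"
proof (rule Bochner_Integration.integrable_bound)
  note [measurable] = assms[THEN L2_space_measurable]
  show "integrable M (\<lambda>x. (cmod (g x))\<^sup>2 + (cmod (h x))\<^sup>2)"
    using assms[THEN L2_space_integrable] by simp
  have "cmod (g x * cnj (h x)) \<le> (cmod (g x))\<^sup>2 + (cmod (h x))\<^sup>2" for x
    using sum_squares_ge_zero[of "cmod (g x) - cmod (h x)" 0]
    by (simp add: norm_mult power2_eq_square algebra_simps) (smt (verit) mult_nonneg_nonneg norm_ge_zero)
  then show "AE x in M. norm (g x * cnj (h x)) \<le> norm ((cmod (g x))\<^sup>2 + (cmod (h x))\<^sup>2)"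
    by (auto intro!: AE_I2 order_trans[OF _ abs_ge_self])
  show "(\<lambda>x. g x * cnj (h x)) \<in> borel_measurable M" by measurable
qed

section \<open>Inner product and norm\<close>

lemma L2_norm_nonneg [simp]: "0 \<le> L2_norm M g"
  by (simp add: L2_norm_def)

lemma L2_norm_sq: "(L2_norm M g)\<^sup>2 = (LINT x|M. (cmod (g x))\<^sup>2)"
  by (simp add: L2_norm_def)

lemma L2_inner_self: "L2_inner M g g = of_real ((L2_norm M g)\<^sup>2)"
  unfolding L2_norm_sq L2_inner_def complex_norm_square[symmetric] by (rule integral_complex_of_real)

lemma L2_inner_lin_left:
  assumes "g \<in> L2_space M" "h \<in> L2_space M" "k \<in> L2_space M"
  shows "L2_inner M (\<lambda>x. a * g x + b * h x) k = a * L2_inner M g k + b * L2_inner M h k"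
proof -
  have "(\<lambda>x. (a * g x + b * h x) * cnj (k x)) = (\<lambda>x. a * (g x * cnj (k x)) + b * (h x * cnj (k x)))"
    by (auto simp: algebra_simps)
  then show ?thesis
    unfolding L2_inner_def using integrable_L2_inner[OF assms(1,3)] integrable_L2_inner[OF assms(2,3)] by simp
qed

lemma L2_inner_cnj: "L2_inner M h g = cnj (L2_inner M g h)"
proof -
  have "(\<lambda>x. h x * cnj (g x)) = (\<lambda>x. cnj (g x * cnj (h x)))" by (simp add: mult.commute)
  then show ?thesis unfolding L2_inner_def by (simp only: Bochner_Integration.integral_cnj)
qed

lemma L2_inner_lin_right:
  assumes "g \<in> L2_space M" "h \<in> L2_space M" "k \<in> L2_space M"
  shows "L2_inner M k (\<lambda>x. a * g x + b * h x) = cnj a * L2_inner M k g + cnj b * L2_inner M k h"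
  using L2_inner_lin_left[OF assms, of a b] L2_inner_cnj[of M] by (metis complex_cnj_add complex_cnj_mult)

lemma L2_inner_add_left:
  "g \<in> L2_space M \<Longrightarrow> h \<in> L2_space M \<Longrightarrow> k \<in> L2_space M \<Longrightarrow>
   L2_inner M (\<lambda>x. g x + h x) k = L2_inner M g k + L2_inner M h k"
  using L2_inner_lin_left[of g M h k 1 1] by simp

lemma L2_inner_diff_left:
  "g \<in> L2_space M \<Longrightarrow> h \<in> L2_space M \<Longrightarrow> k \<in> L2_space M \<Longrightarrow>
   L2_inner M (\<lambda>x. g x - h x) k = L2_inner M g k - L2_inner M h k"
  using L2_inner_lin_left[of g M h k 1 "-1"] by simp

lemma L2_inner_scale_left: "L2_inner M (\<lambda>x. c * g x) k = c * L2_inner M g k"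
  unfolding L2_inner_def by (simp add: mult.assoc)

lemma L2_inner_diff_right:
  "g \<in> L2_space M \<Longrightarrow> h \<in> L2_space M \<Longrightarrow> k \<in> L2_space M \<Longrightarrow>
   L2_inner M k (\<lambda>x. g x - h x) = L2_inner M k g - L2_inner M k h"
  using L2_inner_lin_right[of g M h k 1 "-1"] by simp

lemma L2_inner_scale_right: "L2_inner M k (\<lambda>x. c * g x) = cnj c * L2_inner M k g"
  by (metis L2_inner_cnj L2_inner_scale_left complex_cnj_mult)

lemma L2_inner_mult_cnj: "L2_inner M (\<lambda>x. \<phi> x * g x) h = L2_inner M g (\<lambda>x. cnj (\<phi> x) * h x)"
  unfolding L2_inner_def by (simp add: mult_ac)

lemma L2_norm_zero [simp]: "L2_norm M (\<lambda>x. 0) = 0"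
  by (simp add: L2_norm_def)

lemma L2_norm_scale: "L2_norm M (\<lambda>x. c * g x) = cmod c * L2_norm M g"
  by (simp add: L2_norm_def norm_mult power_mult_distrib real_sqrt_mult)

lemma L2_norm_minus: "L2_norm M (\<lambda>x. - g x) = L2_norm M g"
  by (simp add: L2_norm_def)

lemma L2_norm_minus_commute: "L2_norm M (\<lambda>x. g x - h x) = L2_norm M (\<lambda>x. h x - g x)"
  by (simp add: L2_norm_def norm_minus_commute)

lemma L2_norm_add_sq:
  assumes "g \<in> L2_space M" "h \<in> L2_space M"
  shows "(L2_norm M (\<lambda>x. g x + h x))\<^sup>2 = (L2_norm M g)\<^sup>2 + 2 * Re (L2_inner M g h) + (L2_norm M h)\<^sup>2"
proof -
  have gh: "(\<lambda>x. g x + h x) \<in> L2_space M" using assms by (rule L2_space_add)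
  have "of_real ((L2_norm M (\<lambda>x. g x + h x))\<^sup>2) = L2_inner M (\<lambda>x. g x + h x) (\<lambda>x. g x + h x)"
    by (simp add: L2_inner_self)
  also have "\<dots> = L2_inner M g g + L2_inner M g h + (L2_inner M h g + L2_inner M h h)"
    using L2_inner_lin_left[OF assms gh, of 1 1] L2_inner_lin_right[OF assms assms(1), of 1 1]
      L2_inner_lin_right[OF assms assms(2), of 1 1] by simp
  finally have "(L2_norm M (\<lambda>x. g x + h x))\<^sup>2 = Re (L2_inner M g g + L2_inner M g h + (L2_inner M h g + L2_inner M h h))"
    by (metis Re_complex_of_real)
  then show ?thesis using L2_inner_cnj[of M h g] by (simp add: L2_inner_self)
qed

lemma L2_norm_diff_sq:
  assumes "g \<in> L2_space M" "h \<in> L2_space M"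
  shows "(L2_norm M (\<lambda>x. g x - h x))\<^sup>2 = (L2_norm M g)\<^sup>2 - 2 * Re (L2_inner M g h) + (L2_norm M h)\<^sup>2"
  using L2_norm_add_sq[OF assms(1) L2_space_scale[OF assms(2), of "-1"]]
  by (simp add: L2_norm_minus L2_inner_scale_right[of M g "-1" h, simplified])

lemma L2_parallelogram:
  assumes "g \<in> L2_space M" "h \<in> L2_space M"
  shows "(L2_norm M (\<lambda>x. g x + h x))\<^sup>2 + (L2_norm M (\<lambda>x. g x - h x))\<^sup>2 = 2 * (L2_norm M g)\<^sup>2 + 2 * (L2_norm M h)\<^sup>2"
  using L2_norm_add_sq[OF assms] L2_norm_diff_sq[OF assms] by simp

lemma L2_Cauchy_Schwarz:
  assumes g: "g \<in> L2_space M" and h: "h \<in> L2_space M"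
  shows "cmod (L2_inner M g h) \<le> L2_norm M g * L2_norm M h"
proof -
  define b where "b = L2_inner M g h"
  \<comment> \<open>Expansion of the squared norm of \<open>g - t b h\<close>. The factor
    \<open>b\<close> fixes the phase, so that a real parameter \<open>t\<close> suffices.\<close>
  have *: "0 \<le> (L2_norm M g)\<^sup>2 - 2 * t * (cmod b)\<^sup>2 + t\<^sup>2 * (cmod b)\<^sup>2 * (L2_norm M h)\<^sup>2" for t :: real
  proof -
    have "0 \<le> (L2_norm M (\<lambda>x. g x - (of_real t * b) * h x))\<^sup>2" by simp
    also have "\<dots> = (L2_norm M g)\<^sup>2 - 2 * Re (cnj (of_real t * b) * b) + (cmod (of_real t * b) * L2_norm M h)\<^sup>2"
      using L2_norm_diff_sq[OF g L2_space_scale[OF h, of "of_real t * b"]]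
      by (simp add: L2_inner_scale_right L2_norm_scale b_def)
    also have "Re (cnj (of_real t * b) * b) = t * (cmod b)\<^sup>2"
      by (simp add: cmod_power2) (simp add: power2_eq_square algebra_simps)
    also have "(cmod (of_real t * b) * L2_norm M h)\<^sup>2 = t\<^sup>2 * (cmod b)\<^sup>2 * (L2_norm M h)\<^sup>2"
      by (simp add: norm_mult power_mult_distrib)
    finally show ?thesis by simp
  qed
  have "(cmod b)\<^sup>2 \<le> (L2_norm M g)\<^sup>2 * (L2_norm M h)\<^sup>2"
  proof (cases "L2_norm M h = 0")
    case True
    have "b = 0"
    proof (rule ccontr)
      assume "b \<noteq> 0"
      \<comment> \<open>Elements are functions, so \<open>h\<close> may have norm 0 and be nonzero.
        The expression in \<open>*\<close> is then affine in \<open>t\<close> with slope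
        \<open>-2 * (cmod b)^2\<close>, and it is negative at the value chosen here.\<close>
      then show False
        using *[of "((L2_norm M g)\<^sup>2 + 1) / (cmod b)\<^sup>2"] True zero_le_power2[of "L2_norm M g"]
        by simp
    qed
    then show ?thesis by simp
  next
    case False
    then have "L2_norm M h > 0" by (simp add: less_le)
    then show ?thesis using *[of "1 / (L2_norm M h)\<^sup>2"]
      by (auto simp: field_simps power2_eq_square zero_le_divide_iff mult_le_0_iff)
  qed
  then have "(cmod b)\<^sup>2 \<le> (L2_norm M g * L2_norm M h)\<^sup>2" by (simp add: power_mult_distrib)
  then show ?thesis unfolding b_def by (rule power2_le_imp_le) simp
qed

lemma L2_norm_triangle:
  assumes g: "g \<in> L2_space M" and h: "h \<in> L2_space M"
  shows "L2_norm M (\<lambda>x. g x + h x) \<le> L2_norm M g + L2_norm M h"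
proof (rule power2_le_imp_le)
  have "Re (L2_inner M g h) \<le> L2_norm M g * L2_norm M h"
    using L2_Cauchy_Schwarz[OF g h] complex_Re_le_cmod order_trans by blast
  then show "(L2_norm M (\<lambda>x. g x + h x))\<^sup>2 \<le> (L2_norm M g + L2_norm M h)\<^sup>2"
    unfolding L2_norm_add_sq[OF g h] power2_sum by simp
qed simp

lemma L2_norm_triangle_diff:
  assumes g: "g \<in> L2_space M" and h: "h \<in> L2_space M"
  shows "L2_norm M (\<lambda>x. g x - h x) \<le> L2_norm M g + L2_norm M h"
  using L2_norm_triangle[OF g L2_space_scale[OF h, of "-1"]] by (simp add: L2_norm_minus)

lemma L2_norm_triangle_sub:
  assumes g: "g \<in> L2_space M" and h: "h \<in> L2_space M"
  shows "L2_norm M g \<le> L2_norm M h + L2_norm M (\<lambda>x. g x - h x)"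
  using L2_norm_triangle[OF h L2_space_diff[OF g h]] by simp

lemma L2_norm_triangle3:
  assumes "g \<in> L2_space M" "h \<in> L2_space M" "k \<in> L2_space M"
  shows "L2_norm M (\<lambda>x. g x - k x) \<le> L2_norm M (\<lambda>x. g x - h x) + L2_norm M (\<lambda>x. h x - k x)"
  using L2_norm_triangle[OF L2_space_diff[OF assms(1,2)] L2_space_diff[OF assms(2,3)]] by simp

lemma L2_norm_dominated:
  assumes "g \<in> borel_measurable M" "h \<in> L2_space M" "\<And>x. x \<in> space M \<Longrightarrow> cmod (g x) \<le> c * cmod (h x)" "0 \<le> c"
  shows "L2_norm M g \<le> c * L2_norm M h"
proof (rule power2_le_imp_le)
  have g: "g \<in> L2_space M" using assms(1-3) by (rule L2_space_dominated)
  have "(LINT x|M. (cmod (g x))\<^sup>2) \<le> (LINT x|M. c\<^sup>2 * (cmod (h x))\<^sup>2)"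
  proof (rule integral_mono)
    show "(cmod (g x))\<^sup>2 \<le> c\<^sup>2 * (cmod (h x))\<^sup>2" if "x \<in> space M" for x
      using power_mono[OF assms(3)[OF that], of 2] by (simp add: power_mult_distrib)
  qed (use L2_space_integrable[OF g] L2_space_integrable[OF assms(2)] in auto)
  then show "(L2_norm M g)\<^sup>2 \<le> (c * L2_norm M h)\<^sup>2"
    by (simp add: L2_norm_sq power_mult_distrib)
qed (use assms(4) in simp)

lemma L2_norm_mult:
  assumes "bounded_symbol M B \<phi>" "g \<in> L2_space M"
  shows "L2_norm M (\<lambda>x. \<phi> x * g x) \<le> B * L2_norm M g"
  using assms L2_space_mult[OF assms]
  by (intro L2_norm_dominated) (auto simp: bounded_symbol_def norm_mult intro: mult_right_mono L2_space_measurable)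

lemma L2_norm_cong:
  "(\<And>x. x \<in> space M \<Longrightarrow> cmod (g x) = cmod (h x)) \<Longrightarrow> L2_norm M g = L2_norm M h"
  unfolding L2_norm_def by (auto intro!: arg_cong[where f=sqrt] Bochner_Integration.integral_cong)

lemma L2_inner_cong:
  "(\<And>x. x \<in> space M \<Longrightarrow> g x = g' x) \<Longrightarrow> (\<And>x. x \<in> space M \<Longrightarrow> h x = h' x) \<Longrightarrow>
   L2_inner M g h = L2_inner M g' h'"
  unfolding L2_inner_def by (auto intro!: Bochner_Integration.integral_cong)

text \<open>Fatou's lemma, applied to \<open>u n - u m\<close> as \<open>m\<close> grows, turns the
  Cauchy bound into a bound for \<open>u n - l\<close>. In the Bergman spaces the pointwise limit is
  supplied by the boundedness of point evaluations, and this lemma then yields completeness.\<close>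

lemma L2_pointwise_limit:
  assumes L2: "\<And>n. u n \<in> L2_space M"
    and lim: "\<And>x. x \<in> space M \<Longrightarrow> (\<lambda>n. u n x) \<longlonglongrightarrow> l x"
    and Cauchy: "\<And>e::real. e > 0 \<Longrightarrow> \<exists>N. \<forall>m\<ge>N. \<forall>n\<ge>N. L2_norm M (\<lambda>x. u m x - u n x) < e"
  shows "l \<in> L2_space M" "(\<lambda>n. L2_norm M (\<lambda>x. u n x - l x)) \<longlonglongrightarrow> 0"
proof -
  note [measurable] = L2_space_measurable[OF L2]
  have [measurable]: "l \<in> borel_measurable M"
    by (rule borel_measurable_LIMSEQ_metric[where f=u, OF _ lim]) auto
  have *: "(\<integral>\<^sup>+x. ennreal ((cmod (u n x - l x))\<^sup>2) \<partial>M) \<le> ennreal (e\<^sup>2)"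
    if N: "\<forall>m\<ge>N. \<forall>n\<ge>N. L2_norm M (\<lambda>x. u m x - u n x) < e" and n: "n \<ge> N" for e N n
  proof -
    have "(\<integral>\<^sup>+x. ennreal ((cmod (u n x - l x))\<^sup>2) \<partial>M)
        = (\<integral>\<^sup>+x. liminf (\<lambda>m. ennreal ((cmod (u n x - u m x))\<^sup>2)) \<partial>M)"
    proof (rule nn_integral_cong)
      fix x assume "x \<in> space M"
      then have "(\<lambda>m. ennreal ((cmod (u n x - u m x))\<^sup>2)) \<longlonglongrightarrow> ennreal ((cmod (u n x - l x))\<^sup>2)"
        using lim by (intro tendsto_ennrealI tendsto_intros) auto
      then show "ennreal ((cmod (u n x - l x))\<^sup>2) = liminf (\<lambda>m. ennreal ((cmod (u n x - u m x))\<^sup>2))"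
        using lim_imp_Liminf by (metis sequentially_bot)
    qed
    also have "\<dots> \<le> liminf (\<lambda>m. \<integral>\<^sup>+x. ennreal ((cmod (u n x - u m x))\<^sup>2) \<partial>M)"
      by (rule nn_integral_liminf) measurable
    also have "\<dots> \<le> ennreal (e\<^sup>2)"
    proof (rule Liminf_le)
      have "(\<integral>\<^sup>+x. ennreal ((cmod (u n x - u m x))\<^sup>2) \<partial>M) \<le> ennreal (e\<^sup>2)" if "m \<ge> N" for m
      proof -
        have "(\<integral>\<^sup>+x. ennreal ((cmod (u n x - u m x))\<^sup>2) \<partial>M) = ennreal ((L2_norm M (\<lambda>x. u n x - u m x))\<^sup>2)"
          unfolding L2_norm_sq using L2_space_integrable[OF L2_space_diff[OF L2 L2]]
          by (intro nn_integral_eq_integral) auto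
        also have "\<dots> \<le> ennreal (e\<^sup>2)"
          using N n that by (intro ennreal_leI power_mono) (auto intro: less_imp_le)
        finally show ?thesis .
      qed
      then show "\<forall>\<^sub>F m in sequentially. (\<integral>\<^sup>+x. ennreal ((cmod (u n x - u m x))\<^sup>2) \<partial>M) \<le> ennreal (e\<^sup>2)"
        by (auto simp: eventually_sequentially)
    qed simp
    finally show ?thesis .
  qed
  have **: "(\<lambda>x. u n x - l x) \<in> L2_space M \<and> L2_norm M (\<lambda>x. u n x - l x) \<le> e"
    if N: "\<forall>m\<ge>N. \<forall>n\<ge>N. L2_norm M (\<lambda>x. u m x - u n x) < e" and n: "n \<ge> N" and e: "e > 0" for e N n
  proof
    have int: "integrable M (\<lambda>x. (cmod (u n x - l x))\<^sup>2)"
      using *[OF N n] by (intro integrableI_bounded) (auto simp: less_top[symmetric] top_unique)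
    then show "(\<lambda>x. u n x - l x) \<in> L2_space M" by (intro L2_spaceI) measurable
    have "ennreal ((L2_norm M (\<lambda>x. u n x - l x))\<^sup>2) \<le> ennreal (e\<^sup>2)"
      unfolding L2_norm_sq using *[OF N n] nn_integral_eq_integral[OF int] by simp
    then have "(L2_norm M (\<lambda>x. u n x - l x))\<^sup>2 \<le> e\<^sup>2" by (simp add: ennreal_le_iff)
    then show "L2_norm M (\<lambda>x. u n x - l x) \<le> e" by (rule power2_le_imp_le) (use e in auto)
  qed
  obtain N where N: "\<forall>m\<ge>N. \<forall>n\<ge>N. L2_norm M (\<lambda>x. u m x - u n x) < 1" using Cauchy[of 1] by auto
  have "(\<lambda>x. u N x - (u N x - l x)) \<in> L2_space M"
    by (rule L2_space_diff[OF L2]) (use **[OF N order_refl] in auto)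
  then show "l \<in> L2_space M" by simp
  show "(\<lambda>n. L2_norm M (\<lambda>x. u n x - l x)) \<longlonglongrightarrow> 0"
  proof (rule LIMSEQ_I)
    fix r :: real assume "r > 0"
    then obtain N where "\<forall>m\<ge>N. \<forall>n\<ge>N. L2_norm M (\<lambda>x. u m x - u n x) < r/2" using Cauchy[of "r/2"] by auto
    with **[OF this] \<open>r > 0\<close> show "\<exists>N. \<forall>n\<ge>N. norm (L2_norm M (\<lambda>x. u n x - l x) - 0) < r"
      by (intro exI[of _ N]) force
  qed
qed

section \<open>Hilbert spaces of square-integrable functions\<close>

text \<open>Besides the two Bergman spaces, the locale is instantiated with closed subspaces of
  \<open>H\<close> itself: the kernel of a functional in \<open>riesz\<close>, the closure of a
  subspace in \<open>dense_if_orthogonal_trivial\<close>, the range of an operator in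
  \<open>bijective_inverse\<close>.\<close>

locale L2_hilbert =
  fixes M :: "'a measure" and H :: "('a \<Rightarrow> complex) set"
  assumes subset_L2: "H \<subseteq> L2_space M"
    and zero: "(\<lambda>x. 0) \<in> H"
    and lin: "\<And>g h a b. g \<in> H \<Longrightarrow> h \<in> H \<Longrightarrow> (\<lambda>x. a * g x + b * h x) \<in> H"
    and definite: "\<And>g. g \<in> H \<Longrightarrow> L2_norm M g = 0 \<Longrightarrow> g = (\<lambda>x. 0)"
    and complete: "\<And>u :: nat \<Rightarrow> 'a \<Rightarrow> complex. (\<And>n. u n \<in> H) \<Longrightarrow>
      (\<And>e::real. e > 0 \<Longrightarrow> \<exists>N. \<forall>m\<ge>N. \<forall>n\<ge>N. L2_norm M (\<lambda>x. u m x - u n x) < e) \<Longrightarrow>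
      \<exists>l\<in>H. (\<lambda>n. L2_norm M (\<lambda>x. u n x - l x)) \<longlonglongrightarrow> 0"
begin

lemma L2: "g \<in> H \<Longrightarrow> g \<in> L2_space M"
  using subset_L2 by auto

lemma add: "g \<in> H \<Longrightarrow> h \<in> H \<Longrightarrow> (\<lambda>x. g x + h x) \<in> H"
  using lin[of g h 1 1] by simp

lemma diff: "g \<in> H \<Longrightarrow> h \<in> H \<Longrightarrow> (\<lambda>x. g x - h x) \<in> H"
  using lin[of g h 1 "-1"] by simp

lemma scale: "g \<in> H \<Longrightarrow> (\<lambda>x. c * g x) \<in> H"
  using lin[of g g c 0] by simp

lemma eqI: "g \<in> H \<Longrightarrow> h \<in> H \<Longrightarrow> L2_norm M (\<lambda>x. g x - h x) = 0 \<Longrightarrow> g = h"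
  using definite[OF diff] by (metis eq_iff_diff_eq_0 ext)

lemma inner_eqI:
  assumes "g \<in> H" "h \<in> H" "\<And>k. k \<in> H \<Longrightarrow> L2_inner M g k = L2_inner M h k"
  shows "g = h"
proof (rule eqI[OF assms(1,2)])
  have "L2_inner M (\<lambda>x. g x - h x) (\<lambda>x. g x - h x) = 0"
    using assms(3)[OF diff[OF assms(1,2)]] L2_inner_diff_left[OF L2 L2 L2[OF diff], of g h g h] assms by simp
  then show "L2_norm M (\<lambda>x. g x - h x) = 0" by (simp add: L2_inner_self)
qed

lemma closed_subspace:
  assumes "V \<subseteq> H" "(\<lambda>x. 0) \<in> V" "\<And>g h a b. g \<in> V \<Longrightarrow> h \<in> V \<Longrightarrow> (\<lambda>x. a * g x + b * h x) \<in> V"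
    and "\<And>u l. (\<And>n::nat. u n \<in> V) \<Longrightarrow> l \<in> H \<Longrightarrow> (\<lambda>n. L2_norm M (\<lambda>x. u n x - l x)) \<longlonglongrightarrow> 0 \<Longrightarrow> l \<in> V"
  shows "L2_hilbert M V"
proof
  show "\<exists>l\<in>V. (\<lambda>n. L2_norm M (\<lambda>x. u n x - l x)) \<longlonglongrightarrow> 0"
    if "\<And>n. u n \<in> V" "\<And>e::real. e > 0 \<Longrightarrow> \<exists>N. \<forall>m\<ge>N. \<forall>n\<ge>N. L2_norm M (\<lambda>x. u m x - u n x) < e" for u :: "nat \<Rightarrow> _"
    using complete[of u] that assms by blast
qed (use assms subset_L2 definite in auto)

subsection \<open>Orthogonal projection\<close>

text \<open>The midpoint of two near minimizers belongs to \<open>H\<close>, hence has distance at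
  least \<open>d\<close> from \<open>g\<close>. By the parallelogram law the two are then close to
  each other, so a minimizing sequence is Cauchy.\<close>

lemma minimizer_exists:
  assumes g: "g \<in> L2_space M"
  shows "\<exists>h\<in>H. \<forall>k\<in>H. L2_norm M (\<lambda>x. g x - h x) \<le> L2_norm M (\<lambda>x. g x - k x)"
proof -
  define D where "D = (\<lambda>h. L2_norm M (\<lambda>x. g x - h x)) ` H"
  define d where "d = Inf D"
  have D: "D \<noteq> {}" "bdd_below D" unfolding D_def using zero by (auto intro!: bdd_belowI[of _ 0])
  have dle: "d \<le> L2_norm M (\<lambda>x. g x - k x)" if "k \<in> H" for k
    unfolding d_def using D that by (auto simp: D_def intro: cInf_lower)
  have d0: "0 \<le> d" unfolding d_def using D by (intro cInf_greatest) (auto simp: D_def)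
  have "\<exists>h\<in>H. L2_norm M (\<lambda>x. g x - h x) < d + 1 / Suc n" for n
  proof -
    have "Inf D < d + 1 / Suc n" unfolding d_def by simp
    then show ?thesis using cInf_less_iff[OF D] by (auto simp: D_def)
  qed
  then obtain u where u: "\<And>n. u n \<in> H" "\<And>n. L2_norm M (\<lambda>x. g x - u n x) < d + 1 / Suc n" by metis
  have par: "(L2_norm M (\<lambda>x. u m x - u n x))\<^sup>2 \<le> 2 * ((d + a)\<^sup>2 - d\<^sup>2) + 2 * ((d + a)\<^sup>2 - d\<^sup>2)"
    if "1 / Suc m \<le> a" "1 / Suc n \<le> a" for m n a
  proof -
    have "(L2_norm M (\<lambda>x. (g x - u m x) + (g x - u n x)))\<^sup>2 + (L2_norm M (\<lambda>x. (g x - u m x) - (g x - u n x)))\<^sup>2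
        = 2 * (L2_norm M (\<lambda>x. g x - u m x))\<^sup>2 + 2 * (L2_norm M (\<lambda>x. g x - u n x))\<^sup>2"
      by (rule L2_parallelogram) (intro L2_space_diff g L2 u)+
    moreover have "(L2_norm M (\<lambda>x. g x - u m x))\<^sup>2 \<le> (d + a)\<^sup>2" "(L2_norm M (\<lambda>x. g x - u n x))\<^sup>2 \<le> (d + a)\<^sup>2"
      using u(2)[of m] u(2)[of n] that by (intro power_mono; simp)+
    moreover have "4 * d\<^sup>2 \<le> (L2_norm M (\<lambda>x. (g x - u m x) + (g x - u n x)))\<^sup>2"
    proof -
      have "(\<lambda>x. (1/2) * u m x + (1/2) * u n x) \<in> H" by (intro lin u)
      from dle[OF this] have "2 * d \<le> cmod 2 * L2_norm M (\<lambda>x. g x - ((1/2) * u m x + (1/2) * u n x))" by simp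
      also have "\<dots> = L2_norm M (\<lambda>x. (g x - u m x) + (g x - u n x))"
        by (subst L2_norm_scale[symmetric]) (simp add: algebra_simps)
      finally have "(2 * d)\<^sup>2 \<le> (L2_norm M (\<lambda>x. (g x - u m x) + (g x - u n x)))\<^sup>2"
        using d0 by (intro power_mono) auto
      then show ?thesis by (simp add: power_mult_distrib)
    qed
    moreover have "L2_norm M (\<lambda>x. (g x - u m x) - (g x - u n x)) = L2_norm M (\<lambda>x. u m x - u n x)"
      by (subst L2_norm_minus_commute) simp
    ultimately show ?thesis by (simp add: algebra_simps)
  qed
  have "\<exists>N. \<forall>m\<ge>N. \<forall>n\<ge>N. L2_norm M (\<lambda>x. u m x - u n x) < e" if "e > 0" for e :: real
  proof -
    have "(\<lambda>n. 2 * ((d + 1 / real (Suc n))\<^sup>2 - d\<^sup>2) + 2 * ((d + 1 / real (Suc n))\<^sup>2 - d\<^sup>2)) \<longlonglongrightarrow>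
        2 * ((d + 0)\<^sup>2 - d\<^sup>2) + 2 * ((d + 0)\<^sup>2 - d\<^sup>2)"
      by (intro tendsto_intros LIMSEQ_Suc[OF lim_inverse_n'])
    then have "(\<lambda>n. 2 * ((d + 1 / real (Suc n))\<^sup>2 - d\<^sup>2) + 2 * ((d + 1 / real (Suc n))\<^sup>2 - d\<^sup>2)) \<longlonglongrightarrow> 0" by simp
    from order_tendstoD(2)[OF this, of "e\<^sup>2"] \<open>e > 0\<close>
    obtain N where N: "2 * ((d + 1 / real (Suc N))\<^sup>2 - d\<^sup>2) + 2 * ((d + 1 / real (Suc N))\<^sup>2 - d\<^sup>2) < e\<^sup>2"
      by (auto simp: eventually_sequentially)
    have "L2_norm M (\<lambda>x. u m x - u n x) < e" if "m \<ge> N" "n \<ge> N" for m n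
    proof (rule power2_less_imp_less)
      have "1 / real (Suc m) \<le> 1 / real (Suc N)" "1 / real (Suc n) \<le> 1 / real (Suc N)"
        using that by (auto simp: field_simps)
      from par[OF this] N show "(L2_norm M (\<lambda>x. u m x - u n x))\<^sup>2 < e\<^sup>2" by simp
    qed (use \<open>e > 0\<close> in simp)
    then show ?thesis by blast
  qed
  from complete[OF u(1) this] obtain l where l: "l \<in> H" "(\<lambda>n. L2_norm M (\<lambda>x. u n x - l x)) \<longlonglongrightarrow> 0" by blast
  have "L2_norm M (\<lambda>x. g x - l x) \<le> d + 0 + 0"
  proof (rule LIMSEQ_le_const)
    show "(\<lambda>n. d + 1 / real (Suc n) + L2_norm M (\<lambda>x. u n x - l x)) \<longlonglongrightarrow> d + 0 + 0"
      by (intro tendsto_intros LIMSEQ_Suc[OF lim_inverse_n'] l)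
    have "L2_norm M (\<lambda>x. g x - l x) \<le> d + 1 / real (Suc n) + L2_norm M (\<lambda>x. u n x - l x)" for n
      using L2_norm_triangle3[OF g L2[OF u(1)] L2[OF l(1)], of n] u(2)[of n] by linarith
    then show "\<exists>N. \<forall>n\<ge>N. L2_norm M (\<lambda>x. g x - l x) \<le> d + 1 / real (Suc n) + L2_norm M (\<lambda>x. u n x - l x)" by blast
  qed
  with dle l(1) show ?thesis by (intro bexI[of _ l]) (auto intro: order_trans)
qed

lemma projection_exists:
  assumes g: "g \<in> L2_space M"
  shows "\<exists>h\<in>H. \<forall>k\<in>H. L2_inner M (\<lambda>x. g x - h x) k = 0"
proof -
  obtain h where h: "h \<in> H" "\<And>k. k \<in> H \<Longrightarrow> L2_norm M (\<lambda>x. g x - h x) \<le> L2_norm M (\<lambda>x. g x - k x)"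
    using minimizer_exists[OF g] by blast
  define e where "e = (\<lambda>x. g x - h x)"
  have e: "e \<in> L2_space M" unfolding e_def by (intro L2_space_diff g L2 h)
  have "L2_inner M e k = 0" if k: "k \<in> H" for k
  proof (cases "L2_norm M k = 0")
    case True
    then show ?thesis using L2_Cauchy_Schwarz[OF e L2[OF k]] by simp
  next
    case False
    define b where "b = L2_inner M e k"
    \<comment> \<open>The coefficient of the component of \<open>e\<close> along \<open>k\<close>.
      Subtracting \<open>t k\<close> would lower the squared norm by
      \<open>(cmod b)^2 / (L2_norm M k)^2\<close>, which minimality of \<open>h\<close> forbids
      unless \<open>b = 0\<close>.\<close>
    define t where "t = b / of_real ((L2_norm M k)\<^sup>2)"
    have "L2_norm M e \<le> L2_norm M (\<lambda>x. g x - (1 * h x + t * k x))"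
      unfolding e_def by (rule h(2)) (intro lin h k)
    also have "(\<lambda>x. g x - (1 * h x + t * k x)) = (\<lambda>x. e x - t * k x)" by (auto simp: e_def)
    finally have "(L2_norm M e)\<^sup>2 \<le> (L2_norm M (\<lambda>x. e x - t * k x))\<^sup>2" by (intro power_mono) auto
    also have "\<dots> = (L2_norm M e)\<^sup>2 - 2 * Re (cnj t * b) + (cmod t * L2_norm M k)\<^sup>2"
      using L2_norm_diff_sq[OF e L2_space_scale[OF L2[OF k]], of t]
      by (simp add: L2_inner_scale_right L2_norm_scale b_def)
    also have "cnj t * b = of_real ((cmod b)\<^sup>2 / (L2_norm M k)\<^sup>2)"
      using complex_norm_square[of b] by (simp add: t_def mult.commute)
    also have "(cmod t * L2_norm M k)\<^sup>2 = (cmod b)\<^sup>2 / (L2_norm M k)\<^sup>2"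
      using False by (simp add: t_def norm_divide power_mult_distrib power_divide norm_power) (simp add: field_simps power2_eq_square power4_eq_xxxx)
    finally have "(cmod b)\<^sup>2 / (L2_norm M k)\<^sup>2 \<le> 0" by simp
    then show ?thesis using False by (simp add: b_def divide_le_0_iff)
  qed
  then show ?thesis using h(1) by (auto simp: e_def)
qed

definition proj :: "('a \<Rightarrow> complex) \<Rightarrow> 'a \<Rightarrow> complex" where
  "proj = orthogonal_projection M H"

lemma
  assumes g: "g \<in> L2_space M"
  shows proj_in: "proj g \<in> H"
    and proj_inner: "k \<in> H \<Longrightarrow> L2_inner M (proj g) k = L2_inner M g k"
proof -
  have uniq: "h = h'" if "h \<in> H" "h' \<in> H" "\<forall>k\<in>H. L2_inner M (\<lambda>x. g x - h x) k = 0"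
    "\<forall>k\<in>H. L2_inner M (\<lambda>x. g x - h' x) k = 0" for h h'
    using that L2_inner_diff_left[OF g L2 L2] by (intro inner_eqI) auto
  have ex: "\<exists>!h. h \<in> H \<and> (\<forall>k\<in>H. L2_inner M (\<lambda>x. g x - h x) k = 0)"
  proof (rule ex_ex1I)
    show "\<exists>h. h \<in> H \<and> (\<forall>k\<in>H. L2_inner M (\<lambda>x. g x - h x) k = 0)" using projection_exists[OF g] by blast
  qed (use uniq in blast)
  have "proj g \<in> H \<and> (\<forall>k\<in>H. L2_inner M (\<lambda>x. g x - proj g x) k = 0)"
    using theI'[OF ex] g by (simp add: proj_def orthogonal_projection_def)
  then show "proj g \<in> H" "k \<in> H \<Longrightarrow> L2_inner M (proj g) k = L2_inner M g k"
    using L2_inner_diff_left[OF g L2 L2] by auto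
qed

lemma proj_eqI:
  assumes "g \<in> L2_space M" "h \<in> H" "\<And>k. k \<in> H \<Longrightarrow> L2_inner M g k = L2_inner M h k"
  shows "proj g = h"
  by (rule inner_eqI) (simp_all add: proj_in proj_inner assms)

lemma proj_id: "h \<in> H \<Longrightarrow> proj h = h"
  by (rule proj_eqI) (auto intro: L2)

lemma proj_lin:
  assumes "g \<in> L2_space M" "h \<in> L2_space M"
  shows "proj (\<lambda>x. a * g x + b * h x) = (\<lambda>x. a * proj g x + b * proj h x)"
  by (rule proj_eqI) (simp_all add: L2_space_lin lin proj_in assms L2_inner_lin_left L2 proj_inner)

lemma proj_add:
  "g \<in> L2_space M \<Longrightarrow> h \<in> L2_space M \<Longrightarrow> proj (\<lambda>x. g x + h x) = (\<lambda>x. proj g x + proj h x)"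
  using proj_lin[of g h 1 1] by simp

lemma proj_diff:
  "g \<in> L2_space M \<Longrightarrow> h \<in> L2_space M \<Longrightarrow> proj (\<lambda>x. g x - h x) = (\<lambda>x. proj g x - proj h x)"
  using proj_lin[of g h 1 "-1"] by simp

lemma proj_norm:
  assumes g: "g \<in> L2_space M"
  shows "L2_norm M (proj g) \<le> L2_norm M g"
proof -
  have "(L2_norm M (proj g))\<^sup>2 = cmod (L2_inner M g (proj g))"
    using proj_inner[OF g proj_in[OF g]] L2_inner_self[of M "proj g"]
    by (metis norm_of_real abs_of_nonneg zero_le_power2)
  also have "\<dots> \<le> L2_norm M g * L2_norm M (proj g)"
    by (rule L2_Cauchy_Schwarz[OF g L2[OF proj_in[OF g]]])
  finally show ?thesis
    using L2_norm_nonneg[of M "proj g"] L2_norm_nonneg[of M g]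
    by (cases "L2_norm M (proj g) = 0") (auto simp: power2_eq_square mult_le_cancel_right less_le simp del: L2_norm_nonneg)
qed

lemma proj_minimal:
  assumes g: "g \<in> L2_space M" and k: "k \<in> H"
  shows "L2_norm M (\<lambda>x. g x - proj g x) \<le> L2_norm M (\<lambda>x. g x - k x)"
proof (rule power2_le_imp_le)
  define e where "e = (\<lambda>x. g x - proj g x)"
  define v where "v = (\<lambda>x. proj g x - k x)"
  have v: "v \<in> H" unfolding v_def by (intro diff proj_in g k)
  have e: "e \<in> L2_space M" unfolding e_def by (intro L2_space_diff g L2 proj_in)
  have "L2_inner M e v = 0"
    using proj_inner[OF g v] L2_inner_diff_left[OF g L2[OF proj_in[OF g]] L2[OF v]] by (simp add: e_def)
  then have "(L2_norm M (\<lambda>x. e x + v x))\<^sup>2 = (L2_norm M e)\<^sup>2 + (L2_norm M v)\<^sup>2"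
    using L2_norm_add_sq[OF e L2[OF v]] by simp
  moreover have "(\<lambda>x. e x + v x) = (\<lambda>x. g x - k x)" by (auto simp: e_def v_def)
  ultimately show "(L2_norm M (\<lambda>x. g x - proj g x))\<^sup>2 \<le> (L2_norm M (\<lambda>x. g x - k x))\<^sup>2" by (simp add: e_def)
qed simp

text \<open>The kernel of \<open>l\<close> is closed by the bound. What remains of \<open>x\<close>
  after projecting onto the kernel is orthogonal to it, and every \<open>g\<close> differs from a
  multiple of this remainder by an element of the kernel.\<close>

lemma riesz:
  assumes lin_l: "\<And>g h a b. g \<in> H \<Longrightarrow> h \<in> H \<Longrightarrow> l (\<lambda>x. a * g x + b * h x) = a * l g + b * l h"
    and bound: "\<And>g. g \<in> H \<Longrightarrow> cmod (l g) \<le> C * L2_norm M g"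
  shows "\<exists>k\<in>H. \<forall>g\<in>H. l g = L2_inner M g k"
proof (cases "\<exists>x\<in>H. l x \<noteq> 0")
  case False
  then show ?thesis using zero by (intro bexI[of _ "\<lambda>x. 0"]) (auto simp: L2_inner_def)
next
  case True
  then obtain x where x: "x \<in> H" "l x \<noteq> 0" by auto
  define V where "V = {g\<in>H. l g = 0}"
  have l0: "l (\<lambda>x. 0) = 0" using lin_l[OF zero zero, of 0 0] by simp
  have l_diff: "l (\<lambda>x. g x - h x) = l g - l h" if "g \<in> H" "h \<in> H" for g h
    using lin_l[OF that, of 1 "-1"] by simp
  interpret V: L2_hilbert M V
  proof (rule closed_subspace)
    fix u h assume u: "\<And>n::nat. u n \<in> V" and h: "h \<in> H" "(\<lambda>n. L2_norm M (\<lambda>x. u n x - h x)) \<longlonglongrightarrow> 0"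
    have "cmod (l h) \<le> C * L2_norm M (\<lambda>x. u n x - h x)" for n
      using bound[OF diff[OF _ h(1), of "u n"]] l_diff[of "u n" h] u[of n] h(1) by (simp add: V_def)
    moreover have "(\<lambda>n. C * L2_norm M (\<lambda>x. u n x - h x)) \<longlonglongrightarrow> C * 0" by (intro tendsto_intros h)
    ultimately have "cmod (l h) \<le> C * 0" by (intro LIMSEQ_le_const) auto
    then show "h \<in> V" using h by (simp add: V_def)
  next
    show "V \<subseteq> H" "(\<lambda>x. 0) \<in> V" by (auto simp: V_def zero l0)
    show "(\<lambda>x. a * g x + b * h x) \<in> V" if "g \<in> V" "h \<in> V" for g h a b
      using that lin[of g h a b] lin_l[of g h a b] by (simp add: V_def)
  qed
  define u where "u = (\<lambda>y. x y - V.proj x y)"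
  have px: "V.proj x \<in> V" by (rule V.proj_in[OF L2[OF x(1)]])
  then have px': "V.proj x \<in> H" "l (V.proj x) = 0" by (auto simp: V_def)
  have u: "u \<in> H" "l u = l x" using diff[OF x(1) px'(1)] l_diff[OF x(1) px'(1)] px' by (auto simp: u_def)
  have orth: "L2_inner M k u = 0" if "k \<in> V" for k
  proof -
    have "L2_inner M u k = 0"
      using V.proj_inner[OF L2[OF x(1)] that] L2_inner_diff_left[OF L2[OF x(1)] L2[OF px'(1)] V.L2[OF that]]
      by (simp add: u_def)
    then show ?thesis using L2_inner_cnj[of M k u] by simp
  qed
  have un: "L2_inner M u u \<noteq> 0"
    using definite[OF u(1)] l0 u(2) x(2) by (auto simp: L2_inner_self)
  define c where "c = l u / L2_inner M u u"
  have "l g = L2_inner M g (\<lambda>y. cnj c * u y)" if g: "g \<in> H" for g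
  proof -
    have k: "(\<lambda>y. 1 * g y + (- (l g / l u)) * u y) \<in> V"
      using x(2) u lin[OF g u(1), of 1 "- (l g / l u)"] lin_l[OF g u(1), of 1 "- (l g / l u)"] by (simp add: V_def)
    have "L2_inner M g u - (l g / l u) * L2_inner M u u = 0"
      using orth[OF k] L2_inner_lin_left[OF L2[OF g] L2[OF u(1)] L2[OF u(1)], of 1 "- (l g / l u)"] by simp
    then have "l g = c * L2_inner M g u" using un x(2) u(2) by (simp add: c_def field_simps)
    then show ?thesis by (simp add: L2_inner_scale_right)
  qed
  then show ?thesis using scale[OF u(1)] by blast
qed

text \<open>The points that \<open>V\<close> approximates form a closed subspace \<open>W\<close>.
  The remainder of \<open>x\<close> after projection onto \<open>W\<close> is orthogonal to
  \<open>V\<close>, so it vanishes and \<open>x\<close> lies in \<open>W\<close>.\<close>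

lemma dense_if_orthogonal_trivial:
  assumes V: "V \<subseteq> H" "(\<lambda>x. 0) \<in> V" "\<And>g h a b. g \<in> V \<Longrightarrow> h \<in> V \<Longrightarrow> (\<lambda>x. a * g x + b * h x) \<in> V"
    and triv: "\<And>y. y \<in> H \<Longrightarrow> (\<And>v. v \<in> V \<Longrightarrow> L2_inner M y v = 0) \<Longrightarrow> y = (\<lambda>x. 0)"
    and x: "x \<in> H" and e: "e > 0"
  shows "\<exists>v\<in>V. L2_norm M (\<lambda>y. x y - v y) < e"
proof -
  define W where "W = {x\<in>H. \<forall>e>0. \<exists>v\<in>V. L2_norm M (\<lambda>y. x y - v y) < e}"
  interpret W: L2_hilbert M W
  proof (rule closed_subspace)
    fix g h a b assume g: "g \<in> W" and h: "h \<in> W"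
    have "\<exists>v\<in>V. L2_norm M (\<lambda>y. (a * g y + b * h y) - v y) < e" if "e > 0" for e
    proof -
      define d where "d = e / (cmod a + cmod b + 1)"
      have pos: "cmod a + cmod b + 1 > 0" by (simp add: add_nonneg_pos)
      then have d: "d > 0" "d * (cmod a + cmod b + 1) = e" using that by (simp_all add: d_def)
      obtain v where v: "v \<in> V" "L2_norm M (\<lambda>y. g y - v y) < d" using g d(1) by (auto simp: W_def)
      obtain w where w: "w \<in> V" "L2_norm M (\<lambda>y. h y - w y) < d" using h d(1) by (auto simp: W_def)
      have "L2_norm M (\<lambda>y. (a * g y + b * h y) - (a * v y + b * w y))
         = L2_norm M (\<lambda>y. a * (g y - v y) + b * (h y - w y))" by (simp add: algebra_simps)
      also have "\<dots> \<le> L2_norm M (\<lambda>y. a * (g y - v y)) + L2_norm M (\<lambda>y. b * (h y - w y))"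
        using g h v w V(1) by (intro L2_norm_triangle L2_space_scale L2_space_diff L2) (auto simp: W_def)
      also have "\<dots> \<le> cmod a * d + cmod b * d"
        unfolding L2_norm_scale using v w by (intro add_mono mult_left_mono) auto
      also have "\<dots> < e" using d by (simp add: algebra_simps)
      finally show ?thesis by (rule bexI[OF _ V(3)[OF v(1) w(1)]])
    qed
    then show "(\<lambda>x. a * g x + b * h x) \<in> W" using lin g h by (auto simp: W_def)
  next
    fix u h assume u: "\<And>n::nat. u n \<in> W" and h: "h \<in> H" "(\<lambda>n. L2_norm M (\<lambda>x. u n x - h x)) \<longlonglongrightarrow> 0"
    have "\<exists>v\<in>V. L2_norm M (\<lambda>y. h y - v y) < e" if "e > 0" for e
    proof -
      have half: "e / 2 > 0" using that by simp
      obtain n where n: "L2_norm M (\<lambda>x. u n x - h x) < e/2"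
        using order_tendstoD(2)[OF h(2) half] unfolding eventually_sequentially by blast
      obtain v where v: "v \<in> V" "L2_norm M (\<lambda>y. u n y - v y) < e/2" using u[of n] half unfolding W_def by blast
      have "L2_norm M (\<lambda>y. h y - v y) \<le> L2_norm M (\<lambda>y. h y - u n y) + L2_norm M (\<lambda>y. u n y - v y)"
        using u[of n] v(1) V(1) h(1) by (intro L2_norm_triangle3 L2) (auto simp: W_def)
      then show ?thesis using v n L2_norm_minus_commute[of M h "u n"] by (intro bexI[of _ v]) auto
    qed
    then show "h \<in> W" using h by (auto simp: W_def)
  qed (use V(2) zero in \<open>auto simp: W_def intro!: bexI[of _ "\<lambda>x. 0"]\<close>)
  have VW: "V \<subseteq> W" using V(1) by (auto simp: W_def intro!: bexI)
  have pW: "W.proj x \<in> W" by (rule W.proj_in[OF L2[OF x]])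
  then have pH: "W.proj x \<in> H" by (simp add: W_def)
  have "(\<lambda>y. x y - W.proj x y) = (\<lambda>y. 0)"
    using W.proj_inner[OF L2[OF x]] VW L2_inner_diff_left[OF L2[OF x] L2[OF pH] W.L2]
    by (intro triv diff x pH) auto
  then have "x = W.proj x" by (metis eq_iff_diff_eq_0 ext)
  then show ?thesis using pW e by (auto simp: W_def)
qed

subsection \<open>Bounded operators\<close>

definition bounded_by :: "real \<Rightarrow> (('a \<Rightarrow> complex) \<Rightarrow> ('a \<Rightarrow> complex)) \<Rightarrow> bool" where
  "bounded_by C T \<longleftrightarrow> T \<in> bounded_operators M H \<and> 0 \<le> C \<and> (\<forall>g\<in>H. L2_norm M (T g) \<le> C * L2_norm M g)"

lemma bounded_operatorsE:
  assumes "T \<in> bounded_operators M H"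
  obtains C where "bounded_by C T"
proof -
  obtain C where C: "\<forall>g\<in>H. L2_norm M (T g) \<le> C * L2_norm M g" using assms by (auto simp: bounded_operators_def)
  then have "\<forall>g\<in>H. L2_norm M (T g) \<le> max C 0 * L2_norm M g"
    by (meson L2_norm_nonneg max.cobounded1 mult_right_mono order_trans)
  then show ?thesis using that[of "max C 0"] assms by (auto simp: bounded_by_def)
qed

lemma op_in: "T \<in> bounded_operators M H \<Longrightarrow> g \<in> H \<Longrightarrow> T g \<in> H"
  by (auto simp: bounded_operators_def)

lemma op_L2: "T \<in> bounded_operators M H \<Longrightarrow> g \<in> H \<Longrightarrow> T g \<in> L2_space M"
  using op_in L2 by blast

lemma op_lin: "T \<in> bounded_operators M H \<Longrightarrow> g \<in> H \<Longrightarrow> h \<in> H \<Longrightarrow>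
   T (\<lambda>x. a * g x + b * h x) = (\<lambda>x. a * T g x + b * T h x)"
  by (auto simp: bounded_operators_def)

lemma op_add: "T \<in> bounded_operators M H \<Longrightarrow> g \<in> H \<Longrightarrow> h \<in> H \<Longrightarrow>
   T (\<lambda>x. g x + h x) = (\<lambda>x. T g x + T h x)"
  using op_lin[of T g h 1 1] by simp

lemma op_diff: "T \<in> bounded_operators M H \<Longrightarrow> g \<in> H \<Longrightarrow> h \<in> H \<Longrightarrow>
   T (\<lambda>x. g x - h x) = (\<lambda>x. T g x - T h x)"
  using op_lin[of T g h 1 "-1"] by simp

lemma op_scale: "T \<in> bounded_operators M H \<Longrightarrow> g \<in> H \<Longrightarrow> T (\<lambda>x. c * g x) = (\<lambda>x. c * T g x)"
  using op_lin[of T g g c 0] by simp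

lemma op_zero: "T \<in> bounded_operators M H \<Longrightarrow> T (\<lambda>x. 0) = (\<lambda>x. 0)"
  using op_scale[OF _ zero, of T 0] by simp

lemma op_extensional: "T \<in> bounded_operators M H \<Longrightarrow> g \<notin> H \<Longrightarrow> T g = undefined"
  by (auto simp: bounded_operators_def PiE_def extensional_def)

lemma op_eqI:
  "S \<in> bounded_operators M H \<Longrightarrow> T \<in> bounded_operators M H \<Longrightarrow> (\<And>g. g \<in> H \<Longrightarrow> S g = T g) \<Longrightarrow> S = T"
  using op_extensional by (metis ext)

lemma bounded_operatorsI:
  assumes "\<And>g. g \<notin> H \<Longrightarrow> T g = undefined" "\<And>g. g \<in> H \<Longrightarrow> T g \<in> H"
    "\<And>g h a b. g \<in> H \<Longrightarrow> h \<in> H \<Longrightarrow> T (\<lambda>x. a * g x + b * h x) = (\<lambda>x. a * T g x + b * T h x)"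
    "\<And>g. g \<in> H \<Longrightarrow> L2_norm M (T g) \<le> C * L2_norm M g"
  shows "T \<in> bounded_operators M H"
  unfolding bounded_operators_def using assms by (auto simp: PiE_def extensional_def intro!: exI[of _ C])

text \<open>The lower bound gives injectivity and a closed range; \<open>triv\<close> says that
  nothing is orthogonal to the range, which is therefore everything. The inverse is bounded by
  \<open>1 / c\<close>.\<close>

lemma bijective_inverse:
  assumes T: "T \<in> bounded_operators M H" and c: "c > 0"
    and below: "\<And>g. g \<in> H \<Longrightarrow> c * L2_norm M g \<le> L2_norm M (T g)"
    and triv: "\<And>y. y \<in> H \<Longrightarrow> (\<And>g. g \<in> H \<Longrightarrow> L2_inner M (T g) y = 0) \<Longrightarrow> y = (\<lambda>x. 0)"
  shows "\<exists>S\<in>bounded_operators M H. (\<forall>g\<in>H. S (T g) = g) \<and> (\<forall>g\<in>H. T (S g) = g)"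
proof -
  obtain C where C: "bounded_by C T" using bounded_operatorsE[OF T] .
  interpret R: L2_hilbert M "T ` H"
  proof (rule closed_subspace)
    show "T ` H \<subseteq> H" using op_in[OF T] by auto
    show "(\<lambda>x. 0) \<in> T ` H" using op_zero[OF T] zero by (metis image_eqI)
    show "(\<lambda>x. a * g x + b * h x) \<in> T ` H" if "g \<in> T ` H" "h \<in> T ` H" for g h a b
    proof -
      from that obtain g' h' where "g' \<in> H" "h' \<in> H" "g = T g'" "h = T h'" by auto
      then show ?thesis
        using op_lin[OF T, of g' h' a b] lin[of g' h' a b]
        by (intro image_eqI[of _ _ "\<lambda>x. a * g' x + b * h' x"]) auto
    qed
  next
    fix u l assume u: "\<And>n::nat. u n \<in> T ` H" and l: "l \<in> H" and lim: "(\<lambda>n. L2_norm M (\<lambda>x. u n x - l x)) \<longlonglongrightarrow> 0"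
    have "\<exists>v. \<forall>n. v n \<in> H \<and> u n = T (v n)" by (intro choice) (use u in auto)
    then obtain v where v: "\<And>n. v n \<in> H" "\<And>n. u n = T (v n)" by blast
    have "\<exists>N. \<forall>m\<ge>N. \<forall>n\<ge>N. L2_norm M (\<lambda>x. v m x - v n x) < e" if "e > 0" for e :: real
    proof -
      have "c * e / 2 > 0" using that c by simp
      from order_tendstoD(2)[OF lim this]
      obtain N where N: "\<And>n. n \<ge> N \<Longrightarrow> L2_norm M (\<lambda>x. u n x - l x) < c * e / 2"
        unfolding eventually_sequentially by blast
      have "L2_norm M (\<lambda>x. v m x - v n x) < e" if "m \<ge> N" "n \<ge> N" for m n
      proof -
        have "c * L2_norm M (\<lambda>x. v m x - v n x) \<le> L2_norm M (\<lambda>x. u m x - u n x)"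
          using below[OF diff[OF v(1) v(1)]] op_diff[OF T v(1) v(1)] v(2) by simp
        also have "\<dots> \<le> L2_norm M (\<lambda>x. u m x - l x) + L2_norm M (\<lambda>x. l x - u n x)"
          using v l op_in[OF T] by (intro L2_norm_triangle3 L2) auto
        also have "\<dots> < c * e" using N[OF that(1)] N[OF that(2)] L2_norm_minus_commute[of M l "u n"] by simp
        finally show ?thesis using c by simp
      qed
      then show ?thesis by blast
    qed
    from complete[OF v(1) this] obtain h where h: "h \<in> H" "(\<lambda>n. L2_norm M (\<lambda>x. v n x - h x)) \<longlonglongrightarrow> 0" by blast
    have "L2_norm M (\<lambda>x. l x - T h x) \<le> 0 + C * 0"
    proof (rule LIMSEQ_le_const)
      show "(\<lambda>n. L2_norm M (\<lambda>x. u n x - l x) + C * L2_norm M (\<lambda>x. v n x - h x)) \<longlonglongrightarrow> 0 + C * 0"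
        by (intro tendsto_intros lim h)
      have "L2_norm M (\<lambda>x. l x - T h x) \<le> L2_norm M (\<lambda>x. u n x - l x) + C * L2_norm M (\<lambda>x. v n x - h x)" for n
      proof -
        have "L2_norm M (\<lambda>x. l x - T h x) \<le> L2_norm M (\<lambda>x. l x - u n x) + L2_norm M (\<lambda>x. u n x - T h x)"
          using v l h op_in[OF T] by (intro L2_norm_triangle3 L2) auto
        also have "L2_norm M (\<lambda>x. u n x - T h x) \<le> C * L2_norm M (\<lambda>x. v n x - h x)"
          using C diff[OF v(1)[of n] h(1)] op_diff[OF T v(1)[of n] h(1)] v(2)[of n] by (auto simp: bounded_by_def)
        finally show ?thesis using L2_norm_minus_commute[of M l "u n"] by simp
      qed
      then show "\<exists>N. \<forall>n\<ge>N. L2_norm M (\<lambda>x. l x - T h x) \<le> L2_norm M (\<lambda>x. u n x - l x) + C * L2_norm M (\<lambda>x. v n x - h x)" by blast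
    qed
    then have "L2_norm M (\<lambda>x. l x - T h x) = 0" by (simp add: order_antisym)
    then have "l = T h" by (intro eqI l op_in[OF T] h)
    then show "l \<in> T ` H" using h by simp
  qed
  have surj: "x \<in> T ` H" if x: "x \<in> H" for x
  proof -
    have pT: "R.proj x \<in> T ` H" by (rule R.proj_in[OF L2[OF x]])
    then have pH: "R.proj x \<in> H" using op_in[OF T] by auto
    have "L2_inner M (T g) (\<lambda>y. x y - R.proj x y) = 0" if "g \<in> H" for g
    proof -
      have "L2_inner M (\<lambda>y. x y - R.proj x y) (T g) = 0"
        using R.proj_inner[OF L2[OF x]] that L2_inner_diff_left[OF L2[OF x] L2[OF pH] L2[OF op_in[OF T that]]] by simp
      then show ?thesis by (metis L2_inner_cnj complex_cnj_zero)
    qed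
    then have "(\<lambda>y. x y - R.proj x y) = (\<lambda>y. 0)" by (intro triv diff x pH)
    then have "x = R.proj x" by (metis eq_iff_diff_eq_0 ext)
    then show ?thesis using pT by simp
  qed
  have inj: "g = h" if "g \<in> H" "h \<in> H" "T g = T h" for g h
  proof (rule eqI[OF that(1,2)])
    have "c * L2_norm M (\<lambda>x. g x - h x) \<le> 0" using below[OF diff[OF that(1,2)]] op_diff[OF T that(1,2)] that(3) by simp
    then show "L2_norm M (\<lambda>x. g x - h x) = 0" using c by (simp add: mult_le_0_iff order_antisym)
  qed
  define S where "S = (\<lambda>h\<in>H. THE g. g \<in> H \<and> T g = h)"
  have S: "S h \<in> H \<and> T (S h) = h" if "h \<in> H" for h
  proof -
    have "\<exists>!g. g \<in> H \<and> T g = h" using surj[OF that] inj by (auto simp: image_iff)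
    from theI'[OF this] show ?thesis using that by (simp add: S_def)
  qed
  have ST: "S (T g) = g" if "g \<in> H" for g using S[OF op_in[OF T that]] inj that by blast
  have "S \<in> bounded_operators M H"
  proof (rule bounded_operatorsI)
    show "S (\<lambda>x. a * g x + b * h x) = (\<lambda>x. a * S g x + b * S h x)" if "g \<in> H" "h \<in> H" for g h a b
      by (rule inj) (use that S lin op_lin[OF T] in auto)
    show "L2_norm M (S g) \<le> (1 / c) * L2_norm M g" if "g \<in> H" for g
      using below[of "S g"] S[OF that] c by (simp add: field_simps)
  qed (use S in \<open>auto simp: S_def\<close>)
  then show ?thesis using S ST by blast
qed

end

section \<open>The operator algebra and the Calkin algebra\<close>

definition L2_Cauchy :: "'a measure \<Rightarrow> (nat \<Rightarrow> 'a \<Rightarrow> complex) \<Rightarrow> bool" where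
  "L2_Cauchy M u \<longleftrightarrow> (\<forall>e::real>0. \<exists>N. \<forall>m\<ge>N. \<forall>n\<ge>N. L2_norm M (\<lambda>x. u m x - u n x) < e)"

lemma L2_Cauchy_subseq: "L2_Cauchy M u \<Longrightarrow> strict_mono r \<Longrightarrow> L2_Cauchy M (\<lambda>n. u (r n))"
  unfolding L2_Cauchy_def by (meson order_trans seq_suble)

lemma L2_Cauchy_dominated:
  assumes "L2_Cauchy M u" "\<And>m n. L2_norm N (\<lambda>x. v m x - v n x) \<le> C * L2_norm M (\<lambda>x. u m x - u n x)" "C > 0"
  shows "L2_Cauchy N v"
  unfolding L2_Cauchy_def
proof (intro allI impI)
  fix e :: real assume "e > 0"
  then have "e / C > 0" using assms(3) by simp
  then obtain K where K: "\<forall>m\<ge>K. \<forall>n\<ge>K. L2_norm M (\<lambda>x. u m x - u n x) < e / C"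
    using assms(1) unfolding L2_Cauchy_def by blast
  have "L2_norm N (\<lambda>x. v m x - v n x) < e" if "m \<ge> K" "n \<ge> K" for m n
  proof -
    have "C * L2_norm M (\<lambda>x. u m x - u n x) < C * (e / C)"
      using K that assms(3) by (intro mult_strict_left_mono) auto
    then show ?thesis using assms(2)[of m n] assms(3) by simp
  qed
  then show "\<exists>K. \<forall>m\<ge>K. \<forall>n\<ge>K. L2_norm N (\<lambda>x. v m x - v n x) < e" by blast
qed

lemma L2_Cauchy_add:
  assumes "L2_Cauchy M u" "L2_Cauchy M v" "\<And>n. u n \<in> L2_space M" "\<And>n. v n \<in> L2_space M"
  shows "L2_Cauchy M (\<lambda>n x. u n x + v n x)"
  unfolding L2_Cauchy_def
proof (intro allI impI)
  fix e :: real assume "e > 0"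
  then have "e / 2 > 0" by simp
  then obtain K L where K: "\<forall>m\<ge>K. \<forall>n\<ge>K. L2_norm M (\<lambda>x. u m x - u n x) < e / 2"
    and L: "\<forall>m\<ge>L. \<forall>n\<ge>L. L2_norm M (\<lambda>x. v m x - v n x) < e / 2"
    using assms(1,2) unfolding L2_Cauchy_def by blast
  have "L2_norm M (\<lambda>x. u m x + v m x - (u n x + v n x)) < e" if "m \<ge> max K L" "n \<ge> max K L" for m n
  proof -
    have "L2_norm M (\<lambda>x. (u m x - u n x) + (v m x - v n x)) \<le> L2_norm M (\<lambda>x. u m x - u n x) + L2_norm M (\<lambda>x. v m x - v n x)"
      by (intro L2_norm_triangle L2_space_diff assms)
    moreover have "L2_norm M (\<lambda>x. u m x - u n x) < e / 2" "L2_norm M (\<lambda>x. v m x - v n x) < e / 2"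
      using K L that by auto
    ultimately show ?thesis by (simp add: algebra_simps)
  qed
  then show "\<exists>K. \<forall>m\<ge>K. \<forall>n\<ge>K. L2_norm M (\<lambda>x. u m x + v m x - (u n x + v n x)) < e" by blast
qed

context L2_hilbert
begin

lemma metric: "Metric_space H (L2_dist M)"
proof
  show "0 \<le> L2_dist M x y" for x y by (simp add: L2_dist_def)
  show "L2_dist M x y = L2_dist M y x" for x y unfolding L2_dist_def by (rule L2_norm_minus_commute)
  show "(L2_dist M x y = 0) = (x = y)" if "x \<in> H" "y \<in> H" for x y
    using eqI[OF that] by (auto simp: L2_dist_def)
  show "L2_dist M x z \<le> L2_dist M x y + L2_dist M y z" if "x \<in> H" "y \<in> H" "z \<in> H" for x y z
    unfolding L2_dist_def by (intro L2_norm_triangle3 L2 that)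
qed

interpretation metr: Metric_space H "L2_dist M"
  by (rule metric)

lemma MCauchy_iff: "metr.MCauchy u \<longleftrightarrow> range u \<subseteq> H \<and> L2_Cauchy M u"
proof -
  have "(\<forall>n n'. N \<le> n \<longrightarrow> N \<le> n' \<longrightarrow> Q n n') \<longleftrightarrow> (\<forall>m\<ge>N. \<forall>n\<ge>N. Q m n)" for N :: nat and Q by blast
  then show ?thesis unfolding metr.MCauchy_def L2_Cauchy_def L2_dist_def by simp
qed

lemma mcomplete: "metr.mcomplete"
  unfolding metr.mcomplete_def MCauchy_iff metr.limitin_metric_dist_null L2_dist_def
proof (intro allI impI)
  fix u assume u: "range u \<subseteq> H \<and> L2_Cauchy M u"
  then have uH: "u n \<in> H" for n by auto
  have "\<exists>l\<in>H. (\<lambda>n. L2_norm M (\<lambda>x. u n x - l x)) \<longlonglongrightarrow> 0"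
    using u by (intro complete uH) (simp add: L2_Cauchy_def)
  with uH show "\<exists>x. x \<in> H \<and> (\<forall>\<^sub>F n in sequentially. u n \<in> H) \<and> (\<lambda>n. L2_norm M (\<lambda>xa. u n xa - x xa)) \<longlonglongrightarrow> 0"
    using uH by auto
qed

text \<open>In a complete metric space a set has compact closure exactly if it is totally bounded,
  that is, if each of its sequences has a Cauchy subsequence. All later compactness arguments use
  this sequential form.\<close>

lemma compact_operators_iff:
  "T \<in> compact_operators M H \<longleftrightarrow> T \<in> bounded_operators M H \<and>
    (\<forall>u::nat \<Rightarrow> _. (\<forall>n. u n \<in> H \<and> L2_norm M (u n) \<le> 1) \<longrightarrow> (\<exists>r::nat \<Rightarrow> nat. strict_mono r \<and> L2_Cauchy M (\<lambda>n. T (u (r n)))))"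
proof (cases "T \<in> bounded_operators M H")
  case True
  define S where "S = T ` {g \<in> H. L2_norm M g \<le> 1}"
  have S: "S \<subseteq> H" using op_in[OF True] by (auto simp: S_def)
  have "T \<in> compact_operators M H \<longleftrightarrow> metr.mtotally_bounded S"
    unfolding compact_operators_def metr.mtotally_bounded_eq_compact_closure_of[OF mcomplete]
    using True S by (simp add: S_def)
  also have "\<dots> \<longleftrightarrow> (\<forall>s::nat \<Rightarrow> _. range s \<subseteq> S \<longrightarrow> (\<exists>r::nat \<Rightarrow> nat. strict_mono r \<and> L2_Cauchy M (s \<circ> r)))"
  proof -
    have "range (s \<circ> r) \<subseteq> H" if "range s \<subseteq> S" for s :: "nat \<Rightarrow> _" and r :: "nat \<Rightarrow> nat"
      using S that by auto
    with S show ?thesis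
      unfolding metr.mtotally_bounded_sequentially MCauchy_iff by (intro iffI conjI allI impI) meson+
  qed
  also have "\<dots> \<longleftrightarrow> (\<forall>u::nat \<Rightarrow> _. (\<forall>n. u n \<in> H \<and> L2_norm M (u n) \<le> 1) \<longrightarrow>
      (\<exists>r::nat \<Rightarrow> nat. strict_mono r \<and> L2_Cauchy M (\<lambda>n. T (u (r n)))))" (is "?A \<longleftrightarrow> ?B")
  proof
    assume A: ?A
    show ?B
    proof (intro allI impI)
      fix u :: "nat \<Rightarrow> _" assume "\<forall>n. u n \<in> H \<and> L2_norm M (u n) \<le> 1"
      then have "range (\<lambda>n. T (u n)) \<subseteq> S" by (auto simp: S_def)
      with A show "\<exists>r::nat \<Rightarrow> nat. strict_mono r \<and> L2_Cauchy M (\<lambda>n. T (u (r n)))"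
        by (auto simp: o_def)
    qed
  next
    assume B: ?B
    show ?A
    proof (intro allI impI)
      fix s :: "nat \<Rightarrow> _" assume s: "range s \<subseteq> S"
      have "\<exists>u. \<forall>n. (u n \<in> H \<and> L2_norm M (u n) \<le> 1) \<and> s n = T (u n)"
        using s by (intro choice) (auto simp: S_def)
      then obtain u where u: "\<forall>n. u n \<in> H \<and> L2_norm M (u n) \<le> 1" "\<forall>n. s n = T (u n)" by blast
      with B show "\<exists>r::nat \<Rightarrow> nat. strict_mono r \<and> L2_Cauchy M (s \<circ> r)" by (auto simp: o_def)
    qed
  qed
  finally show ?thesis using True by simp
qed (simp add: compact_operators_def)

lemma compact_operatorD:
  assumes T: "T \<in> compact_operators M H" and u: "\<And>n::nat. u n \<in> H" "\<And>n. L2_norm M (u n) \<le> B"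
  shows "\<exists>r::nat \<Rightarrow> nat. strict_mono r \<and> L2_Cauchy M (\<lambda>n. T (u (r n)))"
proof -
  define c where "c = \<bar>B\<bar> + 1"
  have c: "c > 0" "B \<le> c" by (auto simp: c_def)
  have Tb: "T \<in> bounded_operators M H" using T by (simp add: compact_operators_def)
  define v where "v = (\<lambda>n x. of_real (1 / c) * u n x)"
  have v1: "L2_norm M (v n) \<le> 1" for n
  proof -
    have "L2_norm M (v n) = (1 / c) * L2_norm M (u n)"
      unfolding v_def L2_norm_scale using c by (simp add: norm_divide)
    then have "c * L2_norm M (v n) \<le> c * 1" using u(2)[of n] c by simp
    then show ?thesis using c(1) by (rule mult_left_le_imp_le)
  qed
  have v: "\<forall>n. v n \<in> H \<and> L2_norm M (v n) \<le> 1"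
    using v1 scale[OF u(1), of "of_real (1/c)"] unfolding v_def by blast
  with T obtain r :: "nat \<Rightarrow> nat" where r: "strict_mono r" "L2_Cauchy M (\<lambda>n. T (v (r n)))"
    unfolding compact_operators_iff by blast
  have "L2_Cauchy M (\<lambda>n. T (u (r n)))"
  proof (rule L2_Cauchy_dominated[OF r(2) _ c(1)])
    fix m n
    have "T (v k) = (\<lambda>x. of_real (1 / c) * T (u k) x)" for k
      unfolding v_def by (rule op_scale[OF Tb u(1)])
    then have "L2_norm M (\<lambda>x. T (v (r m)) x - T (v (r n)) x)
        = L2_norm M (\<lambda>x. of_real (1 / c) * (T (u (r m)) x - T (u (r n)) x))" by (simp add: algebra_simps)
    then show "L2_norm M (\<lambda>x. T (u (r m)) x - T (u (r n)) x) \<le> c * L2_norm M (\<lambda>x. T (v (r m)) x - T (v (r n)) x)"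
      unfolding L2_norm_scale using c by (simp add: norm_divide)
  qed
  with r(1) show ?thesis by blast
qed

lemma compose_bounded:
  assumes S: "S \<in> bounded_operators M H" and T: "T \<in> bounded_operators M H"
  shows "compose H S T \<in> bounded_operators M H"
proof -
  obtain C D where C: "bounded_by C S" and D: "bounded_by D T" using bounded_operatorsE S T by meson
  show ?thesis
  proof (rule bounded_operatorsI)
    show "L2_norm M (compose H S T g) \<le> (C * D) * L2_norm M g" if g: "g \<in> H" for g
    proof -
      have "L2_norm M (S (T g)) \<le> C * L2_norm M (T g)" using C op_in[OF T g] by (simp add: bounded_by_def)
      also have "\<dots> \<le> C * (D * L2_norm M g)" using C D g by (intro mult_left_mono) (auto simp: bounded_by_def)
      finally show ?thesis using g by (simp add: compose_def mult.assoc)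
    qed
  qed (simp_all add: compose_def op_in S T lin op_lin)
qed

lemma add_bounded:
  assumes S: "S \<in> bounded_operators M H" and T: "T \<in> bounded_operators M H"
  shows "(\<lambda>g\<in>H. \<lambda>x. S g x + T g x) \<in> bounded_operators M H"
proof -
  obtain C D where C: "bounded_by C S" and D: "bounded_by D T" using bounded_operatorsE S T by meson
  show ?thesis
  proof (rule bounded_operatorsI)
    show "L2_norm M ((\<lambda>g\<in>H. \<lambda>x. S g x + T g x) g) \<le> (C + D) * L2_norm M g" if g: "g \<in> H" for g
    proof -
      have "L2_norm M (\<lambda>x. S g x + T g x) \<le> L2_norm M (S g) + L2_norm M (T g)"
        by (intro L2_norm_triangle op_L2 S T g)
      also have "\<dots> \<le> C * L2_norm M g + D * L2_norm M g" using C D g by (intro add_mono) (auto simp: bounded_by_def)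
      finally show ?thesis using g by (simp add: algebra_simps)
    qed
  qed (simp_all add: op_in S T lin op_lin add algebra_simps)
qed

lemma scale_bounded:
  assumes T: "T \<in> bounded_operators M H"
  shows "(\<lambda>g\<in>H. \<lambda>x. c * T g x) \<in> bounded_operators M H"
proof -
  obtain C where C: "bounded_by C T" using bounded_operatorsE[OF T] by blast
  show ?thesis
  proof (rule bounded_operatorsI)
    show "L2_norm M ((\<lambda>g\<in>H. \<lambda>x. c * T g x) g) \<le> (cmod c * C) * L2_norm M g" if g: "g \<in> H" for g
    proof -
      have "L2_norm M (\<lambda>x. c * T g x) \<le> cmod c * (C * L2_norm M g)"
        unfolding L2_norm_scale using C g by (intro mult_left_mono) (auto simp: bounded_by_def)
      then show ?thesis using g by (simp add: mult.assoc)
    qed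
  qed (simp_all add: op_in T lin op_lin scale algebra_simps)
qed

lemma scalar_bounded: "scalar_operator H c \<in> bounded_operators M H"
  by (rule bounded_operatorsI[where C="cmod c"])
    (simp_all add: scalar_operator_def lin scale L2_norm_scale algebra_simps)

abbreviation "OA \<equiv> operator_algebra M H"

lemma OA_simps:
  "carrier OA = bounded_operators M H" "S \<otimes>\<^bsub>OA\<^esub> T = compose H S T"
  "\<one>\<^bsub>OA\<^esub> = scalar_operator H 1" "\<zero>\<^bsub>OA\<^esub> = scalar_operator H 0"
  "S \<oplus>\<^bsub>OA\<^esub> T = (\<lambda>g\<in>H. \<lambda>x. S g x + T g x)"
  by (simp_all add: operator_algebra_def)

lemma ring_OA: "ring OA"
proof (rule ringI)
  show "abelian_group OA"
  proof (rule abelian_groupI, unfold OA_simps)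
    fix S T U assume "S \<in> bounded_operators M H" "T \<in> bounded_operators M H" "U \<in> bounded_operators M H"
    then show "(\<lambda>g\<in>H. \<lambda>x. (\<lambda>g\<in>H. \<lambda>x. S g x + T g x) g x + U g x) = (\<lambda>g\<in>H. \<lambda>x. S g x + (\<lambda>g\<in>H. \<lambda>x. T g x + U g x) g x)"
      by (intro restrict_ext) (simp add: add.assoc)
  next
    fix S assume S: "S \<in> bounded_operators M H"
    show "(\<lambda>g\<in>H. \<lambda>x. scalar_operator H 0 g x + S g x) = S"
      by (rule op_eqI[OF add_bounded[OF scalar_bounded S] S]) (simp add: scalar_operator_def)
    show "\<exists>T\<in>bounded_operators M H. (\<lambda>g\<in>H. \<lambda>x. T g x + S g x) = scalar_operator H 0"
      by (rule bexI[OF _ scale_bounded[OF S, of "-1"]]) (auto simp: scalar_operator_def intro: restrict_ext)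
  qed (auto intro: add_bounded scalar_bounded restrict_ext simp: add.commute)
  show "monoid OA"
  proof (rule monoidI, unfold OA_simps)
    fix S T U assume S: "S \<in> bounded_operators M H" and T: "T \<in> bounded_operators M H" and U: "U \<in> bounded_operators M H"
    show "compose H (compose H S T) U = compose H S (compose H T U)"
      unfolding compose_def by (intro restrict_ext) (simp add: op_in[OF U])
    show "compose H (scalar_operator H 1) S = S"
      by (rule op_eqI[OF compose_bounded[OF scalar_bounded S] S]) (simp add: compose_def scalar_operator_def op_in[OF S])
    show "compose H S (scalar_operator H 1) = S"
      by (rule op_eqI[OF compose_bounded[OF S scalar_bounded] S]) (simp add: compose_def scalar_operator_def)
  qed (auto intro: compose_bounded scalar_bounded)
  fix S T U assume "S \<in> carrier OA" "T \<in> carrier OA" "U \<in> carrier OA"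
  then have S: "S \<in> bounded_operators M H" and T: "T \<in> bounded_operators M H" and U: "U \<in> bounded_operators M H"
    by (simp_all add: OA_simps)
  show "(S \<oplus>\<^bsub>OA\<^esub> T) \<otimes>\<^bsub>OA\<^esub> U = S \<otimes>\<^bsub>OA\<^esub> U \<oplus>\<^bsub>OA\<^esub> T \<otimes>\<^bsub>OA\<^esub> U"
    unfolding OA_simps compose_def by (intro restrict_ext) (simp add: op_in[OF U])
  show "U \<otimes>\<^bsub>OA\<^esub> (S \<oplus>\<^bsub>OA\<^esub> T) = U \<otimes>\<^bsub>OA\<^esub> S \<oplus>\<^bsub>OA\<^esub> U \<otimes>\<^bsub>OA\<^esub> T"
    unfolding OA_simps compose_def by (intro restrict_ext) (simp add: op_add[OF U] op_in[OF S] op_in[OF T])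
qed

interpretation OA: ring OA
  by (rule ring_OA)

lemma OA_uminus: "S \<in> bounded_operators M H \<Longrightarrow> \<ominus>\<^bsub>OA\<^esub> S = (\<lambda>g\<in>H. \<lambda>x. - 1 * S g x)"
  using scale_bounded[of S "-1"]
  by (intro OA.minus_equality) (auto simp: OA_simps scalar_operator_def intro: restrict_ext)

lemma OA_minus:
  assumes "S \<in> bounded_operators M H" "T \<in> bounded_operators M H"
  shows "S \<ominus>\<^bsub>OA\<^esub> T = (\<lambda>g\<in>H. \<lambda>x. S g x - T g x)"
  unfolding a_minus_def OA_uminus[OF assms(2)] OA_simps by (intro restrict_ext) simp

lemma ideal_compact: "ideal (compact_operators M H) OA"
proof (rule idealI[OF ring_OA])
  have sub: "K \<in> bounded_operators M H" if "K \<in> compact_operators M H" for K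
    using that by (simp add: compact_operators_def)
  have left: "compose H S K \<in> compact_operators M H" if K: "K \<in> compact_operators M H" and S: "S \<in> bounded_operators M H" for K S
    unfolding compact_operators_iff
  proof (intro conjI allI impI)
    show "compose H S K \<in> bounded_operators M H" by (rule compose_bounded[OF S sub[OF K]])
    fix u :: "nat \<Rightarrow> _" assume u: "\<forall>n. u n \<in> H \<and> L2_norm M (u n) \<le> 1"
    then obtain r :: "nat \<Rightarrow> nat" where r: "strict_mono r" "L2_Cauchy M (\<lambda>n. K (u (r n)))"
      using K unfolding compact_operators_iff by blast
    obtain C where C: "bounded_by C S" using bounded_operatorsE[OF S] by blast
    have "L2_Cauchy M (\<lambda>n. compose H S K (u (r n)))"
    proof (rule L2_Cauchy_dominated[OF r(2)])
      fix m n
      have Ku: "K (u (r k)) \<in> H" for k using op_in[OF sub[OF K]] u by blast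
      have "L2_norm M (\<lambda>x. S (K (u (r m))) x - S (K (u (r n))) x) \<le> C * L2_norm M (\<lambda>x. K (u (r m)) x - K (u (r n)) x)"
        using C diff[OF Ku Ku, of m n] op_diff[OF S Ku Ku, of m n] by (auto simp: bounded_by_def)
      \<comment> \<open>\<open>C\<close> may be 0, whereas \<open>L2_Cauchy_dominated\<close> takes
        a positive constant.\<close>
      also have "\<dots> \<le> (C + 1) * L2_norm M (\<lambda>x. K (u (r m)) x - K (u (r n)) x)" by (intro mult_right_mono) auto
      finally show "L2_norm M (\<lambda>x. compose H S K (u (r m)) x - compose H S K (u (r n)) x)
          \<le> (C + 1) * L2_norm M (\<lambda>x. K (u (r m)) x - K (u (r n)) x)" using u by (simp add: compose_def)
    qed (use C in \<open>simp add: bounded_by_def\<close>)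
    with r(1) show "\<exists>r::nat \<Rightarrow> nat. strict_mono r \<and> L2_Cauchy M (\<lambda>n. compose H S K (u (r n)))" by blast
  qed
  then show "S \<otimes>\<^bsub>OA\<^esub> K \<in> compact_operators M H" if "K \<in> compact_operators M H" "S \<in> carrier OA" for K S
    using that by (simp add: OA_simps)
  show "K \<otimes>\<^bsub>OA\<^esub> S \<in> compact_operators M H" if K: "K \<in> compact_operators M H" and "S \<in> carrier OA" for K S
    unfolding OA_simps compact_operators_iff
  proof (intro conjI allI impI)
    have S: "S \<in> bounded_operators M H" using that by (simp add: OA_simps)
    show "compose H K S \<in> bounded_operators M H" by (rule compose_bounded[OF sub[OF K] S])
    fix u :: "nat \<Rightarrow> _" assume u: "\<forall>n. u n \<in> H \<and> L2_norm M (u n) \<le> 1"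
    obtain C where C: "bounded_by C S" using bounded_operatorsE[OF S] by blast
    have "L2_norm M (S (u n)) \<le> C" for n
    proof -
      have "L2_norm M (S (u n)) \<le> C * L2_norm M (u n)" using C u by (auto simp: bounded_by_def)
      also have "\<dots> \<le> C * 1" using C u by (intro mult_left_mono) (auto simp: bounded_by_def)
      finally show ?thesis by simp
    qed
    moreover have "S (u n) \<in> H" for n using op_in[OF S] u by blast
    ultimately obtain r :: "nat \<Rightarrow> nat" where r: "strict_mono r" "L2_Cauchy M (\<lambda>n. K (S (u (r n))))"
      using compact_operatorD[OF K, of "\<lambda>n. S (u n)" C] by blast
    moreover have "(\<lambda>n. compose H K S (u (r n))) = (\<lambda>n. K (S (u (r n))))" using u by (simp add: compose_def)
    ultimately show "\<exists>r::nat \<Rightarrow> nat. strict_mono r \<and> L2_Cauchy M (\<lambda>n. compose H K S (u (r n)))" by (intro exI[of _ r]) simp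
  qed
  show "subgroup (compact_operators M H) (add_monoid OA)"
  proof
    show "compact_operators M H \<subseteq> carrier (add_monoid OA)" using sub by (auto simp: OA_simps)
    show "\<one>\<^bsub>add_monoid OA\<^esub> \<in> compact_operators M H"
      unfolding compact_operators_iff using scalar_bounded[of 0]
      by (auto simp: OA_simps scalar_operator_def L2_Cauchy_def intro!: exI[of _ id] strict_mono_id)
    fix K L assume K: "K \<in> compact_operators M H" and L: "L \<in> compact_operators M H"
    \<comment> \<open>Writing the negative as a composition reduces closure under inverses to the
      left ideal property.\<close>
    have neg: "compose H (scalar_operator H (- 1)) K = (\<lambda>g\<in>H. \<lambda>x. - 1 * K g x)"
      unfolding compose_def by (intro restrict_ext) (simp add: scalar_operator_def op_in[OF sub[OF K]])
    have "inv\<^bsub>add_monoid OA\<^esub> K = \<ominus>\<^bsub>OA\<^esub> K" by (simp add: a_inv_def)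
    then show "inv\<^bsub>add_monoid OA\<^esub> K \<in> compact_operators M H"
      using left[OF K scalar_bounded[of "-1"]] neg OA_uminus[OF sub[OF K]] by simp
    have "(\<lambda>g\<in>H. \<lambda>x. K g x + L g x) \<in> compact_operators M H"
      unfolding compact_operators_iff
    proof (intro conjI allI impI)
      show "(\<lambda>g\<in>H. \<lambda>x. K g x + L g x) \<in> bounded_operators M H" by (intro add_bounded sub K L)
      fix u :: "nat \<Rightarrow> _" assume u: "\<forall>n. u n \<in> H \<and> L2_norm M (u n) \<le> 1"
      then obtain r :: "nat \<Rightarrow> nat" where r: "strict_mono r" "L2_Cauchy M (\<lambda>n. K (u (r n)))"
        using K unfolding compact_operators_iff by blast
      \<comment> \<open>\<open>L\<close> is applied along the subsequence that already serves
        \<open>K\<close>; the subsequence \<open>r \<circ> s\<close> serves both.\<close>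
      have "\<forall>n. u (r n) \<in> H \<and> L2_norm M (u (r n)) \<le> 1" using u by simp
      then obtain s :: "nat \<Rightarrow> nat" where s: "strict_mono s" "L2_Cauchy M (\<lambda>n. L (u (r (s n))))"
        using L[unfolded compact_operators_iff, THEN conjunct2, THEN spec, of "\<lambda>n. u (r n)"] by blast
      have "L2_Cauchy M (\<lambda>n x. K (u (r (s n))) x + L (u (r (s n))) x)"
        using L2_Cauchy_subseq[OF r(2) s(1)] s(2) u by (intro L2_Cauchy_add op_L2 sub K L) auto
      moreover have "(\<lambda>n. (\<lambda>g\<in>H. \<lambda>x. K g x + L g x) (u ((r \<circ> s) n))) = (\<lambda>n x. K (u (r (s n))) x + L (u (r (s n))) x)"
        using u by simp
      ultimately show "\<exists>r::nat \<Rightarrow> nat. strict_mono r \<and> L2_Cauchy M (\<lambda>n. (\<lambda>g\<in>H. \<lambda>x. K g x + L g x) (u (r n)))"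
        using strict_mono_o[OF r(1) s(1)] by (intro exI[of _ "r \<circ> s"]) simp
    qed
    then show "K \<otimes>\<^bsub>add_monoid OA\<^esub> L \<in> compact_operators M H" by (simp add: OA_simps)
  qed
qed

interpretation KI: ideal "compact_operators M H" OA
  by (rule ideal_compact)

interpretation hom: ring_hom_ring OA "calkin_algebra M H" "calkin_coset M H"
  unfolding calkin_algebra_def calkin_coset_def[abs_def] by (rule KI.rcos_ring_hom_ring)

section \<open>Spectrum and essential spectrum in terms of inverses\<close>

definition shift :: "(('a \<Rightarrow> complex) \<Rightarrow> ('a \<Rightarrow> complex)) \<Rightarrow> complex \<Rightarrow> ('a \<Rightarrow> complex) \<Rightarrow> ('a \<Rightarrow> complex)" where
  "shift T c = (\<lambda>g\<in>H. \<lambda>x. T g x - c * g x)"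

lemma shift_eq: "T \<in> bounded_operators M H \<Longrightarrow> shift T c = T \<ominus>\<^bsub>OA\<^esub> scalar_operator H c"
  by (simp add: OA_minus scalar_bounded shift_def) (auto simp: scalar_operator_def intro: restrict_ext)

lemma shift_bounded: "T \<in> bounded_operators M H \<Longrightarrow> shift T c \<in> bounded_operators M H"
  using OA.minus_closed[of T "scalar_operator H c"] by (simp add: shift_eq OA_simps scalar_bounded)

lemma op_spectrum_iff:
  assumes T: "T \<in> bounded_operators M H"
  shows "c \<notin> op_spectrum M H T \<longleftrightarrow>
    (\<exists>S\<in>bounded_operators M H. (\<forall>g\<in>H. S (shift T c g) = g) \<and> (\<forall>g\<in>H. shift T c (S g) = g))"
proof -
  have eq: "compose H S R = scalar_operator H 1 \<longleftrightarrow> (\<forall>g\<in>H. S (R g) = g)" for S R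
  proof
    assume a: "compose H S R = scalar_operator H 1"
    have "S (R g) = g" if "g \<in> H" for g
    proof -
      have "compose H S R g = scalar_operator H 1 g" by (simp only: a)
      then show ?thesis using that by (simp add: compose_def scalar_operator_def)
    qed
    then show "\<forall>g\<in>H. S (R g) = g" by blast
  next
    assume "\<forall>g\<in>H. S (R g) = g"
    then show "compose H S R = scalar_operator H 1"
      unfolding compose_def scalar_operator_def by (intro restrict_ext) simp
  qed
  have "c \<notin> op_spectrum M H T \<longleftrightarrow> shift T c \<in> Units OA"
    unfolding op_spectrum_def algebra_spectrum_def shift_eq[OF T] by simp
  also have "\<dots> \<longleftrightarrow> (\<exists>S\<in>bounded_operators M H. compose H S (shift T c) = scalar_operator H 1 \<and>
      compose H (shift T c) S = scalar_operator H 1)"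
    unfolding Units_def using shift_bounded[OF T] by (simp add: OA_simps)
  finally show ?thesis by (simp add: eq)
qed

text \<open>Every coset has a representative, and the coset map is a ring homomorphism whose kernel
  is the ideal of compact operators. An inverse in the quotient is thus an operator inverting
  \<open>T - c\<close> up to compact errors on both sides.\<close>

lemma essential_spectrum_iff:
  assumes T: "T \<in> bounded_operators M H"
  shows "c \<notin> essential_spectrum M H T \<longleftrightarrow>
    (\<exists>S\<in>bounded_operators M H. (\<lambda>g\<in>H. \<lambda>x. S (shift T c g) x - g x) \<in> compact_operators M H \<and>
       (\<lambda>g\<in>H. \<lambda>x. shift T c (S g) x - g x) \<in> compact_operators M H)"
proof -
  define D where "D = shift T c"
  have D: "D \<in> bounded_operators M H" unfolding D_def by (rule shift_bounded[OF T])
  have sc: "scalar_operator H c \<in> carrier OA" "T \<in> carrier OA" by (simp_all add: OA_simps scalar_bounded T)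
  have eqD: "calkin_coset M H T \<ominus>\<^bsub>calkin_algebra M H\<^esub> calkin_coset M H (scalar_operator H c) = calkin_coset M H D"
    unfolding D_def shift_eq[OF T] using sc by (simp add: a_minus_def)
  have eq: "calkin_coset M H S \<otimes>\<^bsub>calkin_algebra M H\<^esub> calkin_coset M H R = \<one>\<^bsub>calkin_algebra M H\<^esub> \<longleftrightarrow>
      (\<lambda>g\<in>H. \<lambda>x. S (R g) x - g x) \<in> compact_operators M H"
    if "S \<in> bounded_operators M H" "R \<in> bounded_operators M H" for S R
  proof -
    have SR: "S \<in> carrier OA" "R \<in> carrier OA" using that by (simp_all add: OA_simps)
    have "calkin_coset M H S \<otimes>\<^bsub>calkin_algebra M H\<^esub> calkin_coset M H R = \<one>\<^bsub>calkin_algebra M H\<^esub> \<longleftrightarrow>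
        calkin_coset M H (S \<otimes>\<^bsub>OA\<^esub> R) = calkin_coset M H \<one>\<^bsub>OA\<^esub>"
      using SR by simp
    also have "\<dots> \<longleftrightarrow> (S \<otimes>\<^bsub>OA\<^esub> R) \<ominus>\<^bsub>OA\<^esub> \<one>\<^bsub>OA\<^esub> \<in> compact_operators M H"
      unfolding calkin_coset_def using OA.quotient_eq_iff_same_a_r_cos[OF ideal_compact] SR by simp
    also have "(S \<otimes>\<^bsub>OA\<^esub> R) \<ominus>\<^bsub>OA\<^esub> \<one>\<^bsub>OA\<^esub> = (\<lambda>g\<in>H. \<lambda>x. compose H S R g x - scalar_operator H 1 g x)"
      unfolding OA_simps by (rule OA_minus[OF compose_bounded[OF that] scalar_bounded])
    also have "\<dots> = (\<lambda>g\<in>H. \<lambda>x. S (R g) x - g x)"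
      by (intro restrict_ext) (simp add: compose_def scalar_operator_def)
    finally show ?thesis .
  qed
  have car: "carrier (calkin_algebra M H) = calkin_coset M H ` bounded_operators M H"
    unfolding calkin_algebra_def calkin_coset_def FactRing_def A_RCOSETS_def' by (auto simp: OA_simps)
  have "c \<notin> essential_spectrum M H T \<longleftrightarrow> calkin_coset M H D \<in> Units (calkin_algebra M H)"
    unfolding essential_spectrum_def algebra_spectrum_def using eqD by simp
  also have "\<dots> \<longleftrightarrow> (\<exists>S\<in>bounded_operators M H. (\<lambda>g\<in>H. \<lambda>x. S (D g) x - g x) \<in> compact_operators M H \<and>
       (\<lambda>g\<in>H. \<lambda>x. D (S g) x - g x) \<in> compact_operators M H)"
    unfolding Units_def car using eq D by auto
  finally show ?thesis by (simp add: D_def)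
qed

text \<open>A left inverse and a right inverse modulo an ideal coincide modulo that ideal. The two
  are allowed to differ here because they will be produced by two different coercive
  operators.\<close>

lemma essential_spectrumI:
  assumes T: "T \<in> bounded_operators M H" and L: "L \<in> bounded_operators M H" and R: "R \<in> bounded_operators M H"
    and KL: "(\<lambda>g\<in>H. \<lambda>x. L (shift T c g) x - g x) \<in> compact_operators M H"
    and KR: "(\<lambda>g\<in>H. \<lambda>x. shift T c (R g) x - g x) \<in> compact_operators M H"
  shows "c \<notin> essential_spectrum M H T"
proof -
  define D where "D = shift T c"
  have D: "D \<in> bounded_operators M H" unfolding D_def by (rule shift_bounded[OF T])
  define K1 where "K1 = (\<lambda>g\<in>H. \<lambda>x. L (D g) x - g x)"
  define K2 where "K2 = (\<lambda>g\<in>H. \<lambda>x. D (R g) x - g x)"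
  have K12: "K1 \<in> compact_operators M H" "K2 \<in> compact_operators M H" using KL KR by (simp_all add: K1_def K2_def D_def)
  then have Kb: "K1 \<in> bounded_operators M H" "K2 \<in> bounded_operators M H" by (simp_all add: compact_operators_def)
  \<comment> \<open>With \<open>K1 = L D - 1\<close> and \<open>K2 = D R - 1\<close>, this is the
    identity \<open>D L - 1 = K2 + D K1 R - D L K2\<close>; each summand on the right contains a
    compact factor.\<close>
  have "(\<lambda>g\<in>H. \<lambda>x. D (L g) x - g x) = (K2 \<oplus>\<^bsub>OA\<^esub> (D \<otimes>\<^bsub>OA\<^esub> (K1 \<otimes>\<^bsub>OA\<^esub> R))) \<ominus>\<^bsub>OA\<^esub> (D \<otimes>\<^bsub>OA\<^esub> (L \<otimes>\<^bsub>OA\<^esub> K2))"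
  proof -
    have "D (L g) x - g x = K2 g x + D (K1 (R g)) x - D (L (K2 g)) x" if g: "g \<in> H" for g x
    proof -
      note Rg = op_in[OF R g] note DRg = op_in[OF D Rg]
      have "K1 (R g) = (\<lambda>x. L (D (R g)) x - R g x)" using Rg by (simp add: K1_def)
      then have a: "D (K1 (R g)) = (\<lambda>x. D (L (D (R g))) x - D (R g) x)"
        using op_diff[OF D op_in[OF L DRg] Rg] by simp
      have "K2 g = (\<lambda>x. D (R g) x - g x)" using g by (simp add: K2_def)
      then have b: "D (L (K2 g)) = (\<lambda>x. D (L (D (R g))) x - D (L g) x)"
        using op_diff[OF L DRg g] op_diff[OF D op_in[OF L DRg] op_in[OF L g]] by simp
      show ?thesis unfolding a b using g by (simp add: K2_def)
    qed
    then show ?thesis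
      using Kb D L R
      by (simp add: OA_simps OA_minus compose_bounded add_bounded) (intro restrict_ext, simp add: compose_def)
  qed
  also have "\<dots> \<in> compact_operators M H"
  proof -
    have 1: "D \<otimes>\<^bsub>OA\<^esub> (K1 \<otimes>\<^bsub>OA\<^esub> R) \<in> compact_operators M H"
      by (intro KI.I_l_closed KI.I_r_closed K12) (simp_all add: OA_simps D R)
    have 2: "D \<otimes>\<^bsub>OA\<^esub> (L \<otimes>\<^bsub>OA\<^esub> K2) \<in> compact_operators M H"
      by (intro KI.I_l_closed KI.I_r_closed K12) (simp_all add: OA_simps D L)
    show ?thesis
      unfolding a_minus_def by (rule KI.a_closed[OF KI.a_closed[OF K12(2) 1] KI.a_inv_closed[OF 2]])
  qed
  finally show ?thesis using KL L unfolding essential_spectrum_iff[OF T] D_def by blast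
qed

end

section \<open>Toeplitz operators and invertibility criteria\<close>

context L2_hilbert
begin

lemma bounded_byD:
  assumes "bounded_by C T"
  shows "T \<in> bounded_operators M H" "0 \<le> C" "g \<in> H \<Longrightarrow> L2_norm M (T g) \<le> C * L2_norm M g"
  using assms by (auto simp: bounded_by_def)

lemma toeplitz_apply: "g \<in> H \<Longrightarrow> toeplitz M H \<phi> g = proj (\<lambda>x. \<phi> x * g x)"
  by (simp add: toeplitz_def proj_def)

lemma toeplitz_bounded_by:
  assumes phi: "bounded_symbol M B \<phi>"
  shows "bounded_by B (toeplitz M H \<phi>)"
proof -
  have norm: "L2_norm M (toeplitz M H \<phi> g) \<le> B * L2_norm M g" if "g \<in> H" for g
    unfolding toeplitz_apply[OF that]
    using proj_norm[OF L2_space_mult[OF phi L2[OF that]]] L2_norm_mult[OF phi L2[OF that]] by linarith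
  have "toeplitz M H \<phi> \<in> bounded_operators M H"
  proof (rule bounded_operatorsI[OF _ _ _ norm])
    show "toeplitz M H \<phi> g \<in> H" if "g \<in> H" for g
      unfolding toeplitz_apply[OF that] by (intro proj_in L2_space_mult[OF phi] L2 that)
    show "toeplitz M H \<phi> (\<lambda>x. a * g x + b * h x) = (\<lambda>x. a * toeplitz M H \<phi> g x + b * toeplitz M H \<phi> h x)"
      if "g \<in> H" "h \<in> H" for g h a b
    proof -
      have "(\<lambda>x. \<phi> x * (a * g x + b * h x)) = (\<lambda>x. a * (\<phi> x * g x) + b * (\<phi> x * h x))"
        by (auto simp: algebra_simps)
      then show ?thesis
        unfolding toeplitz_apply[OF that(1)] toeplitz_apply[OF that(2)] toeplitz_apply[OF lin[OF that]]
        using proj_lin[OF L2_space_mult[OF phi L2[OF that(1)]] L2_space_mult[OF phi L2[OF that(2)]]] by simp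
    qed
  qed (simp add: toeplitz_def)
  with norm phi show ?thesis by (simp add: bounded_by_def bounded_symbol_def)
qed

lemma toeplitz_bounded: "bounded_symbol M B \<phi> \<Longrightarrow> toeplitz M H \<phi> \<in> bounded_operators M H"
  using toeplitz_bounded_by bounded_byD(1) by blast

lemma toeplitz_in: "bounded_symbol M B \<phi> \<Longrightarrow> g \<in> H \<Longrightarrow> toeplitz M H \<phi> g \<in> H"
  using toeplitz_bounded op_in by blast

lemma toeplitz_norm: "bounded_symbol M B \<phi> \<Longrightarrow> g \<in> H \<Longrightarrow> L2_norm M (toeplitz M H \<phi> g) \<le> B * L2_norm M g"
  using toeplitz_bounded_by bounded_byD(3) by blast

lemma toeplitz_inner:
  "bounded_symbol M B \<phi> \<Longrightarrow> g \<in> H \<Longrightarrow> k \<in> H \<Longrightarrow> L2_inner M (toeplitz M H \<phi> g) k = L2_inner M (\<lambda>x. \<phi> x * g x) k"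
  unfolding toeplitz_apply by (intro proj_inner L2_space_mult L2)

lemma toeplitz_adjoint:
  assumes phi: "bounded_symbol M B \<phi>" and g: "g \<in> H" and k: "k \<in> H"
  shows "L2_inner M (toeplitz M H \<phi> g) k = L2_inner M g (toeplitz M H (\<lambda>x. cnj (\<phi> x)) k)"
  unfolding toeplitz_inner[OF assms] L2_inner_mult_cnj
  using toeplitz_inner[OF bounded_symbol_cnj[OF phi] k g] by (metis L2_inner_cnj)

lemma toeplitz_eqI:
  assumes "bounded_symbol M B \<phi>" "g \<in> H" "h \<in> H" "\<And>k. k \<in> H \<Longrightarrow> L2_inner M (\<lambda>x. \<phi> x * g x) k = L2_inner M h k"
  shows "toeplitz M H \<phi> g = h"
  by (rule inner_eqI[OF toeplitz_in[OF assms(1,2)] assms(3)]) (simp add: toeplitz_inner[OF assms(1,2)] assms(4))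

lemma toeplitz_cong:
  assumes "bounded_symbol M B \<phi>" "bounded_symbol M C \<psi>" "\<And>x. x \<in> space M \<Longrightarrow> \<phi> x = \<psi> x" and g: "g \<in> H"
  shows "toeplitz M H \<phi> g = toeplitz M H \<psi> g"
proof (rule toeplitz_eqI[OF assms(1) g toeplitz_in[OF assms(2) g]])
  fix k assume k: "k \<in> H"
  show "L2_inner M (\<lambda>x. \<phi> x * g x) k = L2_inner M (toeplitz M H \<psi> g) k"
    unfolding toeplitz_inner[OF assms(2) g k] by (rule L2_inner_cong) (simp_all add: assms(3))
qed

lemma toeplitz_add:
  assumes "bounded_symbol M B \<phi>" "bounded_symbol M C \<psi>" "g \<in> H"
  shows "toeplitz M H (\<lambda>x. \<phi> x + \<psi> x) g = (\<lambda>x. toeplitz M H \<phi> g x + toeplitz M H \<psi> g x)"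
  unfolding toeplitz_apply[OF assms(3)] ring_distribs
  by (rule proj_add) (intro L2_space_mult[OF assms(1)] L2_space_mult[OF assms(2)] L2 assms)+

lemma toeplitz_diff:
  assumes "bounded_symbol M B \<phi>" "bounded_symbol M C \<psi>" "g \<in> H"
  shows "toeplitz M H (\<lambda>x. \<phi> x - \<psi> x) g = (\<lambda>x. toeplitz M H \<phi> g x - toeplitz M H \<psi> g x)"
  unfolding toeplitz_apply[OF assms(3)] left_diff_distrib
  by (rule proj_diff) (intro L2_space_mult[OF assms(1)] L2_space_mult[OF assms(2)] L2 assms)+

lemma toeplitz_const: "g \<in> H \<Longrightarrow> toeplitz M H (\<lambda>x. c) g = (\<lambda>x. c * g x)"
  unfolding toeplitz_apply by (rule proj_id[OF scale])

lemma toeplitz_diff_norm: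
  assumes "bounded_symbol M B \<phi>" "bounded_symbol M C \<psi>" "g \<in> H"
    and "\<And>x. x \<in> space M \<Longrightarrow> cmod (\<phi> x - \<psi> x) \<le> \<delta>" "0 \<le> \<delta>"
  shows "L2_norm M (\<lambda>x. toeplitz M H \<phi> g x - toeplitz M H \<psi> g x) \<le> \<delta> * L2_norm M g"
proof -
  have "bounded_symbol M \<delta> (\<lambda>x. \<phi> x - \<psi> x)"
    using bounded_symbol_diff[OF assms(1,2)] assms(4,5) by (simp add: bounded_symbol_def)
  from toeplitz_norm[OF this assms(3)] show ?thesis unfolding toeplitz_diff[OF assms(1-3)] .
qed

lemma shift_toeplitz:
  assumes "bounded_symbol M B \<phi>"
  shows "shift (toeplitz M H \<phi>) c = toeplitz M H (\<lambda>x. \<phi> x - c)"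
proof (rule op_eqI[OF shift_bounded[OF toeplitz_bounded[OF assms]] toeplitz_bounded[OF bounded_symbol_diff[OF assms bounded_symbol_const]]])
  fix g assume "g \<in> H"
  then show "shift (toeplitz M H \<phi>) c g = toeplitz M H (\<lambda>x. \<phi> x - c) g"
    using toeplitz_diff[OF assms bounded_symbol_const[of _ c]] by (simp add: shift_def toeplitz_const)
qed

section \<open>Invertibility through lower bounds\<close>

definition bounded_below :: "(('a \<Rightarrow> complex) \<Rightarrow> ('a \<Rightarrow> complex)) \<Rightarrow> bool" where
  "bounded_below T \<longleftrightarrow> (\<exists>c>0. \<forall>g\<in>H. c * L2_norm M g \<le> L2_norm M (T g))"

lemma bounded_belowI:
  assumes "\<And>g. g \<in> H \<Longrightarrow> L2_norm M g \<le> C * L2_norm M (T g)"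
  shows "bounded_below T"
  unfolding bounded_below_def
proof (intro exI[of _ "1 / (\<bar>C\<bar> + 1)"] conjI ballI)
  show "1 / (\<bar>C\<bar> + 1) * L2_norm M g \<le> L2_norm M (T g)" if "g \<in> H" for g
  proof -
    have "L2_norm M g \<le> (\<bar>C\<bar> + 1) * L2_norm M (T g)"
      using assms[OF that] by (rule order_trans) (intro mult_right_mono, auto)
    then show ?thesis by (simp add: field_simps)
  qed
qed simp

text \<open>The lower bound for the adjoint \<open>T'\<close> stands for surjectivity of
  \<open>T\<close>: a vector orthogonal to the range of \<open>T\<close> is annihilated by
  \<open>T'\<close>. Conversely, pairing \<open>T (S g) = g\<close> with \<open>g\<close> and moving
  \<open>T\<close> to the other side bounds \<open>T'\<close> from below.\<close>

lemma op_spectrum_toeplitz_iff: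
  assumes phi: "bounded_symbol M B \<phi>"
  shows "c \<notin> op_spectrum M H (toeplitz M H \<phi>) \<longleftrightarrow>
    bounded_below (toeplitz M H (\<lambda>x. \<phi> x - c)) \<and> bounded_below (toeplitz M H (\<lambda>x. cnj (\<phi> x - c)))"
proof -
  define T where "T = toeplitz M H (\<lambda>x. \<phi> x - c)"
  define T' where "T' = toeplitz M H (\<lambda>x. cnj (\<phi> x - c))"
  note psi = bounded_symbol_diff[OF phi bounded_symbol_const[of M c]]
  have T: "T \<in> bounded_operators M H" unfolding T_def by (rule toeplitz_bounded[OF psi])
  have T': "T' \<in> bounded_operators M H" unfolding T'_def by (rule toeplitz_bounded[OF bounded_symbol_cnj[OF psi]])
  have adj: "L2_inner M (T g) k = L2_inner M g (T' k)" if "g \<in> H" "k \<in> H" for g k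
    unfolding T_def T'_def by (rule toeplitz_adjoint[OF psi that])
  have "c \<notin> op_spectrum M H (toeplitz M H \<phi>) \<longleftrightarrow> (\<exists>S\<in>bounded_operators M H. (\<forall>g\<in>H. S (T g) = g) \<and> (\<forall>g\<in>H. T (S g) = g))"
    unfolding op_spectrum_iff[OF toeplitz_bounded[OF phi]] shift_toeplitz[OF phi] T_def ..
  also have "\<dots> \<longleftrightarrow> bounded_below T \<and> bounded_below T'"
  proof
    assume "\<exists>S\<in>bounded_operators M H. (\<forall>g\<in>H. S (T g) = g) \<and> (\<forall>g\<in>H. T (S g) = g)"
    then obtain S where S: "S \<in> bounded_operators M H" "\<forall>g\<in>H. S (T g) = g" "\<forall>g\<in>H. T (S g) = g" by blast
    obtain C where C: "bounded_by C S" using bounded_operatorsE[OF S(1)] by blast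
    have "bounded_below T"
      by (rule bounded_belowI[where C=C]) (use bounded_byD(3)[OF C] S(2) op_in[OF T] in metis)
    moreover have "bounded_below T'"
    proof (rule bounded_belowI[where C=C])
      fix g assume g: "g \<in> H"
      have "of_real ((L2_norm M g)\<^sup>2) = L2_inner M (T (S g)) g" using S(3) g by (simp add: L2_inner_self)
      also have "\<dots> = L2_inner M (S g) (T' g)" by (rule adj[OF op_in[OF S(1) g] g])
      finally have "(L2_norm M g)\<^sup>2 = cmod (L2_inner M (S g) (T' g))" by (metis norm_of_real abs_of_nonneg zero_le_power2)
      also have "\<dots> \<le> L2_norm M (S g) * L2_norm M (T' g)" by (intro L2_Cauchy_Schwarz op_L2[OF S(1)] op_L2[OF T'] g)
      also have "\<dots> \<le> (C * L2_norm M g) * L2_norm M (T' g)" by (intro mult_right_mono bounded_byD(3)[OF C g]) simp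
      finally have *: "L2_norm M g * L2_norm M g \<le> L2_norm M g * (C * L2_norm M (T' g))"
        by (simp add: power2_eq_square mult_ac)
      show "L2_norm M g \<le> C * L2_norm M (T' g)"
      proof (cases "L2_norm M g = 0")
        case False
        then have "0 < L2_norm M g" by (simp add: less_le)
        with * show ?thesis by (rule mult_left_le_imp_le)
      qed (use bounded_byD(2)[OF C] in simp)
    qed
    ultimately show "bounded_below T \<and> bounded_below T'" ..
  next
    assume below: "bounded_below T \<and> bounded_below T'"
    then obtain a b where a: "a > 0" "\<forall>g\<in>H. a * L2_norm M g \<le> L2_norm M (T g)"
      and b: "b > 0" "\<forall>g\<in>H. b * L2_norm M g \<le> L2_norm M (T' g)" by (auto simp: bounded_below_def)
    show "\<exists>S\<in>bounded_operators M H. (\<forall>g\<in>H. S (T g) = g) \<and> (\<forall>g\<in>H. T (S g) = g)"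
    proof (rule bijective_inverse[OF T a(1)])
      fix y assume y: "y \<in> H" and orth: "\<And>g. g \<in> H \<Longrightarrow> L2_inner M (T g) y = 0"
      \<comment> \<open>Orthogonality to the range is tested on the image of
        \<open>T' y\<close>.\<close>
      have "L2_inner M (T' y) (T' y) = 0" using orth[OF op_in[OF T' y]] adj[OF op_in[OF T' y] y] by simp
      then have "L2_norm M (T' y) = 0" by (simp add: L2_inner_self)
      then have "b * L2_norm M y \<le> 0" using b(2) y by (metis)
      then have "L2_norm M y = 0" using b(1) by (simp add: mult_le_0_iff order_antisym)
      then show "y = (\<lambda>x. 0)" by (rule definite[OF y])
    qed (use a(2) in blast)
  qed
  finally show ?thesis by (simp add: T_def T'_def)
qed

text \<open>The Lax-Milgram argument: Cauchy-Schwarz turns coercivity into a lower bound, and a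
  vector orthogonal to the range vanishes when paired with its own image.\<close>

lemma coercive_inverse:
  assumes A: "A \<in> bounded_operators M H" and c: "c > 0"
    and coercive: "\<And>g. g \<in> H \<Longrightarrow> c * (L2_norm M g)\<^sup>2 \<le> Re (L2_inner M (A g) g)"
  shows "\<exists>S\<in>bounded_operators M H. (\<forall>g\<in>H. S (A g) = g) \<and> (\<forall>g\<in>H. A (S g) = g)"
proof (rule bijective_inverse[OF A c])
  fix g assume g: "g \<in> H"
  have "c * L2_norm M g * L2_norm M g \<le> L2_norm M (A g) * L2_norm M g"
    using coercive[OF g] L2_Cauchy_Schwarz[OF op_L2[OF A g] L2[OF g]] complex_Re_le_cmod[of "L2_inner M (A g) g"]
    by (simp add: power2_eq_square mult.assoc)
  then show "c * L2_norm M g \<le> L2_norm M (A g)"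
    by (cases "L2_norm M g = 0") (auto simp: mult_le_cancel_right less_le)
next
  fix y assume y: "y \<in> H" and orth: "\<And>g. g \<in> H \<Longrightarrow> L2_inner M (A g) y = 0"
  have "c * (L2_norm M y)\<^sup>2 \<le> 0" using coercive[OF y] orth[OF y] by simp
  then have "L2_norm M y = 0" using c by (simp add: mult_le_0_iff)
  then show "y = (\<lambda>x. 0)" by (rule definite[OF y])
qed

text \<open>For \<open>T\<close> itself the compact error of the left parametrix appears directly.
  For the adjoint \<open>T'\<close>, the equation \<open>g = T (S g) - k\<close> with
  \<open>k\<close> the error of the right parametrix is paired with \<open>g\<close>:
  \<open>T\<close> moves across as \<open>T'\<close>, and one factor \<open>L2_norm M g\<close>
  cancels. The same operator \<open>T S - 1\<close> thus serves as the compact one.\<close>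

lemma fredholm_estimate:
  assumes phi: "bounded_symbol M B \<phi>" and c: "c \<notin> essential_spectrum M H (toeplitz M H \<phi>)"
  shows "\<exists>C. \<exists>K\<in>compact_operators M H. \<forall>g\<in>H. L2_norm M g \<le> C * L2_norm M (toeplitz M H (\<lambda>x. \<phi> x - c) g) + L2_norm M (K g)"
    and "\<exists>C. \<exists>K\<in>compact_operators M H. \<forall>g\<in>H. L2_norm M g \<le> C * L2_norm M (toeplitz M H (\<lambda>x. cnj (\<phi> x - c)) g) + L2_norm M (K g)"
proof -
  define T where "T = toeplitz M H (\<lambda>x. \<phi> x - c)"
  define T' where "T' = toeplitz M H (\<lambda>x. cnj (\<phi> x - c))"
  note psi = bounded_symbol_diff[OF phi bounded_symbol_const[of M c]]
  have T: "T \<in> bounded_operators M H" unfolding T_def by (rule toeplitz_bounded[OF psi])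
  have T': "T' \<in> bounded_operators M H" unfolding T'_def by (rule toeplitz_bounded[OF bounded_symbol_cnj[OF psi]])
  have adj: "L2_inner M (T g) k = L2_inner M g (T' k)" if "g \<in> H" "k \<in> H" for g k
    unfolding T_def T'_def by (rule toeplitz_adjoint[OF psi that])
  obtain S where S: "S \<in> bounded_operators M H" and K1: "(\<lambda>g\<in>H. \<lambda>x. S (T g) x - g x) \<in> compact_operators M H"
    and K2: "(\<lambda>g\<in>H. \<lambda>x. T (S g) x - g x) \<in> compact_operators M H"
    using c unfolding essential_spectrum_iff[OF toeplitz_bounded[OF phi]] shift_toeplitz[OF phi] T_def by blast
  obtain C where C: "bounded_by C S" using bounded_operatorsE[OF S] by blast
  have "L2_norm M g \<le> C * L2_norm M (T g) + L2_norm M ((\<lambda>g\<in>H. \<lambda>x. S (T g) x - g x) g)" if g: "g \<in> H" for g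
  proof -
    have "L2_norm M g \<le> L2_norm M (S (T g)) + L2_norm M (\<lambda>x. g x - S (T g) x)"
      by (intro L2_norm_triangle_sub L2 op_in[OF S] op_in[OF T] g)
    then show ?thesis
      using bounded_byD(3)[OF C op_in[OF T g]] g L2_norm_minus_commute[of M g "S (T g)"] by simp
  qed
  then show "\<exists>C. \<exists>K\<in>compact_operators M H. \<forall>g\<in>H. L2_norm M g \<le> C * L2_norm M (toeplitz M H (\<lambda>x. \<phi> x - c) g) + L2_norm M (K g)"
    using K1 unfolding T_def by blast
  have "L2_norm M g \<le> C * L2_norm M (T' g) + L2_norm M ((\<lambda>g\<in>H. \<lambda>x. T (S g) x - g x) g)" if g: "g \<in> H" for g
  proof -
    define k where "k = (\<lambda>x. T (S g) x - g x)"
    have TSg: "T (S g) \<in> H" by (intro op_in[OF S] op_in[OF T] g)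
    then have k: "k \<in> H" unfolding k_def by (rule diff[OF _ g])
    have "of_real ((L2_norm M g)\<^sup>2) = L2_inner M g g" by (simp add: L2_inner_self)
    also have "\<dots> = L2_inner M (T (S g)) g - L2_inner M k g"
      using L2_inner_diff_left[OF L2[OF TSg] L2[OF g] L2[OF g]] by (simp add: k_def)
    also have "\<dots> = L2_inner M (S g) (T' g) - L2_inner M k g" using adj[OF op_in[OF S g] g] by simp
    finally have "(L2_norm M g)\<^sup>2 = cmod (L2_inner M (S g) (T' g) - L2_inner M k g)"
      by (metis norm_of_real abs_of_nonneg zero_le_power2)
    also have "\<dots> \<le> cmod (L2_inner M (S g) (T' g)) + cmod (L2_inner M k g)" by (rule norm_triangle_ineq4)
    also have "\<dots> \<le> L2_norm M (S g) * L2_norm M (T' g) + L2_norm M k * L2_norm M g"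
      by (intro add_mono L2_Cauchy_Schwarz op_L2[OF S] op_L2[OF T'] L2 k g)
    also have "\<dots> \<le> (C * L2_norm M g) * L2_norm M (T' g) + L2_norm M k * L2_norm M g"
      by (intro add_mono mult_right_mono bounded_byD(3)[OF C g]) simp_all
    finally have *: "L2_norm M g * L2_norm M g \<le> L2_norm M g * (C * L2_norm M (T' g) + L2_norm M k)"
      by (simp add: power2_eq_square algebra_simps)
    have "L2_norm M g \<le> C * L2_norm M (T' g) + L2_norm M k"
    proof (cases "L2_norm M g = 0")
      case False
      then have "0 < L2_norm M g" by (simp add: less_le)
      with * show ?thesis by (rule mult_left_le_imp_le)
    qed (use bounded_byD(2)[OF C] in simp)
    then show ?thesis using g by (simp add: k_def)
  qed
  then show "\<exists>C. \<exists>K\<in>compact_operators M H. \<forall>g\<in>H. L2_norm M g \<le> C * L2_norm M (toeplitz M H (\<lambda>x. cnj (\<phi> x - c)) g) + L2_norm M (K g)"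
    using K2 unfolding T'_def by blast
qed

text \<open>
  If \<open>T\<close> is bounded below up to the compression of a projection \<open>\<chi>\<close> with \<open>T\<^sub>\<chi>\<close> compact, then
  \<open>A = T\<^sup>* T + T\<^sub>\<chi>\<close> is coercive, and \<open>A\<^sup>-\<^sup>1 T\<^sup>*\<close> is a left inverse of \<open>T\<close> modulo compact operators;
  the same for \<open>T\<^sup>*\<close> gives a right inverse.
\<close>

lemma coercive_parametrix:
  assumes phi: "bounded_symbol M B \<phi>" and Q: "Q \<in> sets M"
    and est: "\<And>g. g \<in> H \<Longrightarrow> L2_norm M g \<le> C * (L2_norm M (toeplitz M H \<phi> g) + L2_norm M (\<lambda>x. indicator Q x * g x))"
  defines "A \<equiv> \<lambda>g\<in>H. \<lambda>x. toeplitz M H (\<lambda>x. cnj (\<phi> x)) (toeplitz M H \<phi> g) x + toeplitz M H (indicator Q) g x"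
  shows "A \<in> bounded_operators M H"
    and "\<exists>c>0. \<forall>g\<in>H. c * (L2_norm M g)\<^sup>2 \<le> Re (L2_inner M (A g) g)"
proof -
  let ?T = "toeplitz M H \<phi>" and ?T' = "toeplitz M H (\<lambda>x. cnj (\<phi> x))" and ?X = "toeplitz M H (indicator Q)"
  note phi' = bounded_symbol_cnj[OF phi] and ind = bounded_symbol_indicator[OF Q]
  have "(\<lambda>g\<in>H. \<lambda>x. (compose H ?T' ?T) g x + ?X g x) \<in> bounded_operators M H"
    by (intro add_bounded compose_bounded toeplitz_bounded[OF phi] toeplitz_bounded[OF phi'] toeplitz_bounded[OF ind])
  also have "(\<lambda>g\<in>H. \<lambda>x. (compose H ?T' ?T) g x + ?X g x) = A"
    unfolding A_def by (intro restrict_ext) (simp add: compose_def)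
  finally show "A \<in> bounded_operators M H" .
  define D where "D = \<bar>C\<bar> + 1"
  have D: "D > 0" by (simp add: D_def)
  \<comment> \<open>Coercivity is quadratic, the hypothesis linear; squaring the sum of two norms
    costs the factor 2.\<close>
  have "1 / (2 * D\<^sup>2) * (L2_norm M g)\<^sup>2 \<le> Re (L2_inner M (A g) g)" if g: "g \<in> H" for g
  proof -
    let ?q = "\<lambda>x. indicator Q x * g x"
    have "L2_norm M g \<le> D * (L2_norm M (?T g) + L2_norm M ?q)"
      using est[OF g] unfolding D_def by (rule order_trans) (intro mult_right_mono, auto)
    then have "(L2_norm M g)\<^sup>2 \<le> D\<^sup>2 * (L2_norm M (?T g) + L2_norm M ?q)\<^sup>2"
      unfolding power_mult_distrib[symmetric] by (rule power_mono) simp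
    also have "\<dots> \<le> D\<^sup>2 * (2 * (L2_norm M (?T g))\<^sup>2 + 2 * (L2_norm M ?q)\<^sup>2)"
      by (intro mult_left_mono sum_power2_le) simp
    finally have 1: "(L2_norm M g)\<^sup>2 \<le> 2 * D\<^sup>2 * ((L2_norm M (?T g))\<^sup>2 + (L2_norm M ?q)\<^sup>2)" by (simp add: algebra_simps)
    have "L2_inner M (A g) g = L2_inner M (?T' (?T g)) g + L2_inner M (?X g) g"
      unfolding A_def using g by (simp add: L2_inner_add_left L2 toeplitz_in[OF phi] toeplitz_in[OF phi'] toeplitz_in[OF ind])
    also have "L2_inner M (?T' (?T g)) g = of_real ((L2_norm M (?T g))\<^sup>2)"
      using toeplitz_adjoint[OF phi' toeplitz_in[OF phi g] g] by (simp add: L2_inner_self)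
    also have "L2_inner M (?X g) g = L2_inner M ?q g" by (rule toeplitz_inner[OF ind g g])
    \<comment> \<open>The indicator is idempotent and real.\<close>
    also have "\<dots> = L2_inner M ?q ?q"
      unfolding L2_inner_def
      by (intro Bochner_Integration.integral_cong) (auto simp: indicator_def)
    also have "\<dots> = of_real ((L2_norm M ?q)\<^sup>2)" by (rule L2_inner_self)
    finally have "Re (L2_inner M (A g) g) = (L2_norm M (?T g))\<^sup>2 + (L2_norm M ?q)\<^sup>2" by simp
    with 1 D show ?thesis by (simp add: field_simps)
  qed
  then show "\<exists>c>0. \<forall>g\<in>H. c * (L2_norm M g)\<^sup>2 \<le> Re (L2_inner M (A g) g)"
    using D by (intro exI[of _ "1 / (2 * D\<^sup>2)"]) simp
qed

lemma not_essential_spectrumI: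
  assumes phi: "bounded_symbol M B \<phi>" and Q: "Q \<in> sets M" "Q' \<in> sets M"
    and comp: "toeplitz M H (indicator Q) \<in> compact_operators M H" "toeplitz M H (indicator Q') \<in> compact_operators M H"
    and est: "\<And>g. g \<in> H \<Longrightarrow> L2_norm M g \<le> C * (L2_norm M (toeplitz M H (\<lambda>x. \<phi> x - c) g) + L2_norm M (\<lambda>x. indicator Q x * g x))"
    and est': "\<And>g. g \<in> H \<Longrightarrow> L2_norm M g \<le> C' * (L2_norm M (toeplitz M H (\<lambda>x. cnj (\<phi> x - c)) g) + L2_norm M (\<lambda>x. indicator Q' x * g x))"
  shows "c \<notin> essential_spectrum M H (toeplitz M H \<phi>)"
proof -
  define T where "T = toeplitz M H (\<lambda>x. \<phi> x - c)"
  define T' where "T' = toeplitz M H (\<lambda>x. cnj (\<phi> x - c))"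
  define X where "X = toeplitz M H (indicator Q)"
  define X' where "X' = toeplitz M H (indicator Q')"
  note psi = bounded_symbol_diff[OF phi bounded_symbol_const[of M c]]
  note psi' = bounded_symbol_cnj[OF psi]
  have T: "T \<in> bounded_operators M H" unfolding T_def by (rule toeplitz_bounded[OF psi])
  have T': "T' \<in> bounded_operators M H" unfolding T'_def by (rule toeplitz_bounded[OF psi'])
  have X: "X \<in> bounded_operators M H" "X' \<in> bounded_operators M H" using comp by (simp_all add: X_def X'_def compact_operators_def)
  define A where "A = (\<lambda>g\<in>H. \<lambda>x. T' (T g) x + X g x)"
  define A' where "A' = (\<lambda>g\<in>H. \<lambda>x. T (T' g) x + X' g x)"
  have A: "A \<in> bounded_operators M H" "\<exists>c>0. \<forall>g\<in>H. c * (L2_norm M g)\<^sup>2 \<le> Re (L2_inner M (A g) g)"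
    unfolding A_def T_def T'_def X_def by (rule coercive_parametrix[OF psi Q(1) est], assumption)+
  have A': "A' \<in> bounded_operators M H" "\<exists>c>0. \<forall>g\<in>H. c * (L2_norm M g)\<^sup>2 \<le> Re (L2_inner M (A' g) g)"
    using coercive_parametrix[OF psi' Q(2) est'] by (simp_all add: A'_def T_def T'_def X'_def)
  obtain S where S: "S \<in> bounded_operators M H" "\<And>g. g \<in> H \<Longrightarrow> S (A g) = g" using coercive_inverse[OF A(1)] A(2) by blast
  obtain S' where S': "S' \<in> bounded_operators M H" "\<And>g. g \<in> H \<Longrightarrow> A' (S' g) = g" using coercive_inverse[OF A'(1)] A'(2) by blast
  interpret OA: ring OA by (rule ring_OA)
  interpret KI: ideal "compact_operators M H" OA by (rule ideal_compact)
  \<comment> \<open>From \<open>S (T' T + X) = 1\<close> the error of the left parametrix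
    \<open>S T'\<close> is exactly \<open>- S X\<close>.\<close>
  have 1: "(\<lambda>g\<in>H. \<lambda>x. compose H S T' (shift (toeplitz M H \<phi>) c g) x - g x) \<in> compact_operators M H"
  proof -
    have "\<ominus>\<^bsub>OA\<^esub> (S \<otimes>\<^bsub>OA\<^esub> X) \<in> compact_operators M H"
      using comp S by (intro KI.a_inv_closed KI.I_l_closed) (simp_all add: X_def OA_simps)
    moreover have "\<ominus>\<^bsub>OA\<^esub> (S \<otimes>\<^bsub>OA\<^esub> X) = (\<lambda>g\<in>H. \<lambda>x. - 1 * compose H S X g x)"
      unfolding OA_simps by (rule OA_uminus[OF compose_bounded[OF S(1) X(1)]])
    moreover have "\<dots> = (\<lambda>g\<in>H. \<lambda>x. compose H S T' (shift (toeplitz M H \<phi>) c g) x - g x)"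
    proof (intro restrict_ext ext)
      fix g x assume g: "g \<in> H"
      have "g = S (\<lambda>x. T' (T g) x + X g x)" using S(2)[OF g] g by (simp add: A_def)
      also have "\<dots> = (\<lambda>x. S (T' (T g)) x + S (X g) x)" by (intro op_add[OF S(1)] op_in[OF T] op_in[OF T'] op_in[OF X(1)] g)
      finally have "g x = S (T' (T g)) x + S (X g) x" by (rule fun_cong)
      then show "- 1 * compose H S X g x = compose H S T' (shift (toeplitz M H \<phi>) c g) x - g x"
        unfolding shift_toeplitz[OF phi] T_def[symmetric] using g op_in[OF T g] by (simp add: compose_def)
    qed
    ultimately show ?thesis by simp
  qed
  \<comment> \<open>From \<open>(T T' + X') S' = 1\<close> the error of the right parametrix
    \<open>T' S'\<close> is exactly \<open>- X' S'\<close>.\<close>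
  have 2: "(\<lambda>g\<in>H. \<lambda>x. shift (toeplitz M H \<phi>) c (compose H T' S' g) x - g x) \<in> compact_operators M H"
  proof -
    have "\<ominus>\<^bsub>OA\<^esub> (X' \<otimes>\<^bsub>OA\<^esub> S') \<in> compact_operators M H"
      using comp S' by (intro KI.a_inv_closed KI.I_r_closed) (simp_all add: X'_def OA_simps)
    moreover have "\<ominus>\<^bsub>OA\<^esub> (X' \<otimes>\<^bsub>OA\<^esub> S') = (\<lambda>g\<in>H. \<lambda>x. - 1 * compose H X' S' g x)"
      unfolding OA_simps by (rule OA_uminus[OF compose_bounded[OF X(2) S'(1)]])
    moreover have "\<dots> = (\<lambda>g\<in>H. \<lambda>x. shift (toeplitz M H \<phi>) c (compose H T' S' g) x - g x)"
    proof (intro restrict_ext ext)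
      fix g x assume g: "g \<in> H"
      have "g = (\<lambda>x. T (T' (S' g)) x + X' (S' g) x)" using S'(2)[OF g] op_in[OF S'(1) g] by (simp add: A'_def)
      then have "g x = T (T' (S' g)) x + X' (S' g) x" by (rule fun_cong)
      then show "- 1 * compose H X' S' g x = shift (toeplitz M H \<phi>) c (compose H T' S' g) x - g x"
        unfolding shift_toeplitz[OF phi] T_def[symmetric] using g by (simp add: compose_def)
    qed
    ultimately show ?thesis by simp
  qed
  show ?thesis
    by (rule essential_spectrumI[OF toeplitz_bounded[OF phi] compose_bounded[OF S(1) T'] compose_bounded[OF T' S'(1)] 1 2])
qed

end

section \<open>The Bergman space of the disc\<close>

lemma open_disc: "open disc" by (simp add: disc_def)

lemma space_area_disc [simp]: "space area_disc = disc"
  by (simp add: area_disc_def space_restrict_space)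

lemma sets_area_disc: "A \<in> sets borel \<Longrightarrow> A \<subseteq> disc \<Longrightarrow> A \<in> sets area_disc"
  unfolding area_disc_def sets_restrict_space by (auto simp: image_iff intro!: bexI[of _ A])

lemma cball_sets_area_disc: "s < 1 \<Longrightarrow> cball 0 s \<in> sets area_disc"
  by (rule sets_area_disc) (auto simp: disc_def)

lemma finite_measure_area_disc: "finite_measure area_disc"
proof
  have "emeasure area_disc (space area_disc) = emeasure lborel disc"
    unfolding space_area_disc unfolding area_disc_def
    by (rule emeasure_restrict_space) (auto simp: open_disc)
  also have "\<dots> < \<infinity>" unfolding disc_def by (rule emeasure_lborel_ball_finite)
  finally show "emeasure area_disc (space area_disc) \<noteq> \<infinity>" by simp
qed

lemma measurable_area_discI:
  fixes g :: "complex \<Rightarrow> 'b::topological_space"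
  assumes "continuous_on disc g"
  shows "g \<in> borel_measurable area_disc"
  using borel_measurable_continuous_on_restrict[OF assms]
  by (simp add: area_disc_def cong: measurable_cong_sets sets_restrict_space_cong)

lemma compact_continuous_bounded:
  fixes f :: "'a::topological_space \<Rightarrow> 'b::real_normed_vector"
  assumes "compact K" "continuous_on K f"
  shows "\<exists>B. \<forall>x\<in>K. norm (f x) \<le> B"
proof -
  have "bounded (f ` K)" by (intro compact_imp_bounded compact_continuous_image assms)
  then show ?thesis by (simp add: bounded_iff)
qed

lemma bounded_symbol_discI:
  assumes "continuous_on (closure disc) \<phi>"
  obtains B where "bounded_symbol area_disc B \<phi>" "\<And>z. z \<in> closure disc \<Longrightarrow> cmod (\<phi> z) \<le> B"
proof -
  have "compact (closure disc)" by (simp add: disc_def)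
  then obtain B where B: "\<forall>z\<in>closure disc. cmod (\<phi> z) \<le> B"
    using compact_continuous_bounded[OF _ assms] by blast
  have "0 \<le> B" using order_trans[OF norm_ge_zero B[rule_format, of 0]] by (simp add: disc_def)
  moreover have "continuous_on disc \<phi>" using assms closure_subset continuous_on_subset by blast
  ultimately show ?thesis
    using B that[of B] closure_subset[of disc] by (auto simp: bounded_symbol_def measurable_area_discI)
qed

lemma L2_one: "(\<lambda>x. c) \<in> L2_space area_disc"
proof -
  interpret finite_measure area_disc by (rule finite_measure_area_disc)
  show ?thesis by (rule L2_spaceI) auto
qed

subsection \<open>Bounds on compact subsets\<close>

text \<open>Cauchy's formula at the off-centre point \<open>w\<close>, which stays at distance at
  least \<open>R / 2\<close> from the circle about \<open>c\<close>. The centre is left free so that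
  the bound can be integrated over \<open>c\<close>; values in \<open>ennreal\<close> make Tonelli's
  theorem directly applicable.\<close>

lemma circle_average_bound:
  assumes hol: "g holomorphic_on S" and S: "open S" "cball w (2 * R) \<subseteq> S" and R: "R > 0" and c: "c \<in> ball w (R / 2)"
  shows "ennreal (cmod (g w)) \<le> 2 * (\<integral>\<^sup>+x. indicator {0..1} x * ennreal (cmod (g (circlepath c R x))) \<partial>lborel)"
proof -
  have cw: "dist c w < R / 2" using c by (simp add: dist_commute)
  have sub: "cball c R \<subseteq> cball w (2 * R)"
  proof
    fix u assume "u \<in> cball c R"
    then show "u \<in> cball w (2 * R)" using cw R dist_triangle[of w u c] by (simp add: dist_commute)
  qed
  have cont: "continuous_on (cball w (2 * R)) g"
    using hol S holomorphic_on_imp_continuous_on holomorphic_on_subset by blast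
  let ?\<gamma> = "circlepath c R"
  have \<gamma>: "?\<gamma> x \<in> cball w (2 * R)" for x
    using sub by (rule subsetD) (simp add: circlepath dist_norm norm_mult R less_imp_le)
  define F where "F = (\<lambda>x. g (?\<gamma> x) / (?\<gamma> x - w) * vector_derivative ?\<gamma> (at x within {0..1}))"
  have "((\<lambda>u. g u / (u - w)) has_contour_integral (2 * of_real pi * \<i> * g w)) ?\<gamma>"
  proof (rule Cauchy_integral_circlepath)
    show "continuous_on (cball c R) g" using cont sub continuous_on_subset by blast
    show "g holomorphic_on ball c R" using hol S sub ball_subset_cball holomorphic_on_subset by (metis order_trans)
    show "cmod (w - c) < R" using cw R by (simp add: dist_norm norm_minus_commute)
  qed
  then have F: "(F has_integral (2 * of_real pi * \<i> * g w)) {0..1}"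
    by (simp add: has_contour_integral_def F_def)
  have g\<gamma>: "continuous_on {0..1} (\<lambda>x. cmod (g (?\<gamma> x)))"
    using \<gamma> by (intro continuous_on_norm continuous_on_compose2[OF cont]) (auto simp: circlepath intro!: continuous_intros)
  then have int: "(\<lambda>x. cmod (g (?\<gamma> x))) integrable_on {0..1}" by (rule integrable_continuous_real)
  have "cmod (integral {0..1} F) \<le> integral {0..1} (\<lambda>x. 4 * pi * cmod (g (?\<gamma> x)))"
  proof (rule integral_norm_bound_integral)
    show "F integrable_on {0..1}" using F by blast
    show "(\<lambda>x. 4 * pi * cmod (g (?\<gamma> x))) integrable_on {0..1}"
      using integrable_cmul[OF int, of "4 * pi"] by simp
    fix x :: real assume x: "x \<in> {0..1}"
    have "R \<le> cmod (?\<gamma> x - c)" using R by (simp add: circlepath norm_mult)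
    also have "\<dots> \<le> cmod (?\<gamma> x - w) + cmod (w - c)" using norm_triangle_ineq[of "?\<gamma> x - w" "w - c"] by simp
    finally have d: "R / 2 \<le> cmod (?\<gamma> x - w)" using cw by (simp add: dist_norm norm_minus_commute)
    have "cmod (F x) = cmod (g (?\<gamma> x)) / cmod (?\<gamma> x - w) * (2 * pi * R)"
      using x R unfolding F_def by (simp add: vector_derivative_circlepath01 norm_mult norm_divide)
    \<comment> \<open>Speed \<open>2 * pi * R\<close> over distance \<open>R / 2\<close> gives
      \<open>4 * pi\<close>; dividing by the \<open>2 * pi\<close> in Cauchy's formula leaves the
      factor 2 of the statement.\<close>
    also have "\<dots> \<le> cmod (g (?\<gamma> x)) / (R / 2) * (2 * pi * R)"
    proof -
      have "0 < cmod (?\<gamma> x - w)" using d R by linarith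
      then show ?thesis using d R by (intro mult_right_mono divide_left_mono) auto
    qed
    also have "\<dots> = 4 * pi * cmod (g (?\<gamma> x))" using R by simp
    finally show "norm (F x) \<le> 4 * pi * cmod (g (?\<gamma> x))" by simp
  qed
  also have "integral {0..1} F = 2 * of_real pi * \<i> * g w" using F by (rule integral_unique)
  finally have "cmod (g w) \<le> 2 * integral {0..1} (\<lambda>x. cmod (g (?\<gamma> x)))"
    by (simp add: norm_mult)
  then have "ennreal (cmod (g w)) \<le> 2 * ennreal (integral {0..1} (\<lambda>x. cmod (g (?\<gamma> x))))"
    by (metis ennreal_leI ennreal_mult' ennreal_numeral zero_le_numeral)
  also have "ennreal (integral {0..1} (\<lambda>x. cmod (g (?\<gamma> x)))) = (\<integral>\<^sup>+x. indicator {0..1} x * ennreal (cmod (g (?\<gamma> x))) \<partial>lborel)"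
    using nn_integral_has_integral_lebesgue[OF _ integrable_integral[OF int]] by (simp add: ennreal_mult' ennreal_indicator)
  finally show ?thesis .
qed

text \<open>
  Averaging Cauchy's formula over circles of the same radius but with different centres needs only
  the translation invariance of Lebesgue measure.
\<close>

lemma area_average_bound:
  assumes hol: "g holomorphic_on S" and S: "open S" "cball w (2 * R) \<subseteq> S" and R: "R > 0"
  shows "emeasure lborel (ball w (R / 2)) * ennreal (cmod (g w))
    \<le> 2 * (\<integral>\<^sup>+u. ennreal (cmod (g u)) * indicator (cball w (2 * R)) u \<partial>lborel)"
proof -
  \<comment> \<open>Extension by 0 off the closed disc makes the integrand measurable on the whole
    plane, where translations act.\<close>
  define G where "G = (\<lambda>u. ennreal (cmod (indicator (cball w (2 * R)) u *\<^sub>R g u)))"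
  have cont: "continuous_on (cball w (2 * R)) g"
    using hol S holomorphic_on_imp_continuous_on holomorphic_on_subset by blast
  have [measurable]: "(\<lambda>u. indicator (cball w (2 * R)) u *\<^sub>R g u) \<in> borel_measurable borel"
    by (rule borel_measurable_continuous_on_indicator[OF _ cont]) simp
  have [measurable]: "G \<in> borel_measurable borel" unfolding G_def by measurable
  have [measurable]: "(\<lambda>x::real. exp (2 * of_real pi * \<i> * of_real x)) \<in> borel_measurable borel"
    by (intro borel_measurable_continuous_onI continuous_intros)
  have "ennreal (cmod (g w)) * indicator (ball w (R / 2)) c
      \<le> 2 * (\<integral>\<^sup>+x. indicator {0..1} x * G (circlepath c R x) \<partial>lborel)" for c
  proof (cases "c \<in> ball w (R / 2)")
    case True
    then have "G (circlepath c R x) = ennreal (cmod (g (circlepath c R x)))" for x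
    proof -
      have "dist w (circlepath c R x) \<le> dist w c + dist c (circlepath c R x)" by (rule dist_triangle)
      also have "\<dots> \<le> R / 2 + R" using True R by (intro add_mono) (auto simp: circlepath dist_norm norm_mult)
      finally show ?thesis using R by (simp add: G_def)
    qed
    with circle_average_bound[OF hol S R True] True show ?thesis by simp
  qed simp
  then have "(\<integral>\<^sup>+c. ennreal (cmod (g w)) * indicator (ball w (R / 2)) c \<partial>lborel)
      \<le> (\<integral>\<^sup>+c. 2 * (\<integral>\<^sup>+x. indicator {0..1} x * G (circlepath c R x) \<partial>lborel) \<partial>lborel)"
    by (intro nn_integral_mono)
  also have "\<dots> = 2 * (\<integral>\<^sup>+c. (\<integral>\<^sup>+x. indicator {0..1} x * G (circlepath c R x) \<partial>lborel) \<partial>lborel)"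
    unfolding circlepath by (intro nn_integral_cmult) measurable
  also have "(\<integral>\<^sup>+c. (\<integral>\<^sup>+x. indicator {0..1} x * G (circlepath c R x) \<partial>lborel) \<partial>lborel)
      = (\<integral>\<^sup>+x. (\<integral>\<^sup>+c. indicator {0..1} x * G (circlepath c R x) \<partial>lborel) \<partial>lborel)"
    unfolding circlepath by (intro lborel_pair.Fubini') measurable
  also have "\<dots> = (\<integral>\<^sup>+x. indicator {0..1::real} x * (\<integral>\<^sup>+u. G u \<partial>lborel) \<partial>lborel)"
  proof (rule nn_integral_cong)
    fix x :: real
    let ?t = "R * exp (2 * of_real pi * \<i> * of_real x)"
    have "(\<integral>\<^sup>+c. G (?t + c) \<partial>lborel) = (\<integral>\<^sup>+u. G u \<partial>(distr lborel borel ((+) ?t)))"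
      by (subst nn_integral_distr) auto
    then have "(\<integral>\<^sup>+c. G (circlepath c R x) \<partial>lborel) = (\<integral>\<^sup>+u. G u \<partial>lborel)"
      by (simp add: lborel_distr_plus circlepath add.commute)
    moreover have "(\<integral>\<^sup>+c. indicator {0..1} x * G (circlepath c R x) \<partial>lborel)
        = indicator {0..1} x * (\<integral>\<^sup>+c. G (circlepath c R x) \<partial>lborel)"
      unfolding circlepath by (rule nn_integral_cmult) measurable
    ultimately show "(\<integral>\<^sup>+c. indicator {0..1} x * G (circlepath c R x) \<partial>lborel)
        = indicator {0..1} x * (\<integral>\<^sup>+u. G u \<partial>lborel)" by simp
  qed
  also have "\<dots> = (\<integral>\<^sup>+u. G u \<partial>lborel)"
    by (subst nn_integral_multc) simp_all
  also have "\<dots> = (\<integral>\<^sup>+u. ennreal (cmod (g u)) * indicator (cball w (2 * R)) u \<partial>lborel)"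
    by (intro nn_integral_cong) (auto simp: G_def indicator_def)
  finally show ?thesis by (subst (asm) nn_integral_cmult_indicator) (simp_all add: mult.commute)
qed

text \<open>Only the values of \<open>g\<close> on a slightly larger closed disc enter, and
  \<open>g\<close> is merely holomorphic. Both features matter: slices of functions on the bidisc
  are not yet known to be square integrable when the bound is applied to them, and the Hankel
  estimate for \<open>cnj\<close> has to bound \<open>g\<close> near the origin by
  \<open>cut s g\<close>.\<close>

lemma eval_bound_compact:
  assumes s: "0 \<le> s" "s < 1"
  shows "\<exists>C>0. \<forall>g w. g holomorphic_on disc \<longrightarrow> w \<in> cball 0 s \<longrightarrow>
    cmod (g w) \<le> C * dnorm (\<lambda>u. indicator (cball 0 ((1 + s) / 2)) u * g u)"
proof -
  interpret finite_measure area_disc by (rule finite_measure_area_disc)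
  \<comment> \<open>Discs of radius \<open>2 * R\<close> about points of \<open>cball 0 s\<close>
    reach up to \<open>s + (1 - s) / 2 = (1 + s) / 2\<close>, the radius of
    \<open>K\<close>.\<close>
  define R where "R = (1 - s) / 4"
  define K where "K = cball (0::complex) ((1 + s) / 2)"
  define v where "v = unit_ball_vol 2 * (R / 2)\<^sup>2"
  have R: "R > 0" using s by (simp add: R_def)
  then have v: "v > 0" by (simp add: v_def)
  have Kd: "K \<subseteq> disc" "K \<in> sets area_disc" using s by (auto simp: K_def disc_def intro!: cball_sets_area_disc[unfolded K_def])
  \<comment> \<open>The area average gives
    \<open>v * cmod (g w) \<le> 2 * \<integral> cmod g\<close>, and Cauchy-Schwarz against the
    constant 1 gives the norm of 1. The summand 1 makes positivity evident.\<close>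
  define C where "C = 2 * dnorm (\<lambda>x. 1) / v + 1"
  have "C > 0" using v by (auto simp: C_def intro!: add_nonneg_pos)
  moreover have "cmod (g w) \<le> C * dnorm (\<lambda>u. indicator K u * g u)"
    if g: "g holomorphic_on disc" and w: "w \<in> cball 0 s" for g w
  proof -
    have wK: "cball w (2 * R) \<subseteq> K"
    proof
      fix u assume "u \<in> cball w (2 * R)"
      then show "u \<in> K" using w norm_triangle_sub[of u w] by (simp add: K_def R_def dist_norm norm_minus_commute field_simps)
    qed
    have contK: "continuous_on K g" using g Kd holomorphic_on_imp_continuous_on continuous_on_subset by blast
    have meas: "g \<in> borel_measurable area_disc" by (intro measurable_area_discI holomorphic_on_imp_continuous_on g)
    then have [measurable]: "(\<lambda>u. indicator K u * g u) \<in> borel_measurable area_disc" using Kd(2) by measurable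
    obtain b where b: "\<forall>u\<in>K. cmod (g u) \<le> b"
      using compact_continuous_bounded[OF _ contK] by (auto simp: K_def)
    have h: "(\<lambda>u. of_real (cmod (indicator K u * g u))) \<in> L2_space area_disc"
    proof (rule L2_space_dominated[OF _ L2_one[of 1]])
      show "cmod (of_real (cmod (indicator K u * g u))) \<le> \<bar>b\<bar> * cmod 1" if "u \<in> space area_disc" for u
        using b by (auto simp: indicator_def)
    qed measurable
    have int: "integrable area_disc (\<lambda>u. cmod (indicator K u * g u))"
      using integrable_norm[OF integrable_L2_inner[OF h L2_one[of 1]]] by simp
    have "emeasure lborel (ball w (R / 2)) * ennreal (cmod (g w))
        \<le> 2 * (\<integral>\<^sup>+u. ennreal (cmod (g u)) * indicator (cball w (2 * R)) u \<partial>lborel)"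
      using wK Kd by (intro area_average_bound[OF g open_disc _ R]) auto
    also have "emeasure lborel (ball w (R / 2)) = ennreal v"
      using R emeasure_ball[of "R / 2" w] by (simp add: v_def)
    also have "(\<integral>\<^sup>+u. ennreal (cmod (g u)) * indicator (cball w (2 * R)) u \<partial>lborel)
        \<le> (\<integral>\<^sup>+u. ennreal (cmod (indicator K u * g u)) * indicator disc u \<partial>lborel)"
      using wK Kd by (intro nn_integral_mono) (auto simp: indicator_def)
    also have "\<dots> = (\<integral>\<^sup>+u. ennreal (cmod (indicator K u * g u)) \<partial>area_disc)"
      unfolding area_disc_def by (subst nn_integral_restrict_space) (auto simp: open_disc)
    also have "\<dots> = ennreal (LINT u|area_disc. cmod (indicator K u * g u))"
      by (rule nn_integral_eq_integral[OF int]) simp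
    finally have "ennreal v * ennreal (cmod (g w)) \<le> 2 * ennreal (LINT u|area_disc. cmod (indicator K u * g u))"
      by (simp add: mult_left_mono)
    then have "ennreal (v * cmod (g w)) \<le> ennreal (2 * (LINT u|area_disc. cmod (indicator K u * g u)))"
      using v by (simp add: ennreal_mult')
    then have "v * cmod (g w) \<le> 2 * (LINT u|area_disc. cmod (indicator K u * g u))"
      by (subst (asm) ennreal_le_iff) (auto intro!: Bochner_Integration.integral_nonneg)
    also have "(LINT u|area_disc. cmod (indicator K u * g u)) = cmod (L2_inner area_disc (\<lambda>u. of_real (cmod (indicator K u * g u))) (\<lambda>x. 1))"
    proof -
      have "L2_inner area_disc (\<lambda>u. of_real (cmod (indicator K u * g u))) (\<lambda>x. 1)
          = of_real (LINT u|area_disc. cmod (indicator K u * g u))"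
        unfolding L2_inner_def complex_cnj_one mult_1_right by (rule integral_complex_of_real)
      then show ?thesis by (simp add: Bochner_Integration.integral_nonneg)
    qed
    also have "\<dots> \<le> dnorm (\<lambda>u. of_real (cmod (indicator K u * g u))) * dnorm (\<lambda>x. 1)"
      by (rule L2_Cauchy_Schwarz[OF h L2_one])
    also have "dnorm (\<lambda>u. of_real (cmod (indicator K u * g u))) = dnorm (\<lambda>u. indicator K u * g u)"
      by (rule L2_norm_cong) simp
    finally have "cmod (g w) \<le> (2 * dnorm (\<lambda>x. 1) / v) * dnorm (\<lambda>u. indicator K u * g u)"
      using v by (simp add: field_simps)
    also have "\<dots> \<le> C * dnorm (\<lambda>u. indicator K u * g u)"
      unfolding C_def by (intro mult_right_mono) auto
    finally show ?thesis .
  qed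
  ultimately show ?thesis unfolding K_def by blast
qed

lemma bergman_discD:
  assumes "g \<in> bergman_disc"
  shows "g \<in> L2_space area_disc" "g holomorphic_on disc" "z \<notin> disc \<Longrightarrow> g z = 0" "continuous_on disc g"
  using assms holomorphic_on_imp_continuous_on by (auto simp: bergman_disc_def)

lemma L2_norm_indicator_le:
  assumes "g \<in> L2_space M" "S \<in> sets M"
  shows "L2_norm M (\<lambda>x. indicator S x * g x) \<le> L2_norm M g"
  using L2_norm_mult[OF bounded_symbol_indicator[OF assms(2)] assms(1)] by simp

lemma eval_bound:
  assumes s: "s < 1"
  shows "\<exists>C>0. \<forall>g\<in>bergman_disc. \<forall>w\<in>cball 0 s. cmod (g w) \<le> C * dnorm g"
proof -
  \<comment> \<open>\<open>eval_bound_compact\<close> starts from a nonnegative radius; for negative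
    \<open>s\<close> the disc in question is empty.\<close>
  define t where "t = max s 0"
  have t: "0 \<le> t" "t < 1" "s \<le> t" using s by (auto simp: t_def)
  obtain C where C: "C > 0" "\<And>g w. g holomorphic_on disc \<Longrightarrow> w \<in> cball 0 t \<Longrightarrow>
    cmod (g w) \<le> C * dnorm (\<lambda>u. indicator (cball 0 ((1 + t) / 2)) u * g u)"
    using eval_bound_compact[OF t(1,2)] by blast
  have "cmod (g w) \<le> C * dnorm g" if g: "g \<in> bergman_disc" and w: "w \<in> cball 0 s" for g w
  proof -
    have "cmod (g w) \<le> C * dnorm (\<lambda>u. indicator (cball 0 ((1 + t) / 2)) u * g u)"
      using bergman_discD(2)[OF g] w t(3) by (intro C(2)) auto
    also have "\<dots> \<le> C * dnorm g"
      using t C(1) by (intro mult_left_mono L2_norm_indicator_le bergman_discD(1)[OF g] cball_sets_area_disc) auto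
    finally show ?thesis .
  qed
  with C(1) show ?thesis by blast
qed

lemma bergman_disc_eval: "w \<in> disc \<Longrightarrow> \<exists>C>0. \<forall>g\<in>bergman_disc. cmod (g w) \<le> C * dnorm g"
  using eval_bound[of "cmod w"] by (auto simp: disc_def)

lemma L2_Cauchy_uniform_limit:
  fixes u :: "nat \<Rightarrow> 'a \<Rightarrow> complex"
  assumes "L2_Cauchy M u" and bound: "\<And>m n p. p \<in> K \<Longrightarrow> cmod (u m p - u n p) \<le> C * L2_norm M (\<lambda>x. u m x - u n x)"
    and C: "C > 0" and lim: "\<And>p. p \<in> K \<Longrightarrow> (\<lambda>n. u n p) \<longlonglongrightarrow> l p"
  shows "uniform_limit K u l sequentially"
  unfolding uniform_limit_sequentially_iff
proof (intro allI impI)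
  fix e :: real assume e: "e > 0"
  \<comment> \<open>Passing to the limit keeps only a weak inequality; halving \<open>e\<close>
    restores the strict one.\<close>
  then have "e / (2 * C) > 0" using C by simp
  with assms(1) obtain N where N: "\<forall>m\<ge>N. \<forall>n\<ge>N. L2_norm M (\<lambda>x. u m x - u n x) < e / (2 * C)"
    unfolding L2_Cauchy_def by blast
  have "dist (u n p) (l p) < e" if "n \<ge> N" "p \<in> K" for n p
  proof -
    have "cmod (u n p - l p) \<le> e / 2"
    proof (rule LIMSEQ_le_const2)
      show "(\<lambda>m. cmod (u n p - u m p)) \<longlonglongrightarrow> cmod (u n p - l p)" by (intro tendsto_intros lim that)
      have "cmod (u n p - u m p) \<le> e / 2" if "m \<ge> N" for m
      proof -
        have "cmod (u n p - u m p) \<le> C * L2_norm M (\<lambda>x. u n x - u m x)" by (rule bound) fact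
        also have "\<dots> \<le> C * (e / (2 * C))" using C N \<open>n \<ge> N\<close> that by (intro mult_left_mono) (auto intro: less_imp_le)
        also have "\<dots> = e / 2" using C by simp
        finally show ?thesis .
      qed
      then show "\<exists>N. \<forall>m\<ge>N. cmod (u n p - u m p) \<le> e / 2" by blast
    qed
    then show ?thesis using e by (simp add: dist_norm)
  qed
  then show "\<exists>N. \<forall>n\<ge>N. \<forall>x\<in>K. dist (u n x) (l x) < e" by blast
qed

lemma L2_Cauchy_pointwise:
  fixes u :: "nat \<Rightarrow> 'a \<Rightarrow> complex"
  assumes "L2_Cauchy M u" and bound: "\<And>m n. cmod (u m p - u n p) \<le> C * L2_norm M (\<lambda>x. u m x - u n x)" and C: "C > 0"
  shows "convergent (\<lambda>n. u n p)"
proof -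
  have "Cauchy (\<lambda>n. u n p)"
  proof (rule metric_CauchyI)
    fix e :: real assume e: "e > 0"
    then have "e / C > 0" using C by simp
    with assms(1) obtain N where N: "\<forall>m\<ge>N. \<forall>n\<ge>N. L2_norm M (\<lambda>x. u m x - u n x) < e / C"
      unfolding L2_Cauchy_def by blast
    have "dist (u m p) (u n p) < e" if "m \<ge> N" "n \<ge> N" for m n
    proof -
      have "cmod (u m p - u n p) \<le> C * L2_norm M (\<lambda>x. u m x - u n x)" by (rule bound)
      also have "\<dots> < C * (e / C)" using N that C by (intro mult_strict_left_mono) auto
      finally show ?thesis using C by (simp add: dist_norm)
    qed
    then show "\<exists>N. \<forall>m\<ge>N. \<forall>n\<ge>N. dist (u m p) (u n p) < e" by blast
  qed
  then show ?thesis by (rule Cauchy_convergent)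
qed

lemma bergman_disc_lin:
  assumes "g \<in> bergman_disc" "h \<in> bergman_disc"
  shows "(\<lambda>x. a * g x + b * h x) \<in> bergman_disc"
  using assms by (auto simp: bergman_disc_def intro!: L2_space_lin holomorphic_intros)

text \<open>Evaluations are bounded uniformly on smaller discs. Hence norm 0 forces the zero
  function, and a Cauchy sequence converges locally uniformly, so that the limit is holomorphic;
  convergence in norm follows from \<open>L2_pointwise_limit\<close>.\<close>

interpretation D: L2_hilbert area_disc bergman_disc
proof
  show "bergman_disc \<subseteq> L2_space area_disc" by (auto simp: bergman_disc_def)
  show "(\<lambda>x. 0) \<in> bergman_disc" by (auto simp: bergman_disc_def L2_space_zero)
  show "(\<lambda>x. a * g x + b * h x) \<in> bergman_disc" if "g \<in> bergman_disc" "h \<in> bergman_disc" for g h a b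
    using that by (rule bergman_disc_lin)
  show "g = (\<lambda>x. 0)" if g: "g \<in> bergman_disc" "dnorm g = 0" for g
  proof
    fix w show "g w = 0"
    proof (cases "w \<in> disc")
      case True
      then show ?thesis using bergman_disc_eval[OF True] g by fastforce
    qed (use bergman_discD(3)[OF g(1)] in simp)
  qed
  fix u :: "nat \<Rightarrow> complex \<Rightarrow> complex"
  assume u: "\<And>n. u n \<in> bergman_disc"
    and "\<And>e::real. e > 0 \<Longrightarrow> \<exists>N. \<forall>m\<ge>N. \<forall>n\<ge>N. dnorm (\<lambda>x. u m x - u n x) < e"
  then have Cau: "L2_Cauchy area_disc u" by (simp add: L2_Cauchy_def)
  have diff: "(\<lambda>x. u m x - u n x) \<in> bergman_disc" for m n using bergman_disc_lin[OF u u, of 1 m "-1" n] by simp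
  define l where "l = (\<lambda>w. if w \<in> disc then lim (\<lambda>n. u n w) else 0)"
  have lim: "(\<lambda>n. u n w) \<longlonglongrightarrow> l w" if w: "w \<in> disc" for w
  proof -
    obtain C where C: "C > 0" "\<forall>g\<in>bergman_disc. cmod (g w) \<le> C * dnorm g"
      using bergman_disc_eval[OF w] by blast
    have "convergent (\<lambda>n. u n w)"
      by (rule L2_Cauchy_pointwise[OF Cau _ C(1)]) (use bspec[OF C(2) diff] in simp)
    then show ?thesis using w by (simp add: l_def convergent_LIMSEQ_iff)
  qed
  have hol: "l holomorphic_on disc"
  proof (rule holomorphic_uniform_sequence[OF open_disc])
    show "u n holomorphic_on disc" for n by (rule bergman_discD(2)[OF u])
    fix w assume w: "w \<in> disc"
    then obtain d where d: "d > 0" "cball w d \<subseteq> disc" using open_disc open_contains_cball by blast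
    define s where "s = cmod w + (1 - cmod w) / 2"
    define d where "d = (1 - cmod w) / 2"
    have s: "s < 1" "d > 0" using w by (auto simp: s_def d_def disc_def field_simps)
    have sub: "cball w d \<subseteq> cball 0 s"
    proof
      fix y assume "y \<in> cball w d"
      then have "cmod (y - w) \<le> d" by (simp add: dist_norm norm_minus_commute)
      then have "cmod y \<le> s" using norm_triangle_sub[of y w] unfolding s_def d_def by linarith
      then show "y \<in> cball 0 s" by simp
    qed
    obtain C where C: "C > 0" "\<forall>g\<in>bergman_disc. \<forall>w\<in>cball 0 s. cmod (g w) \<le> C * dnorm g"
      using eval_bound[OF s(1)] by blast
    have sd: "cball 0 s \<subseteq> disc" using s by (auto simp: disc_def)
    have "uniform_limit (cball w d) u l sequentially"
    proof (rule L2_Cauchy_uniform_limit[OF Cau _ C(1)])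
      fix p assume p: "p \<in> cball w d"
      show "cmod (u m p - u n p) \<le> C * dnorm (\<lambda>x. u m x - u n x)" for m n
        using bspec[OF bspec[OF C(2) diff], of p m n] p sub by auto
      show "(\<lambda>n. u n p) \<longlonglongrightarrow> l p" using p sub sd by (intro lim) auto
    qed
    then show "\<exists>d>0. cball w d \<subseteq> disc \<and> uniform_limit (cball w d) u l sequentially"
      using s sub sd by blast
  qed
  have "l \<in> L2_space area_disc" "(\<lambda>n. dnorm (\<lambda>x. u n x - l x)) \<longlonglongrightarrow> 0"
    by (rule L2_pointwise_limit[of u]; use bergman_discD(1)[OF u] lim Cau in \<open>simp add: L2_Cauchy_def\<close>)+
  with hol show "\<exists>l\<in>bergman_disc. (\<lambda>n. dnorm (\<lambda>x. u n x - l x)) \<longlonglongrightarrow> 0"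
    by (intro bexI[of _ l]) (auto simp: bergman_disc_def l_def)
qed

lemma eval_lipschitz:
  assumes s: "s < 1"
  shows "\<exists>L>0. \<forall>g\<in>bergman_disc. \<forall>w\<in>cball 0 s. \<forall>z\<in>cball 0 s. cmod (g w - g z) \<le> L * dnorm g * cmod (w - z)"
proof -
  \<comment> \<open>Half the distance to the unit circle: the circles used in Cauchy's inequality
    stay inside the disc of radius \<open>s + r\<close>, on which \<open>eval_bound\<close> is
    available.\<close>
  define r where "r = (1 - s) / 2"
  have r: "r > 0" "s + r < 1" using s by (auto simp: r_def field_simps)
  obtain C where C: "C > 0" "\<forall>g\<in>bergman_disc. \<forall>w\<in>cball 0 (s + r). cmod (g w) \<le> C * dnorm g"
    using eval_bound[OF r(2)] by blast
  have "cmod (g w - g z) \<le> C / r * dnorm g * cmod (w - z)"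
    if g: "g \<in> bergman_disc" and w: "w \<in> cball 0 s" and z: "z \<in> cball 0 s" for g w z
  proof (rule field_differentiable_bound[OF convex_cball _ _ w z])
    fix y assume y: "y \<in> cball (0::complex) s"
    have sub: "cball y r \<subseteq> cball 0 (s + r)"
    proof
      fix u assume "u \<in> cball y r"
      then show "u \<in> cball 0 (s + r)" using y norm_triangle_sub[of u y] by (simp add: dist_norm norm_minus_commute)
    qed
    also have "\<dots> \<subseteq> disc" using r by (auto simp: disc_def)
    finally have sub': "cball y r \<subseteq> disc" .
    have "y \<in> disc" using sub' r by auto
    then show "(g has_field_derivative deriv g y) (at y within cball 0 s)"
      using bergman_discD(2)[OF g] open_disc holomorphic_derivI has_field_derivative_at_within by blast
    have "cmod ((deriv ^^ 1) g y) \<le> fact 1 * (C * dnorm g) / r ^ 1"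
    proof (rule Cauchy_inequality)
      show "g holomorphic_on ball y r" using bergman_discD(2)[OF g] sub' ball_subset_cball holomorphic_on_subset by (metis order_trans)
      show "continuous_on (cball y r) g" using bergman_discD(4)[OF g] sub' continuous_on_subset by blast
      show "cmod (g u) \<le> C * dnorm g" if "cmod (y - u) = r" for u
      proof -
        have "u \<in> cball y r" using that by (simp add: dist_norm)
        then show ?thesis using C(2) g sub by blast
      qed
    qed (use r in simp)
    then show "cmod (deriv g y) \<le> C / r * dnorm g" by simp
  qed
  then show ?thesis using C r by (intro exI[of _ "C / r"]) simp
qed

section \<open>Reproducing kernels\<close>

lemma kernel_exists:
  assumes w: "w \<in> disc"
  shows "\<exists>k\<in>bergman_disc. \<forall>g\<in>bergman_disc. g w = L2_inner area_disc g k"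
proof -
  obtain C where "C > 0" "\<forall>g\<in>bergman_disc. cmod (g w) \<le> C * dnorm g"
    using bergman_disc_eval[OF w] by blast
  then show ?thesis by (intro D.riesz) auto
qed

text \<open>The Bergman kernel of the disc with pole parameter \<open>w\<close>; the choice is
  unique by \<open>D.inner_eqI\<close>.\<close>

definition kern :: "complex \<Rightarrow> complex \<Rightarrow> complex" where
  "kern w = (SOME k. k \<in> bergman_disc \<and> (\<forall>g\<in>bergman_disc. g w = L2_inner area_disc g k))"

lemma
  assumes "w \<in> disc"
  shows kern_in: "kern w \<in> bergman_disc"
    and kern: "g \<in> bergman_disc \<Longrightarrow> g w = L2_inner area_disc g (kern w)"
proof -
  have "\<exists>k. k \<in> bergman_disc \<and> (\<forall>g\<in>bergman_disc. g w = L2_inner area_disc g k)"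
    using kernel_exists[OF assms] by blast
  from someI_ex[OF this] show "kern w \<in> bergman_disc" "g \<in> bergman_disc \<Longrightarrow> g w = L2_inner area_disc g (kern w)"
    unfolding kern_def by blast+
qed

lemma proj_eval: "w \<in> disc \<Longrightarrow> h \<in> L2_space area_disc \<Longrightarrow> D.proj h w = L2_inner area_disc h (kern w)"
  using kern[OF _ D.proj_in] D.proj_inner[OF _ kern_in] by simp

text \<open>The dual of \<open>eval_lipschitz\<close>: with \<open>d\<close> the difference of two
  kernels, the reproducing property gives
  \<open>\<parallel>d\<parallel>\<^sup>2 = d w - d z\<close>, and one factor
  \<open>\<parallel>d\<parallel>\<close> cancels.\<close>

lemma kern_lipschitz:
  assumes s: "s < 1"
  shows "\<exists>L>0. \<forall>w\<in>cball 0 s. \<forall>z\<in>cball 0 s. dnorm (\<lambda>u. kern w u - kern z u) \<le> L * cmod (w - z)"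
proof -
  obtain L where L: "L > 0" "\<forall>g\<in>bergman_disc. \<forall>w\<in>cball 0 s. \<forall>z\<in>cball 0 s. cmod (g w - g z) \<le> L * dnorm g * cmod (w - z)"
    using eval_lipschitz[OF s] by blast
  have "dnorm (\<lambda>u. kern w u - kern z u) \<le> L * cmod (w - z)" if w: "w \<in> cball 0 s" and z: "z \<in> cball 0 s" for w z
  proof -
    have wz: "w \<in> disc" "z \<in> disc" using w z s by (auto simp: disc_def)
    define d where "d = (\<lambda>u. kern w u - kern z u)"
    have d: "d \<in> bergman_disc" unfolding d_def by (intro D.diff kern_in wz)
    have "L2_inner area_disc d d = d w - d z"
      unfolding kern[OF wz(1) d] kern[OF wz(2) d]
      using L2_inner_diff_right[OF D.L2[OF kern_in[OF wz(1)]] D.L2[OF kern_in[OF wz(2)]] D.L2[OF d]]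
      by (simp add: d_def)
    then have "(dnorm d)\<^sup>2 = cmod (d w - d z)" by (metis L2_inner_self norm_of_real abs_of_nonneg zero_le_power2)
    also have "\<dots> \<le> L * dnorm d * cmod (w - z)" using L(2) d w z by blast
    finally have "dnorm d * dnorm d \<le> dnorm d * (L * cmod (w - z))"
      by (simp add: power2_eq_square mult_ac)
    then show ?thesis unfolding d_def[symmetric] using L(1)
      by (cases "dnorm d = 0") (auto simp: mult_le_cancel_left less_le)
  qed
  with L(1) show ?thesis by blast
qed

section \<open>Toeplitz operators on the disc\<close>

abbreviation cut :: "real \<Rightarrow> (complex \<Rightarrow> complex) \<Rightarrow> complex \<Rightarrow> complex" where
  "cut s g \<equiv> (\<lambda>z. indicator (cball 0 s) z * g z)"

text \<open>A quantitative form of compactness.\<close>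

definition vanishing :: "((complex \<Rightarrow> complex) \<Rightarrow> complex \<Rightarrow> complex) \<Rightarrow> bool" where
  "vanishing A \<longleftrightarrow> (\<forall>e>0. \<exists>s<1. \<exists>C\<ge>0. \<forall>g\<in>bergman_disc.
     dnorm (A g) \<le> e * dnorm g + C * dnorm (cut s g))"

lemma vanishingE:
  assumes "vanishing A" "e > 0"
  obtains s C where "s < 1" "0 \<le> C" "\<And>g. g \<in> bergman_disc \<Longrightarrow>
    dnorm (A g) \<le> e * dnorm g + C * dnorm (cut s g)"
  using assms unfolding vanishing_def by meson

lemma cnj_indicator [simp]: "cnj (indicator S x) = indicator S x"
  by (cases "x \<in> S") auto

lemma cut_L2: "s < 1 \<Longrightarrow> g \<in> L2_space area_disc \<Longrightarrow> cut s g \<in> L2_space area_disc"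
  by (rule L2_space_mult[OF bounded_symbol_indicator[OF cball_sets_area_disc]])

lemma cut_norm: "s < 1 \<Longrightarrow> g \<in> L2_space area_disc \<Longrightarrow> dnorm (cut s g) \<le> dnorm g"
  by (intro L2_norm_indicator_le cball_sets_area_disc)

lemma cut_mono:
  assumes "s \<le> t" "t < 1" "g \<in> L2_space area_disc"
  shows "dnorm (cut s g) \<le> dnorm (cut t g)"
  using L2_norm_dominated[OF L2_space_measurable[OF cut_L2[of s]] cut_L2[of t], of g g 1] assms
  by (auto simp: indicator_def)

lemma L2_norm_tail_tendsto:
  assumes g: "g \<in> L2_space M" and S: "\<And>n::nat. S n \<in> sets M"
    and ev: "\<And>x. x \<in> space M \<Longrightarrow> \<forall>\<^sub>F n in sequentially. x \<notin> S n"
  shows "(\<lambda>n. L2_norm M (\<lambda>x. indicator (S n) x * g x)) \<longlonglongrightarrow> 0"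
proof -
  have [measurable]: "g \<in> borel_measurable M" "\<And>n. S n \<in> sets M" using L2_space_measurable[OF g] S by auto
  have "(\<lambda>n. LINT x|M. (cmod (indicator (S n) x * g x))\<^sup>2) \<longlonglongrightarrow> (LINT x|M. 0)"
  proof (rule integral_dominated_convergence[where w="\<lambda>x. (cmod (g x))\<^sup>2"])
    show "integrable M (\<lambda>x. (cmod (g x))\<^sup>2)" by (rule L2_space_integrable[OF g])
    show "AE x in M. (\<lambda>n. (cmod (indicator (S n) x * g x))\<^sup>2) \<longlonglongrightarrow> 0"
    proof (rule AE_I2)
      fix x assume "x \<in> space M"
      from ev[OF this] have "\<forall>\<^sub>F n in sequentially. (cmod (indicator (S n) x * g x))\<^sup>2 = 0"
        by eventually_elim simp
      then show "(\<lambda>n. (cmod (indicator (S n) x * g x))\<^sup>2) \<longlonglongrightarrow> 0" by (rule tendsto_eventually)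
    qed
    show "AE x in M. norm ((cmod (indicator (S n) x * g x))\<^sup>2) \<le> (cmod (g x))\<^sup>2" for n
      by (auto simp: indicator_def)
  qed measurable
  then have "(\<lambda>n. sqrt (LINT x|M. (cmod (indicator (S n) x * g x))\<^sup>2)) \<longlonglongrightarrow> sqrt 0"
    by (intro tendsto_real_sqrt) simp
  then show ?thesis by (simp add: L2_norm_def)
qed

lemma disc_diff_cball_sets: "disc - cball 0 s \<in> sets area_disc"
  by (rule sets_area_disc) (auto simp: open_disc)

lemma tail_small:
  assumes g: "g \<in> L2_space area_disc" and e: "e > 0"
  shows "\<exists>s<1. \<forall>t\<ge>s. dnorm (\<lambda>x. indicator (disc - cball 0 t) x * g x) < e"
proof -
  have "(\<lambda>n. dnorm (\<lambda>x. indicator (disc - cball 0 (1 - 1 / real (Suc n))) x * g x)) \<longlonglongrightarrow> 0"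
  proof (rule L2_norm_tail_tendsto[OF g disc_diff_cball_sets])
    fix x assume "x \<in> space area_disc"
    then have "1 - cmod x > 0" by (simp add: disc_def)
    from order_tendstoD(2)[OF LIMSEQ_Suc[OF lim_inverse_n'] this]
    show "\<forall>\<^sub>F n in sequentially. x \<notin> disc - cball 0 (1 - 1 / real (Suc n))"
      by eventually_elim (simp del: of_nat_Suc)
  qed
  from order_tendstoD(2)[OF this e] obtain n
    where n: "dnorm (\<lambda>x. indicator (disc - cball 0 (1 - 1 / real (Suc n))) x * g x) < e"
    unfolding eventually_sequentially by blast
  have "dnorm (\<lambda>x. indicator (disc - cball 0 t) x * g x) < e" if t: "t \<ge> 1 - 1 / real (Suc n)" for t
  proof -
    have "dnorm (\<lambda>x. indicator (disc - cball 0 t) x * g x)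
        \<le> 1 * dnorm (\<lambda>x. indicator (disc - cball 0 (1 - 1 / real (Suc n))) x * g x)"
      using t by (intro L2_norm_dominated L2_space_measurable L2_space_mult[OF bounded_symbol_indicator[OF disc_diff_cball_sets]] g)
        (auto simp: indicator_def)
    with n show ?thesis by simp
  qed
  then show ?thesis by (intro exI[of _ "1 - 1 / real (Suc n)"]) (auto simp del: of_nat_Suc)
qed

text \<open>Each single kernel has a small tail near the circle. Uniformity comes from compactness
  of \<open>cball 0 s\<close>: finitely many kernels approximate all of them up to
  \<open>e / 2\<close>, and the tails of these finitely many are below \<open>e / 2\<close>.\<close>

lemma kern_tail_small:
  assumes s: "s < 1" and e: "e > 0"
  shows "\<exists>t<1. \<forall>w\<in>cball 0 s. dnorm (\<lambda>x. indicator (disc - cball 0 t) x * kern w x) \<le> e"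
proof -
  obtain L where L: "L > 0" "\<forall>w\<in>cball 0 s. \<forall>z\<in>cball 0 s. dnorm (\<lambda>u. kern w u - kern z u) \<le> L * cmod (w - z)"
    using kern_lipschitz[OF s] by blast
  define d where "d = e / (2 * L)"
  have d: "d > 0" using e L by (simp add: d_def)
  have sd: "cball 0 s \<subseteq> disc" using s by (auto simp: disc_def)
  have cover: "cball (0::complex) s \<subseteq> (\<Union>x\<in>cball 0 s. ball x d)" using d by auto
  obtain F :: "complex set" where F: "F \<subseteq> cball 0 s" "finite F" "cball 0 s \<subseteq> (\<Union>x\<in>F. ball x d)"
    by (rule compactE_image[OF compact_cball _ cover]) auto
  have "\<exists>t. \<forall>w\<in>F. t w < 1 \<and> (\<forall>r\<ge>t w. dnorm (\<lambda>x. indicator (disc - cball 0 r) x * kern w x) < e / 2)"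
    using F(1) sd e by (intro bchoice ballI tail_small D.L2 kern_in) auto
  then obtain t where t: "\<And>w. w \<in> F \<Longrightarrow> t w < 1"
    "\<And>w r. w \<in> F \<Longrightarrow> r \<ge> t w \<Longrightarrow> dnorm (\<lambda>x. indicator (disc - cball 0 r) x * kern w x) < e / 2" by blast
  define T where "T = Max (insert 0 (t ` F))"
  have T: "T < 1" "\<And>w. w \<in> F \<Longrightarrow> t w \<le> T" using F(2) t(1) by (auto simp: T_def)
  have "dnorm (\<lambda>x. indicator (disc - cball 0 T) x * kern w x) \<le> e" if w: "w \<in> cball 0 s" for w
  proof -
    obtain z where z: "z \<in> F" "w \<in> ball z d" using F(3) w by auto
    have zw: "z \<in> disc" "w \<in> disc" "z \<in> cball 0 s" using z F(1) w sd by auto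
    let ?i = "indicator (disc - cball 0 T) :: complex \<Rightarrow> complex"
    note ind = bounded_symbol_indicator[OF disc_diff_cball_sets[of T]]
    note kd = L2_space_diff[OF D.L2[OF kern_in[OF zw(2)]] D.L2[OF kern_in[OF zw(1)]]]
    have "dnorm (\<lambda>x. ?i x * (kern w x - kern z x) + ?i x * kern z x)
        \<le> dnorm (\<lambda>x. ?i x * (kern w x - kern z x)) + dnorm (\<lambda>x. ?i x * kern z x)"
      by (intro L2_norm_triangle L2_space_mult[OF ind] kd D.L2 kern_in zw)
    also have "dnorm (\<lambda>x. ?i x * (kern w x - kern z x)) \<le> dnorm (\<lambda>x. kern w x - kern z x)"
      by (rule L2_norm_indicator_le[OF kd disc_diff_cball_sets])
    also have "\<dots> \<le> L * cmod (w - z)" using L(2) w zw(3) by blast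
    also have "\<dots> \<le> L * d" using z(2) L(1) by (intro mult_left_mono) (auto simp: dist_norm norm_minus_commute)
    also have "\<dots> = e / 2" using L(1) by (simp add: d_def)
    also have "dnorm (\<lambda>x. ?i x * kern z x) \<le> e / 2" using t(2)[OF z(1) T(2)[OF z(1)]] by simp
    finally show ?thesis by (simp add: algebra_simps)
  qed
  with T(1) show ?thesis by blast
qed

text \<open>Split \<open>\<phi> g\<close> at radius \<open>t\<close>. The inner part is bounded by
  \<open>B\<close> times \<open>cut t g\<close>. The projection of the outer part, evaluated at
  \<open>w\<close> in \<open>cball 0 s\<close>, is a pairing with the tail of \<open>kern w\<close>,
  which is uniformly small.\<close>

lemma toeplitz_local:
  assumes phi: "bounded_symbol area_disc B \<phi>" and s: "s < 1"
  shows "vanishing (\<lambda>g. cut s (toeplitz_disc \<phi> g))"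
  unfolding vanishing_def
proof (intro allI impI)
  fix e :: real assume e: "e > 0"
  define V where "V = dnorm (\<lambda>x. 1)"
  have B: "B \<ge> 0" using phi by (simp add: bounded_symbol_def)
  have V: "V \<ge> 0" by (simp add: V_def)
  \<comment> \<open>A pointwise bound on the disc becomes a norm bound at the cost of
    \<open>V\<close>, the norm of the constant 1; the symbol costs \<open>B\<close>.\<close>
  define d where "d = e / (B * V + 1)"
  have BV: "B * V + 1 > 0" using B V by (intro add_nonneg_pos mult_nonneg_nonneg) auto
  then have d: "d > 0" "B * d * V \<le> e" using e by (simp_all add: d_def field_simps)
  obtain t where t: "t < 1" "\<And>w. w \<in> cball 0 s \<Longrightarrow> dnorm (\<lambda>x. indicator (disc - cball 0 t) x * kern w x) \<le> d"
    using kern_tail_small[OF s d(1)] by blast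
  have "dnorm (cut s (toeplitz_disc \<phi> g)) \<le> e * dnorm g + B * dnorm (cut t g)"
    if g: "g \<in> bergman_disc" for g
  proof -
    let ?i = "indicator (disc - cball 0 t) :: complex \<Rightarrow> complex"
    note ind = bounded_symbol_indicator[OF disc_diff_cball_sets[of t]]
    define h where "h = (\<lambda>z. \<phi> z * g z)"
    have h: "h \<in> L2_space area_disc" unfolding h_def by (rule L2_space_mult[OF phi D.L2[OF g]])
    define p where "p = D.proj (cut t h)"
    define q where "q = D.proj (\<lambda>z. ?i z * h z)"
    note ch = cut_L2[OF t(1) h] and ih = L2_space_mult[OF ind h]
    have p: "p \<in> bergman_disc" and q: "q \<in> bergman_disc"
      unfolding p_def q_def by (rule D.proj_in[OF ch], rule D.proj_in[OF ih])
    have "toeplitz_disc \<phi> g = (\<lambda>z. p z + q z)"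
    proof (rule D.toeplitz_eqI[OF phi g D.add[OF p q]])
      fix k assume k: "k \<in> bergman_disc"
      have "L2_inner area_disc h k = L2_inner area_disc (\<lambda>z. cut t h z + ?i z * h z) k"
        using t(1) by (intro L2_inner_cong) (auto simp: indicator_def)
      also have "\<dots> = L2_inner area_disc (cut t h) k + L2_inner area_disc (\<lambda>z. ?i z * h z) k"
        by (rule L2_inner_add_left[OF ch ih D.L2[OF k]])
      also have "\<dots> = L2_inner area_disc (\<lambda>z. p z + q z) k"
        unfolding L2_inner_add_left[OF D.L2[OF p] D.L2[OF q] D.L2[OF k]]
        by (simp add: p_def q_def D.proj_inner[OF ch k] D.proj_inner[OF ih k])
      finally show "L2_inner area_disc (\<lambda>z. \<phi> z * g z) k = L2_inner area_disc (\<lambda>z. p z + q z) k" by (simp add: h_def)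
    qed
    then have "dnorm (cut s (toeplitz_disc \<phi> g)) = dnorm (\<lambda>z. cut s p z + cut s q z)"
      by (simp add: distrib_left)
    also have "\<dots> \<le> dnorm (cut s p) + dnorm (cut s q)"
      by (intro L2_norm_triangle cut_L2[OF s] D.L2 p q)
    also have "dnorm (cut s p) \<le> B * dnorm (cut t g)"
    proof -
      have "dnorm (cut s p) \<le> dnorm (cut t h)"
        using cut_norm[OF s D.L2[OF p]] D.proj_norm[OF ch] unfolding p_def by linarith
      also have "cut t h = (\<lambda>z. \<phi> z * cut t g z)" by (auto simp: h_def)
      also have "dnorm \<dots> \<le> B * dnorm (cut t g)"
        by (rule L2_norm_mult[OF phi cut_L2[OF t(1) D.L2[OF g]]])
      finally show ?thesis .
    qed
    also have "dnorm (cut s q) \<le> e * dnorm g"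
    proof -
      have bound: "cmod (q w) \<le> B * dnorm g * d" if w: "w \<in> cball 0 s" for w
      proof -
        have wd: "w \<in> disc" using w s by (auto simp: disc_def)
        have "q w = L2_inner area_disc (\<lambda>z. ?i z * h z) (kern w)" unfolding q_def by (rule proj_eval[OF wd ih])
        also have "\<dots> = L2_inner area_disc h (\<lambda>z. ?i z * kern w z)"
          unfolding L2_inner_mult_cnj by simp
        also have "cmod \<dots> \<le> dnorm h * dnorm (\<lambda>z. ?i z * kern w z)"
          by (intro L2_Cauchy_Schwarz h L2_space_mult[OF ind] D.L2 kern_in wd)
        also have "\<dots> \<le> (B * dnorm g) * d"
          using L2_norm_mult[OF phi D.L2[OF g]] t(2)[OF w] B unfolding h_def by (intro mult_mono) auto
        finally show ?thesis .
      qed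
      have Bd: "0 \<le> B * dnorm g * d" using B d by simp
      have "dnorm (cut s q) \<le> (B * dnorm g * d) * dnorm (\<lambda>x. 1)"
        using bound Bd by (intro L2_norm_dominated L2_space_measurable[OF cut_L2[OF s D.L2[OF q]]] L2_one) (auto simp: indicator_def)
      also have "\<dots> = (B * d * V) * dnorm g" by (simp add: V_def)
      also have "\<dots> \<le> e * dnorm g" using d by (intro mult_right_mono) auto
      finally show ?thesis .
    qed
    finally show ?thesis by simp
  qed
  then show "\<exists>s'<1. \<exists>C\<ge>0. \<forall>g\<in>bergman_disc. dnorm (cut s (toeplitz_disc \<phi> g))
      \<le> e * dnorm g + C * dnorm (cut s' g)"
    using t(1) B by blast
qed

section \<open>Hankel operators with continuous symbols\<close>

definition hankel :: "(complex \<Rightarrow> complex) \<Rightarrow> (complex \<Rightarrow> complex) \<Rightarrow> complex \<Rightarrow> complex" where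
  "hankel \<phi> g = (\<lambda>z. \<phi> z * g z - toeplitz_disc \<phi> g z)"

lemma hankel_L2: "bounded_symbol area_disc B \<phi> \<Longrightarrow> g \<in> bergman_disc \<Longrightarrow> hankel \<phi> g \<in> L2_space area_disc"
  unfolding hankel_def by (intro L2_space_diff L2_space_mult D.L2 D.toeplitz_in)

text \<open>The norm of \<open>hankel \<phi> g\<close> is the distance of \<open>\<phi> g\<close> to
  the Bergman space, so every competitor \<open>h\<close> gives an upper bound. The estimates for
  products, limits and \<open>cnj\<close> each consist in choosing a good competitor.\<close>

lemma hankel_minimal:
  assumes "bounded_symbol area_disc B \<phi>" "g \<in> bergman_disc" "h \<in> bergman_disc"
  shows "dnorm (hankel \<phi> g) \<le> dnorm (\<lambda>z. \<phi> z * g z - h z)"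
  unfolding hankel_def D.toeplitz_apply[OF assms(2)]
  by (rule D.proj_minimal[OF L2_space_mult[OF assms(1) D.L2[OF assms(2)]] assms(3)])

text \<open>The bound on the symbol is carried along so that the class is closed under sums and
  products.\<close>

definition hankel_compact :: "(complex \<Rightarrow> complex) \<Rightarrow> bool" where
  "hankel_compact \<phi> \<longleftrightarrow> (\<exists>B. bounded_symbol area_disc B \<phi>) \<and> vanishing (hankel \<phi>)"

lemma hankel_compact_add:
  assumes "hankel_compact \<phi>" "hankel_compact \<psi>"
  shows "hankel_compact (\<lambda>z. \<phi> z + \<psi> z)"
proof -
  obtain B C where B: "bounded_symbol area_disc B \<phi>" and C: "bounded_symbol area_disc C \<psi>"
    using assms by (auto simp: hankel_compact_def)
  have "vanishing (hankel (\<lambda>z. \<phi> z + \<psi> z))"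
    unfolding vanishing_def
  proof (intro allI impI)
    fix e :: real assume "e > 0"
    then have e2: "e / 2 > 0" by simp
    obtain s a where a: "s < 1" "0 \<le> a" "\<And>g. g \<in> bergman_disc \<Longrightarrow>
      dnorm (hankel \<phi> g) \<le> e / 2 * dnorm g + a * dnorm (cut s g)"
      using assms(1) vanishingE[OF _ e2] unfolding hankel_compact_def by metis
    obtain t b where b: "t < 1" "0 \<le> b" "\<And>g. g \<in> bergman_disc \<Longrightarrow>
      dnorm (hankel \<psi> g) \<le> e / 2 * dnorm g + b * dnorm (cut t g)"
      using assms(2) vanishingE[OF _ e2] unfolding hankel_compact_def by metis
    have "dnorm (hankel (\<lambda>z. \<phi> z + \<psi> z) g) \<le> e * dnorm g + (a + b) * dnorm (cut (max s t) g)"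
      if g: "g \<in> bergman_disc" for g
    proof -
      have "hankel (\<lambda>z. \<phi> z + \<psi> z) g = (\<lambda>z. hankel \<phi> g z + hankel \<psi> g z)"
        by (auto simp: hankel_def D.toeplitz_add[OF B C g] algebra_simps)
      then have "dnorm (hankel (\<lambda>z. \<phi> z + \<psi> z) g) \<le> dnorm (hankel \<phi> g) + dnorm (hankel \<psi> g)"
        using L2_norm_triangle[OF hankel_L2[OF B g] hankel_L2[OF C g]] by simp
      moreover have "a * dnorm (cut s g) \<le> a * dnorm (cut (max s t) g)"
        "b * dnorm (cut t g) \<le> b * dnorm (cut (max s t) g)"
        using a b by (auto intro!: mult_left_mono cut_mono D.L2[OF g])
      ultimately show ?thesis using a(3)[OF g] b(3)[OF g] by (simp add: algebra_simps)
    qed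
    then show "\<exists>s<1. \<exists>C\<ge>0. \<forall>g\<in>bergman_disc. dnorm (hankel (\<lambda>z. \<phi> z + \<psi> z) g)
        \<le> e * dnorm g + C * dnorm (cut s g)"
      using a(1,2) b(1,2) by (intro exI[of _ "max s t"] conjI exI[of _ "a + b"]) auto
  qed
  with bounded_symbol_add[OF B C] show ?thesis by (auto simp: hankel_compact_def)
qed

text \<open>The competitor is \<open>T\<^sub>\<phi> u\<close> with
  \<open>u = T\<^sub>\<psi> g\<close>, since \<open>\<phi> \<psi> g - T\<^sub>\<phi> u = \<phi>
  H\<^sub>\<psi> g + H\<^sub>\<phi> u\<close> with \<open>H\<close> the Hankel operators. The second
  term leaves a cut of \<open>u\<close>, which \<open>toeplitz_local\<close> exchanges for a cut of
  \<open>g\<close>.\<close>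

lemma hankel_compact_mult:
  assumes "hankel_compact \<phi>" "hankel_compact \<psi>"
  shows "hankel_compact (\<lambda>z. \<phi> z * \<psi> z)"
proof -
  obtain B C where B: "bounded_symbol area_disc B \<phi>" and C: "bounded_symbol area_disc C \<psi>"
    using assms by (auto simp: hankel_compact_def)
  have B0: "0 \<le> B" and C0: "0 \<le> C" using B C by (auto simp: bounded_symbol_def)
  note BC = bounded_symbol_mult[OF B C]
  have "vanishing (hankel (\<lambda>z. \<phi> z * \<psi> z))"
    unfolding vanishing_def
  proof (intro allI impI)
    fix e :: real assume e: "e > 0"
    define e1 where "e1 = e / (3 * (B + 1))"
    define e2 where "e2 = e / (3 * (C + 1))"
    have e12: "e1 > 0" "e2 > 0" "B * e1 \<le> e / 3" "e2 * C \<le> e / 3"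
      using e B0 C0 by (auto simp: e1_def e2_def field_simps)
    obtain s a where a: "s < 1" "0 \<le> a" "\<And>g. g \<in> bergman_disc \<Longrightarrow>
      dnorm (hankel \<psi> g) \<le> e1 * dnorm g + a * dnorm (cut s g)"
      using assms(2) vanishingE[OF _ e12(1)] unfolding hankel_compact_def by metis
    obtain t b where b: "t < 1" "0 \<le> b" "\<And>g. g \<in> bergman_disc \<Longrightarrow>
      dnorm (hankel \<phi> g) \<le> e2 * dnorm g + b * dnorm (cut t g)"
      using assms(1) vanishingE[OF _ e12(2)] unfolding hankel_compact_def by metis
    \<comment> \<open>Chosen last: the cut of \<open>u\<close> comes with the constant
      \<open>b\<close>, which is known only after \<open>e2\<close> has been fixed. The three errors
      are at most \<open>e / 3\<close> each.\<close>
    define e3 where "e3 = e / (3 * (b + 1))"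
    have e3: "e3 > 0" "b * e3 \<le> e / 3" using e b by (auto simp: e3_def field_simps)
    obtain r c where c: "r < 1" "0 \<le> c" "\<And>g. g \<in> bergman_disc \<Longrightarrow>
      dnorm (cut t (toeplitz_disc \<psi> g)) \<le> e3 * dnorm g + c * dnorm (cut r g)"
      using vanishingE[OF toeplitz_local[OF C b(1)] e3(1)] by metis
    have "dnorm (hankel (\<lambda>z. \<phi> z * \<psi> z) g) \<le> e * dnorm g + (B * a + b * c) * dnorm (cut (max s r) g)"
      if g: "g \<in> bergman_disc" for g
    proof -
      define u where "u = toeplitz_disc \<psi> g"
      have u: "u \<in> bergman_disc" unfolding u_def by (rule D.toeplitz_in[OF C g])
      have "dnorm (hankel (\<lambda>z. \<phi> z * \<psi> z) g) \<le> dnorm (\<lambda>z. \<phi> z * \<psi> z * g z - toeplitz_disc \<phi> u z)"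
        by (rule hankel_minimal[OF BC g D.toeplitz_in[OF B u]])
      also have "(\<lambda>z. \<phi> z * \<psi> z * g z - toeplitz_disc \<phi> u z) = (\<lambda>z. \<phi> z * hankel \<psi> g z + hankel \<phi> u z)"
        by (auto simp: hankel_def u_def algebra_simps)
      also have "dnorm \<dots> \<le> dnorm (\<lambda>z. \<phi> z * hankel \<psi> g z) + dnorm (hankel \<phi> u)"
        by (intro L2_norm_triangle L2_space_mult[OF B] hankel_L2[OF B u] hankel_L2[OF C g])
      also have "dnorm (\<lambda>z. \<phi> z * hankel \<psi> g z) \<le> B * (e1 * dnorm g + a * dnorm (cut s g))"
        using L2_norm_mult[OF B hankel_L2[OF C g]] mult_left_mono[OF a(3)[OF g] B0] by linarith
      also have "\<dots> \<le> e / 3 * dnorm g + B * a * dnorm (cut (max s r) g)"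
      proof -
        have "B * e1 * dnorm g \<le> e / 3 * dnorm g" by (intro mult_right_mono e12) simp
        moreover have "B * a * dnorm (cut s g) \<le> B * a * dnorm (cut (max s r) g)"
          using B0 a c by (intro mult_left_mono cut_mono D.L2[OF g]) auto
        ultimately show ?thesis by (simp add: algebra_simps)
      qed
      also have "dnorm (hankel \<phi> u) \<le> e2 * (C * dnorm g) + b * (e3 * dnorm g + c * dnorm (cut r g))"
      proof -
        have "e2 * dnorm u \<le> e2 * (C * dnorm g)"
          unfolding u_def using e12 by (intro mult_left_mono D.toeplitz_norm[OF C g]) auto
        moreover have "b * dnorm (cut t u) \<le> b * (e3 * dnorm g + c * dnorm (cut r g))"
          unfolding u_def by (intro mult_left_mono c(3) g b)
        ultimately show ?thesis using b(3)[OF u] by linarith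
      qed
      also have "\<dots> \<le> e / 3 * dnorm g + e / 3 * dnorm g + b * c * dnorm (cut (max s r) g)"
      proof -
        have "e2 * C * dnorm g \<le> e / 3 * dnorm g" by (intro mult_right_mono e12) simp
        moreover have "b * e3 * dnorm g \<le> e / 3 * dnorm g" by (intro mult_right_mono e3) simp
        moreover have "b * c * dnorm (cut r g) \<le> b * c * dnorm (cut (max s r) g)"
          using a b c by (intro mult_left_mono cut_mono D.L2[OF g]) auto
        ultimately show ?thesis by (simp add: algebra_simps)
      qed
      finally show ?thesis by (simp add: algebra_simps)
    qed
    then show "\<exists>s<1. \<exists>C\<ge>0. \<forall>g\<in>bergman_disc. dnorm (hankel (\<lambda>z. \<phi> z * \<psi> z) g)
        \<le> e * dnorm g + C * dnorm (cut s g)"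
      using a(1,2) b(1,2) c(1,2) B0 by (intro exI[of _ "max s r"] conjI exI[of _ "B * a + b * c"]) auto
  qed
  with BC show ?thesis by (auto simp: hankel_compact_def)
qed

text \<open>With \<open>T\<^sub>\<psi> g\<close> as competitor, the difference of the symbols enters
  only through its supremum.\<close>

lemma hankel_compact_limit:
  assumes phi: "bounded_symbol area_disc B \<phi>"
    and approx: "\<And>d. d > 0 \<Longrightarrow> \<exists>\<psi>. hankel_compact \<psi> \<and> (\<forall>z\<in>disc. cmod (\<phi> z - \<psi> z) \<le> d)"
  shows "hankel_compact \<phi>"
proof -
  have "vanishing (hankel \<phi>)"
    unfolding vanishing_def
  proof (intro allI impI)
    fix e :: real assume "e > 0"
    then have e2: "e / 2 > 0" by simp
    obtain \<psi> where psi: "hankel_compact \<psi>" "\<forall>z\<in>disc. cmod (\<phi> z - \<psi> z) \<le> e / 2" using approx[OF e2] by blast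
    obtain C where C: "bounded_symbol area_disc C \<psi>" using psi(1) by (auto simp: hankel_compact_def)
    obtain s a where a: "s < 1" "0 \<le> a" "\<And>g. g \<in> bergman_disc \<Longrightarrow>
      dnorm (hankel \<psi> g) \<le> e / 2 * dnorm g + a * dnorm (cut s g)"
      using psi(1) vanishingE[OF _ e2] unfolding hankel_compact_def by metis
    have pd: "bounded_symbol area_disc (e / 2) (\<lambda>z. \<phi> z - \<psi> z)"
      using bounded_symbol_diff[OF phi C] psi(2) e2 by (simp add: bounded_symbol_def)
    have "dnorm (hankel \<phi> g) \<le> e * dnorm g + a * dnorm (cut s g)"
      if g: "g \<in> bergman_disc" for g
    proof -
      have "dnorm (hankel \<phi> g) \<le> dnorm (\<lambda>z. \<phi> z * g z - toeplitz_disc \<psi> g z)"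
        by (rule hankel_minimal[OF phi g D.toeplitz_in[OF C g]])
      also have "(\<lambda>z. \<phi> z * g z - toeplitz_disc \<psi> g z) = (\<lambda>z. (\<phi> z - \<psi> z) * g z + hankel \<psi> g z)"
        by (auto simp: hankel_def algebra_simps)
      also have "dnorm \<dots> \<le> dnorm (\<lambda>z. (\<phi> z - \<psi> z) * g z) + dnorm (hankel \<psi> g)"
        by (intro L2_norm_triangle L2_space_mult[OF pd] hankel_L2[OF C g] D.L2 g)
      also have "\<dots> \<le> e / 2 * dnorm g + (e / 2 * dnorm g + a * dnorm (cut s g))"
        by (intro add_mono L2_norm_mult[OF pd D.L2[OF g]] a(3)[OF g])
      finally show ?thesis by simp
    qed
    then show "\<exists>s<1. \<exists>C\<ge>0. \<forall>g\<in>bergman_disc. dnorm (hankel \<phi> g)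
        \<le> e * dnorm g + C * dnorm (cut s g)"
      using a(1,2) by blast
  qed
  with phi show ?thesis by (auto simp: hankel_compact_def)
qed

lemma hankel_compact_holomorphic:
  assumes phi: "bounded_symbol area_disc B \<phi>" and hol: "\<phi> holomorphic_on disc"
  shows "hankel_compact \<phi>"
proof -
  have "hankel \<phi> g = (\<lambda>z. 0)" if g: "g \<in> bergman_disc" for g
  proof -
    have "(\<lambda>z. \<phi> z * g z) \<in> bergman_disc"
      using L2_space_mult[OF phi D.L2[OF g]] bergman_discD[OF g] hol
      by (auto simp: bergman_disc_def intro!: holomorphic_intros)
    then show ?thesis by (simp add: hankel_def D.toeplitz_apply[OF g] D.proj_id)
  qed
  then have "vanishing (hankel \<phi>)"
    unfolding vanishing_def by (auto intro!: exI[of _ 0])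
  with phi show ?thesis by (auto simp: hankel_compact_def)
qed

text \<open>
  Near the boundary \<open>cnj z\<close> is close to \<open>1 / z\<close>, so \<open>cnj z * g z\<close> is close to the holomorphic function
  \<open>(g z - g 0) / z\<close>.
\<close>

lemma hankel_compact_cnj: "hankel_compact cnj"
proof -
  have sym: "bounded_symbol area_disc 1 cnj"
    by (auto simp: bounded_symbol_def disc_def intro!: measurable_area_discI continuous_intros)
  define V where "V = dnorm (\<lambda>x. 1)"
  obtain C where C: "C > 0" "\<And>g w. g holomorphic_on disc \<Longrightarrow> w \<in> cball 0 (3/4) \<Longrightarrow>
      cmod (g w) \<le> C * dnorm (\<lambda>u. indicator (cball 0 ((1 + 3/4) / 2)) u * g u)"
    using eval_bound_compact[of "3/4"] by auto
  have "vanishing (hankel cnj)"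
    unfolding vanishing_def
  proof (intro allI impI)
    fix e :: real assume e: "e > 0"
    \<comment> \<open>\<open>7/8 = (1 + 3/4) / 2\<close> is the radius in the bound for
      \<open>g\<close> on \<open>cball 0 (3/4)\<close>; the other bound makes
      \<open>2 * (1 - s\<^sup>2)\<close> at most \<open>e\<close>.\<close>
    define s where "s = max (7/8) (1 - e / 4)"
    have s: "s < 1" "7/8 \<le> s" "1 - e / 4 \<le> s" using e by (auto simp: s_def)
    have s2: "2 * (1 - s\<^sup>2) \<le> e"
    proof -
      have "1 - s\<^sup>2 = (1 - s) * (1 + s)" by (simp add: power2_eq_square algebra_simps)
      also have "\<dots> \<le> (e / 4) * 2" using s e by (intro mult_mono) auto
      finally show ?thesis by simp
    qed
    have "dnorm (hankel cnj g) \<le> e * dnorm g + (4 * C * V + 2) * dnorm (cut s g)"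
      if g: "g \<in> bergman_disc" for g
    proof -
      note gD = bergman_discD[OF g]
      define b where "b = C * dnorm (cut s g)"
      have b: "cmod (g w) \<le> b" if "w \<in> cball 0 (3/4)" for w
      proof -
        have "cmod (g w) \<le> C * dnorm (cut ((1 + 3/4) / 2) g)" by (rule C(2)[OF gD(2) that])
        also have "\<dots> \<le> b" unfolding b_def using s C(1) by (intro mult_left_mono cut_mono gD(1)) auto
        finally show ?thesis .
      qed
      have b0: "0 \<le> b" unfolding b_def using C(1) by simp
      \<comment> \<open>The competitor is the difference quotient at 0, completed by the derivative
        there so that the singularity is removed.\<close>
      define h0 where "h0 = (\<lambda>z. if z = 0 then deriv g 0 else (g z - g 0) / (z - 0))"
      define h where "h = (\<lambda>z. if z \<in> disc then h0 z else 0)"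
      have h0: "h0 holomorphic_on disc" unfolding h0_def by (rule pole_lemma_open[OF gD(2) open_disc])
      then have h: "h holomorphic_on disc" by (rule holomorphic_transform) (simp add: h_def)
      have far: "cmod (h0 z) \<le> 4/3 * (cmod (g z) + b)" if "3/4 \<le> cmod z" for z
      proof -
        have z: "z \<noteq> 0" using that by auto
        have "cmod (h0 z) = cmod (g z - g 0) / cmod z" using z by (simp add: h0_def norm_divide)
        also have "\<dots> \<le> (cmod (g z) + b) / (3/4)"
          using that b[of 0] norm_triangle_ineq4[of "g z" "g 0"] z b0 by (intro frac_le) auto
        finally show ?thesis by simp
      qed
      \<comment> \<open>Close to 0 the quotient is not controlled by its formula. The maximum
        principle carries the bound over from the circle of radius \<open>3/4\<close>, where
        \<open>far\<close> gives \<open>4/3 * (b + b)\<close>.\<close>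
      have near: "cmod (h0 z) \<le> 8/3 * b" if "z \<in> cball 0 (3/4)" for z
      proof (rule maximum_modulus_frontier[OF _ _ _ _ that])
        have sub: "cball 0 (3/4) \<subseteq> disc" by (auto simp: disc_def)
        show "h0 holomorphic_on interior (cball 0 (3/4))" using h0 sub interior_subset holomorphic_on_subset by (metis order_trans)
        show "continuous_on (closure (cball 0 (3/4))) h0"
          using holomorphic_on_imp_continuous_on[OF h0] sub continuous_on_subset by (metis closure_closed closed_cball)
        show "cmod (h0 z) \<le> 8/3 * b" if "z \<in> frontier (cball 0 (3/4))" for z
          using that far[of z] b[of z] by (auto simp: frontier_cball)
      qed simp
      \<comment> \<open>A majorant of \<open>cnj z * g z - h z\<close> in three parts:
        \<open>4 b\<close> covers the constant term and the small disc; the cut term covers radii up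
        to \<open>s\<close>, where the weight \<open>1 - (cmod z)\<^sup>2\<close> is at most 1; the
        last term covers radii beyond \<open>s\<close>, where the weight is at most
        \<open>1 - s\<^sup>2\<close>.\<close>
      define X where "X = (\<lambda>z. of_real (4 * b) + (of_real (2 * cmod (cut s g z)) + of_real (2 * (1 - s\<^sup>2) * cmod (g z))) :: complex)"
      have abs_L2: "(\<lambda>z. of_real (c * cmod (k z))) \<in> L2_space area_disc" if "k \<in> L2_space area_disc" for k and c :: real
      proof -
        have [measurable]: "k \<in> borel_measurable area_disc" by (rule L2_space_measurable[OF that])
        show ?thesis by (rule L2_space_dominated[OF _ that, where c="\<bar>c\<bar>"]) (auto simp: norm_mult abs_mult)
      qed
      have abs_norm: "dnorm (\<lambda>z. of_real (c * cmod (k z))) = \<bar>c\<bar> * dnorm k" for k and c :: real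
      proof -
        have "dnorm (\<lambda>z. of_real (c * cmod (k z))) = dnorm (\<lambda>z. of_real c * k z)"
          by (rule L2_norm_cong) (simp add: norm_mult abs_mult)
        then show ?thesis by (simp add: L2_norm_scale)
      qed
      note cg = cut_L2[OF s(1) gD(1)]
      have X: "X \<in> L2_space area_disc" unfolding X_def by (intro L2_space_add L2_one abs_L2 cg gD(1))
      have s2': "0 \<le> 1 - s\<^sup>2" using s by (simp add: power_le_one)
      have Xnorm: "dnorm X \<le> 4 * b * V + (2 * dnorm (cut s g) + 2 * (1 - s\<^sup>2) * dnorm g)"
      proof -
        have "dnorm X \<le> dnorm (\<lambda>z. of_real (4 * b)) +
            dnorm (\<lambda>z. of_real (2 * cmod (cut s g z)) + of_real (2 * (1 - s\<^sup>2) * cmod (g z)))"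
          unfolding X_def by (intro L2_norm_triangle L2_space_add L2_one abs_L2 cg gD(1))
        also have "dnorm (\<lambda>z. of_real (2 * cmod (cut s g z)) + of_real (2 * (1 - s\<^sup>2) * cmod (g z)))
           \<le> dnorm (\<lambda>z. of_real (2 * cmod (cut s g z))) + dnorm (\<lambda>z. of_real (2 * (1 - s\<^sup>2) * cmod (g z)))"
          by (intro L2_norm_triangle L2_space_add L2_one abs_L2 cg gD(1))
        also have "dnorm (\<lambda>z. of_real (4 * b)) = 4 * b * V"
          using L2_norm_scale[of area_disc "of_real (4 * b)" "\<lambda>x. 1"] b0 by (simp add: V_def)
        finally show ?thesis using s2' unfolding abs_norm by simp
      qed
      have le: "cmod (cnj z * g z - h z) \<le> cmod (X z)" if z: "z \<in> disc" for z
      proof -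
        have z1: "cmod z < 1" using z by (simp add: disc_def)
        have "0 \<le> 4 * b + (2 * cmod (cut s g z) + 2 * (1 - s\<^sup>2) * cmod (g z))" using b0 s2' by simp
        then have Xz: "cmod (X z) = 4 * b + (2 * cmod (cut s g z) + 2 * (1 - s\<^sup>2) * cmod (g z))"
          unfolding X_def of_real_add[symmetric] norm_of_real by simp
        show ?thesis
        proof (cases "cmod z \<le> 3/4")
          case True
          have "cmod (cnj z * g z - h z) \<le> cmod z * cmod (g z) + cmod (h0 z)"
            using norm_triangle_ineq4[of "cnj z * g z" "h z"] z by (simp add: norm_mult h_def)
          also have "\<dots> \<le> 1 * b + 8/3 * b"
            using True b[of z] near[of z] z1 b0 by (intro add_mono mult_mono) auto
          also have "\<dots> \<le> 4 * b" using b0 by simp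
          also have "\<dots> \<le> cmod (X z)" unfolding Xz using s2' by simp
          finally show ?thesis .
        next
          case False
          then have z0: "z \<noteq> 0" by auto
          \<comment> \<open>Over the common denominator \<open>z\<close> the numerator is
            \<open>(cnj z * z - 1) * g z + g 0\<close>, and the coefficient of \<open>g z\<close>
            vanishes on the unit circle.\<close>
          have "cnj z * g z - h z = (of_real ((cmod z)\<^sup>2 - 1) * g z + g 0) / z"
            using z z0 by (simp add: h_def h0_def field_simps complex_norm_square mult.commute del: of_real_power)
          then have "cmod (cnj z * g z - h z) = cmod (of_real ((cmod z)\<^sup>2 - 1) * g z + g 0) / cmod z" by (simp add: norm_divide)
          also have "\<dots> \<le> ((1 - (cmod z)\<^sup>2) * cmod (g z) + b) / (3/4)"
          proof (rule frac_le)
            have "cmod (of_real ((cmod z)\<^sup>2 - 1) * g z + g 0) \<le> cmod (of_real ((cmod z)\<^sup>2 - 1) * g z) + cmod (g 0)"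
              by (rule norm_triangle_ineq)
            also have "cmod (of_real ((cmod z)\<^sup>2 - 1) * g z) = (1 - (cmod z)\<^sup>2) * cmod (g z)"
              using z1 power_le_one[of "cmod z" 2] unfolding norm_mult norm_of_real by simp
            finally show "cmod (of_real ((cmod z)\<^sup>2 - 1) * g z + g 0) \<le> (1 - (cmod z)\<^sup>2) * cmod (g z) + b" using b[of 0] by simp
            show "0 \<le> (1 - (cmod z)\<^sup>2) * cmod (g z) + b" using z1 b0 power_le_one[of "cmod z" 2] by simp
          qed (use False in auto)
          also have "\<dots> \<le> 2 * ((1 - (cmod z)\<^sup>2) * cmod (g z)) + 4 * b"
          proof -
            have "(y + b) / (3/4) \<le> 2 * y + 4 * b" if "0 \<le> y" for y using b0 that by simp
            then show ?thesis using z1 power_le_one[of "cmod z" 2] by simp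
          qed
          also have "(1 - (cmod z)\<^sup>2) * cmod (g z) \<le> cmod (cut s g z) + (1 - s\<^sup>2) * cmod (g z)"
          proof (cases "cmod z \<le> s")
            case True
            have "(1 - (cmod z)\<^sup>2) * cmod (g z) \<le> 1 * cmod (g z)" by (intro mult_right_mono) auto
            then show ?thesis using True s2' by (simp add: add_increasing2)
          next
            case False
            have "s\<^sup>2 \<le> (cmod z)\<^sup>2" using False s by (intro power_mono) auto
            then have "(1 - (cmod z)\<^sup>2) * cmod (g z) \<le> (1 - s\<^sup>2) * cmod (g z)" by (intro mult_right_mono) auto
            then show ?thesis by (simp add: add_increasing)
          qed
          finally show ?thesis unfolding Xz by (simp add: algebra_simps)
        qed
      qed
      have hm: "h \<in> borel_measurable area_disc" by (intro measurable_area_discI holomorphic_on_imp_continuous_on h)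
      then have dm: "(\<lambda>z. cnj z * g z - h z) \<in> borel_measurable area_disc"
        using L2_space_measurable[OF L2_space_mult[OF sym gD(1)]] by simp
      have dL2: "(\<lambda>z. cnj z * g z - h z) \<in> L2_space area_disc"
        by (rule L2_space_dominated[OF dm X, where c=1]) (use le in simp)
      have "(\<lambda>z. cnj z * g z - (cnj z * g z - h z)) \<in> L2_space area_disc"
        by (rule L2_space_diff[OF L2_space_mult[OF sym gD(1)] dL2])
      then have hB: "h \<in> bergman_disc" using h by (simp add: bergman_disc_def) (simp add: h_def)
      have "dnorm (hankel cnj g) \<le> dnorm (\<lambda>z. cnj z * g z - h z)"
        by (rule hankel_minimal[OF sym g hB])
      also have "\<dots> \<le> 1 * dnorm X" by (rule L2_norm_dominated[OF dm X]) (use le in auto)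
      also have "\<dots> \<le> (4 * C * V + 2) * dnorm (cut s g) + 2 * (1 - s\<^sup>2) * dnorm g"
        using Xnorm by (simp add: b_def algebra_simps)
      also have "2 * (1 - s\<^sup>2) * dnorm g \<le> e * dnorm g" by (intro mult_right_mono s2) simp
      finally show ?thesis by simp
    qed
    moreover have "0 \<le> 4 * C * V + 2" using C(1) by (simp add: V_def)
    ultimately show "\<exists>s<1. \<exists>C\<ge>0. \<forall>g\<in>bergman_disc. dnorm (hankel cnj g)
        \<le> e * dnorm g + C * dnorm (cut s g)"
      using s(1) by blast
  qed
  with sym show ?thesis by (auto simp: hankel_compact_def)
qed

text \<open>The class contains the constants, \<open>z\<close> and \<open>cnj z\<close>, and it is
  closed under sums, products and bounded uniform limits, so Stone-Weierstrass applies.\<close>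

lemma hankel_compact_continuous:
  assumes "continuous_on (closure disc) \<phi>"
  shows "hankel_compact \<phi>"
proof -
  obtain B where B: "bounded_symbol area_disc B \<phi>" using bounded_symbol_discI[OF assms] by blast
  have const': "hankel_compact (\<lambda>z. c)" for c
    by (rule hankel_compact_holomorphic[OF bounded_symbol_const]) auto
  have ident: "hankel_compact (\<lambda>z. z)"
    by (rule hankel_compact_holomorphic[where B=1])
      (auto simp: bounded_symbol_def disc_def intro!: measurable_area_discI continuous_intros)
  have poly: "hankel_compact (\<lambda>z. of_real (q z))" if "real_polynomial_function q" for q :: "complex \<Rightarrow> real"
    using that
  proof induction
    case (linear q)
    interpret bounded_linear q by fact
    define a where "a = complex_of_real (q 1)"
    define b where "b = complex_of_real (q \<i>)"
    have qz: "q z = Re z * q 1 + Im z * q \<i>" for z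
    proof -
      have "z = Re z *\<^sub>R 1 + Im z *\<^sub>R \<i>" by (simp add: complex_eq_iff)
      then have "q z = q (Re z *\<^sub>R 1 + Im z *\<^sub>R \<i>)" by simp
      then show ?thesis by (simp only: add scale real_scaleR_def)
    qed
    \<comment> \<open>A real-linear functional is a combination of \<open>z\<close> and
      \<open>cnj z\<close>, obtained by substituting \<open>(z + cnj z) / 2\<close> and
      \<open>(z - cnj z) / (2 \<i>)\<close> for the real and imaginary parts.\<close>
    have "(\<lambda>z. of_real (q z)) = (\<lambda>z. (a / 2 - \<i> * b / 2) * z + (a / 2 + \<i> * b / 2) * cnj z)"
    proof
      fix z show "of_real (q z) = (a / 2 - \<i> * b / 2) * z + (a / 2 + \<i> * b / 2) * cnj z"
        using qz[of z] by (simp add: a_def b_def complex_eq_iff mult.commute)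
    qed
    then show ?case
      using hankel_compact_add[OF hankel_compact_mult[OF const' ident] hankel_compact_mult[OF const' hankel_compact_cnj]] by simp
  next
    case (const c)
    show ?case by (rule const')
  next
    case (add p q)
    then show ?case using hankel_compact_add[of "\<lambda>z. of_real (p z)" "\<lambda>z. of_real (q z)"] by simp
  next
    case (mult p q)
    then show ?case using hankel_compact_mult[of "\<lambda>z. of_real (p z)" "\<lambda>z. of_real (q z)"] by simp
  qed
  show ?thesis
  proof (rule hankel_compact_limit[OF B])
    fix d :: real assume d: "d > 0"
    have "compact (closure disc)" by (simp add: disc_def)
    from Stone_Weierstrass_polynomial_function[OF this assms d]
    obtain p where p: "polynomial_function p" "\<forall>z\<in>closure disc. cmod (\<phi> z - p z) < d" by blast
    have "real_polynomial_function (\<lambda>z. Re (p z))" "real_polynomial_function (\<lambda>z. Im (p z))"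
      using p(1) bounded_linear_Re bounded_linear_Im unfolding polynomial_function_def o_def by blast+
    then have "hankel_compact (\<lambda>z. of_real (Re (p z)) + \<i> * of_real (Im (p z)))"
      by (intro hankel_compact_add hankel_compact_mult const' poly)
    then have "hankel_compact p" by (simp add: complex_eq[symmetric])
    moreover have "\<forall>z\<in>disc. cmod (\<phi> z - p z) \<le> d"
      using p(2) closure_subset by (meson less_imp_le subsetD)
    ultimately show "\<exists>\<psi>. hankel_compact \<psi> \<and> (\<forall>z\<in>disc. cmod (\<phi> z - \<psi> z) \<le> d)" by blast
  qed
qed

section \<open>The Bergman space of the bidisc\<close>

subsection \<open>Slices\<close>

lemma open_bidisc: "open bidisc"
  by (simp add: bidisc_def open_Times open_disc)

lemma space_area_bidisc [simp]: "space area_bidisc = bidisc"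
  by (simp add: area_bidisc_def space_restrict_space)

text \<open>This opens the way to Fubini's theorem on the bidisc. Both measures agree on rectangles
  by \<open>lborel_prod\<close>, and agreement on rectangles suffices for sigma-finite
  factors.\<close>

lemma area_bidisc_pair: "area_bidisc = area_disc \<Otimes>\<^sub>M area_disc"
proof (rule pair_measure_eqI[symmetric])
  interpret finite_measure area_disc by (rule finite_measure_area_disc)
  show "sigma_finite_measure area_disc" "sigma_finite_measure area_disc" by unfold_locales
  have disc_sets: "A \<subseteq> disc \<and> A \<in> sets borel" if "A \<in> sets area_disc" for A
    using that open_disc unfolding area_disc_def sets_restrict_space by auto
  have bidisc_sets: "A \<times> B \<in> sets area_bidisc" if "A \<in> sets area_disc" "B \<in> sets area_disc" for A B
  proof -
    have "A \<times> B \<in> sets (borel \<Otimes>\<^sub>M borel)" using that disc_sets by (intro pair_measureI) auto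
    then have "A \<times> B \<in> sets borel" by (simp only: borel_prod)
    moreover have "A \<times> B = bidisc \<inter> (A \<times> B)" using that disc_sets by (auto simp: bidisc_def)
    ultimately show ?thesis unfolding area_bidisc_def sets_restrict_space sets_lborel by blast
  qed
  show "sets (area_disc \<Otimes>\<^sub>M area_disc) = sets area_bidisc"
  proof
    show "sets (area_disc \<Otimes>\<^sub>M area_disc) \<subseteq> sets area_bidisc"
      by (rule sets_pair_in_sets) (rule bidisc_sets)
    show "sets area_bidisc \<subseteq> sets (area_disc \<Otimes>\<^sub>M area_disc)"
    proof
      fix X assume "X \<in> sets area_bidisc"
      then obtain Y where Y: "Y \<in> sets borel" "X = bidisc \<inter> Y"
        unfolding area_bidisc_def sets_restrict_space by auto
      have "(\<lambda>x. x) \<in> measurable area_disc borel" by (intro measurable_area_discI continuous_intros)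
      then have "(\<lambda>p. (fst p, snd p)) \<in> measurable (area_disc \<Otimes>\<^sub>M area_disc) (borel \<Otimes>\<^sub>M borel)"
        by (intro measurable_Pair measurable_compose[OF measurable_fst] measurable_compose[OF measurable_snd])
      then have "(\<lambda>p. p) \<in> measurable (area_disc \<Otimes>\<^sub>M area_disc) borel" by (simp add: borel_prod)
      from measurable_sets[OF this Y(1)] show "X \<in> sets (area_disc \<Otimes>\<^sub>M area_disc)"
        by (simp add: Y(2) space_pair_measure bidisc_def Int_commute)
    qed
  qed
  fix A B assume AB: "A \<in> sets area_disc" "B \<in> sets area_disc"
  have e: "emeasure area_disc C = emeasure lborel C" if "C \<in> sets area_disc" for C
    unfolding area_disc_def using disc_sets[OF that] open_disc by (subst emeasure_restrict_space) auto
  have "emeasure area_bidisc (A \<times> B) = emeasure lborel (A \<times> B)"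
    unfolding area_bidisc_def using disc_sets[OF AB(1)] disc_sets[OF AB(2)] open_bidisc
    by (subst emeasure_restrict_space) (auto simp: bidisc_def)
  also have "\<dots> = emeasure (lborel \<Otimes>\<^sub>M lborel) (A \<times> B)" by (simp only: lborel_prod)
  also have "\<dots> = emeasure lborel A * emeasure lborel B"
    using disc_sets[OF AB(1)] disc_sets[OF AB(2)] by (intro lborel.emeasure_pair_measure_Times) auto
  finally show "emeasure area_disc A * emeasure area_disc B = emeasure area_bidisc (A \<times> B)"
    using e AB by simp
qed

interpretation AD: finite_measure area_disc
  by (rule finite_measure_area_disc)

interpretation PD: pair_sigma_finite area_disc area_disc
  by unfold_locales

lemma
  assumes "X \<in> L2_space area_bidisc"
  shows L2_slices_integrable: "integrable area_disc (\<lambda>z. (dnorm (\<lambda>w. X (z, w)))\<^sup>2)"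
    and L2_slices: "(LINT z|area_disc. (dnorm (\<lambda>w. X (z, w)))\<^sup>2) = (bnorm X)\<^sup>2"
  using PD.integrable_fst'[of "\<lambda>p. (cmod (X p))\<^sup>2"] PD.integral_fst'[of "\<lambda>p. (cmod (X p))\<^sup>2"] L2_space_integrable[OF assms]
  by (simp_all add: L2_norm_sq area_bidisc_pair)

lemma L2_inner_slices:
  assumes "X \<in> L2_space area_bidisc" "Y \<in> L2_space area_bidisc"
  shows "L2_inner area_bidisc X Y = (LINT z|area_disc. L2_inner area_disc (\<lambda>w. X (z, w)) (\<lambda>w. Y (z, w)))"
  unfolding L2_inner_def
  using PD.integral_fst'[of "\<lambda>p. X p * cnj (Y p)"] integrable_L2_inner[OF assms] by (simp add: area_bidisc_pair)

section \<open>Exchange of the two variables\<close>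

definition swp :: "(complex \<times> complex \<Rightarrow> complex) \<Rightarrow> complex \<times> complex \<Rightarrow> complex" where
  "swp X = (\<lambda>p. X (snd p, fst p))"

lemma swp_apply [simp]: "swp X (z, w) = X (w, z)"
  by (simp add: swp_def)

lemma swp_swp [simp]: "swp (swp X) = X"
  by (simp add: swp_def)

lemma swp_measurable: "X \<in> borel_measurable area_bidisc \<Longrightarrow> swp X \<in> borel_measurable area_bidisc"
  unfolding swp_def area_bidisc_pair by (erule measurable_compose[rotated]) measurable

lemma integrable_swp:
  fixes F :: "complex \<times> complex \<Rightarrow> 'b::{banach, second_countable_topology}"
  shows "integrable area_bidisc F \<Longrightarrow> integrable area_bidisc (\<lambda>p. F (snd p, fst p))"
  using PD.integrable_product_swap[of F] by (simp add: area_bidisc_pair case_prod_beta')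

lemma integral_swp:
  fixes F :: "complex \<times> complex \<Rightarrow> 'b::{banach, second_countable_topology}"
  shows "F \<in> borel_measurable area_bidisc \<Longrightarrow> (LINT p|area_bidisc. F (snd p, fst p)) = integral\<^sup>L area_bidisc F"
  using PD.integral_product_swap[of F] by (simp add: area_bidisc_pair case_prod_beta')

lemma swp_L2: "X \<in> L2_space area_bidisc \<Longrightarrow> swp X \<in> L2_space area_bidisc"
  using integrable_swp[of "\<lambda>p. (cmod (X p))\<^sup>2"] swp_measurable by (auto simp: L2_space_def swp_def)

lemma swp_inner:
  assumes "X \<in> L2_space area_bidisc" "Y \<in> L2_space area_bidisc"
  shows "L2_inner area_bidisc (swp X) (swp Y) = L2_inner area_bidisc X Y"
  using integral_swp[OF borel_measurable_integrable[OF integrable_L2_inner[OF assms]]]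
  by (simp add: L2_inner_def swp_def)

lemma swp_norm: "X \<in> L2_space area_bidisc \<Longrightarrow> bnorm (swp X) = bnorm X"
  using integral_swp[OF borel_measurable_integrable[OF L2_space_integrable], of X] by (simp add: L2_norm_def swp_def)

lemma slice_dominated_single:
  assumes X: "X \<in> L2_space area_bidisc" and Y: "Y \<in> L2_space area_bidisc" and a: "0 \<le> a"
    and le: "\<And>z. z \<in> disc \<Longrightarrow> dnorm (\<lambda>w. X (z, w)) \<le> a * dnorm (\<lambda>w. Y (z, w))"
  shows "bnorm X \<le> a * bnorm Y"
proof (rule power2_le_imp_le)
  have "(LINT z|area_disc. (dnorm (\<lambda>w. X (z, w)))\<^sup>2) \<le> (LINT z|area_disc. a\<^sup>2 * (dnorm (\<lambda>w. Y (z, w)))\<^sup>2)"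
  proof (rule integral_mono)
    show "(dnorm (\<lambda>w. X (z, w)))\<^sup>2 \<le> a\<^sup>2 * (dnorm (\<lambda>w. Y (z, w)))\<^sup>2" if "z \<in> space area_disc" for z
      using power_mono[OF le[of z], of 2] that by (simp add: power_mult_distrib)
  qed (use L2_slices_integrable[OF X] L2_slices_integrable[OF Y] in auto)
  then show "(bnorm X)\<^sup>2 \<le> (a * bnorm Y)\<^sup>2"
    by (simp add: L2_slices X Y power_mult_distrib)
qed (use a in simp)

text \<open>The slicewise inequality is squared and integrated. The factor 2 is the price of
  \<open>(A + B)\<^sup>2 \<le> 2 A\<^sup>2 + 2 B\<^sup>2\<close>, absorbed later in the choice of
  small constants.\<close>

lemma slice_dominated:
  assumes X: "X \<in> L2_space area_bidisc" and Y: "Y \<in> L2_space area_bidisc" and Z: "Z \<in> L2_space area_bidisc"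
    and ab: "0 \<le> a" "0 \<le> b"
    and le: "\<And>z. z \<in> disc \<Longrightarrow> dnorm (\<lambda>w. X (z, w)) \<le> a * dnorm (\<lambda>w. Y (z, w)) + b * dnorm (\<lambda>w. Z (z, w))"
  shows "bnorm X \<le> 2 * (a * bnorm Y + b * bnorm Z)"
proof (rule power2_le_imp_le)
  have "(LINT z|area_disc. (dnorm (\<lambda>w. X (z, w)))\<^sup>2)
      \<le> (LINT z|area_disc. 2 * a\<^sup>2 * (dnorm (\<lambda>w. Y (z, w)))\<^sup>2 + 2 * b\<^sup>2 * (dnorm (\<lambda>w. Z (z, w)))\<^sup>2)"
  proof (rule integral_mono)
    fix z assume "z \<in> space area_disc"
    then have "(dnorm (\<lambda>w. X (z, w)))\<^sup>2 \<le> (a * dnorm (\<lambda>w. Y (z, w)) + b * dnorm (\<lambda>w. Z (z, w)))\<^sup>2"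
      using le by (intro power_mono) auto
    also have "\<dots> \<le> 2 * (a * dnorm (\<lambda>w. Y (z, w)))\<^sup>2 + 2 * (b * dnorm (\<lambda>w. Z (z, w)))\<^sup>2" by (rule sum_power2_le)
    finally show "(dnorm (\<lambda>w. X (z, w)))\<^sup>2 \<le> 2 * a\<^sup>2 * (dnorm (\<lambda>w. Y (z, w)))\<^sup>2 + 2 * b\<^sup>2 * (dnorm (\<lambda>w. Z (z, w)))\<^sup>2"
      by (simp add: power_mult_distrib)
  qed (use L2_slices_integrable[OF X] L2_slices_integrable[OF Y] L2_slices_integrable[OF Z] in auto)
  also have "\<dots> = 2 * a\<^sup>2 * (bnorm Y)\<^sup>2 + 2 * b\<^sup>2 * (bnorm Z)\<^sup>2"
    using L2_slices_integrable[OF Y] L2_slices_integrable[OF Z] by (simp add: L2_slices Y Z)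
  finally have "(bnorm X)\<^sup>2 \<le> 2 * (a * bnorm Y)\<^sup>2 + 2 * (b * bnorm Z)\<^sup>2"
    by (simp add: L2_slices X power_mult_distrib)
  also have "\<dots> \<le> (2 * (a * bnorm Y + b * bnorm Z))\<^sup>2"
  proof -
    have "2 * A\<^sup>2 + 2 * B\<^sup>2 \<le> (2 * (A + B))\<^sup>2" if "0 \<le> A" "0 \<le> B" for A B :: real
    proof -
      have "(2 * (A + B))\<^sup>2 = 2 * A\<^sup>2 + 2 * B\<^sup>2 + (2 * A\<^sup>2 + 2 * B\<^sup>2 + 8 * (A * B))"
        by (simp add: power2_eq_square algebra_simps)
      then show ?thesis using that by simp
    qed
    then show ?thesis using ab by simp
  qed
  finally show "(bnorm X)\<^sup>2 \<le> (2 * (a * bnorm Y + b * bnorm Z))\<^sup>2" .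
qed (use ab in simp)

lemma slice_dominated_snd:
  assumes X: "X \<in> L2_space area_bidisc" and Y: "Y \<in> L2_space area_bidisc" and Z: "Z \<in> L2_space area_bidisc"
    and ab: "0 \<le> a" "0 \<le> b"
    and le: "\<And>w. w \<in> disc \<Longrightarrow> dnorm (\<lambda>z. X (z, w)) \<le> a * dnorm (\<lambda>z. Y (z, w)) + b * dnorm (\<lambda>z. Z (z, w))"
  shows "bnorm X \<le> 2 * (a * bnorm Y + b * bnorm Z)"
  using slice_dominated[OF swp_L2[OF X] swp_L2[OF Y] swp_L2[OF Z] ab] le by (simp add: swp_norm X Y Z)

lemma measurable_bidiscI:
  fixes x :: "complex \<times> complex \<Rightarrow> 'b::topological_space"
  assumes "continuous_on bidisc x"
  shows "x \<in> borel_measurable area_bidisc"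
  using borel_measurable_continuous_on_restrict[OF assms]
  by (simp add: area_bidisc_def cong: measurable_cong_sets sets_restrict_space_cong)

subsection \<open>Holomorphic functions of two variables\<close>

lemma holomorphic2_onD:
  assumes "holomorphic2_on x bidisc"
  shows "continuous_on bidisc x" "z \<in> disc \<Longrightarrow> (\<lambda>w. x (z, w)) holomorphic_on disc"
    "w \<in> disc \<Longrightarrow> (\<lambda>z. x (z, w)) holomorphic_on disc"
proof -
  have D: "\<exists>a b. (x has_derivative (\<lambda>(u, v). a * u + b * v)) (at p)" if "p \<in> bidisc" for p
  proof -
    have "\<exists>a b. (x has_derivative (\<lambda>(u, v). a * u + b * v)) (at p within bidisc)"
      using assms that unfolding holomorphic2_on_def by blast
    then show ?thesis by (simp only: at_within_open[OF that open_bidisc])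
  qed
  then show "continuous_on bidisc x"
    by (intro continuous_at_imp_continuous_on) (blast intro: has_derivative_continuous)
  show "(\<lambda>w. x (z, w)) holomorphic_on disc" if z: "z \<in> disc"
    unfolding holomorphic_on_open[OF open_disc]
  proof (intro ballI)
    fix w assume w: "w \<in> disc"
    then have "(z, w) \<in> bidisc" using z by (simp add: bidisc_def)
    from D[OF this] obtain a b where ab: "(x has_derivative (\<lambda>(u, v). a * u + b * v)) (at (z, w))" by blast
    have "((\<lambda>w. x (z, w)) has_derivative (\<lambda>v. (\<lambda>(u, v). a * u + b * v) (0, v))) (at w)"
      by (rule has_derivative_compose[where f="\<lambda>w. (z, w)" and f'="\<lambda>v. (0, v)" and g=x, OF _ ab]) (auto intro!: derivative_eq_intros)
    then have "((\<lambda>w. x (z, w)) has_field_derivative b) (at w)" by (simp add: has_field_derivative_def)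
    then show "\<exists>f'. ((\<lambda>w. x (z, w)) has_field_derivative f') (at w)" by blast
  qed
  show "(\<lambda>z. x (z, w)) holomorphic_on disc" if w: "w \<in> disc"
    unfolding holomorphic_on_open[OF open_disc]
  proof (intro ballI)
    fix z assume z: "z \<in> disc"
    then have "(z, w) \<in> bidisc" using w by (simp add: bidisc_def)
    from D[OF this] obtain a b where ab: "(x has_derivative (\<lambda>(u, v). a * u + b * v)) (at (z, w))" by blast
    have "((\<lambda>z. x (z, w)) has_derivative (\<lambda>u. (\<lambda>(u, v). a * u + b * v) (u, 0))) (at z)"
      by (rule has_derivative_compose[where f="\<lambda>z. (z, w)" and f'="\<lambda>u. (u, 0)" and g=x, OF _ ab]) (auto intro!: derivative_eq_intros)
    then have "((\<lambda>z. x (z, w)) has_field_derivative a) (at z)" by (simp add: has_field_derivative_def)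
    then show "\<exists>f'. ((\<lambda>z. x (z, w)) has_field_derivative f') (at z)" by blast
  qed
qed

text \<open>Joint continuity of one partial derivative, the analytic input to Osgood's lemma. For a
  change of \<open>z\<close>, the difference of two slices is small on a circle about
  \<open>w\<close> by uniform continuity, and Cauchy's inequality passes this on to the derivative;
  for a change of \<open>w\<close>, one fixed slice has a continuous derivative.\<close>

lemma deriv_slice_continuous:
  assumes cont: "continuous_on bidisc x" and hol: "\<And>z. z \<in> disc \<Longrightarrow> (\<lambda>w. x (z, w)) holomorphic_on disc"
    and zw: "z0 \<in> disc" "w0 \<in> disc"
  shows "((\<lambda>(z, w). deriv (\<lambda>w. x (z, w)) w) \<longlongrightarrow> deriv (\<lambda>w. x (z0, w)) w0) (at (z0, w0) within disc \<times> disc)"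
  unfolding tendsto_iff
proof (intro allI impI)
  fix e :: real assume e: "e > 0"
  obtain a where a: "a > 0" "cball z0 a \<subseteq> disc" using zw(1) open_disc open_contains_cball by blast
  obtain b where b: "b > 0" "cball w0 b \<subseteq> disc" using zw(2) open_disc open_contains_cball by blast
  \<comment> \<open>Circles of radius \<open>r\<close> about points \<open>w\<close> with
    \<open>dist w w0 < r\<close> remain in \<open>cball w0 b\<close>. Cauchy's inequality divides by
    \<open>r\<close>, which is why the modulus of continuity is taken for
    \<open>e * r / 4\<close>.\<close>
  define r where "r = b / 2"
  have r: "r > 0" using b by (simp add: r_def)
  define K where "K = cball z0 a \<times> cball w0 b"
  have K: "compact K" "K \<subseteq> bidisc" using a b by (auto simp: K_def bidisc_def intro!: compact_Times)
  have "uniformly_continuous_on K x"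
    using compact_uniformly_continuous[OF continuous_on_subset[OF cont K(2)] K(1)] .
  moreover have "e * r / 4 > 0" using e r by simp
  ultimately obtain d where d: "d > 0" "\<And>p q. p \<in> K \<Longrightarrow> q \<in> K \<Longrightarrow> dist q p < d \<Longrightarrow> dist (x q) (x p) < e * r / 4"
    unfolding uniformly_continuous_on_def by metis
  have "isCont (deriv (\<lambda>w. x (z0, w))) w0"
    using holomorphic_on_imp_continuous_on[OF holomorphic_deriv[OF hol[OF zw(1)] open_disc]] zw(2) open_disc
    by (simp add: continuous_on_eq_continuous_at)
  then obtain c where c: "c > 0" "\<And>w. dist w w0 < c \<Longrightarrow> dist (deriv (\<lambda>w. x (z0, w)) w) (deriv (\<lambda>w. x (z0, w)) w0) < e / 2"
    using e unfolding continuous_at_eps_delta by (metis half_gt_zero)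
  define m where "m = min (min d a) (min r c)"
  have m: "m > 0" "m \<le> d" "m \<le> a" "m \<le> r" "m \<le> c" using d a r c by (auto simp: m_def)
  have "dist (deriv (\<lambda>w. x (z, w)) w) (deriv (\<lambda>w. x (z0, w)) w0) < e" if near: "dist (z, w) (z0, w0) < m" for z w
  proof -
    have z: "dist z z0 < m" and w: "dist w w0 < m"
      using near dist_fst_le[of "(z, w)" "(z0, w0)"] dist_snd_le[of "(z, w)" "(z0, w0)"] by auto
    have zd: "z \<in> disc" using z a m by (auto simp: dist_commute subset_iff)
    have sub: "cball w r \<subseteq> cball w0 b"
    proof
      fix u assume "u \<in> cball w r"
      then show "u \<in> cball w0 b" using w m dist_triangle[of w0 u w] by (simp add: r_def dist_commute)
    qed
    have wd: "w \<in> disc" "cball w r \<subseteq> disc" using sub subsetD[OF sub, of w] b r by auto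
    define k where "k = (\<lambda>u. x (z, u) - x (z0, u))"
    have k: "k holomorphic_on disc" unfolding k_def by (intro holomorphic_intros hol zd zw)
    have "cmod ((deriv ^^ 1) k w) \<le> fact 1 * (e * r / 4) / r ^ 1"
    proof (rule Cauchy_inequality)
      show "k holomorphic_on ball w r" using k wd ball_subset_cball holomorphic_on_subset by (metis order_trans)
      show "continuous_on (cball w r) k" using holomorphic_on_imp_continuous_on[OF k] wd continuous_on_subset by blast
      show "cmod (k u) \<le> e * r / 4" if "cmod (w - u) = r" for u
      proof -
        have u: "u \<in> cball w0 b" using that sub by (auto simp: dist_norm)
        have "dist (z, u) (z0, u) = dist z z0" by (simp add: dist_Pair_Pair)
        then have "dist (x (z, u)) (x (z0, u)) < e * r / 4"
          using u z m a by (intro d(2)) (auto simp: K_def dist_commute)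
        then show ?thesis by (simp add: k_def dist_norm)
      qed
    qed (use r in simp)
    also have "\<dots> = e / 4" using r by simp
    finally have "cmod (deriv k w) \<le> e / 4" by simp
    moreover have "deriv k w = deriv (\<lambda>w. x (z, w)) w - deriv (\<lambda>w. x (z0, w)) w"
      unfolding k_def using hol[OF zd] hol[OF zw(1)] wd open_disc
      by (intro deriv_diff) (auto simp: holomorphic_on_imp_differentiable_at)
    ultimately have "dist (deriv (\<lambda>w. x (z, w)) w) (deriv (\<lambda>w. x (z0, w)) w) \<le> e / 4" by (simp add: dist_norm)
    moreover have "dist (deriv (\<lambda>w. x (z0, w)) w) (deriv (\<lambda>w. x (z0, w)) w0) < e / 2" using c(2) w m by simp
    ultimately show ?thesis
      using dist_triangle[of "deriv (\<lambda>w. x (z, w)) w" "deriv (\<lambda>w. x (z0, w)) w0" "deriv (\<lambda>w. x (z0, w)) w"] e by simp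
  qed
  then show "\<forall>\<^sub>F p in at (z0, w0) within disc \<times> disc.
      dist (case p of (z, w) \<Rightarrow> deriv (\<lambda>w. x (z, w)) w) (deriv (\<lambda>w. x (z0, w)) w0) < e"
    unfolding eventually_at using m(1) by (intro exI[of _ m]) (auto simp: split_beta)
qed

text \<open>Osgood's lemma.\<close>

lemma holomorphic2_onI:
  assumes cont: "continuous_on bidisc x" and hol: "\<And>z. z \<in> disc \<Longrightarrow> (\<lambda>w. x (z, w)) holomorphic_on disc"
    and hol': "\<And>w. w \<in> disc \<Longrightarrow> (\<lambda>z. x (z, w)) holomorphic_on disc"
  shows "holomorphic2_on x bidisc"
  unfolding holomorphic2_on_def
proof
  fix p assume "p \<in> bidisc"
  then obtain z w where p: "p = (z, w)" "z \<in> disc" "w \<in> disc" by (auto simp: bidisc_def)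
  define D where "D = (\<lambda>z w. deriv (\<lambda>w. x (z, w)) w)"
  \<comment> \<open>One partial derivative at the point itself, together with the other one nearby
    and continuous at the point, gives total differentiability.\<close>
  have "((\<lambda>(z, w). x (z, w)) has_derivative
      (\<lambda>(u, v). deriv (\<lambda>z. x (z, w)) z * u + blinfun_apply (blinfun_mult_right (D z w)) v)) (at (z, w) within disc \<times> disc)"
  proof (rule has_derivative_partialsI)
    show "((\<lambda>z. x (z, w)) has_derivative (*) (deriv (\<lambda>z. x (z, w)) z)) (at z within disc)"
      using holomorphic_derivI[OF hol'[OF p(3)] open_disc p(2)] has_field_derivative_at_within
      by (auto simp: has_field_derivative_def intro: has_derivative_at_withinI)
    show "((\<lambda>w. x (z, w)) has_derivative blinfun_apply (blinfun_mult_right (D z w))) (at w within disc)"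
      if "z \<in> disc" "w \<in> disc" for z w
      using holomorphic_derivI[OF hol[OF that(1)] open_disc that(2)]
      by (auto simp: has_field_derivative_def D_def intro: has_derivative_at_withinI)
    have "((\<lambda>p. blinfun_mult_right ((\<lambda>(z, w). D z w) p)) \<longlongrightarrow> blinfun_mult_right (D z w)) (at (z, w) within disc \<times> disc)"
      using deriv_slice_continuous[OF cont hol p(2,3)] unfolding D_def
      by (rule bounded_linear.tendsto[OF bounded_linear_blinfun_mult_right])
    then show "continuous (at (z, w) within disc \<times> disc) (\<lambda>(z, w). blinfun_mult_right (D z w))"
      by (simp add: continuous_within case_prod_beta')
  qed (use p in \<open>auto simp: disc_def\<close>)
  then have "(x has_derivative (\<lambda>(u, v). deriv (\<lambda>z. x (z, w)) z * u + D z w * v)) (at p within bidisc)"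
    using p by (simp add: bidisc_def)
  then show "\<exists>a b. (x has_derivative (\<lambda>(u, v). a * u + b * v)) (at p within bidisc)" by blast
qed

lemma bergman_bidiscD:
  assumes "x \<in> bergman_bidisc"
  shows "x \<in> L2_space area_bidisc" "continuous_on bidisc x" "p \<notin> bidisc \<Longrightarrow> x p = 0"
    "z \<in> disc \<Longrightarrow> (\<lambda>w. x (z, w)) holomorphic_on disc" "w \<in> disc \<Longrightarrow> (\<lambda>z. x (z, w)) holomorphic_on disc"
  using assms holomorphic2_onD[of x] unfolding bergman_bidisc_def by blast+

lemma bergman_bidiscI:
  assumes "x \<in> L2_space area_bidisc" "continuous_on bidisc x" "\<And>p. p \<notin> bidisc \<Longrightarrow> x p = 0"
    "\<And>z. z \<in> disc \<Longrightarrow> (\<lambda>w. x (z, w)) holomorphic_on disc" "\<And>w. w \<in> disc \<Longrightarrow> (\<lambda>z. x (z, w)) holomorphic_on disc"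
  shows "x \<in> bergman_bidisc"
  using assms holomorphic2_onI by (auto simp: bergman_bidisc_def)

lemma swp_bergman:
  assumes "x \<in> bergman_bidisc"
  shows "swp x \<in> bergman_bidisc"
proof (rule bergman_bidiscI)
  note xD = bergman_bidiscD[OF assms]
  show "swp x \<in> L2_space area_bidisc" by (rule swp_L2[OF xD(1)])
  show "continuous_on bidisc (swp x)"
    unfolding swp_def by (rule continuous_on_compose2[OF xD(2)]) (auto simp: bidisc_def intro!: continuous_intros)
  show "swp x p = 0" if "p \<notin> bidisc" for p
    unfolding swp_def using that by (intro xD(3)) (auto simp: bidisc_def mem_Times_iff)
qed (use bergman_bidiscD(4,5)[OF assms] in simp_all)

lemma cball_times_sets: "s < 1 \<Longrightarrow> t < 1 \<Longrightarrow> cball 0 s \<times> cball 0 t \<in> sets area_bidisc"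
  unfolding area_bidisc_pair by (intro pair_measureI cball_sets_area_disc)

lemma cball_disc_sets: "s < 1 \<Longrightarrow> cball 0 s \<times> disc \<in> sets area_bidisc"
  unfolding area_bidisc_pair by (intro pair_measureI cball_sets_area_disc sets_area_disc) (auto simp: open_disc)

text \<open>For each fixed \<open>w\<close> the evaluation at \<open>z\<close> is bounded by the
  part over \<open>cball 0 t\<close> of the slice through \<open>w\<close>. Squaring and integrating
  over \<open>w\<close> bounds the slice at \<open>z\<close> by the full norm. The evaluation bound
  for merely holomorphic functions is used, since membership of slices in
  \<open>bergman_disc\<close> is being proved here.\<close>

lemma slice_bergman:
  assumes s: "s < 1"
  shows "\<exists>C>0. \<forall>x\<in>bergman_bidisc. \<forall>z\<in>cball 0 s.
    (\<lambda>w. x (z, w)) \<in> bergman_disc \<and> dnorm (\<lambda>w. x (z, w)) \<le> C * bnorm x"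
proof (cases "0 \<le> s")
  case True
  define t where "t = (1 + s) / 2"
  have t: "t < 1" using s by (simp add: t_def)
  obtain C where C: "C > 0" "\<And>g w. g holomorphic_on disc \<Longrightarrow> w \<in> cball 0 s \<Longrightarrow> cmod (g w) \<le> C * dnorm (cut t g)"
    using eval_bound_compact[OF True s] unfolding t_def by blast
  have "(\<lambda>w. x (z, w)) \<in> bergman_disc \<and> dnorm (\<lambda>w. x (z, w)) \<le> C * bnorm x"
    if x: "x \<in> bergman_bidisc" and z: "z \<in> cball 0 s" for x z
  proof -
    note xD = bergman_bidiscD[OF x]
    have zd: "z \<in> disc" using z s by (auto simp: disc_def)
    \<comment> \<open>The slices of \<open>X\<close> in \<open>z\<close> are the cut slices of
      \<open>x\<close>; \<open>X\<close> itself is square integrable, so Fubini applies to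
      it.\<close>
    define X where "X = (\<lambda>p. indicator (cball 0 t \<times> disc) p * x p)"
    have X: "X \<in> L2_space area_bidisc"
      unfolding X_def by (rule L2_space_mult[OF bounded_symbol_indicator[OF cball_disc_sets[OF t]] xD(1)])
    have int: "integrable area_disc (\<lambda>w. (dnorm (\<lambda>z. X (z, w)))\<^sup>2)"
      and eq: "(LINT w|area_disc. (dnorm (\<lambda>z. X (z, w)))\<^sup>2) = (bnorm X)\<^sup>2"
      using L2_slices_integrable[OF swp_L2[OF X]] L2_slices[OF swp_L2[OF X]] by (simp_all add: swp_norm[OF X])
    have le: "(cmod (x (z, w)))\<^sup>2 \<le> C\<^sup>2 * (dnorm (\<lambda>z. X (z, w)))\<^sup>2" if w: "w \<in> disc" for w
    proof -
      have "cmod (x (z, w)) \<le> C * dnorm (cut t (\<lambda>z. x (z, w)))" by (rule C(2)[OF xD(5)[OF w] z])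
      also have "dnorm (cut t (\<lambda>z. x (z, w))) = dnorm (\<lambda>z. X (z, w))"
        using w by (intro L2_norm_cong) (auto simp: X_def indicator_def)
      finally have "(cmod (x (z, w)))\<^sup>2 \<le> (C * dnorm (\<lambda>z. X (z, w)))\<^sup>2" by (intro power_mono) auto
      then show ?thesis by (simp add: power_mult_distrib)
    qed
    have meas: "(\<lambda>w. x (z, w)) \<in> borel_measurable area_disc"
      by (intro measurable_area_discI holomorphic_on_imp_continuous_on xD(4) zd)
    have int': "integrable area_disc (\<lambda>w. (cmod (x (z, w)))\<^sup>2)"
    proof (rule Bochner_Integration.integrable_bound[where f="\<lambda>w. C\<^sup>2 * (dnorm (\<lambda>z. X (z, w)))\<^sup>2"])
      show "AE w in area_disc. norm ((cmod (x (z, w)))\<^sup>2) \<le> norm (C\<^sup>2 * (dnorm (\<lambda>z. X (z, w)))\<^sup>2)"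
        using le by (intro AE_I2) simp
    qed (use int meas in auto)
    then have L2: "(\<lambda>w. x (z, w)) \<in> L2_space area_disc" by (rule L2_spaceI[OF meas])
    have "(dnorm (\<lambda>w. x (z, w)))\<^sup>2 \<le> (LINT w|area_disc. C\<^sup>2 * (dnorm (\<lambda>z. X (z, w)))\<^sup>2)"
      unfolding L2_norm_sq using int int' le by (intro integral_mono) (auto simp: L2_norm_sq)
    also have "\<dots> = (C * bnorm X)\<^sup>2" by (simp add: eq power_mult_distrib)
    finally have "dnorm (\<lambda>w. x (z, w)) \<le> C * bnorm X" using C(1) by (intro power2_le_imp_le[OF _ mult_nonneg_nonneg]) auto
    also have "\<dots> \<le> C * bnorm x"
      unfolding X_def using C(1) by (intro mult_left_mono L2_norm_indicator_le xD(1) cball_disc_sets t) auto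
    finally have "dnorm (\<lambda>w. x (z, w)) \<le> C * bnorm x" .
    moreover have "(\<lambda>w. x (z, w)) \<in> bergman_disc"
      unfolding bergman_disc_def using L2 xD(4)[OF zd] xD(3) by (auto simp: bidisc_def)
    ultimately show ?thesis by blast
  qed
  with C(1) show ?thesis by blast
next
  case False
  then show ?thesis by (intro exI[of _ 1]) auto
qed

lemma slice_fst_in:
  assumes "x \<in> bergman_bidisc"
  shows "(\<lambda>w. x (z, w)) \<in> bergman_disc"
proof (cases "z \<in> disc")
  case True
  then have "cmod z < 1" by (simp add: disc_def)
  from slice_bergman[OF this] assms show ?thesis by (metis mem_cball_0 order_refl)
next
  case False
  then have "(\<lambda>w. x (z, w)) = (\<lambda>w. 0)" using bergman_bidiscD(3)[OF assms] by (auto simp: bidisc_def)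
  then show ?thesis using D.zero by simp
qed

lemma slice_snd_in: "x \<in> bergman_bidisc \<Longrightarrow> (\<lambda>z. x (z, w)) \<in> bergman_disc"
  using slice_fst_in[OF swp_bergman, of x w] by simp

lemma eval_bound2:
  assumes s: "s < 1"
  shows "\<exists>C>0. \<forall>x\<in>bergman_bidisc. \<forall>p\<in>cball 0 s \<times> cball 0 s. cmod (x p) \<le> C * bnorm x"
proof -
  obtain C where C: "C > 0" "\<forall>x\<in>bergman_bidisc. \<forall>z\<in>cball 0 s.
      (\<lambda>w. x (z, w)) \<in> bergman_disc \<and> dnorm (\<lambda>w. x (z, w)) \<le> C * bnorm x"
    using slice_bergman[OF s] by blast
  obtain C' where C': "C' > 0" "\<forall>g\<in>bergman_disc. \<forall>w\<in>cball 0 s. cmod (g w) \<le> C' * dnorm g"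
    using eval_bound[OF s] by blast
  have "cmod (x (z, w)) \<le> C' * C * bnorm x" if x: "x \<in> bergman_bidisc" and zw: "z \<in> cball 0 s" "w \<in> cball 0 s" for x z w
  proof -
    have "cmod (x (z, w)) \<le> C' * dnorm (\<lambda>w. x (z, w))"
      using bspec[OF bspec[OF C'(2) slice_fst_in[OF x, of z]] zw(2)] .
    also have "\<dots> \<le> C' * (C * bnorm x)" using C(2) C'(1) x zw by (intro mult_left_mono) auto
    finally show ?thesis by (simp add: mult.assoc)
  qed
  then show ?thesis using C(1) C'(1) by (intro exI[of _ "C' * C"]) auto
qed

lemma bergman_bidisc_lin:
  assumes "x \<in> bergman_bidisc" "y \<in> bergman_bidisc"
  shows "(\<lambda>p. a * x p + b * y p) \<in> bergman_bidisc"
  by (rule bergman_bidiscI)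
    (use bergman_bidiscD[OF assms(1)] bergman_bidiscD[OF assms(2)] in
      \<open>auto intro!: L2_space_lin continuous_intros holomorphic_intros\<close>)

lemma bidisc_exhaustion:
  assumes "p \<in> bidisc"
  obtains s where "s < 1" "p \<in> ball 0 s \<times> ball 0 s" "cball 0 s \<times> cball 0 s \<subseteq> bidisc"
proof -
  obtain s where "max (cmod (fst p)) (cmod (snd p)) < s" "s < 1"
    using dense[of "max (cmod (fst p)) (cmod (snd p))" 1] assms by (auto simp: bidisc_def disc_def)
  then show ?thesis by (intro that[of s]) (auto simp: bidisc_def disc_def mem_Times_iff)
qed

text \<open>As on the disc, norm convergence is locally uniform. The limit is therefore jointly
  continuous and holomorphic in each variable, and Osgood's lemma, through
  \<open>bergman_bidiscI\<close>, makes it holomorphic in both.\<close>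

interpretation B: L2_hilbert area_bidisc bergman_bidisc
proof
  show "bergman_bidisc \<subseteq> L2_space area_bidisc" by (auto simp: bergman_bidisc_def)
  show "(\<lambda>p. 0) \<in> bergman_bidisc" by (rule bergman_bidiscI) (auto intro: L2_space_zero)
  show "(\<lambda>p. a * g p + b * h p) \<in> bergman_bidisc" if "g \<in> bergman_bidisc" "h \<in> bergman_bidisc" for g h a b
    using that by (rule bergman_bidisc_lin)
  show "g = (\<lambda>p. 0)" if g: "g \<in> bergman_bidisc" "bnorm g = 0" for g
  proof
    fix p show "g p = 0"
    proof (cases "p \<in> bidisc")
      case True
      then obtain s where s: "s < 1" "p \<in> ball 0 s \<times> ball 0 s" by (rule bidisc_exhaustion)
      then have p: "p \<in> cball 0 s \<times> cball 0 s" by auto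
      obtain C where "\<forall>x\<in>bergman_bidisc. \<forall>p\<in>cball 0 s \<times> cball 0 s. cmod (x p) \<le> C * bnorm x"
        using eval_bound2[OF s(1)] by blast
      from bspec[OF bspec[OF this g(1)] p] g(2) show ?thesis by simp
    qed (use bergman_bidiscD(3)[OF g(1)] in simp)
  qed
  fix u :: "nat \<Rightarrow> complex \<times> complex \<Rightarrow> complex"
  assume u: "\<And>n. u n \<in> bergman_bidisc"
    and "\<And>e::real. e > 0 \<Longrightarrow> \<exists>N. \<forall>m\<ge>N. \<forall>n\<ge>N. bnorm (\<lambda>x. u m x - u n x) < e"
  then have Cau: "L2_Cauchy area_bidisc u" by (simp add: L2_Cauchy_def)
  have diff: "(\<lambda>x. u m x - u n x) \<in> bergman_bidisc" for m n using bergman_bidisc_lin[OF u u, of 1 m "-1" n] by simp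
  have bound: "\<exists>C>0. \<forall>m n. \<forall>p\<in>cball 0 s \<times> cball 0 s. cmod (u m p - u n p) \<le> C * bnorm (\<lambda>x. u m x - u n x)" if s: "s < 1" for s
  proof -
    obtain C where C: "C > 0" "\<forall>x\<in>bergman_bidisc. \<forall>p\<in>cball 0 s \<times> cball 0 s. cmod (x p) \<le> C * bnorm x"
      using eval_bound2[OF s] by blast
    have "\<forall>p\<in>cball 0 s \<times> cball 0 s. cmod (u m p - u n p) \<le> C * bnorm (\<lambda>x. u m x - u n x)" for m n
      using bspec[OF C(2) diff] by simp
    with C(1) show ?thesis by blast
  qed
  define l where "l = (\<lambda>p. if p \<in> bidisc then lim (\<lambda>n. u n p) else 0)"
  have lim: "(\<lambda>n. u n p) \<longlonglongrightarrow> l p" if p: "p \<in> bidisc" for p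
  proof -
    obtain s where s: "s < 1" "p \<in> ball 0 s \<times> ball 0 s" using bidisc_exhaustion[OF p] by blast
    then have ps: "p \<in> cball 0 s \<times> cball 0 s" by auto
    obtain C where C: "C > 0" "\<forall>m n. \<forall>p\<in>cball 0 s \<times> cball 0 s. cmod (u m p - u n p) \<le> C * bnorm (\<lambda>x. u m x - u n x)"
      using bound[OF s(1)] by blast
    have "convergent (\<lambda>n. u n p)"
      by (rule L2_Cauchy_pointwise[OF Cau _ C(1)]) (use C(2) ps in blast)
    then show ?thesis using p by (simp add: l_def convergent_LIMSEQ_iff)
  qed
  have unif: "uniform_limit (cball 0 s \<times> cball 0 s) u l sequentially" if s: "s < 1" for s
  proof -
    obtain C where C: "C > 0" "\<forall>m n. \<forall>p\<in>cball 0 s \<times> cball 0 s. cmod (u m p - u n p) \<le> C * bnorm (\<lambda>x. u m x - u n x)"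
      using bound[OF s] by blast
    show ?thesis
    proof (rule L2_Cauchy_uniform_limit[OF Cau _ C(1)])
      show "(\<lambda>n. u n p) \<longlonglongrightarrow> l p" if "p \<in> cball 0 s \<times> cball 0 s" for p
        using that s by (intro lim) (auto simp: bidisc_def disc_def)
    qed (use C(2) in blast)
  qed
  have cont: "continuous_on bidisc l"
    unfolding continuous_on_eq_continuous_at[OF open_bidisc]
  proof
    fix p assume p: "p \<in> bidisc"
    obtain s where s: "s < 1" "p \<in> ball 0 s \<times> ball 0 s" "cball 0 s \<times> cball 0 s \<subseteq> bidisc" using bidisc_exhaustion[OF p] by blast
    have "continuous_on (cball 0 s \<times> cball 0 s) l"
      by (rule uniform_limit_theorem[OF _ unif[OF s(1)]])
        (use continuous_on_subset[OF bergman_bidiscD(2)[OF u] s(3)] in auto)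
    then have "continuous_on (ball 0 s \<times> ball 0 s) l" by (rule continuous_on_subset) auto
    then show "isCont l p" using s(2) by (cases p) (auto simp: continuous_on_eq_continuous_at open_Times)
  qed
  \<comment> \<open>One radius \<open>s\<close> serves the fixed coordinate \<open>t\<close> and a
    whole disc about the moving coordinate \<open>v\<close>, so uniform convergence on
    \<open>cball 0 s \<times> cball 0 s\<close> restricts to slices.\<close>
  have radius: "\<exists>d>0. cball v d \<subseteq> disc \<and> (\<exists>s<1. t \<in> cball 0 s \<and> cball v d \<subseteq> cball 0 s)"
    if v: "v \<in> disc" and t: "t \<in> disc" for v t
  proof -
    obtain s where s: "max (cmod v) (cmod t) < s" "s < 1"
      using dense[of "max (cmod v) (cmod t)" 1] v t by (auto simp: disc_def)
    have "v \<in> ball 0 s" using s by simp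
    then obtain d where d: "d > 0" "cball v d \<subseteq> ball 0 s" using open_ball open_contains_cball by blast
    have "ball 0 s \<subseteq> disc" "ball (0::complex) s \<subseteq> cball 0 s" using s by (auto simp: disc_def)
    then show ?thesis using d s by (intro exI[of _ d]) (auto intro!: exI[of _ s])
  qed
  have hol: "(\<lambda>w. l (z, w)) holomorphic_on disc" if z: "z \<in> disc" for z
  proof (rule holomorphic_uniform_sequence[OF open_disc])
    show "(\<lambda>w. u n (z, w)) holomorphic_on disc" for n by (rule bergman_bidiscD(4)[OF u z])
    fix w assume w: "w \<in> disc"
    obtain d s where ds: "d > 0" "cball w d \<subseteq> disc" "s < 1" "z \<in> cball 0 s" "cball w d \<subseteq> cball 0 s"
      using radius[OF w z] by blast
    have "uniform_limit (cball w d) (\<lambda>n w. u n (z, w)) (\<lambda>w. l (z, w)) sequentially"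
      using unif[OF ds(3)] ds(4,5) unfolding uniform_limit_sequentially_iff by (metis mem_Times_iff fst_conv snd_conv subsetD)
    with ds show "\<exists>d>0. cball w d \<subseteq> disc \<and> uniform_limit (cball w d) (\<lambda>n w. u n (z, w)) (\<lambda>w. l (z, w)) sequentially" by blast
  qed
  have hol': "(\<lambda>z. l (z, w)) holomorphic_on disc" if w: "w \<in> disc" for w
  proof (rule holomorphic_uniform_sequence[OF open_disc])
    show "(\<lambda>z. u n (z, w)) holomorphic_on disc" for n by (rule bergman_bidiscD(5)[OF u w])
    fix z assume z: "z \<in> disc"
    obtain d s where ds: "d > 0" "cball z d \<subseteq> disc" "s < 1" "w \<in> cball 0 s" "cball z d \<subseteq> cball 0 s"
      using radius[OF z w] by blast
    have "uniform_limit (cball z d) (\<lambda>n z. u n (z, w)) (\<lambda>z. l (z, w)) sequentially"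
      using unif[OF ds(3)] ds(4,5) unfolding uniform_limit_sequentially_iff by (metis mem_Times_iff fst_conv snd_conv subsetD)
    with ds show "\<exists>d>0. cball z d \<subseteq> disc \<and> uniform_limit (cball z d) (\<lambda>n z. u n (z, w)) (\<lambda>z. l (z, w)) sequentially" by blast
  qed
  have L2: "l \<in> L2_space area_bidisc" and conv: "(\<lambda>n. bnorm (\<lambda>x. u n x - l x)) \<longlonglongrightarrow> 0"
    by (rule L2_pointwise_limit[of u]; use bergman_bidiscD(1)[OF u] lim Cau in \<open>simp add: L2_Cauchy_def\<close>)+
  have "l \<in> bergman_bidisc"
    by (rule bergman_bidiscI[OF L2 cont _ hol hol']) (simp_all add: l_def)
  with conv show "\<exists>l\<in>bergman_bidisc. (\<lambda>n. bnorm (\<lambda>x. u n x - l x)) \<longlonglongrightarrow> 0" by blast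
qed

subsection \<open>Tensor products\<close>

definition tensor :: "(complex \<Rightarrow> complex) \<Rightarrow> (complex \<Rightarrow> complex) \<Rightarrow> complex \<times> complex \<Rightarrow> complex" where
  "tensor a b = (\<lambda>p. a (fst p) * b (snd p))"

lemma tensor_apply [simp]: "tensor a b (z, w) = a z * b w"
  by (simp add: tensor_def)

lemma swp_tensor [simp]: "swp (tensor a b) = tensor b a"
  by (simp add: swp_def tensor_def mult.commute)

lemma tensor_measurable:
  assumes "a \<in> borel_measurable area_disc" "b \<in> borel_measurable area_disc"
  shows "tensor a b \<in> borel_measurable area_bidisc"
  unfolding tensor_def area_bidisc_pair
  by (intro borel_measurable_times measurable_compose[OF measurable_fst assms(1)] measurable_compose[OF measurable_snd assms(2)])

lemma tensor_L2:
  assumes a: "a \<in> L2_space area_disc" and b: "b \<in> L2_space area_disc"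
  shows "tensor a b \<in> L2_space area_bidisc"
proof (rule L2_spaceI)
  show meas: "tensor a b \<in> borel_measurable area_bidisc" by (intro tensor_measurable L2_space_measurable a b)
  then have [measurable]: "tensor a b \<in> borel_measurable (area_disc \<Otimes>\<^sub>M area_disc)" by (simp add: area_bidisc_pair)
  have eq: "(cmod (a z * b w))\<^sup>2 = (cmod (a z))\<^sup>2 * (cmod (b w))\<^sup>2" for z w
    by (simp add: norm_mult power_mult_distrib)
  have "integrable (area_disc \<Otimes>\<^sub>M area_disc) (\<lambda>p. (cmod (tensor a b p))\<^sup>2)"
  proof (rule PD.Fubini_integrable)
    show "integrable area_disc (\<lambda>z. LINT w|area_disc. norm ((cmod (tensor a b (z, w)))\<^sup>2))"
      using L2_space_integrable[OF a] by (simp add: eq)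
    show "AE z in area_disc. integrable area_disc (\<lambda>w. (cmod (tensor a b (z, w)))\<^sup>2)"
      using L2_space_integrable[OF b] by (simp add: eq)
  qed measurable
  then show "integrable area_bidisc (\<lambda>p. (cmod (tensor a b p))\<^sup>2)" by (simp add: area_bidisc_pair)
qed

lemma tensor_norm:
  assumes "a \<in> L2_space area_disc" "b \<in> L2_space area_disc"
  shows "bnorm (tensor a b) = dnorm a * dnorm b"
proof (rule power2_eq_imp_eq)
  have "(bnorm (tensor a b))\<^sup>2 = (LINT z|area_disc. (cmod (a z))\<^sup>2 * (dnorm b)\<^sup>2)"
    by (simp add: L2_slices[OF tensor_L2[OF assms], symmetric] L2_norm_scale power_mult_distrib)
  then show "(bnorm (tensor a b))\<^sup>2 = (dnorm a * dnorm b)\<^sup>2"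
    by (simp add: L2_norm_sq power_mult_distrib)
qed simp_all

lemma tensor_bergman:
  assumes a: "a \<in> bergman_disc" and b: "b \<in> bergman_disc"
  shows "tensor a b \<in> bergman_bidisc"
proof (rule bergman_bidiscI)
  show "tensor a b \<in> L2_space area_bidisc" by (intro tensor_L2 D.L2 a b)
  show "continuous_on bidisc (tensor a b)"
    unfolding tensor_def
    by (intro continuous_intros continuous_on_compose2[OF bergman_discD(4)[OF a]] continuous_on_compose2[OF bergman_discD(4)[OF b]])
      (auto simp: bidisc_def)
  show "tensor a b p = 0" if "p \<notin> bidisc" for p
    using that bergman_discD(3)[OF a] bergman_discD(3)[OF b] by (auto simp: tensor_def bidisc_def mem_Times_iff)
qed (use bergman_discD(2)[OF a] bergman_discD(2)[OF b] in \<open>auto intro!: holomorphic_intros\<close>)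

lemma tensor_inner_slices:
  assumes "a \<in> L2_space area_disc" "b \<in> L2_space area_disc" "y \<in> L2_space area_bidisc"
  shows "L2_inner area_bidisc (tensor a b) y = (LINT z|area_disc. a z * L2_inner area_disc b (\<lambda>w. y (z, w)))"
  unfolding L2_inner_slices[OF tensor_L2[OF assms(1,2)] assms(3)] by (simp add: L2_inner_scale_left)

text \<open>The pairing with \<open>k\<close> is an integral over \<open>z\<close> of pairings of
  \<open>b\<close> with slices of \<open>k\<close>. These slices lie in \<open>bergman_disc\<close>,
  so replacing \<open>b\<close> by its projection changes nothing. Applied in both variables, this
  shows that the projection of the bidisc factors on tensors.\<close>

lemma tensor_inner_proj_snd:
  assumes a: "a \<in> L2_space area_disc" and b: "b \<in> L2_space area_disc" and k: "k \<in> bergman_bidisc"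
  shows "L2_inner area_bidisc (tensor a b) k = L2_inner area_bidisc (tensor a (D.proj b)) k"
  unfolding tensor_inner_slices[OF a b B.L2[OF k]] tensor_inner_slices[OF a D.L2[OF D.proj_in[OF b]] B.L2[OF k]]
  by (simp add: D.proj_inner[OF b slice_fst_in[OF k]])

lemma tensor_inner_proj_fst:
  assumes a: "a \<in> L2_space area_disc" and b: "b \<in> L2_space area_disc" and k: "k \<in> bergman_bidisc"
  shows "L2_inner area_bidisc (tensor a b) k = L2_inner area_bidisc (tensor (D.proj a) b) k"
  using tensor_inner_proj_snd[OF b a swp_bergman[OF k]]
    swp_inner[OF tensor_L2[OF a b] B.L2[OF k]] swp_inner[OF tensor_L2[OF D.L2[OF D.proj_in[OF a]] b] B.L2[OF k]] by simp

lemma proj_tensor: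
  assumes a: "a \<in> L2_space area_disc" and b: "b \<in> L2_space area_disc"
  shows "B.proj (tensor a b) = tensor (D.proj a) (D.proj b)"
proof (rule B.proj_eqI[OF tensor_L2[OF a b] tensor_bergman[OF D.proj_in[OF a] D.proj_in[OF b]]])
  show "L2_inner area_bidisc (tensor a b) k = L2_inner area_bidisc (tensor (D.proj a) (D.proj b)) k" if "k \<in> bergman_bidisc" for k
    using tensor_inner_proj_snd[OF a b that] tensor_inner_proj_fst[OF a D.L2[OF D.proj_in[OF b]] that] by simp
qed

lemma bounded_symbol_tensor:
  assumes "bounded_symbol area_disc B \<phi>" "bounded_symbol area_disc C \<psi>"
  shows "bounded_symbol area_bidisc (B * C) (tensor \<phi> \<psi>)"
  using assms tensor_measurable unfolding bounded_symbol_def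
  by (auto simp: tensor_def norm_mult bidisc_def intro!: mult_mono)

lemma toeplitz_tensor:
  assumes phi: "bounded_symbol area_disc B \<phi>" and psi: "bounded_symbol area_disc C \<psi>"
    and a: "a \<in> bergman_disc" and b: "b \<in> bergman_disc"
  shows "toeplitz_bidisc (tensor \<phi> \<psi>) (tensor a b) = tensor (toeplitz_disc \<phi> a) (toeplitz_disc \<psi> b)"
proof -
  have "(\<lambda>p. tensor \<phi> \<psi> p * tensor a b p) = tensor (\<lambda>z. \<phi> z * a z) (\<lambda>w. \<psi> w * b w)"
    by (auto simp: tensor_def)
  then show ?thesis
    unfolding B.toeplitz_apply[OF tensor_bergman[OF a b]] D.toeplitz_apply[OF a] D.toeplitz_apply[OF b]
    using proj_tensor[OF L2_space_mult[OF phi D.L2[OF a]] L2_space_mult[OF psi D.L2[OF b]]] by simp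
qed

text \<open>Finite sums of elementary tensors, built one tensor at a time so that every induction
  step involves a single product.\<close>

inductive_set tspan :: "(complex \<times> complex \<Rightarrow> complex) set" where
  zero: "(\<lambda>p. 0) \<in> tspan"
| add: "x \<in> tspan \<Longrightarrow> a \<in> bergman_disc \<Longrightarrow> b \<in> bergman_disc \<Longrightarrow> (\<lambda>p. x p + tensor a b p) \<in> tspan"

lemma tspan_bergman: "x \<in> tspan \<Longrightarrow> x \<in> bergman_bidisc"
  by (induction rule: tspan.induct) (auto intro: B.zero B.add tensor_bergman)

lemma tensor_tspan: "a \<in> bergman_disc \<Longrightarrow> b \<in> bergman_disc \<Longrightarrow> tensor a b \<in> tspan"
  using tspan.add[OF tspan.zero, of a b] by simp

lemma tspan_scale: "x \<in> tspan \<Longrightarrow> (\<lambda>p. c * x p) \<in> tspan"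
proof (induction rule: tspan.induct)
  case (add x a b)
  have "(\<lambda>p. c * (x p + tensor a b p)) = (\<lambda>p. c * x p + tensor (\<lambda>z. c * a z) b p)"
    by (auto simp: tensor_def algebra_simps)
  then show ?case using tspan.add[OF add.IH D.scale[OF add.hyps(2)] add.hyps(3)] by simp
qed (use tspan.zero in simp)

lemma tspan_add: "x \<in> tspan \<Longrightarrow> y \<in> tspan \<Longrightarrow> (\<lambda>p. x p + y p) \<in> tspan"
proof (induction arbitrary: y rule: tspan.induct)
  case (add x a b)
  have "(\<lambda>p. x p + tensor a b p + y p) = (\<lambda>p. x p + (y p + tensor a b p))" by (auto simp: algebra_simps)
  then show ?case using add.IH[OF tspan.add[OF add.prems add.hyps(2,3)]] by simp
qed simp

text \<open>Pairing with the tensor of the kernels at \<open>z\<close> and \<open>w\<close> is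
  evaluation at \<open>(z, w)\<close> up to conjugation, since each kernel reproduces in its own
  variable. A function orthogonal to all tensors therefore vanishes at every point.\<close>

lemma tspan_dense:
  assumes x: "x \<in> bergman_bidisc" and e: "e > 0"
  shows "\<exists>v\<in>tspan. bnorm (\<lambda>p. x p - v p) < e"
proof (rule B.dense_if_orthogonal_trivial[OF _ tspan.zero _ _ x e])
  show "tspan \<subseteq> bergman_bidisc" using tspan_bergman by blast
  show "(\<lambda>p. a * g p + b * h p) \<in> tspan" if "g \<in> tspan" "h \<in> tspan" for g h a b
    using that by (intro tspan_add tspan_scale)
  fix y assume y: "y \<in> bergman_bidisc" and orth: "\<And>v. v \<in> tspan \<Longrightarrow> L2_inner area_bidisc y v = 0"
  show "y = (\<lambda>p. 0)"
  proof
    fix p show "y p = 0"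
    proof (cases "p \<in> bidisc")
      case True
      then obtain z w where p: "p = (z, w)" "z \<in> disc" "w \<in> disc" by (auto simp: bidisc_def)
      note kz = kern_in[OF p(2)] and kw = kern_in[OF p(3)]
      have "0 = cnj (L2_inner area_bidisc y (tensor (kern z) (kern w)))"
        using orth[OF tensor_tspan[OF kz kw]] by simp
      also have "\<dots> = L2_inner area_bidisc (tensor (kern z) (kern w)) y" by (metis L2_inner_cnj)
      also have "\<dots> = (LINT u|area_disc. kern z u * L2_inner area_disc (kern w) (\<lambda>v. y (u, v)))"
        by (intro tensor_inner_slices D.L2 B.L2 y kz kw)
      also have "\<dots> = (LINT u|area_disc. kern z u * cnj (y (u, w)))"
        using kern[OF p(3) slice_fst_in[OF y]] by (metis (no_types, lifting) L2_inner_cnj)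
      also have "\<dots> = cnj (L2_inner area_disc (\<lambda>u. y (u, w)) (kern z))"
        by (subst L2_inner_cnj[symmetric]) (simp add: L2_inner_def)
      also have "\<dots> = cnj (y p)" using kern[OF p(2) slice_snd_in[OF y]] p by simp
      finally show ?thesis by (metis complex_cnj_zero_iff)
    qed (use bergman_bidiscD(3)[OF y] in simp)
  qed
qed

section \<open>Toeplitz operators acting in one variable\<close>

definition opw :: "(complex \<Rightarrow> complex) \<Rightarrow> (complex \<times> complex \<Rightarrow> complex) \<Rightarrow> complex \<times> complex \<Rightarrow> complex" where
  "opw \<psi> x = (\<lambda>p. toeplitz_disc \<psi> (\<lambda>w. x (fst p, w)) (snd p))"

definition opz :: "(complex \<Rightarrow> complex) \<Rightarrow> (complex \<times> complex \<Rightarrow> complex) \<Rightarrow> complex \<times> complex \<Rightarrow> complex" where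
  "opz \<phi> x = (\<lambda>p. toeplitz_disc \<phi> (\<lambda>z. x (z, snd p)) (fst p))"

lemma opz_swp: "opz \<phi> x = swp (opw \<phi> (swp x))"
  by (auto simp: opz_def opw_def swp_def)

lemma opw_slice: "(\<lambda>w. opw \<psi> x (z, w)) = toeplitz_disc \<psi> (\<lambda>w. x (z, w))"
  by (simp add: opw_def)

lemma opw_zero: "bounded_symbol area_disc C \<psi> \<Longrightarrow> opw \<psi> (\<lambda>p. 0) = (\<lambda>p. 0)"
  using D.op_zero[OF D.toeplitz_bounded] by (simp add: opw_def)

lemma opw_add_tensor:
  assumes psi: "bounded_symbol area_disc C \<psi>" and x: "x \<in> bergman_bidisc" and b: "b \<in> bergman_disc"
  shows "opw \<psi> (\<lambda>p. x p + tensor a b p) = (\<lambda>p. opw \<psi> x p + tensor a (toeplitz_disc \<psi> b) p)"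
proof
  fix p :: "complex \<times> complex"
  have "toeplitz_disc \<psi> (\<lambda>w. x (fst p, w) + a (fst p) * b w)
      = (\<lambda>w. toeplitz_disc \<psi> (\<lambda>w. x (fst p, w)) w + toeplitz_disc \<psi> (\<lambda>w. a (fst p) * b w) w)"
    by (rule D.op_add[OF D.toeplitz_bounded[OF psi] slice_fst_in[OF x] D.scale[OF b]])
  then show "opw \<psi> (\<lambda>p. x p + tensor a b p) p = opw \<psi> x p + tensor a (toeplitz_disc \<psi> b) p"
    using D.op_scale[OF D.toeplitz_bounded[OF psi] b, of "a (fst p)"] by (simp add: opw_def tensor_def)
qed

text \<open>The slicewise definition makes sense for arbitrary functions; on finite sums of tensors
  the result is visibly a Bergman function of two variables. This is why the estimates below are
  first proved on \<open>tspan\<close>.\<close>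

lemma opw_tspan:
  assumes psi: "bounded_symbol area_disc C \<psi>"
  shows "x \<in> tspan \<Longrightarrow> opw \<psi> x \<in> tspan"
proof (induction rule: tspan.induct)
  case zero
  show ?case using tspan.zero by (simp add: opw_zero[OF psi])
next
  case (add x a b)
  then show ?case
    using tspan.add[OF add.IH add.hyps(2) D.toeplitz_in[OF psi add.hyps(3)]]
    by (simp add: opw_add_tensor[OF psi tspan_bergman])
qed

lemma opz_add_tensor:
  assumes phi: "bounded_symbol area_disc C \<phi>" and x: "x \<in> bergman_bidisc" and a: "a \<in> bergman_disc"
  shows "opz \<phi> (\<lambda>p. x p + tensor a b p) = (\<lambda>p. opz \<phi> x p + tensor (toeplitz_disc \<phi> a) b p)"
proof -
  have "swp (\<lambda>p. x p + tensor a b p) = (\<lambda>p. swp x p + tensor b a p)" by (auto simp: swp_def tensor_def)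
  then show ?thesis
    unfolding opz_swp using opw_add_tensor[OF phi swp_bergman[OF x] a, of b] by (simp add: swp_def tensor_def mult.commute)
qed

text \<open>The passage from one variable to two: a product symbol gives a Toeplitz operator in
  \<open>w\<close> followed by one in \<open>z\<close>, so that estimates on the disc can be applied
  slice by slice.\<close>

lemma toeplitz_tensor_tspan:
  assumes phi: "bounded_symbol area_disc B \<phi>" and psi: "bounded_symbol area_disc C \<psi>"
  shows "x \<in> tspan \<Longrightarrow> toeplitz_bidisc (tensor \<phi> \<psi>) x = opz \<phi> (opw \<psi> x)"
proof (induction rule: tspan.induct)
  case zero
  show ?case
    using B.op_zero[OF B.toeplitz_bounded[OF bounded_symbol_tensor[OF phi psi]]]
    by (simp add: opw_zero[OF psi] opz_swp swp_def opw_zero[OF phi])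
next
  case (add x a b)
  note xB = tspan_bergman[OF add.hyps(1)]
  have "toeplitz_bidisc (tensor \<phi> \<psi>) (\<lambda>p. x p + tensor a b p)
      = (\<lambda>p. toeplitz_bidisc (tensor \<phi> \<psi>) x p + toeplitz_bidisc (tensor \<phi> \<psi>) (tensor a b) p)"
    by (rule B.op_add[OF B.toeplitz_bounded[OF bounded_symbol_tensor[OF phi psi]] xB tensor_bergman[OF add.hyps(2,3)]])
  also have "\<dots> = (\<lambda>p. opz \<phi> (opw \<psi> x) p + tensor (toeplitz_disc \<phi> a) (toeplitz_disc \<psi> b) p)"
    by (simp add: add.IH toeplitz_tensor[OF phi psi add.hyps(2,3)])
  also have "\<dots> = opz \<phi> (\<lambda>p. opw \<psi> x p + tensor a (toeplitz_disc \<psi> b) p)"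
    by (rule opz_add_tensor[OF phi tspan_bergman[OF opw_tspan[OF psi add.hyps(1)]] add.hyps(2), symmetric])
  also have "\<dots> = opz \<phi> (opw \<psi> (\<lambda>p. x p + tensor a b p))"
    by (simp add: opw_add_tensor[OF psi xB add.hyps(3)])
  finally show ?case .
qed

lemma bounded_symbol_swp: "bounded_symbol area_bidisc B f \<Longrightarrow> bounded_symbol area_bidisc B (swp f)"
  using swp_measurable by (auto simp: bounded_symbol_def swp_def bidisc_def)

lemma toeplitz_swp:
  assumes f: "bounded_symbol area_bidisc B f" and x: "x \<in> bergman_bidisc"
  shows "toeplitz_bidisc (swp f) (swp x) = swp (toeplitz_bidisc f x)"
proof (rule B.toeplitz_eqI[OF bounded_symbol_swp[OF f] swp_bergman[OF x] swp_bergman[OF B.toeplitz_in[OF f x]]])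
  fix k assume k: "k \<in> bergman_bidisc"
  have "(\<lambda>p. swp f p * swp x p) = swp (\<lambda>p. f p * x p)" by (simp add: swp_def)
  then have "L2_inner area_bidisc (\<lambda>p. swp f p * swp x p) k = L2_inner area_bidisc (swp (\<lambda>p. f p * x p)) (swp (swp k))"
    by simp
  also have "\<dots> = L2_inner area_bidisc (\<lambda>p. f p * x p) (swp k)"
    by (intro swp_inner L2_space_mult[OF f] B.L2 x swp_bergman k)
  also have "\<dots> = L2_inner area_bidisc (toeplitz_bidisc f x) (swp k)"
    by (rule B.toeplitz_inner[OF f x swp_bergman[OF k], symmetric])
  also have "\<dots> = L2_inner area_bidisc (swp (toeplitz_bidisc f x)) (swp (swp k))"
    by (intro swp_inner[symmetric] B.L2 B.toeplitz_in[OF f] x swp_bergman k)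
  finally show "L2_inner area_bidisc (\<lambda>p. swp f p * swp x p) k = L2_inner area_bidisc (swp (toeplitz_bidisc f x)) k" by simp
qed

subsection \<open>Compactly supported symbols\<close>

text \<open>One coordinate is moved at a time, the second case being the first one with the
  variables exchanged; the two moves account for the factor 2.\<close>

lemma bidisc_equicontinuous:
  assumes s: "s < 1"
  shows "\<exists>L>0. \<forall>x\<in>bergman_bidisc. \<forall>p\<in>cball 0 s \<times> cball 0 s. \<forall>q\<in>cball 0 s \<times> cball 0 s.
    cmod (x p - x q) \<le> L * bnorm x * norm (p - q)"
proof -
  obtain C where C: "C > 0" "\<forall>x\<in>bergman_bidisc. \<forall>z\<in>cball 0 s. (\<lambda>w. x (z, w)) \<in> bergman_disc \<and> dnorm (\<lambda>w. x (z, w)) \<le> C * bnorm x"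
    using slice_bergman[OF s] by blast
  obtain L where L: "L > 0" "\<forall>g\<in>bergman_disc. \<forall>w\<in>cball 0 s. \<forall>z\<in>cball 0 s. cmod (g w - g z) \<le> L * dnorm g * cmod (w - z)"
    using eval_lipschitz[OF s] by blast
  have fst_le: "cmod (x (z, w) - x (z, w')) \<le> L * C * bnorm x * cmod (w - w')"
    if x: "x \<in> bergman_bidisc" and zw: "z \<in> cball 0 s" "w \<in> cball 0 s" "w' \<in> cball 0 s" for x z w w'
  proof -
    have "cmod (x (z, w) - x (z, w')) \<le> L * dnorm (\<lambda>w. x (z, w)) * cmod (w - w')"
      using bspec[OF bspec[OF bspec[OF L(2) slice_fst_in[OF x, of z]] zw(2)] zw(3)] .
    also have "\<dots> \<le> L * (C * bnorm x) * cmod (w - w')"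
      using C(2) L(1) x zw by (intro mult_right_mono mult_left_mono) auto
    finally show ?thesis by (simp add: mult.assoc)
  qed
  have "cmod (x (z, w) - x (z', w')) \<le> 2 * (L * C) * bnorm x * norm ((z, w) - (z', w'))"
    if x: "x \<in> bergman_bidisc" and zw: "z \<in> cball 0 s" "w \<in> cball 0 s" "z' \<in> cball 0 s" "w' \<in> cball 0 s" for x z w z' w'
  proof -
    have "cmod (x (z, w) - x (z', w')) \<le> cmod (x (z, w) - x (z, w')) + cmod (x (z, w') - x (z', w'))"
      using norm_triangle_ineq[of "x (z, w) - x (z, w')" "x (z, w') - x (z', w')"] by simp
    also have "cmod (x (z, w') - x (z', w')) \<le> L * C * bnorm x * cmod (z - z')"
      using fst_le[OF swp_bergman[OF x] zw(4,1,3)] by (simp add: swp_norm[OF B.L2[OF x]])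
    also have "\<dots> \<le> L * C * bnorm x * norm ((z, w) - (z', w'))"
      using norm_fst_le[of "z - z'" "w - w'"] L C by (intro mult_left_mono) auto
    also have "cmod (x (z, w) - x (z, w')) \<le> L * C * bnorm x * cmod (w - w')" by (rule fst_le[OF x zw(1,2,4)])
    also have "\<dots> \<le> L * C * bnorm x * norm ((z, w) - (z', w'))"
      using norm_snd_le[of "w - w'" "z - z'"] L C by (intro mult_left_mono) auto
    finally show ?thesis by (simp add: mult_ac)
  qed
  then show ?thesis using L(1) C(1) by (intro exI[of _ "2 * (L * C)"]) auto
qed

lemma L2_one_bidisc: "(\<lambda>p. c) \<in> L2_space area_bidisc"
  using tensor_L2[OF L2_one[of c] L2_one[of 1]] by (simp add: tensor_def)

text \<open>Montel's argument: on the closed bidisc of radius \<open>s\<close>, bounded sequences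
  are uniformly bounded and equicontinuous, so a subsequence converges uniformly there by
  Arzela-Ascoli. The cut functions are then Cauchy in norm, and the projection is a
  contraction.\<close>

lemma toeplitz_cball_compact:
  assumes s: "s < 1"
  shows "toeplitz_bidisc (indicator (cball 0 s \<times> cball 0 s)) \<in> compact_operators area_bidisc bergman_bidisc"
  unfolding B.compact_operators_iff
proof (intro conjI allI impI)
  let ?Q = "cball (0::complex) s \<times> cball (0::complex) s"
  let ?T = "toeplitz_bidisc (indicator ?Q)"
  note ind = bounded_symbol_indicator[OF cball_times_sets[OF s s]]
  show T: "?T \<in> bounded_operators area_bidisc bergman_bidisc" by (rule B.toeplitz_bounded[OF ind])
  fix u :: "nat \<Rightarrow> _" assume u: "\<forall>n. u n \<in> bergman_bidisc \<and> bnorm (u n) \<le> 1"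
  obtain C where C: "C > 0" "\<forall>x\<in>bergman_bidisc. \<forall>p\<in>?Q. cmod (x p) \<le> C * bnorm x" using eval_bound2[OF s] by blast
  obtain L where L: "L > 0" "\<forall>x\<in>bergman_bidisc. \<forall>p\<in>?Q. \<forall>q\<in>?Q. cmod (x p - x q) \<le> L * bnorm x * norm (p - q)"
    using bidisc_equicontinuous[OF s] by blast
  obtain g k where gk: "strict_mono (k :: nat \<Rightarrow> nat)" "\<And>e. 0 < e \<Longrightarrow> \<exists>N. \<forall>n p. n \<ge> N \<and> p \<in> ?Q \<longrightarrow> norm (u (k n) p - g p) < e"
  proof (rule Arzela_Ascoli[of ?Q u C])
    show "compact ?Q" by (intro compact_Times) auto
    show "norm (u n p) \<le> C" if "p \<in> ?Q" for n p
    proof -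
      have "cmod (u n p) \<le> C * bnorm (u n)" using C(2) u that by blast
      also have "\<dots> \<le> C * 1" using u C(1) by (intro mult_left_mono) auto
      finally show ?thesis by simp
    qed
    show "\<exists>d. 0 < d \<and> (\<forall>n q. q \<in> ?Q \<and> norm (p - q) < d \<longrightarrow> norm (u n p - u n q) < e)"
      if p: "p \<in> ?Q" and e: "0 < e" for p e
    proof (intro exI[of _ "e / L"] conjI allI impI)
      show "0 < e / L" using e L by simp
      fix n q assume q: "q \<in> ?Q \<and> norm (p - q) < e / L"
      have "cmod (u n p - u n q) \<le> L * bnorm (u n) * norm (p - q)" using L(2) u p q by blast
      also have "\<dots> \<le> L * 1 * norm (p - q)" using u L(1) by (intro mult_right_mono mult_left_mono) auto
      also have "\<dots> < L * (e / L)" using q L(1) by (simp add: field_simps)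
      finally show "norm (u n p - u n q) < e" using L(1) by simp
    qed
  qed blast
  have "L2_Cauchy area_bidisc (\<lambda>n. ?T (u (k n)))"
    unfolding L2_Cauchy_def
  proof (intro allI impI)
    fix e :: real assume e: "e > 0"
    define V where "V = bnorm (\<lambda>p. 1)"
    have V: "V \<ge> 0" by (simp add: V_def)
    \<comment> \<open>Two members of the subsequence differ by at most \<open>2 * d\<close>, each
      being \<open>d\<close>-close to the limit \<open>g\<close>; integration costs
      \<open>V\<close>, the norm of 1.\<close>
    define d where "d = e / (2 * (V + 1))"
    have d: "d > 0" "2 * d * V < e" using e V by (auto simp: d_def field_simps)
    obtain N where N: "\<And>n p. n \<ge> N \<Longrightarrow> p \<in> ?Q \<Longrightarrow> cmod (u (k n) p - g p) < d" using gk(2)[OF d(1)] by blast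
    have "bnorm (\<lambda>p. ?T (u (k m)) p - ?T (u (k n)) p) < e" if mn: "m \<ge> N" "n \<ge> N" for m n
    proof -
      define v where "v = (\<lambda>p. u (k m) p - u (k n) p)"
      have v: "v \<in> bergman_bidisc" unfolding v_def using u by (intro B.diff) auto
      have "?T v = (\<lambda>p. ?T (u (k m)) p - ?T (u (k n)) p)" unfolding v_def using u by (intro B.op_diff[OF T]) auto
      then have "bnorm (\<lambda>p. ?T (u (k m)) p - ?T (u (k n)) p) = bnorm (B.proj (\<lambda>p. indicator ?Q p * v p))"
        using B.toeplitz_apply[OF v, of "indicator ?Q"] by simp
      also have "\<dots> \<le> bnorm (\<lambda>p. indicator ?Q p * v p)" by (rule B.proj_norm[OF L2_space_mult[OF ind B.L2[OF v]]])
      also have "\<dots> \<le> (2 * d) * bnorm (\<lambda>p. 1)"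
      proof (rule L2_norm_dominated[OF L2_space_measurable[OF L2_space_mult[OF ind B.L2[OF v]]] L2_one_bidisc])
        show "cmod (indicator ?Q p * v p) \<le> 2 * d * cmod 1" for p
        proof (cases "p \<in> ?Q")
          case True
          have "cmod (v p) \<le> cmod (u (k m) p - g p) + cmod (u (k n) p - g p)"
            using norm_triangle_ineq4[of "u (k m) p - g p" "u (k n) p - g p"] by (simp add: v_def)
          then show ?thesis using N[OF mn(1) True] N[OF mn(2) True] True by simp
        qed (use d in simp)
      qed (use d in simp)
      finally show ?thesis using d(2) by (simp add: V_def)
    qed
    then show "\<exists>N. \<forall>m\<ge>N. \<forall>n\<ge>N. bnorm (\<lambda>p. ?T (u (k m)) p - ?T (u (k n)) p) < e" by blast
  qed
  with gk(1) show "\<exists>r::nat \<Rightarrow> nat. strict_mono r \<and> L2_Cauchy area_bidisc (\<lambda>n. ?T (u (r n)))" by blast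
qed

section \<open>Estimates for Toeplitz operators on the bidisc\<close>

definition zcut :: "real \<Rightarrow> (complex \<times> complex \<Rightarrow> complex) \<Rightarrow> complex \<times> complex \<Rightarrow> complex" where
  "zcut s x = (\<lambda>p. indicator (cball 0 s) (fst p) * x p)"

definition wcut :: "real \<Rightarrow> (complex \<times> complex \<Rightarrow> complex) \<Rightarrow> complex \<times> complex \<Rightarrow> complex" where
  "wcut s x = (\<lambda>p. indicator (cball 0 s) (snd p) * x p)"

lemma zcut_symbol: "s < 1 \<Longrightarrow> bounded_symbol area_bidisc 1 (\<lambda>p. indicator (cball 0 s) (fst p))"
  using bounded_symbol_tensor[OF bounded_symbol_indicator[OF cball_sets_area_disc[of s]] bounded_symbol_const[of area_disc 1]]
  by (simp add: tensor_def)

lemma wcut_symbol: "s < 1 \<Longrightarrow> bounded_symbol area_bidisc 1 (\<lambda>p. indicator (cball 0 s) (snd p))"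
  using bounded_symbol_swp[OF zcut_symbol[of s]] by (simp add: swp_def)

lemma zcut_L2: "s < 1 \<Longrightarrow> x \<in> L2_space area_bidisc \<Longrightarrow> zcut s x \<in> L2_space area_bidisc"
  unfolding zcut_def by (rule L2_space_mult[OF zcut_symbol])

lemma wcut_L2: "s < 1 \<Longrightarrow> x \<in> L2_space area_bidisc \<Longrightarrow> wcut s x \<in> L2_space area_bidisc"
  unfolding wcut_def by (rule L2_space_mult[OF wcut_symbol])

lemma zcut_norm: "s < 1 \<Longrightarrow> x \<in> L2_space area_bidisc \<Longrightarrow> bnorm (zcut s x) \<le> bnorm x"
  unfolding zcut_def using L2_norm_mult[OF zcut_symbol] by simp

lemma wcut_norm: "s < 1 \<Longrightarrow> x \<in> L2_space area_bidisc \<Longrightarrow> bnorm (wcut s x) \<le> bnorm x"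
  unfolding wcut_def using L2_norm_mult[OF wcut_symbol] by simp

lemma swp_zcut: "swp (zcut s x) = wcut s (swp x)"
  by (simp add: swp_def zcut_def wcut_def)

lemma zcut_mono:
  assumes "s \<le> t" "t < 1" "x \<in> L2_space area_bidisc"
  shows "bnorm (zcut s x) \<le> bnorm (zcut t x)"
  using L2_norm_dominated[OF L2_space_measurable[OF zcut_L2[of s x]] zcut_L2[of t x], of 1] assms
  by (auto simp: zcut_def indicator_def)

lemma zcut_add_norm:
  assumes "s < 1" "x \<in> L2_space area_bidisc" "y \<in> L2_space area_bidisc"
  shows "bnorm (zcut s (\<lambda>p. x p + y p)) \<le> bnorm (zcut s x) + bnorm (zcut s y)"
  using L2_norm_triangle[OF zcut_L2 zcut_L2, of s x s y] assms by (simp add: zcut_def distrib_left)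

text \<open>Lipschitz continuity of \<open>bnorm (A x)\<close> in \<open>x\<close>. It is stated for
  this seminorm instead of for \<open>A\<close>, since inequalities between such seminorms are what
  has to pass from a dense set to the whole space.\<close>

definition blip :: "real \<Rightarrow> ((complex \<times> complex \<Rightarrow> complex) \<Rightarrow> complex \<times> complex \<Rightarrow> complex) \<Rightarrow> bool" where
  "blip K A \<longleftrightarrow> 0 \<le> K \<and> (\<forall>x\<in>bergman_bidisc. \<forall>y\<in>bergman_bidisc.
     bnorm (A x) \<le> bnorm (A y) + K * bnorm (\<lambda>p. x p - y p))"

lemma blipI:
  assumes "0 \<le> K" "\<And>x. x \<in> bergman_bidisc \<Longrightarrow> A x \<in> L2_space area_bidisc"
    "\<And>x y. x \<in> bergman_bidisc \<Longrightarrow> y \<in> bergman_bidisc \<Longrightarrow> A (\<lambda>p. x p - y p) = (\<lambda>p. A x p - A y p)"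
    "\<And>x. x \<in> bergman_bidisc \<Longrightarrow> bnorm (A x) \<le> K * bnorm x"
  shows "blip K A"
  unfolding blip_def
proof (intro conjI ballI)
  fix x y assume xy: "x \<in> bergman_bidisc" "y \<in> bergman_bidisc"
  have "bnorm (A x) \<le> bnorm (A y) + bnorm (\<lambda>p. A x p - A y p)"
    by (intro L2_norm_triangle_sub assms(2) xy)
  then show "bnorm (A x) \<le> bnorm (A y) + K * bnorm (\<lambda>p. x p - y p)"
    using assms(3)[OF xy] assms(4)[OF B.diff[OF xy]] by simp
qed fact

lemma blip_id: "blip 1 (\<lambda>x. x)"
  by (rule blipI) (auto intro: B.L2)

lemma blip_zcut: "s < 1 \<Longrightarrow> blip 1 (zcut s)"
  by (rule blipI) (auto intro: zcut_L2 B.L2 simp: zcut_norm B.L2, auto simp: zcut_def algebra_simps)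

lemma blip_toeplitz:
  assumes f: "bounded_symbol area_bidisc K f"
  shows "blip K (toeplitz_bidisc f)"
  by (rule blipI)
    (use f in \<open>auto intro: B.L2 B.toeplitz_in[OF f] B.toeplitz_norm[OF f] B.op_diff[OF B.toeplitz_bounded[OF f]]
      simp: bounded_symbol_def\<close>)

lemma blip_zcut_toeplitz:
  assumes f: "bounded_symbol area_bidisc K f" and s: "s < 1"
  shows "blip K (\<lambda>x. zcut s (toeplitz_bidisc f x))"
proof (rule blipI)
  show "0 \<le> K" using f by (simp add: bounded_symbol_def)
  fix x assume x: "x \<in> bergman_bidisc"
  note Tx = B.L2[OF B.toeplitz_in[OF f x]]
  show "zcut s (toeplitz_bidisc f x) \<in> L2_space area_bidisc" by (rule zcut_L2[OF s Tx])
  show "bnorm (zcut s (toeplitz_bidisc f x)) \<le> K * bnorm x"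
    using zcut_norm[OF s Tx] B.toeplitz_norm[OF f x] by linarith
  fix y assume y: "y \<in> bergman_bidisc"
  show "zcut s (toeplitz_bidisc f (\<lambda>p. x p - y p)) = (\<lambda>p. zcut s (toeplitz_bidisc f x) p - zcut s (toeplitz_bidisc f y) p)"
    unfolding B.op_diff[OF B.toeplitz_bounded[OF f] x y] by (simp add: zcut_def algebra_simps)
qed

lemma blip_zcut_wcut:
  assumes s: "s < 1" "t < 1"
  shows "blip 1 (\<lambda>x. zcut s (wcut t x))"
proof (rule blipI)
  fix x assume x: "x \<in> bergman_bidisc"
  note wx = wcut_L2[OF s(2) B.L2[OF x]]
  show "zcut s (wcut t x) \<in> L2_space area_bidisc" by (rule zcut_L2[OF s(1) wx])
  show "bnorm (zcut s (wcut t x)) \<le> 1 * bnorm x"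
    using zcut_norm[OF s(1) wx] wcut_norm[OF s(2) B.L2[OF x]] by linarith
  fix y
  show "zcut s (wcut t (\<lambda>p. x p - y p)) = (\<lambda>p. zcut s (wcut t x) p - zcut s (wcut t y) p)"
    by (simp add: zcut_def wcut_def algebra_simps)
qed simp

text \<open>Replacing \<open>x\<close> by a nearby sum of tensors \<open>v\<close> changes each term
  by at most its Lipschitz constant times the distance; density makes the total change arbitrarily
  small.\<close>

lemma tspan_estimate:
  assumes A: "blip K A" and R: "blip L R" and S: "blip N S" and nonneg: "0 \<le> a" "0 \<le> b" "0 \<le> c"
    and le: "\<And>x. x \<in> tspan \<Longrightarrow> bnorm (A x) \<le> a * bnorm x + b * bnorm (R x) + c * bnorm (S x)"
    and x: "x \<in> bergman_bidisc"
  shows "bnorm (A x) \<le> a * bnorm x + b * bnorm (R x) + c * bnorm (S x)"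
proof (rule field_le_epsilon)
  fix e :: real assume e: "e > 0"
  \<comment> \<open>The total Lipschitz cost of exchanging \<open>x\<close> for \<open>v\<close> on
    both sides of the inequality.\<close>
  define Q where "Q = K + a + b * L + c * N"
  have Q: "0 \<le> Q" using A R S nonneg by (simp add: Q_def blip_def)
  then have "e / (Q + 1) > 0" using e by simp
  from tspan_dense[OF x this] obtain v where v: "v \<in> tspan" "bnorm (\<lambda>p. x p - v p) < e / (Q + 1)" by blast
  define d where "d = bnorm (\<lambda>p. x p - v p)"
  have dc: "bnorm (\<lambda>p. v p - x p) = d" unfolding d_def by (rule L2_norm_minus_commute)
  have vB: "v \<in> bergman_bidisc" by (rule tspan_bergman[OF v(1)])
  have "bnorm (A x) \<le> bnorm (A v) + K * d" using A x vB unfolding blip_def d_def by blast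
  moreover have "bnorm (A v) \<le> a * bnorm v + b * bnorm (R v) + c * bnorm (S v)" by (rule le[OF v(1)])
  moreover have "a * bnorm v \<le> a * (bnorm x + d)"
    using L2_norm_triangle_sub[OF B.L2[OF vB] B.L2[OF x]] dc nonneg by (intro mult_left_mono) auto
  moreover have "b * bnorm (R v) \<le> b * (bnorm (R x) + L * d)"
    using R x vB nonneg unfolding blip_def dc[symmetric] by (intro mult_left_mono) blast+
  moreover have "c * bnorm (S v) \<le> c * (bnorm (S x) + N * d)"
    using S x vB nonneg unfolding blip_def dc[symmetric] by (intro mult_left_mono) blast+
  ultimately have "bnorm (A x) \<le> a * bnorm x + b * bnorm (R x) + c * bnorm (S x) + Q * d"
    by (simp add: Q_def algebra_simps)
  moreover have "Q * d \<le> (Q + 1) * (e / (Q + 1))" using v(2) Q unfolding d_def by (intro mult_mono) auto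
  moreover have "(Q + 1) * (e / (Q + 1)) = e" using Q by simp
  ultimately show "bnorm (A x) \<le> a * bnorm x + b * bnorm (R x) + c * bnorm (S x) + e" by linarith
qed

subsection \<open>Symbols that are sums of products\<close>

inductive_set tsym :: "(complex \<times> complex \<Rightarrow> complex) set" where
  tensor: "continuous_on (closure disc) \<phi> \<Longrightarrow> continuous_on (closure disc) \<psi> \<Longrightarrow> tensor \<phi> \<psi> \<in> tsym"
| add: "f \<in> tsym \<Longrightarrow> g \<in> tsym \<Longrightarrow> (\<lambda>p. f p + g p) \<in> tsym"

text \<open>Sums of products form an algebra, so a polynomial belongs to \<open>tsym\<close> as soon
  as constants and real-linear functions do.\<close>

lemma tsym_mult: "f \<in> tsym \<Longrightarrow> g \<in> tsym \<Longrightarrow> (\<lambda>p. f p * g p) \<in> tsym"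
proof (induction arbitrary: g rule: tsym.induct)
  case (tensor \<phi> \<psi>)
  from tensor.prems show ?case
  proof (induction rule: tsym.induct)
    case (tensor \<phi>' \<psi>')
    have "(\<lambda>p. tensor \<phi> \<psi> p * tensor \<phi>' \<psi>' p) = tensor (\<lambda>z. \<phi> z * \<phi>' z) (\<lambda>z. \<psi> z * \<psi>' z)"
      by (auto simp: tensor_def)
    then show ?case using tensor \<open>continuous_on (closure disc) \<phi>\<close> \<open>continuous_on (closure disc) \<psi>\<close>
      by (auto intro!: tsym.tensor continuous_on_mult)
  next
    case (add f g)
    then show ?case using tsym.add by (simp add: distrib_left)
  qed
next
  case (add f f')
  then show ?case using tsym.add[OF add.IH(1)[OF add.prems] add.IH(2)[OF add.prems]] by (simp add: distrib_right)
qed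

lemma closure_bidisc: "closure bidisc = closure disc \<times> closure disc"
  by (simp add: bidisc_def closure_Times)

lemma compact_closure_bidisc: "compact (closure bidisc)"
  unfolding closure_bidisc by (intro compact_Times) (simp_all add: disc_def)

lemma bounded_symbol_bidiscI:
  assumes f: "continuous_on (closure bidisc) f"
  shows "\<exists>B. bounded_symbol area_bidisc B f"
proof -
  obtain B where B: "\<forall>p\<in>closure bidisc. cmod (f p) \<le> B"
    using compact_continuous_bounded[OF compact_closure_bidisc f] by blast
  have "bounded_symbol area_bidisc \<bar>B\<bar> f"
    using B closure_subset[of bidisc] f
    by (auto simp: bounded_symbol_def intro!: measurable_bidiscI continuous_on_subset[OF f] order_trans[OF _ abs_ge_self])
  then show ?thesis by blast
qed

text \<open>By Stone-Weierstrass it is enough to treat polynomials in the four real coordinates, and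
  their generators are constants and real-linear functions.\<close>

lemma tsym_dense:
  assumes f: "continuous_on (closure bidisc) f" and d: "d > 0"
  shows "\<exists>g\<in>tsym. \<forall>p\<in>closure bidisc. cmod (f p - g p) < d"
proof -
  have const: "(\<lambda>p. c) \<in> tsym" for c
    using tsym.tensor[of "\<lambda>z. c" "\<lambda>z. 1"] by (simp add: tensor_def)
  have poly: "(\<lambda>p. of_real (q p)) \<in> tsym" if "real_polynomial_function q" for q :: "complex \<times> complex \<Rightarrow> real"
    using that
  proof induction
    case (linear q)
    then interpret bounded_linear q .
    have cont: "continuous_on S q" for S by (rule linear_continuous_on) (rule bounded_linear_axioms)
    \<comment> \<open>A linear function of the pair splits into one function of each coordinate,
      hence into two tensors with a constant factor.\<close>
    have "q p = q (fst p, 0) + q (0, snd p)" for p by (simp add: add[symmetric])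
    then have "(\<lambda>p. of_real (q p)) = (\<lambda>p. tensor (\<lambda>z. of_real (q (z, 0))) (\<lambda>w. 1) p + tensor (\<lambda>z. 1) (\<lambda>w. of_real (q (0, w))) p)"
      unfolding tensor_def by (metis mult_1_left mult_1_right of_real_add)
    moreover have "continuous_on (closure disc) (\<lambda>z. complex_of_real (q (z, 0)))" "continuous_on (closure disc) (\<lambda>w. complex_of_real (q (0, w)))"
      by (intro continuous_on_of_real continuous_on_compose2[OF cont[of UNIV]] continuous_intros; simp)+
    ultimately show ?case by (auto intro!: tsym.intros continuous_on_const)
  next
    case (add p q)
    then show ?case using tsym.add by fastforce
  next
    case (mult p q)
    then show ?case using tsym_mult by fastforce
  qed (rule const)
  from Stone_Weierstrass_polynomial_function[OF compact_closure_bidisc f d]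
  obtain p where p: "polynomial_function p" "\<forall>x\<in>closure bidisc. cmod (f x - p x) < d" by blast
  have "real_polynomial_function (\<lambda>z. Re (p z))" "real_polynomial_function (\<lambda>z. Im (p z))"
    using p(1) bounded_linear_Re bounded_linear_Im unfolding polynomial_function_def o_def by blast+
  then have "(\<lambda>z. of_real (Re (p z)) + \<i> * of_real (Im (p z))) \<in> tsym"
    by (intro tsym.add tsym_mult const poly)
  then have "p \<in> tsym" by (simp add: complex_eq[symmetric])
  with p(2) show ?thesis by blast
qed

lemma tsym_bounded: "f \<in> tsym \<Longrightarrow> \<exists>B. bounded_symbol area_bidisc B f"
proof (induction rule: tsym.induct)
  case (tensor \<phi> \<psi>)
  then show ?case using bounded_symbol_discI[OF tensor(1)] bounded_symbol_discI[OF tensor(2)] bounded_symbol_tensor by metis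
next
  case (add f g)
  then show ?case using bounded_symbol_add by blast
qed

lemma tsym_slice_bounded: "f \<in> tsym \<Longrightarrow> \<exists>B. bounded_symbol area_disc B (\<lambda>w. f (z, w))"
proof (induction rule: tsym.induct)
  case (tensor \<phi> \<psi>)
  obtain B where "bounded_symbol area_disc B \<psi>" using bounded_symbol_discI[OF tensor(2)] by blast
  from bounded_symbol_mult[OF bounded_symbol_const[of area_disc "\<phi> z"] this] show ?case by (auto simp: tensor_def)
next
  case (add f g)
  then show ?case using bounded_symbol_add by blast
qed

section \<open>Locality in the first variable\<close>

definition zlocal :: "((complex \<times> complex \<Rightarrow> complex) \<Rightarrow> complex \<times> complex \<Rightarrow> complex) \<Rightarrow> bool" where
  "zlocal X \<longleftrightarrow> (\<forall>s<1. \<forall>e>0. \<exists>t<1. \<exists>C\<ge>0. \<forall>x\<in>bergman_bidisc.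
     bnorm (zcut s (X x)) \<le> e * bnorm x + C * bnorm (zcut t x))"

lemma zlocalE:
  assumes "zlocal X" "s < 1" "e > 0"
  obtains t C where "t < 1" "0 \<le> C" "\<And>x. x \<in> bergman_bidisc \<Longrightarrow> bnorm (zcut s (X x)) \<le> e * bnorm x + C * bnorm (zcut t x)"
  using assms unfolding zlocal_def by meson

text \<open>The operator acts within each slice in \<open>w\<close>, so it respects any cut in
  \<open>z\<close>.\<close>

lemma opw_norms:
  assumes psi: "bounded_symbol area_disc B \<psi>" and x: "x \<in> tspan"
  shows "bnorm (opw \<psi> x) \<le> B * bnorm x" "s < 1 \<Longrightarrow> bnorm (zcut s (opw \<psi> x)) \<le> B * bnorm (zcut s x)"
proof -
  have B: "0 \<le> B" using psi by (simp add: bounded_symbol_def)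
  note xB = tspan_bergman[OF x] and oB = tspan_bergman[OF opw_tspan[OF psi x]]
  have le: "dnorm (\<lambda>w. opw \<psi> x (z, w)) \<le> B * dnorm (\<lambda>w. x (z, w))" for z
    unfolding opw_slice by (rule D.toeplitz_norm[OF psi slice_fst_in[OF xB]])
  show "bnorm (opw \<psi> x) \<le> B * bnorm x"
    by (rule slice_dominated_single[OF B.L2[OF oB] B.L2[OF xB] B le])
  assume s: "s < 1"
  show "bnorm (zcut s (opw \<psi> x)) \<le> B * bnorm (zcut s x)"
  proof (rule slice_dominated_single[OF zcut_L2[OF s B.L2[OF oB]] zcut_L2[OF s B.L2[OF xB]] B])
    fix z
    have "cmod (indicator (cball 0 s) z) * dnorm (\<lambda>w. opw \<psi> x (z, w)) \<le> cmod (indicator (cball 0 s) z) * (B * dnorm (\<lambda>w. x (z, w)))"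
      by (intro mult_left_mono le) simp
    then show "dnorm (\<lambda>w. zcut s (opw \<psi> x) (z, w)) \<le> B * dnorm (\<lambda>w. zcut s x (z, w))"
      unfolding zcut_def fst_conv L2_norm_scale by (simp only: mult.left_commute)
  qed
qed

text \<open>Integrates a one-variable \<open>vanishing\<close> bound in \<open>z\<close> over all
  \<open>w\<close>, after a Toeplitz operator in \<open>w\<close> has been applied. It serves twice:
  with a cut Toeplitz operator for locality, and with a Hankel operator for the comparison with
  slicewise action.\<close>

lemma vanishing_slices:
  assumes A: "vanishing A" and psi: "bounded_symbol area_disc B \<psi>" and e: "e > 0"
    and L2: "\<And>x. x \<in> tspan \<Longrightarrow> (\<lambda>p. A (\<lambda>z. opw \<psi> x (z, snd p)) (fst p)) \<in> L2_space area_bidisc"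
  shows "\<exists>s<1. \<exists>C\<ge>0. \<forall>x\<in>tspan. bnorm (\<lambda>p. A (\<lambda>z. opw \<psi> x (z, snd p)) (fst p)) \<le> e * bnorm x + C * bnorm (zcut s x)"
proof -
  have B: "0 \<le> B" using psi by (simp add: bounded_symbol_def)
  \<comment> \<open>The 2 comes from \<open>slice_dominated_snd\<close>, the \<open>B\<close> from
    the operator in \<open>w\<close>.\<close>
  define d where "d = e / (2 * (B + 1))"
  have d: "d > 0" "2 * d * B \<le> e" using B e by (auto simp: d_def field_simps)
  obtain s C where sC: "s < 1" "0 \<le> C" "\<And>g. g \<in> bergman_disc \<Longrightarrow> dnorm (A g) \<le> d * dnorm g + C * dnorm (cut s g)"
    using vanishingE[OF A d(1)] by blast
  have "bnorm (\<lambda>p. A (\<lambda>z. opw \<psi> x (z, snd p)) (fst p)) \<le> e * bnorm x + 2 * C * B * bnorm (zcut s x)" if x: "x \<in> tspan" for x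
  proof -
    define y where "y = opw \<psi> x"
    have y: "y \<in> bergman_bidisc" unfolding y_def by (rule tspan_bergman[OF opw_tspan[OF psi x]])
    have "bnorm (\<lambda>p. A (\<lambda>z. y (z, snd p)) (fst p)) \<le> 2 * (d * bnorm y + C * bnorm (zcut s y))"
    proof (rule slice_dominated_snd)
      show "(\<lambda>p. A (\<lambda>z. y (z, snd p)) (fst p)) \<in> L2_space area_bidisc" unfolding y_def by (rule L2[OF x])
      show "dnorm (\<lambda>u. A (\<lambda>z. y (z, snd (u, w))) (fst (u, w))) \<le> d * dnorm (\<lambda>z. y (z, w)) + C * dnorm (\<lambda>z. zcut s y (z, w))" for w
        using sC(3)[OF slice_snd_in[OF y, of w]] by (simp add: zcut_def)
    qed (use y d sC in \<open>auto intro: B.L2 zcut_L2\<close>)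
    also have "\<dots> \<le> 2 * (d * (B * bnorm x) + C * (B * bnorm (zcut s x)))"
      unfolding y_def using d sC opw_norms[OF psi x] by (intro mult_left_mono add_mono) auto
    also have "\<dots> = 2 * d * B * bnorm x + 2 * C * B * bnorm (zcut s x)" by (simp add: algebra_simps)
    also have "\<dots> \<le> e * bnorm x + 2 * C * B * bnorm (zcut s x)" using d(2) by (intro add_right_mono mult_right_mono) auto
    finally show ?thesis by (simp add: y_def)
  qed
  then show ?thesis using sC(1,2) B by (intro exI[of _ s] conjI exI[of _ "2 * C * B"]) auto
qed

lemma zlocal_tensor:
  assumes phi: "bounded_symbol area_disc B \<phi>" and psi: "bounded_symbol area_disc C \<psi>"
  shows "zlocal (toeplitz_bidisc (tensor \<phi> \<psi>))"
  unfolding zlocal_def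
proof (intro allI impI)
  fix s e :: real assume s: "s < 1" and e: "e > 0"
  note sym = bounded_symbol_tensor[OF phi psi]
  have eq: "(\<lambda>p. cut s (toeplitz_disc \<phi> (\<lambda>z. opw \<psi> x (z, snd p))) (fst p)) = zcut s (toeplitz_bidisc (tensor \<phi> \<psi>) x)"
    if "x \<in> tspan" for x
    by (simp add: toeplitz_tensor_tspan[OF phi psi that] zcut_def opz_def)
  have "\<exists>t<1. \<exists>K\<ge>0. \<forall>x\<in>tspan. bnorm (\<lambda>p. cut s (toeplitz_disc \<phi> (\<lambda>z. opw \<psi> x (z, snd p))) (fst p)) \<le> e * bnorm x + K * bnorm (zcut t x)"
  proof (rule vanishing_slices[OF toeplitz_local[OF phi s] psi e])
    show "(\<lambda>p. cut s (toeplitz_disc \<phi> (\<lambda>z. opw \<psi> x (z, snd p))) (fst p)) \<in> L2_space area_bidisc" if "x \<in> tspan" for x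
      unfolding eq[OF that] by (intro zcut_L2 s B.L2 B.toeplitz_in[OF sym] tspan_bergman that)
  qed
  then obtain t K where K: "t < 1" "0 \<le> K"
    "\<And>x. x \<in> tspan \<Longrightarrow> bnorm (zcut s (toeplitz_bidisc (tensor \<phi> \<psi>) x)) \<le> e * bnorm x + K * bnorm (zcut t x)"
    using eq by auto
  have "bnorm (zcut s (toeplitz_bidisc (tensor \<phi> \<psi>) x)) \<le> e * bnorm x + K * bnorm (zcut t x)" if "x \<in> bergman_bidisc" for x
    using tspan_estimate[OF blip_zcut_toeplitz[OF sym s] blip_zcut[OF K(1)] blip_id _ K(2), of e 0] K(3) e that by simp
  with K(1,2) show "\<exists>t<1. \<exists>C\<ge>0. \<forall>x\<in>bergman_bidisc. bnorm (zcut s (toeplitz_bidisc (tensor \<phi> \<psi>) x)) \<le> e * bnorm x + C * bnorm (zcut t x)"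
    by blast
qed

lemma zlocal_add:
  assumes X: "zlocal X" and Y: "zlocal Y" and eq: "\<And>x. x \<in> bergman_bidisc \<Longrightarrow> Z x = (\<lambda>p. X x p + Y x p)"
    and L2: "\<And>x. x \<in> bergman_bidisc \<Longrightarrow> X x \<in> L2_space area_bidisc" "\<And>x. x \<in> bergman_bidisc \<Longrightarrow> Y x \<in> L2_space area_bidisc"
  shows "zlocal Z"
  unfolding zlocal_def
proof (intro allI impI)
  fix s e :: real assume s: "s < 1" and "e > 0"
  then have e2: "e / 2 > 0" by simp
  obtain t C where t: "t < 1" "0 \<le> C" "\<And>x. x \<in> bergman_bidisc \<Longrightarrow> bnorm (zcut s (X x)) \<le> e / 2 * bnorm x + C * bnorm (zcut t x)"
    by (rule zlocalE[OF X s e2]) blast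
  obtain u K where u: "u < 1" "0 \<le> K" "\<And>x. x \<in> bergman_bidisc \<Longrightarrow> bnorm (zcut s (Y x)) \<le> e / 2 * bnorm x + K * bnorm (zcut u x)"
    by (rule zlocalE[OF Y s e2]) blast
  have "bnorm (zcut s (Z x)) \<le> e * bnorm x + (C + K) * bnorm (zcut (max t u) x)" if x: "x \<in> bergman_bidisc" for x
  proof -
    have "C * bnorm (zcut t x) \<le> C * bnorm (zcut (max t u) x)" "K * bnorm (zcut u x) \<le> K * bnorm (zcut (max t u) x)"
      using t u by (auto intro!: mult_left_mono zcut_mono B.L2[OF x])
    then show ?thesis
      using zcut_add_norm[OF s L2(1)[OF x] L2(2)[OF x]] t(3)[OF x] u(3)[OF x] by (simp add: eq[OF x] algebra_simps)
  qed
  then show "\<exists>t<1. \<exists>C\<ge>0. \<forall>x\<in>bergman_bidisc. bnorm (zcut s (Z x)) \<le> e * bnorm x + C * bnorm (zcut t x)"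
    using t(1,2) u(1,2) by (intro exI[of _ "max t u"] conjI exI[of _ "C + K"]) auto
qed

text \<open>Locality of \<open>X\<close> leaves a cut of \<open>Y x\<close> at some radius
  \<open>t\<close>, and locality of \<open>Y\<close> at that radius turns it into a cut of
  \<open>x\<close>.\<close>

lemma zlocal_compose:
  assumes X: "zlocal X" and Y: "zlocal Y" and YB: "B.bounded_by b Y"
  shows "zlocal (\<lambda>x. X (Y x))"
  unfolding zlocal_def
proof (intro allI impI)
  fix s e :: real assume s: "s < 1" and e: "e > 0"
  note b = B.bounded_byD[OF YB]
  define d where "d = e / (2 * (b + 1))"
  have d: "d > 0" "d * b \<le> e / 2" using b(2) e by (auto simp: d_def field_simps)
  obtain t C where t: "t < 1" "0 \<le> C" "\<And>x. x \<in> bergman_bidisc \<Longrightarrow> bnorm (zcut s (X x)) \<le> d * bnorm x + C * bnorm (zcut t x)"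
    by (rule zlocalE[OF X s d(1)]) blast
  \<comment> \<open>The tolerance for \<open>Y\<close> has to beat the constant \<open>C\<close>,
    which becomes known only once \<open>X\<close> has been treated.\<close>
  define d' where "d' = e / (2 * (C + 1))"
  have d': "d' > 0" "C * d' \<le> e / 2" using t(2) e by (auto simp: d'_def field_simps)
  obtain u K where u: "u < 1" "0 \<le> K" "\<And>x. x \<in> bergman_bidisc \<Longrightarrow> bnorm (zcut t (Y x)) \<le> d' * bnorm x + K * bnorm (zcut u x)"
    by (rule zlocalE[OF Y t(1) d'(1)]) blast
  have "bnorm (zcut s (X (Y x))) \<le> e * bnorm x + C * K * bnorm (zcut u x)" if x: "x \<in> bergman_bidisc" for x
  proof -
    have "bnorm (zcut s (X (Y x))) \<le> d * bnorm (Y x) + C * bnorm (zcut t (Y x))" by (rule t(3)[OF B.op_in[OF b(1) x]])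
    also have "\<dots> \<le> d * (b * bnorm x) + C * (d' * bnorm x + K * bnorm (zcut u x))"
      using b(3)[OF x] u(3)[OF x] d t by (intro add_mono mult_left_mono) auto
    also have "\<dots> = (d * b + C * d') * bnorm x + C * K * bnorm (zcut u x)" by (simp add: algebra_simps)
    also have "\<dots> \<le> e * bnorm x + C * K * bnorm (zcut u x)" using d d' by (intro add_right_mono mult_right_mono) auto
    finally show ?thesis .
  qed
  then show "\<exists>t<1. \<exists>C\<ge>0. \<forall>x\<in>bergman_bidisc. bnorm (zcut s (X (Y x))) \<le> e * bnorm x + C * bnorm (zcut t x)"
    using u(1,2) t(2) by (intro exI[of _ u] conjI exI[of _ "C * K"]) auto
qed

lemma zlocal_tsym: "f \<in> tsym \<Longrightarrow> zlocal (toeplitz_bidisc f)"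
proof (induction rule: tsym.induct)
  case (tensor \<phi> \<psi>)
  obtain B where "bounded_symbol area_disc B \<phi>" using bounded_symbol_discI[OF tensor(1)] by blast
  moreover obtain C where "bounded_symbol area_disc C \<psi>" using bounded_symbol_discI[OF tensor(2)] by blast
  ultimately show ?case by (rule zlocal_tensor)
next
  case (add f g)
  obtain B where B: "bounded_symbol area_bidisc B f" using tsym_bounded[OF add.hyps(1)] by blast
  obtain C where C: "bounded_symbol area_bidisc C g" using tsym_bounded[OF add.hyps(2)] by blast
  show ?case
    by (rule zlocal_add[OF add.IH]) (auto intro: B.toeplitz_add[OF B C] B.L2 B.toeplitz_in[OF B] B.toeplitz_in[OF C])
qed

text \<open>A uniform approximation of the symbol from \<open>tsym\<close> costs half of the
  tolerance, locality for the approximation the other half.\<close>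

lemma zlocal_toeplitz:
  assumes f: "continuous_on (closure bidisc) f"
  shows "zlocal (toeplitz_bidisc f)"
  unfolding zlocal_def
proof (intro allI impI)
  fix s e :: real assume s: "s < 1" and "e > 0"
  then have e2: "e / 2 > 0" by simp
  obtain g where g: "g \<in> tsym" "\<forall>p\<in>closure bidisc. cmod (f p - g p) < e / 2" using tsym_dense[OF f e2] by blast
  obtain B where B: "bounded_symbol area_bidisc B f" using bounded_symbol_bidiscI[OF f] by blast
  obtain C where C: "bounded_symbol area_bidisc C g" using tsym_bounded[OF g(1)] by blast
  obtain t K where t: "t < 1" "0 \<le> K" "\<And>x. x \<in> bergman_bidisc \<Longrightarrow> bnorm (zcut s (toeplitz_bidisc g x)) \<le> e / 2 * bnorm x + K * bnorm (zcut t x)"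
    by (rule zlocalE[OF zlocal_tsym[OF g(1)] s e2]) blast
  have "bnorm (zcut s (toeplitz_bidisc f x)) \<le> e * bnorm x + K * bnorm (zcut t x)" if x: "x \<in> bergman_bidisc" for x
  proof -
    define v where "v = (\<lambda>p. toeplitz_bidisc f x p - toeplitz_bidisc g x p)"
    have v: "v \<in> L2_space area_bidisc"
      unfolding v_def by (intro L2_space_diff B.L2 B.toeplitz_in[OF B] B.toeplitz_in[OF C] x)
    have "bnorm v \<le> e / 2 * bnorm x"
      unfolding v_def using g(2) closure_subset[of bidisc] e2
      by (intro B.toeplitz_diff_norm[OF B C x]) (auto intro: less_imp_le)
    moreover have "bnorm (zcut s (\<lambda>p. v p + toeplitz_bidisc g x p)) \<le> bnorm (zcut s v) + bnorm (zcut s (toeplitz_bidisc g x))"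
      by (intro zcut_add_norm s v B.L2 B.toeplitz_in[OF C] x)
    moreover have "(\<lambda>p. v p + toeplitz_bidisc g x p) = toeplitz_bidisc f x" by (simp add: v_def)
    ultimately show ?thesis using t(3)[OF x] zcut_norm[OF s v] by simp
  qed
  with t(1,2) show "\<exists>t<1. \<exists>C\<ge>0. \<forall>x\<in>bergman_bidisc. bnorm (zcut s (toeplitz_bidisc f x)) \<le> e * bnorm x + C * bnorm (zcut t x)"
    by blast
qed

subsection \<open>Lower bounds from one family of slices\<close>

lemma toeplitz_disc_scale:
  assumes "bounded_symbol area_disc B \<phi>" "g \<in> bergman_disc"
  shows "toeplitz_disc (\<lambda>w. c * \<phi> w) g = (\<lambda>w. c * toeplitz_disc \<phi> g w)"
proof -
  have h: "(\<lambda>w. \<phi> w * g w) \<in> L2_space area_disc" by (rule L2_space_mult[OF assms(1) D.L2[OF assms(2)]])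
  show ?thesis
    unfolding D.toeplitz_apply[OF assms(2)] mult.assoc using D.proj_lin[OF h h, of c 0] by simp
qed

definition sop :: "(complex \<times> complex \<Rightarrow> complex) \<Rightarrow> (complex \<times> complex \<Rightarrow> complex) \<Rightarrow> complex \<times> complex \<Rightarrow> complex" where
  "sop f x = (\<lambda>p. toeplitz_disc (\<lambda>w. f (fst p, w)) (\<lambda>w. x (fst p, w)) (snd p))"

lemma sop_slice: "(\<lambda>w. sop f x (z, w)) = toeplitz_disc (\<lambda>w. f (z, w)) (\<lambda>w. x (z, w))"
  by (simp add: sop_def)

lemma sop_tensor:
  assumes psi: "bounded_symbol area_disc B \<psi>" and x: "x \<in> bergman_bidisc"
  shows "sop (tensor \<phi> \<psi>) x = (\<lambda>p. \<phi> (fst p) * opw \<psi> x p)"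
  using toeplitz_disc_scale[OF psi slice_fst_in[OF x]] by (auto simp: sop_def opw_def tensor_def)

lemma sop_add:
  assumes "f \<in> tsym" "g \<in> tsym" "x \<in> bergman_bidisc"
  shows "sop (\<lambda>p. f p + g p) x = (\<lambda>p. sop f x p + sop g x p)"
proof
  fix p :: "complex \<times> complex"
  obtain B C where "bounded_symbol area_disc B (\<lambda>w. f (fst p, w))" "bounded_symbol area_disc C (\<lambda>w. g (fst p, w))"
    using tsym_slice_bounded assms by blast
  from D.toeplitz_add[OF this slice_fst_in[OF assms(3)]]
  show "sop (\<lambda>p. f p + g p) x p = sop f x p + sop g x p" by (simp add: sop_def)
qed

text \<open>
  \<open>sop f x\<close> is the projection of \<open>f x\<close> in the second variable only; it differs from \<open>T\<^sub>f x\<close> by a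
  Hankel operator in the first variable.
\<close>

lemma sop_estimate:
  "f \<in> tsym \<Longrightarrow> (\<forall>x\<in>tspan. sop f x \<in> L2_space area_bidisc) \<and>
    (\<forall>e>0. \<exists>s<1. \<exists>C\<ge>0. \<forall>x\<in>tspan. bnorm (\<lambda>p. sop f x p - toeplitz_bidisc f x p) \<le> e * bnorm x + C * bnorm (zcut s x))"
proof (induction rule: tsym.induct)
  case (tensor \<phi> \<psi>)
  obtain B where phi: "bounded_symbol area_disc B \<phi>" using bounded_symbol_discI[OF tensor(1)] by blast
  obtain C where psi: "bounded_symbol area_disc C \<psi>" using bounded_symbol_discI[OF tensor(2)] by blast
  note sym = bounded_symbol_tensor[OF phi psi]
  have L2: "sop (tensor \<phi> \<psi>) x \<in> L2_space area_bidisc" if x: "x \<in> tspan" for x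
    unfolding sop_tensor[OF psi tspan_bergman[OF x]]
    using L2_space_mult[OF bounded_symbol_tensor[OF phi bounded_symbol_const[of area_disc 1]] B.L2[OF tspan_bergman[OF opw_tspan[OF psi x]]]]
    by (simp add: tensor_def)
  have eq: "(\<lambda>p. hankel \<phi> (\<lambda>z. opw \<psi> x (z, snd p)) (fst p)) = (\<lambda>p. sop (tensor \<phi> \<psi>) x p - toeplitz_bidisc (tensor \<phi> \<psi>) x p)"
    if x: "x \<in> tspan" for x
    by (simp add: sop_tensor[OF psi tspan_bergman[OF x]] toeplitz_tensor_tspan[OF phi psi x] hankel_def opz_def)
  have "\<exists>s<1. \<exists>C\<ge>0. \<forall>x\<in>tspan. bnorm (\<lambda>p. hankel \<phi> (\<lambda>z. opw \<psi> x (z, snd p)) (fst p)) \<le> e * bnorm x + C * bnorm (zcut s x)"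
    if "e > 0" for e
  proof (rule vanishing_slices[OF _ psi that])
    show "vanishing (hankel \<phi>)" using hankel_compact_continuous[OF tensor(1)] by (simp add: hankel_compact_def)
    show "(\<lambda>p. hankel \<phi> (\<lambda>z. opw \<psi> x (z, snd p)) (fst p)) \<in> L2_space area_bidisc" if x: "x \<in> tspan" for x
      unfolding eq[OF x] by (intro L2_space_diff L2 x B.L2 B.toeplitz_in[OF sym] tspan_bergman)
  qed
  with L2 show ?case by (auto simp: eq cong: conj_cong)
next
  case (add f g)
  obtain B where B: "bounded_symbol area_bidisc B f" using tsym_bounded[OF add.hyps(1)] by blast
  obtain C where C: "bounded_symbol area_bidisc C g" using tsym_bounded[OF add.hyps(2)] by blast
  have L2: "sop f x \<in> L2_space area_bidisc" "sop g x \<in> L2_space area_bidisc" if "x \<in> tspan" for x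
    using add.IH that by auto
  have "\<exists>s<1. \<exists>K\<ge>0. \<forall>x\<in>tspan. bnorm (\<lambda>p. sop (\<lambda>p. f p + g p) x p - toeplitz_bidisc (\<lambda>p. f p + g p) x p) \<le> e * bnorm x + K * bnorm (zcut s x)"
    if "e > 0" for e
  proof -
    have e2: "e / 2 > 0" using that by simp
    obtain s a where a: "s < 1" "0 \<le> a" "\<And>x. x \<in> tspan \<Longrightarrow> bnorm (\<lambda>p. sop f x p - toeplitz_bidisc f x p) \<le> e / 2 * bnorm x + a * bnorm (zcut s x)"
      using conjunct2[OF add.IH(1)] e2 by meson
    obtain t b where b: "t < 1" "0 \<le> b" "\<And>x. x \<in> tspan \<Longrightarrow> bnorm (\<lambda>p. sop g x p - toeplitz_bidisc g x p) \<le> e / 2 * bnorm x + b * bnorm (zcut t x)"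
      using conjunct2[OF add.IH(2)] e2 by meson
    have "bnorm (\<lambda>p. sop (\<lambda>p. f p + g p) x p - toeplitz_bidisc (\<lambda>p. f p + g p) x p) \<le> e * bnorm x + (a + b) * bnorm (zcut (max s t) x)"
      if x: "x \<in> tspan" for x
    proof -
      note xB = tspan_bergman[OF x]
      have "(\<lambda>p. sop (\<lambda>p. f p + g p) x p - toeplitz_bidisc (\<lambda>p. f p + g p) x p)
          = (\<lambda>p. (sop f x p - toeplitz_bidisc f x p) + (sop g x p - toeplitz_bidisc g x p))"
        by (simp add: sop_add[OF add.hyps xB] B.toeplitz_add[OF B C xB] algebra_simps)
      moreover have "bnorm \<dots> \<le> bnorm (\<lambda>p. sop f x p - toeplitz_bidisc f x p) + bnorm (\<lambda>p. sop g x p - toeplitz_bidisc g x p)"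
        by (intro L2_norm_triangle L2_space_diff L2 x B.L2 B.toeplitz_in[OF B] B.toeplitz_in[OF C] xB)
      moreover have "a * bnorm (zcut s x) \<le> a * bnorm (zcut (max s t) x)" "b * bnorm (zcut t x) \<le> b * bnorm (zcut (max s t) x)"
        using a b by (auto intro!: mult_left_mono zcut_mono B.L2[OF xB])
      ultimately show ?thesis using a(3)[OF x] b(3)[OF x] by (simp add: algebra_simps)
    qed
    then show ?thesis using a(1,2) b(1,2) by (intro exI[of _ "max s t"] conjI exI[of _ "a + b"]) auto
  qed
  moreover have "sop (\<lambda>p. f p + g p) x \<in> L2_space area_bidisc" if "x \<in> tspan" for x
    unfolding sop_add[OF add.hyps tspan_bergman[OF that]] by (intro L2_space_add L2 that)
  ultimately show ?case by blast
qed

lemma slice_continuous: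
  assumes f: "continuous_on (closure bidisc) f" and z: "z \<in> closure disc"
  shows "continuous_on (closure disc) (\<lambda>w. f (z, w))"
  by (rule continuous_on_compose2[OF f]) (use z in \<open>auto simp: closure_bidisc intro!: continuous_intros\<close>)

lemma slice_symbol:
  assumes f: "continuous_on (closure bidisc) f" and z: "z \<in> closure disc"
  shows "\<exists>B. bounded_symbol area_disc B (\<lambda>w. f (z, w))"
  using bounded_symbol_discI[OF slice_continuous[OF f z]] by blast

lemma slice_close:
  assumes f: "continuous_on (closure bidisc) f" and e: "e > 0"
  shows "\<exists>d>0. \<forall>z\<in>closure disc. \<forall>z'\<in>closure disc. dist z z' < d \<longrightarrow> (\<forall>w\<in>closure disc. cmod (f (z, w) - f (z', w)) < e)"
proof -
  have "uniformly_continuous_on (closure bidisc) f" by (rule compact_uniformly_continuous[OF f compact_closure_bidisc])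
  then obtain d where d: "d > 0" "\<And>p q. p \<in> closure bidisc \<Longrightarrow> q \<in> closure bidisc \<Longrightarrow> dist q p < d \<Longrightarrow> dist (f q) (f p) < e"
    using e unfolding uniformly_continuous_on_def by metis
  have "cmod (f (z, w) - f (z', w)) < e" if "z \<in> closure disc" "z' \<in> closure disc" "dist z z' < d" "w \<in> closure disc" for z z' w
    using d(2)[of "(z', w)" "(z, w)"] that by (simp add: closure_bidisc dist_Pair_Pair dist_norm)
  with d(1) show ?thesis by blast
qed

text \<open>By compactness: points \<open>z n\<close> tending to the circle at which the lower bound
  deteriorates would cluster at some \<open>\<zeta>\<close>. The slice at \<open>\<zeta>\<close> is
  bounded below by \<open>c\<close>, and nearby slices differ from it by less than
  \<open>c / 2\<close> in supremum, hence keep the lower bound \<open>c / 2\<close>.\<close>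

lemma uniform_lower_bound:
  assumes f: "continuous_on (closure bidisc) f"
    and below: "\<And>\<zeta>. \<zeta> \<in> sphere 0 1 \<Longrightarrow> D.bounded_below (toeplitz_disc (\<lambda>w. f (\<zeta>, w)))"
  shows "\<exists>c>0. \<exists>r<1. \<forall>z\<in>disc. r \<le> cmod z \<longrightarrow> (\<forall>g\<in>bergman_disc. c * dnorm g \<le> dnorm (toeplitz_disc (\<lambda>w. f (z, w)) g))"
proof (rule ccontr)
  assume not: "\<not> ?thesis"
  have "\<exists>z g. z \<in> disc \<and> 1 - 1 / real (Suc n) \<le> cmod z \<and> g \<in> bergman_disc \<and> dnorm (toeplitz_disc (\<lambda>w. f (z, w)) g) < 1 / real (Suc n) * dnorm g" for n
  proof -
    have "1 / real (Suc n) > 0" "1 - 1 / real (Suc n) < 1" by simp_all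
    with not show ?thesis by (meson not_le)
  qed
  then obtain z g where zg: "\<And>n. z n \<in> disc" "\<And>n. 1 - 1 / real (Suc n) \<le> cmod (z n)" "\<And>n. g n \<in> bergman_disc"
    "\<And>n. dnorm (toeplitz_disc (\<lambda>w. f (z n, w)) (g n)) < 1 / real (Suc n) * dnorm (g n)" by metis
  have inv: "(\<lambda>n. 1 / real (Suc n)) \<longlonglongrightarrow> 0" by (rule LIMSEQ_Suc[OF lim_inverse_n'])
  have sub: "disc \<subseteq> closure disc" by (rule closure_subset)
  have "compact (closure disc)" by (simp add: disc_def)
  then obtain \<zeta> k where k: "\<zeta> \<in> closure disc" "strict_mono (k :: nat \<Rightarrow> nat)" "(z \<circ> k) \<longlonglongrightarrow> \<zeta>"
    using zg(1) sub unfolding compact_def by (metis subsetD)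
  have inv': "(\<lambda>n. 1 / real (Suc (k n))) \<longlonglongrightarrow> 0" using LIMSEQ_subseq_LIMSEQ[OF inv k(2)] by (simp add: o_def)
  have lim: "(\<lambda>n. cmod (z (k n))) \<longlonglongrightarrow> cmod \<zeta>" using tendsto_norm[OF k(3)] by (simp add: o_def)
  \<comment> \<open>The moduli of the chosen points exceed these numbers, so the cluster point lies
    on the unit circle, where the hypothesis applies.\<close>
  have "(\<lambda>n. 1 - 1 / real (Suc (k n))) \<longlonglongrightarrow> 1 - 0" by (intro tendsto_intros inv')
  then have "1 - 0 \<le> cmod \<zeta>" by (rule LIMSEQ_le[OF _ lim]) (use zg(2) in auto)
  moreover have "cmod \<zeta> \<le> 1" using k(1) by (simp add: disc_def)
  ultimately have \<zeta>: "\<zeta> \<in> sphere 0 1" by simp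
  obtain c where c: "c > 0" "\<And>h. h \<in> bergman_disc \<Longrightarrow> c * dnorm h \<le> dnorm (toeplitz_disc (\<lambda>w. f (\<zeta>, w)) h)"
    using below[OF \<zeta>] unfolding D.bounded_below_def by blast
  have c2: "c / 2 > 0" using c(1) by simp
  obtain d where d: "d > 0" "\<forall>z\<in>closure disc. \<forall>z'\<in>closure disc. dist z z' < d \<longrightarrow> (\<forall>w\<in>closure disc. cmod (f (z, w) - f (z', w)) < c / 2)"
    using slice_close[OF f c2] by blast
  obtain n where n: "dist (z (k n)) \<zeta> < d" "1 / real (Suc (k n)) < c / 2"
    using eventually_happens[OF eventually_conj[OF tendstoD[OF k(3) d(1)] order_tendstoD(2)[OF inv' c2]]] by (auto simp: o_def)
  define m where "m = k n"
  have zm: "z m \<in> closure disc" using zg(1) sub by blast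
  obtain B where B: "bounded_symbol area_disc B (\<lambda>w. f (\<zeta>, w))" using slice_symbol[OF f k(1)] by blast
  obtain C where C: "bounded_symbol area_disc C (\<lambda>w. f (z m, w))" using slice_symbol[OF f zm] by blast
  have "dnorm (\<lambda>u. toeplitz_disc (\<lambda>w. f (\<zeta>, w)) (g m) u - toeplitz_disc (\<lambda>w. f (z m, w)) (g m) u) \<le> c / 2 * dnorm (g m)"
  proof (rule D.toeplitz_diff_norm[OF B C zg(3)])
    show "cmod (f (\<zeta>, w) - f (z m, w)) \<le> c / 2" if "w \<in> space area_disc" for w
      using d(2) zm k(1) n(1) that sub unfolding m_def by (simp add: norm_minus_commute[of "f (\<zeta>, w)"] less_imp_le subset_iff)
  qed (use c in simp)
  then have "c * dnorm (g m) \<le> dnorm (toeplitz_disc (\<lambda>w. f (z m, w)) (g m)) + c / 2 * dnorm (g m)"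
    using c(2)[OF zg(3)[of m]] L2_norm_triangle_sub[OF D.L2[OF D.toeplitz_in[OF B zg(3)]] D.L2[OF D.toeplitz_in[OF C zg(3)]], of m m] by linarith
  moreover have "1 / real (Suc m) * dnorm (g m) \<le> c / 2 * dnorm (g m)" using n(2) by (intro mult_right_mono) (auto simp: m_def)
  ultimately show False using zg(4)[of m] by (simp add: field_simps)
qed

text \<open>The slicewise operator inherits the uniform lower bound in the collar
  \<open>r < cmod z\<close>. It is comparable to the Toeplitz operator up to a Hankel error for sums
  of products, so \<open>f\<close> is first replaced by a nearby \<open>F\<close> in
  \<open>tsym\<close>.\<close>

lemma one_sided_estimate:
  assumes f: "continuous_on (closure bidisc) f"
    and below: "\<And>\<zeta>. \<zeta> \<in> sphere 0 1 \<Longrightarrow> D.bounded_below (toeplitz_disc (\<lambda>w. f (\<zeta>, w)))"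
  shows "\<exists>s<1. \<exists>C\<ge>0. \<forall>x\<in>bergman_bidisc. bnorm x \<le> C * (bnorm (toeplitz_bidisc f x) + bnorm (zcut s x))"
proof -
  obtain c r where c: "c > 0" "r < 1" "\<And>z g. z \<in> disc \<Longrightarrow> r \<le> cmod z \<Longrightarrow> g \<in> bergman_disc \<Longrightarrow> c * dnorm g \<le> dnorm (toeplitz_disc (\<lambda>w. f (z, w)) g)"
    using uniform_lower_bound[OF f below] by blast
  \<comment> \<open>Of the lower bound \<open>8 \<delta>\<close>, one \<open>\<delta>\<close> is
    lost when the slices of \<open>f\<close> are replaced by those of \<open>F\<close>, one in
    comparing \<open>sop F\<close> with the operator of \<open>F\<close>, and one in returning from
    \<open>F\<close> to \<open>f\<close>. The last two are measured against the full norm of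
    \<open>x\<close>, so \<open>5 \<delta>\<close> remain.\<close>
  define \<delta> where "\<delta> = c / 8"
  have \<delta>: "\<delta> > 0" "c = 8 * \<delta>" using c(1) by (simp_all add: \<delta>_def)
  obtain F where F: "F \<in> tsym" "\<forall>p\<in>closure bidisc. cmod (f p - F p) < \<delta>" using tsym_dense[OF f \<delta>(1)] by blast
  obtain B where B: "bounded_symbol area_bidisc B f" using bounded_symbol_bidiscI[OF f] by blast
  obtain B' where B': "bounded_symbol area_bidisc B' F" using tsym_bounded[OF F(1)] by blast
  have sopL2: "sop F x \<in> L2_space area_bidisc" if "x \<in> tspan" for x using sop_estimate[OF F(1)] that by blast
  obtain s C where sC: "s < 1" "0 \<le> C" "\<And>x. x \<in> tspan \<Longrightarrow> bnorm (\<lambda>p. sop F x p - toeplitz_bidisc F x p) \<le> \<delta> * bnorm x + C * bnorm (zcut s x)"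
    using conjunct2[OF sop_estimate[OF F(1)]] \<delta>(1) by meson
  define t where "t = max r s"
  have t: "t < 1" "r \<le> t" "s \<le> t" using c sC by (auto simp: t_def)
  define K where "K = (1 + C + 7 * \<delta>) / (5 * \<delta>)"
  have K: "0 \<le> K" using sC \<delta> by (simp add: K_def)
  have main: "bnorm x \<le> K * bnorm (toeplitz_bidisc f x) + K * bnorm (zcut t x)" if x: "x \<in> tspan" for x
  proof -
    note xB = tspan_bergman[OF x]
    have xL2: "x \<in> L2_space area_bidisc" by (rule B.L2[OF xB])
    \<comment> \<open>Only slices with \<open>cmod z > r\<close> contribute on the left, because the
      cut removes the others completely.\<close>
    have far: "7 * \<delta> * bnorm (\<lambda>p. x p - zcut r x p) \<le> bnorm (sop F x)"
    proof -
      have "bnorm (\<lambda>p. x p - zcut r x p) \<le> 1 / (7 * \<delta>) * bnorm (sop F x)"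
      proof (rule slice_dominated_single)
        fix z assume z: "z \<in> disc"
        show "dnorm (\<lambda>w. x (z, w) - zcut r x (z, w)) \<le> 1 / (7 * \<delta>) * dnorm (\<lambda>w. sop F x (z, w))"
        proof (cases "cmod z \<le> r")
          case True
          then have "(\<lambda>w. x (z, w) - zcut r x (z, w)) = (\<lambda>w. 0)" by (simp add: zcut_def)
          then show ?thesis using \<delta> by simp
        next
          case False
          then have eq: "(\<lambda>w. x (z, w) - zcut r x (z, w)) = (\<lambda>w. x (z, w))" by (simp add: zcut_def)
          define g where "g = (\<lambda>w. x (z, w))"
          have g: "g \<in> bergman_disc" unfolding g_def by (rule slice_fst_in[OF xB])
          have zc: "z \<in> closure disc" using z closure_subset by blast
          obtain b where b: "bounded_symbol area_disc b (\<lambda>w. f (z, w))" using slice_symbol[OF f zc] by blast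
          obtain b' where b': "bounded_symbol area_disc b' (\<lambda>w. F (z, w))" using tsym_slice_bounded[OF F(1)] by blast
          have "dnorm (\<lambda>u. toeplitz_disc (\<lambda>w. f (z, w)) g u - toeplitz_disc (\<lambda>w. F (z, w)) g u) \<le> \<delta> * dnorm g"
          proof (rule D.toeplitz_diff_norm[OF b b' g])
            show "cmod (f (z, w) - F (z, w)) \<le> \<delta>" if "w \<in> space area_disc" for w
            proof -
              have "w \<in> closure disc" using that closure_subset by auto
              then show ?thesis using F(2) zc by (auto simp: closure_bidisc intro: less_imp_le)
            qed
          qed (use \<delta> in simp)
          then have "c * dnorm g \<le> dnorm (toeplitz_disc (\<lambda>w. F (z, w)) g) + \<delta> * dnorm g"
            using c(3)[OF z _ g] False L2_norm_triangle_sub[OF D.L2[OF D.toeplitz_in[OF b g]] D.L2[OF D.toeplitz_in[OF b' g]]] by linarith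
          then have "7 * \<delta> * dnorm g \<le> dnorm (toeplitz_disc (\<lambda>w. F (z, w)) g)" by (simp add: \<delta>(2))
          then show ?thesis unfolding eq sop_slice g_def[symmetric] using \<delta> by (simp add: field_simps)
        qed
      qed (use \<delta> c(2) in \<open>auto intro!: L2_space_diff zcut_L2 xL2 sopL2 x\<close>)
      then show ?thesis using \<delta> by (simp add: field_simps)
    qed
    have 1: "bnorm x \<le> bnorm (zcut r x) + bnorm (\<lambda>p. x p - zcut r x p)"
      by (rule L2_norm_triangle_sub[OF xL2 zcut_L2[OF c(2) xL2]])
    have 2: "bnorm (sop F x) \<le> bnorm (toeplitz_bidisc F x) + (\<delta> * bnorm x + C * bnorm (zcut s x))"
      using L2_norm_triangle_sub[OF sopL2[OF x] B.L2[OF B.toeplitz_in[OF B' xB]]] sC(3)[OF x] by linarith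
    have "bnorm (\<lambda>p. toeplitz_bidisc F x p - toeplitz_bidisc f x p) \<le> \<delta> * bnorm x"
      using F(2) closure_subset[of bidisc] \<delta>
      by (intro B.toeplitz_diff_norm[OF B' B xB]) (auto simp: norm_minus_commute intro: less_imp_le)
    then have 3: "bnorm (toeplitz_bidisc F x) \<le> bnorm (toeplitz_bidisc f x) + \<delta> * bnorm x"
      using L2_norm_triangle_sub[OF B.L2[OF B.toeplitz_in[OF B' xB]] B.L2[OF B.toeplitz_in[OF B xB]]] by linarith
    have 4: "bnorm (zcut r x) \<le> bnorm (zcut t x)" by (rule zcut_mono[OF t(2,1) xL2])
    have 5: "C * bnorm (zcut s x) \<le> C * bnorm (zcut t x)" using sC by (intro mult_left_mono zcut_mono[OF t(3,1) xL2])
    have "7 * \<delta> * bnorm x \<le> 7 * \<delta> * (bnorm (zcut r x) + bnorm (\<lambda>p. x p - zcut r x p))"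
      using \<delta>(1) by (intro mult_left_mono 1) simp
    also have "\<dots> \<le> 7 * \<delta> * (bnorm (zcut t x) + bnorm (\<lambda>p. x p - zcut r x p))"
      using \<delta>(1) by (intro mult_left_mono add_right_mono 4) simp
    finally have "7 * \<delta> * bnorm x \<le> 7 * \<delta> * bnorm (zcut t x) + 7 * \<delta> * bnorm (\<lambda>p. x p - zcut r x p)"
      by (simp only: distrib_left)
    then have "5 * \<delta> * bnorm x \<le> bnorm (toeplitz_bidisc f x) + (C + 7 * \<delta>) * bnorm (zcut t x)"
      using far 2 3 5 by (simp add: algebra_simps)
    also have "\<dots> \<le> (1 + C + 7 * \<delta>) * bnorm (toeplitz_bidisc f x) + (1 + C + 7 * \<delta>) * bnorm (zcut t x)"
    proof -
      have "1 * bnorm (toeplitz_bidisc f x) \<le> (1 + C + 7 * \<delta>) * bnorm (toeplitz_bidisc f x)"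
        "(C + 7 * \<delta>) * bnorm (zcut t x) \<le> (1 + C + 7 * \<delta>) * bnorm (zcut t x)"
        using sC(2) \<delta>(1) by (intro mult_right_mono; simp)+
      then show ?thesis by linarith
    qed
    also have "1 + C + 7 * \<delta> = 5 * \<delta> * K" using \<delta>(1) by (simp add: K_def)
    finally have "5 * \<delta> * bnorm x \<le> 5 * \<delta> * (K * bnorm (toeplitz_bidisc f x) + K * bnorm (zcut t x))"
      by (simp only: distrib_left mult.assoc)
    then show ?thesis by (rule mult_left_le_imp_le) (use \<delta>(1) in simp)
  qed
  have "bnorm x \<le> K * (bnorm (toeplitz_bidisc f x) + bnorm (zcut t x))" if "x \<in> bergman_bidisc" for x
    using tspan_estimate[OF blip_id blip_toeplitz[OF B] blip_zcut[OF t(1)] _ K K, of 0] main that by (simp add: distrib_left)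
  with t(1) K show ?thesis by blast
qed

lemma continuous_swp:
  assumes "continuous_on (closure bidisc) f"
  shows "continuous_on (closure bidisc) (swp f)"
  unfolding swp_def
  by (rule continuous_on_compose2[OF assms]) (auto simp: closure_bidisc intro!: continuous_intros)

subsection \<open>Combining the two families of slices\<close>

lemma wcut_toeplitz:
  assumes r: "r < 1" and x: "x \<in> bergman_bidisc"
  shows "wcut r x = (\<lambda>p. indicator (disc \<times> cball 0 r) p * x p)"
proof
  fix p show "wcut r x p = indicator (disc \<times> cball 0 r) p * x p"
    using bergman_bidiscD(3)[OF x, of p] by (cases p) (auto simp: wcut_def indicator_def bidisc_def)
qed

lemma disc_cball_sets: "r < 1 \<Longrightarrow> disc \<times> cball 0 r \<in> sets area_bidisc"
  unfolding area_bidisc_pair by (intro pair_measureI cball_sets_area_disc sets_area_disc) (auto simp: open_disc)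

text \<open>On the bidisc the indicator is a product with constant first factor, so the operator
  acts in \<open>w\<close> alone and does not mix slices with different \<open>z\<close>. The cut in
  \<open>z\<close> therefore passes through with the same radius and without an error term, and the
  cut in \<open>w\<close> is kept on the right.\<close>

lemma zcut_toeplitz_indicator:
  assumes r: "r < 1" and s: "s < 1" and x: "x \<in> bergman_bidisc"
  shows "bnorm (zcut s (toeplitz_bidisc (indicator (disc \<times> cball 0 r)) x)) \<le> bnorm (zcut s (wcut r x))"
proof -
  note one = bounded_symbol_const[of area_disc 1]
  note ind = bounded_symbol_indicator[OF cball_sets_area_disc[OF r]]
  note ind2 = bounded_symbol_indicator[OF disc_cball_sets[OF r]]
  have eq: "toeplitz_bidisc (indicator (disc \<times> cball 0 r)) x = opw (indicator (cball 0 r)) x" if x: "x \<in> tspan" for x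
  proof -
    \<comment> \<open>The two symbols differ off the bidisc; \<open>toeplitz_cong\<close> compares
      them on the space of the measure.\<close>
    have "toeplitz_bidisc (indicator (disc \<times> cball 0 r)) x = toeplitz_bidisc (tensor (\<lambda>z. 1) (indicator (cball 0 r))) x"
      by (rule B.toeplitz_cong[OF ind2 bounded_symbol_tensor[OF one ind] _ tspan_bergman[OF x]])
        (auto simp: bidisc_def indicator_def)
    also have "\<dots> = opz (\<lambda>z. 1) (opw (indicator (cball 0 r)) x)" by (rule toeplitz_tensor_tspan[OF one ind x])
    also have "\<dots> = opw (indicator (cball 0 r)) x"
      unfolding opz_def by (subst D.toeplitz_const[OF slice_snd_in[OF tspan_bergman[OF opw_tspan[OF ind x]]]]) simp
    finally show ?thesis .
  qed
  have "bnorm (zcut s (toeplitz_bidisc (indicator (disc \<times> cball 0 r)) x)) \<le> 0 * bnorm x + 1 * bnorm (zcut s (wcut r x)) + 0 * bnorm x"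
  proof (rule tspan_estimate[OF blip_zcut_toeplitz[OF ind2 s] blip_zcut_wcut[OF s r] blip_id _ _ _ _ x])
    fix x assume xt: "x \<in> tspan"
    note x = tspan_bergman[OF xt]
    have "bnorm (zcut s (opw (indicator (cball 0 r)) x)) \<le> 1 * bnorm (zcut s (wcut r x))"
    proof (rule slice_dominated_single)
      fix z
      have "dnorm (toeplitz_disc (indicator (cball 0 r)) (\<lambda>w. x (z, w))) \<le> dnorm (\<lambda>w. indicator (cball 0 r) w * x (z, w))"
        unfolding D.toeplitz_apply[OF slice_fst_in[OF x]]
        by (rule D.proj_norm[OF L2_space_mult[OF ind D.L2[OF slice_fst_in[OF x]]]])
      then show "dnorm (\<lambda>w. zcut s (opw (indicator (cball 0 r)) x) (z, w)) \<le> 1 * dnorm (\<lambda>w. zcut s (wcut r x) (z, w))"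
        unfolding zcut_def wcut_def fst_conv snd_conv L2_norm_scale opw_slice by (simp add: mult_left_mono)
    qed (auto intro!: zcut_L2 s wcut_L2 r B.L2[OF x] B.L2[OF tspan_bergman[OF opw_tspan[OF ind xt]]])
    then show "bnorm (zcut s (toeplitz_bidisc (indicator (disc \<times> cball 0 r)) x)) \<le> 0 * bnorm x + 1 * bnorm (zcut s (wcut r x)) + 0 * bnorm x"
      by (simp add: eq[OF xt])
  qed auto
  then show ?thesis by simp
qed

text \<open>The symbol is discontinuous and thus outside the scope of
  \<open>zlocal_toeplitz\<close>; dropping the cut in \<open>w\<close> from the preceding exact
  estimate gives locality.\<close>

lemma zlocal_indicator:
  assumes r: "r < 1"
  shows "zlocal (toeplitz_bidisc (indicator (disc \<times> cball 0 r)))"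
  unfolding zlocal_def
proof (intro allI impI)
  fix s e :: real assume s: "s < 1" and e: "e > 0"
  have "bnorm (zcut s (toeplitz_bidisc (indicator (disc \<times> cball 0 r)) x)) \<le> e * bnorm x + 1 * bnorm (zcut s x)"
    if x: "x \<in> bergman_bidisc" for x
  proof -
    have "zcut s (wcut r x) = wcut r (zcut s x)" by (simp add: zcut_def wcut_def mult.left_commute)
    then have "bnorm (zcut s (wcut r x)) \<le> bnorm (zcut s x)" using wcut_norm[OF r zcut_L2[OF s B.L2[OF x]]] by simp
    moreover have "0 \<le> e * bnorm x" using e by simp
    ultimately show ?thesis using zcut_toeplitz_indicator[OF r s x] by linarith
  qed
  with s show "\<exists>t<1. \<exists>C\<ge>0. \<forall>x\<in>bergman_bidisc. bnorm (zcut s (toeplitz_bidisc (indicator (disc \<times> cball 0 r)) x)) \<le> e * bnorm x + C * bnorm (zcut t x)"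
    using zero_le_one by blast
qed

lemma zlocal_scale:
  assumes X: "zlocal X" and eq: "\<And>x. x \<in> bergman_bidisc \<Longrightarrow> Z x = (\<lambda>p. c * X x p)"
  shows "zlocal Z"
  unfolding zlocal_def
proof (intro allI impI)
  fix s e :: real assume s: "s < 1" and e: "e > 0"
  define d where "d = e / (cmod c + 1)"
  have pos: "cmod c + 1 > 0" by (simp add: add_nonneg_pos)
  then have d: "d > 0" "cmod c * d \<le> e" using e by (simp_all add: d_def field_simps)
  obtain t C where t: "t < 1" "0 \<le> C" "\<And>x. x \<in> bergman_bidisc \<Longrightarrow> bnorm (zcut s (X x)) \<le> d * bnorm x + C * bnorm (zcut t x)"
    by (rule zlocalE[OF X s d(1)]) blast
  have "bnorm (zcut s (Z x)) \<le> e * bnorm x + (cmod c * C) * bnorm (zcut t x)" if x: "x \<in> bergman_bidisc" for x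
  proof -
    have "zcut s (Z x) = (\<lambda>p. c * zcut s (X x) p)" by (simp add: eq[OF x] zcut_def mult.left_commute)
    then have "bnorm (zcut s (Z x)) = cmod c * bnorm (zcut s (X x))" by (simp add: L2_norm_scale)
    also have "\<dots> \<le> cmod c * (d * bnorm x + C * bnorm (zcut t x))" by (intro mult_left_mono t(3) x) simp
    also have "\<dots> = (cmod c * d) * bnorm x + (cmod c * C) * bnorm (zcut t x)" by (simp add: algebra_simps)
    also have "\<dots> \<le> e * bnorm x + (cmod c * C) * bnorm (zcut t x)" using d by (intro add_right_mono mult_right_mono) auto
    finally show ?thesis .
  qed
  then show "\<exists>t<1. \<exists>C\<ge>0. \<forall>x\<in>bergman_bidisc. bnorm (zcut s (Z x)) \<le> e * bnorm x + C * bnorm (zcut t x)"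
    using t(1,2) by (intro exI[of _ t] conjI exI[of _ "cmod c * C"]) auto
qed

lemma zlocal_ident: "(\<And>x. x \<in> bergman_bidisc \<Longrightarrow> Z x = x) \<Longrightarrow> zlocal Z"
  unfolding zlocal_def
proof (intro allI impI)
  fix s e :: real assume Z: "\<And>x. x \<in> bergman_bidisc \<Longrightarrow> Z x = x" and s: "s < 1" and e: "e > 0"
  show "\<exists>t<1. \<exists>C\<ge>0. \<forall>x\<in>bergman_bidisc. bnorm (zcut s (Z x)) \<le> e * bnorm x + C * bnorm (zcut t x)"
    by (intro exI[of _ s] conjI exI[of _ 1] s ballI) (use Z e in auto)
qed

text \<open>
  Let \<open>A = T\<^sup>* T + T\<^sub>\<chi>\<close> with \<open>\<chi>\<close> the indicator of \<open>disc \<times> cball 0 r\<close>. It is coercive, so \<open>R = 1 - t A\<close> is a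
  contraction for small \<open>t > 0\<close>, and \<open>x = t (A x + R A x + \<dots> + R\<^sup>K\<^sup>-\<^sup>1 A x) + R\<^sup>K x\<close>. All the operators \<open>R\<^sup>k\<close> are local
  in the first variable, which bounds \<open>zcut s x\<close> by \<open>T x\<close> and \<open>zcut t (wcut r x)\<close>.
\<close>

lemma neumann_estimate:
  assumes f: "continuous_on (closure bidisc) f" and r: "r < 1"
    and est: "\<And>x. x \<in> bergman_bidisc \<Longrightarrow> bnorm x \<le> C * (bnorm (toeplitz_bidisc f x) + bnorm (wcut r x))"
    and s: "s < 1" and e: "e > 0"
  shows "\<exists>t<1. \<exists>C\<ge>0. \<forall>x\<in>bergman_bidisc. bnorm (zcut s x) \<le> e * bnorm x + C * (bnorm (toeplitz_bidisc f x) + bnorm (zcut t (wcut r x)))"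
proof -
  obtain B where B: "bounded_symbol area_bidisc B f" using bounded_symbol_bidiscI[OF f] by blast
  note B' = bounded_symbol_cnj[OF B]
  note ind = bounded_symbol_indicator[OF disc_cball_sets[OF r]]
  define T where "T = toeplitz_bidisc f"
  define T' where "T' = toeplitz_bidisc (\<lambda>p. cnj (f p))"
  define X where "X = toeplitz_bidisc (indicator (disc \<times> cball 0 r))"
  have T: "B.bounded_by B T" and T': "B.bounded_by B T'" and X: "B.bounded_by 1 X"
    unfolding T_def T'_def X_def by (intro B.toeplitz_bounded_by B B' ind)+
  note TB = B.bounded_byD[OF T] and TB' = B.bounded_byD[OF T'] and XB = B.bounded_byD[OF X]
  define A where "A = (\<lambda>x\<in>bergman_bidisc. \<lambda>p. T' (T x) p + X x p)"
  have est': "bnorm x \<le> C * (bnorm (toeplitz_bidisc f x) + bnorm (\<lambda>p. indicator (disc \<times> cball 0 r) p * x p))"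
    if "x \<in> bergman_bidisc" for x using est[OF that] unfolding wcut_toeplitz[OF r that] .
  have A: "A \<in> bounded_operators area_bidisc bergman_bidisc"
    "\<exists>c>0. \<forall>x\<in>bergman_bidisc. c * (bnorm x)\<^sup>2 \<le> Re (L2_inner area_bidisc (A x) x)"
    unfolding A_def T_def T'_def X_def by (rule B.coercive_parametrix[OF B disc_cball_sets[OF r] est'], assumption)+
  obtain c where c: "c > 0" "\<And>x. x \<in> bergman_bidisc \<Longrightarrow> c * (bnorm x)\<^sup>2 \<le> Re (L2_inner area_bidisc (A x) x)" using A(2) by blast
  obtain a where a: "B.bounded_by a A" using B.bounded_operatorsE[OF A(1)] by blast
  \<comment> \<open>Serves as a divisor, and \<open>a\<close> may be 0.\<close>
  define m where "m = a + 1"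
  have m: "m \<ge> 1" "\<And>x. x \<in> bergman_bidisc \<Longrightarrow> bnorm (A x) \<le> m * bnorm x"
  proof -
    show "m \<ge> 1" using B.bounded_byD(2)[OF a] by (simp add: m_def)
    show "bnorm (A x) \<le> m * bnorm x" if "x \<in> bergman_bidisc" for x
      using B.bounded_byD(3)[OF a that] by (rule order_trans) (simp add: m_def mult_right_mono)
  qed
  \<comment> \<open>Minimizes \<open>1 - 2 * t * c + t\<^sup>2 * m\<^sup>2\<close>, the resulting
    bound for the squared norm of \<open>R = 1 - t A\<close>. The minimum is
    \<open>1 - c\<^sup>2 / m\<^sup>2\<close>; \<open>q\<close> is its root, with \<open>max\<close>
    keeping the radicand nonnegative.\<close>
  define t where "t = c / m\<^sup>2"
  have t: "t > 0" using c m by (simp add: t_def)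
  define q where "q = sqrt (max 0 (1 - c\<^sup>2 / m\<^sup>2))"
  have q: "0 \<le> q" "q < 1" using c(1) m(1) by (auto simp: q_def)
  define R where "R = (\<lambda>x\<in>bergman_bidisc. \<lambda>p. x p - of_real t * A x p)"
  have R: "R \<in> bounded_operators area_bidisc bergman_bidisc"
  proof -
    have "(\<lambda>x\<in>bergman_bidisc. \<lambda>p. scalar_operator bergman_bidisc 1 x p + (\<lambda>x\<in>bergman_bidisc. \<lambda>p. - of_real t * A x p) x p)
        \<in> bounded_operators area_bidisc bergman_bidisc"
      by (intro B.add_bounded B.scalar_bounded B.scale_bounded A)
    also have "(\<lambda>x\<in>bergman_bidisc. \<lambda>p. scalar_operator bergman_bidisc 1 x p + (\<lambda>x\<in>bergman_bidisc. \<lambda>p. - of_real t * A x p) x p) = R"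
      unfolding R_def by (intro restrict_ext) (simp add: scalar_operator_def)
    finally show ?thesis .
  qed
  have Rnorm: "bnorm (R x) \<le> q * bnorm x" if x: "x \<in> bergman_bidisc" for x
  proof (rule power2_le_imp_le)
    note xL = B.L2[OF x] and AL = B.op_L2[OF A(1) x]
    have "(bnorm (R x))\<^sup>2 = (bnorm (\<lambda>p. x p - of_real t * A x p))\<^sup>2" using x by (simp add: R_def)
    also have "\<dots> = (bnorm x)\<^sup>2 - 2 * Re (L2_inner area_bidisc x (\<lambda>p. of_real t * A x p)) + (bnorm (\<lambda>p. of_real t * A x p))\<^sup>2"
      by (rule L2_norm_diff_sq[OF xL L2_space_scale[OF AL]])
    also have "Re (L2_inner area_bidisc x (\<lambda>p. of_real t * A x p)) = t * Re (L2_inner area_bidisc (A x) x)"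
      using L2_inner_cnj[of area_bidisc "A x" x] by (simp add: L2_inner_scale_right)
    also have "(bnorm (\<lambda>p. of_real t * A x p))\<^sup>2 = t\<^sup>2 * (bnorm (A x))\<^sup>2"
      unfolding L2_norm_scale by (simp add: power_mult_distrib)
    also have "(bnorm x)\<^sup>2 - 2 * (t * Re (L2_inner area_bidisc (A x) x)) + t\<^sup>2 * (bnorm (A x))\<^sup>2
        \<le> (bnorm x)\<^sup>2 - 2 * (t * (c * (bnorm x)\<^sup>2)) + t\<^sup>2 * (m * bnorm x)\<^sup>2"
      using t c(2)[OF x] m(2)[OF x] by (intro add_mono diff_mono mult_left_mono power_mono) auto
    also have "\<dots> = (1 - c\<^sup>2 / m\<^sup>2) * (bnorm x)\<^sup>2"
      using m(1) by (simp add: t_def field_simps power2_eq_square)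
    also have "\<dots> \<le> q\<^sup>2 * (bnorm x)\<^sup>2" unfolding q_def by (intro mult_right_mono) auto
    finally show "(bnorm (R x))\<^sup>2 \<le> (q * bnorm x)\<^sup>2" by (simp add: power_mult_distrib)
  qed (use q in simp)
  have Rb: "B.bounded_by q R" using R q Rnorm by (simp add: B.bounded_by_def)
  have Rloc: "zlocal R"
  proof -
    have 1: "zlocal (\<lambda>x. T' (T x))"
      unfolding T_def T'_def
      by (rule zlocal_compose[OF zlocal_toeplitz zlocal_toeplitz[OF f] T[unfolded T_def]]) (intro continuous_intros f)
    have 2: "zlocal X" unfolding X_def by (rule zlocal_indicator[OF r])
    have 3: "zlocal A"
      by (rule zlocal_add[OF 1 2]) (auto simp: A_def intro: B.L2 B.op_in[OF TB(1)] B.op_in[OF TB'(1)] B.op_in[OF XB(1)])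
    have 4: "zlocal (\<lambda>x p. - of_real t * A x p)" by (rule zlocal_scale[OF 3]) (rule refl)
    show ?thesis
    proof (rule zlocal_add[OF zlocal_ident[of "\<lambda>x. x"] 4])
      fix x assume x: "x \<in> bergman_bidisc"
      show "R x = (\<lambda>p. x p + - of_real t * A x p)" using x by (simp add: R_def)
      show "x \<in> L2_space area_bidisc" by (rule B.L2[OF x])
      show "(\<lambda>p. - of_real t * A x p) \<in> L2_space area_bidisc" by (rule L2_space_scale[OF B.op_L2[OF A(1) x]])
    qed simp
  qed
  have split: "x = (\<lambda>p. R x p + of_real t * (T' (T x) p + X x p))" if "x \<in> bergman_bidisc" for x
    using that by (simp add: R_def A_def)
  \<comment> \<open>The induction invariant for the remainder \<open>P = R\<^sup>K\<close>: besides
    its norm and its locality it records the estimate reached so far, in which the cut of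
    \<open>P x\<close> is still to be treated. All \<open>s\<close> and \<open>e\<close> are
    quantified inside because each step splits the tolerance again.\<close>
  define good where "good = (\<lambda>K P. P \<in> bounded_operators area_bidisc bergman_bidisc \<and> zlocal P \<and>
    (\<forall>x\<in>bergman_bidisc. bnorm (P x) \<le> q ^ K * bnorm x) \<and>
    (\<forall>s<1. \<forall>e>0. \<exists>u<1. \<exists>C\<ge>0. \<forall>x\<in>bergman_bidisc.
      bnorm (zcut s x) \<le> e * bnorm x + C * (bnorm (T x) + bnorm (zcut u (wcut r x))) + bnorm (zcut s (P x))))"
  have "\<exists>P. good K P" for K :: nat
  proof (induction K)
    case 0
    have "good 0 (scalar_operator bergman_bidisc 1)"
      unfolding good_def
    proof (intro conjI allI impI)
      show "scalar_operator bergman_bidisc 1 \<in> bounded_operators area_bidisc bergman_bidisc" by (rule B.scalar_bounded)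
      show "zlocal (scalar_operator bergman_bidisc 1)" by (rule zlocal_ident) (simp add: scalar_operator_def)
      show "\<forall>x\<in>bergman_bidisc. bnorm (scalar_operator bergman_bidisc 1 x) \<le> q ^ 0 * bnorm x" by (simp add: scalar_operator_def)
      fix s e :: real assume "s < 1" "e > 0"
      then show "\<exists>u<1. \<exists>C\<ge>0. \<forall>x\<in>bergman_bidisc. bnorm (zcut s x) \<le> e * bnorm x + C * (bnorm (T x) + bnorm (zcut u (wcut r x))) +
          bnorm (zcut s (scalar_operator bergman_bidisc 1 x))"
        by (intro exI[of _ 0] conjI ballI) (auto simp: scalar_operator_def)
    qed
    then show ?case by blast
  next
    case (Suc K)
    then obtain P where P: "P \<in> bounded_operators area_bidisc bergman_bidisc" "zlocal P"
      and Pn: "\<And>x. x \<in> bergman_bidisc \<Longrightarrow> bnorm (P x) \<le> q ^ K * bnorm x"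
      and Pe: "\<And>s e. s < 1 \<Longrightarrow> e > 0 \<Longrightarrow> \<exists>u<1. \<exists>C\<ge>0. \<forall>x\<in>bergman_bidisc.
        bnorm (zcut s x) \<le> e * bnorm x + C * (bnorm (T x) + bnorm (zcut u (wcut r x))) + bnorm (zcut s (P x))"
      unfolding good_def by blast
    have "good (Suc K) (compose bergman_bidisc P R)"
      unfolding good_def
    proof (intro conjI allI impI ballI)
      show "compose bergman_bidisc P R \<in> bounded_operators area_bidisc bergman_bidisc" by (rule B.compose_bounded[OF P(1) R])
      show "zlocal (compose bergman_bidisc P R)"
        by (rule zlocal_scale[OF zlocal_compose[OF P(2) Rloc Rb], where c=1]) (simp add: compose_def)
      show "bnorm (compose bergman_bidisc P R x) \<le> q ^ Suc K * bnorm x" if x: "x \<in> bergman_bidisc" for x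
      proof -
        have "bnorm (P (R x)) \<le> q ^ K * bnorm (R x)" by (rule Pn[OF B.op_in[OF R x]])
        also have "\<dots> \<le> q ^ K * (q * bnorm x)" using q by (intro mult_left_mono Rnorm x) simp
        finally show ?thesis using x by (simp add: compose_def mult_ac)
      qed
      fix s e :: real assume s: "s < 1" and e: "e > 0"
      then have e2: "e / 2 > 0" by simp
      obtain u C1 where C1: "u < 1" "0 \<le> C1" "\<And>x. x \<in> bergman_bidisc \<Longrightarrow>
        bnorm (zcut s x) \<le> e / 2 * bnorm x + C1 * (bnorm (T x) + bnorm (zcut u (wcut r x))) + bnorm (zcut s (P x))"
        using Pe[OF s e2] by blast
      \<comment> \<open>The new summand carries the factor \<open>t\<close>, so its error becomes
        \<open>t * d = e / 2\<close>.\<close>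
      define d where "d = e / (2 * t)"
      have d: "d > 0" "t * d = e / 2" using e t by (simp_all add: d_def)
      obtain v C2 where C2: "v < 1" "0 \<le> C2" "\<And>x. x \<in> bergman_bidisc \<Longrightarrow> bnorm (zcut s (P x)) \<le> d * bnorm x + C2 * bnorm (zcut v x)"
        by (rule zlocalE[OF P(2) s d(1)]) blast
      define w where "w = max u v"
      have w: "w < 1" "u \<le> w" "v \<le> w" using C1 C2 by (auto simp: w_def)
      have B0: "0 \<le> B" by (rule TB(2))
      define C3 where "C3 = C1 + t * B + t * C2"
      have C3: "0 \<le> C3" using C1 C2 t B0 by (simp add: C3_def)
      have "bnorm (zcut s x) \<le> e * bnorm x + C3 * (bnorm (T x) + bnorm (zcut w (wcut r x))) + bnorm (zcut s (compose bergman_bidisc P R x))"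
        if x: "x \<in> bergman_bidisc" for x
      proof -
        note xL = B.L2[OF x]
        have Tx: "T x \<in> bergman_bidisc" and Xx: "X x \<in> bergman_bidisc" and Rx: "R x \<in> bergman_bidisc"
          by (rule B.op_in[OF TB(1) x], rule B.op_in[OF XB(1) x], rule B.op_in[OF R x])
        have TTx: "T' (T x) \<in> bergman_bidisc" by (rule B.op_in[OF TB'(1) Tx])
        define y where "y = (\<lambda>p. of_real t * (T' (T x) p + X x p))"
        have y: "y \<in> bergman_bidisc" unfolding y_def by (intro B.scale B.add TTx Xx)
        \<comment> \<open>One further term of the Neumann expansion: \<open>x = R x + t A x\<close>,
          with \<open>y = t A x\<close> split into \<open>T' (T x)\<close> and
          \<open>X x\<close>.\<close>
        have "P x = P (\<lambda>p. R x p + y p)" using arg_cong[OF split[OF x], of P] unfolding y_def .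
        also have "\<dots> = (\<lambda>p. P (R x) p + P y p)" by (rule B.op_add[OF P(1) Rx y])
        finally have Px: "P x = (\<lambda>p. P (R x) p + P y p)" .
        have Py: "P y = (\<lambda>p. of_real t * (P (T' (T x)) p + P (X x) p))"
          unfolding y_def B.op_scale[OF P(1) B.add[OF TTx Xx]] B.op_add[OF P(1) TTx Xx] ..
        have P1: "bnorm (P z) \<le> bnorm z" if z: "z \<in> bergman_bidisc" for z
        proof -
          have "q ^ K * bnorm z \<le> 1 * bnorm z" using q by (intro mult_right_mono power_le_one) auto
          then show ?thesis using Pn[OF z] by simp
        qed
        have sum: "bnorm (zcut s (P x)) \<le> bnorm (zcut s (P (R x))) + bnorm (zcut s (P y))"
          unfolding Px by (intro zcut_add_norm s B.op_L2[OF P(1)] Rx y)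
        have "bnorm (zcut s (P y)) = t * bnorm (zcut s (\<lambda>p. P (T' (T x)) p + P (X x) p))"
        proof -
          have "zcut s (P y) = (\<lambda>p. of_real t * zcut s (\<lambda>p. P (T' (T x)) p + P (X x) p) p)"
            unfolding Py by (simp add: zcut_def mult.left_commute)
          then show ?thesis using t by (simp add: L2_norm_scale)
        qed
        also have "\<dots> \<le> t * (B * bnorm (T x) + (d * bnorm x + C2 * bnorm (zcut w (wcut r x))))"
        proof -
          have "bnorm (zcut s (\<lambda>p. P (T' (T x)) p + P (X x) p)) \<le> bnorm (zcut s (P (T' (T x)))) + bnorm (zcut s (P (X x)))"
            by (intro zcut_add_norm s B.op_L2[OF P(1)] TTx Xx)
          moreover have "bnorm (zcut s (P (T' (T x)))) \<le> B * bnorm (T x)"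
            using zcut_norm[OF s B.op_L2[OF P(1) TTx]] P1[OF TTx] TB'(3)[OF Tx] by linarith
          \<comment> \<open>Here the joint cut arises: locality of \<open>P\<close> returns a cut of
            \<open>X x\<close> in \<open>z\<close>, and such a cut is bounded by the same cut of
            \<open>wcut r x\<close>.\<close>
          moreover have "bnorm (zcut s (P (X x))) \<le> d * bnorm x + C2 * bnorm (zcut w (wcut r x))"
          proof -
            have "d * bnorm (X x) \<le> d * bnorm x" using XB(3)[OF x] d by (intro mult_left_mono) auto
            moreover have "bnorm (zcut v (X x)) \<le> bnorm (zcut w (wcut r x))"
              using zcut_toeplitz_indicator[OF r C2(1) x] zcut_mono[OF w(3,1) wcut_L2[OF r xL]] unfolding X_def by linarith
            then have "C2 * bnorm (zcut v (X x)) \<le> C2 * bnorm (zcut w (wcut r x))" using C2(2) by (rule mult_left_mono)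
            ultimately show ?thesis using C2(3)[OF Xx] by linarith
          qed
          ultimately have "bnorm (zcut s (\<lambda>p. P (T' (T x)) p + P (X x) p)) \<le> B * bnorm (T x) + (d * bnorm x + C2 * bnorm (zcut w (wcut r x)))"
            by linarith
          then show ?thesis using t by (intro mult_left_mono) auto
        qed
        also have "\<dots> = t * B * bnorm (T x) + e / 2 * bnorm x + t * C2 * bnorm (zcut w (wcut r x))"
          by (simp add: d(2)[symmetric] algebra_simps)
        finally have main: "bnorm (zcut s (P x)) \<le> bnorm (zcut s (P (R x))) + (t * B * bnorm (T x) + e / 2 * bnorm x + t * C2 * bnorm (zcut w (wcut r x)))"
          using sum by linarith
        have "C1 * (bnorm (T x) + bnorm (zcut u (wcut r x))) \<le> C1 * (bnorm (T x) + bnorm (zcut w (wcut r x)))"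
          using C1(2) by (intro mult_left_mono add_left_mono zcut_mono[OF w(2,1) wcut_L2[OF r xL]])
        moreover have "C1 * (bnorm (T x) + bnorm (zcut w (wcut r x))) + t * B * bnorm (T x) + t * C2 * bnorm (zcut w (wcut r x))
            \<le> C3 * (bnorm (T x) + bnorm (zcut w (wcut r x)))"
        proof -
          have "0 \<le> t * B * bnorm (zcut w (wcut r x))" "0 \<le> t * C2 * bnorm (T x)" using t B0 C2 by simp_all
          then show ?thesis by (simp add: C3_def algebra_simps)
        qed
        moreover have "e / 2 * bnorm x + e / 2 * bnorm x = e * bnorm x" by simp
        moreover have "compose bergman_bidisc P R x = P (R x)" using x by (simp add: compose_def)
        ultimately show ?thesis using C1(3)[OF x] main by simp
      qed
      with w(1) C3 show "\<exists>u<1. \<exists>C\<ge>0. \<forall>x\<in>bergman_bidisc. bnorm (zcut s x) \<le> e * bnorm x + C * (bnorm (T x) + bnorm (zcut u (wcut r x))) +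
          bnorm (zcut s (compose bergman_bidisc P R x))" by blast
    qed
    then show ?case by blast
  qed
  moreover have e2: "e / 2 > 0" using e by simp
  \<comment> \<open>After this many steps the remainder is below \<open>e / 2\<close> times the norm
    of \<open>x\<close>, even when its cut is ignored.\<close>
  then obtain K where K: "q ^ K < e / 2" using real_arch_pow_inv[OF _ q(2)] by blast
  ultimately obtain P where P: "good K P" by blast
  then have Pb: "P \<in> bounded_operators area_bidisc bergman_bidisc" and Pn: "\<And>x. x \<in> bergman_bidisc \<Longrightarrow> bnorm (P x) \<le> q ^ K * bnorm x"
    unfolding good_def by blast+
  obtain u C where C: "u < 1" "0 \<le> C" "\<And>x. x \<in> bergman_bidisc \<Longrightarrow>
      bnorm (zcut s x) \<le> e / 2 * bnorm x + C * (bnorm (T x) + bnorm (zcut u (wcut r x))) + bnorm (zcut s (P x))"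
    using P s e2 unfolding good_def by meson
  have "bnorm (zcut s x) \<le> e * bnorm x + C * (bnorm (T x) + bnorm (zcut u (wcut r x)))" if x: "x \<in> bergman_bidisc" for x
  proof -
    have "q ^ K * bnorm x \<le> e / 2 * bnorm x" using K by (intro mult_right_mono) auto
    then show ?thesis using C(3)[OF x] zcut_norm[OF s B.op_L2[OF Pb x]] Pn[OF x] by linarith
  qed
  with C(1,2) show ?thesis unfolding T_def by blast
qed

text \<open>The slices in \<open>w\<close> leave the error \<open>zcut s x\<close>; the slices in
  \<open>z\<close>, after exchanging the variables, leave \<open>wcut r x\<close>. Fed with the
  second estimate, \<open>neumann_estimate\<close> bounds \<open>zcut s x\<close> by a cut in both
  variables plus a small multiple of the full norm.\<close>

lemma two_sided_estimate:
  assumes f: "continuous_on (closure bidisc) f"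
    and below1: "\<And>\<zeta>. \<zeta> \<in> sphere 0 1 \<Longrightarrow> D.bounded_below (toeplitz_disc (\<lambda>w. f (\<zeta>, w)))"
    and below2: "\<And>\<zeta>. \<zeta> \<in> sphere 0 1 \<Longrightarrow> D.bounded_below (toeplitz_disc (\<lambda>z. f (z, \<zeta>)))"
  shows "\<exists>s<1. \<exists>C. \<forall>x\<in>bergman_bidisc. bnorm x \<le> C * (bnorm (toeplitz_bidisc f x) + bnorm (\<lambda>p. indicator (cball 0 s \<times> cball 0 s) p * x p))"
proof -
  obtain B where B: "bounded_symbol area_bidisc B f" using bounded_symbol_bidiscI[OF f] by blast
  obtain s C where sC: "s < 1" "0 \<le> C" "\<And>x. x \<in> bergman_bidisc \<Longrightarrow> bnorm x \<le> C * (bnorm (toeplitz_bidisc f x) + bnorm (zcut s x))"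
    using one_sided_estimate[OF f below1] by blast
  have "D.bounded_below (toeplitz_disc (\<lambda>w. swp f (\<zeta>, w)))" if "\<zeta> \<in> sphere 0 1" for \<zeta>
    using below2[OF that] by simp
  from one_sided_estimate[OF continuous_swp[OF f] this]
  obtain r D where rD: "r < 1" "0 \<le> D" "\<And>x. x \<in> bergman_bidisc \<Longrightarrow> bnorm x \<le> D * (bnorm (toeplitz_bidisc (swp f) x) + bnorm (zcut r x))"
    by blast
  have est: "bnorm x \<le> D * (bnorm (toeplitz_bidisc f x) + bnorm (wcut r x))" if x: "x \<in> bergman_bidisc" for x
  proof -
    have "bnorm (toeplitz_bidisc (swp f) (swp x)) = bnorm (toeplitz_bidisc f x)"
      unfolding toeplitz_swp[OF B x] by (intro swp_norm B.L2 B.toeplitz_in[OF B] x)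
    moreover have "bnorm (zcut r (swp x)) = bnorm (wcut r x)"
      using swp_norm[OF zcut_L2[OF rD(1) B.L2[OF swp_bergman[OF x]]]] by (simp add: swp_zcut)
    ultimately show ?thesis using rD(3)[OF swp_bergman[OF x]] by (simp add: swp_norm B.L2[OF x])
  qed
  \<comment> \<open>Makes \<open>C * e\<close> at most \<open>1 / 2\<close>, so that this multiple
    of the norm of \<open>x\<close> can be absorbed on the left; the result then doubles the
    constants.\<close>
  define e where "e = 1 / (2 * (C + 1))"
  have e: "e > 0" "C * e \<le> 1 / 2" using sC(2) by (auto simp: e_def field_simps)
  obtain t K where tK: "t < 1" "0 \<le> K" "\<And>x. x \<in> bergman_bidisc \<Longrightarrow>
      bnorm (zcut s x) \<le> e * bnorm x + K * (bnorm (toeplitz_bidisc f x) + bnorm (zcut t (wcut r x)))"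
    using neumann_estimate[OF f rD(1) est sC(1) e(1)] by blast
  \<comment> \<open>A single radius whose closed bidisc contains both cuts.\<close>
  define u where "u = max t r"
  have u: "u < 1" "t \<le> u" "r \<le> u" using tK(1) rD(1) by (auto simp: u_def)
  have "bnorm x \<le> (2 * C * (1 + K)) * (bnorm (toeplitz_bidisc f x) + bnorm (\<lambda>p. indicator (cball 0 u \<times> cball 0 u) p * x p))"
    if x: "x \<in> bergman_bidisc" for x
  proof -
    let ?i = "\<lambda>p. indicator (cball 0 u \<times> cball 0 u) p * x p"
    have "bnorm (zcut t (wcut r x)) \<le> 1 * bnorm ?i"
      using u by (intro L2_norm_dominated L2_space_measurable zcut_L2 wcut_L2 tK(1) rD(1) B.L2 x
          L2_space_mult[OF bounded_symbol_indicator[OF cball_times_sets[OF u(1) u(1)]]])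
        (auto simp: zcut_def wcut_def indicator_def mem_Times_iff)
    then have "K * (bnorm (toeplitz_bidisc f x) + bnorm (zcut t (wcut r x))) \<le> K * (bnorm (toeplitz_bidisc f x) + bnorm ?i)"
      using tK(2) by (intro mult_left_mono) auto
    then have "bnorm (zcut s x) \<le> e * bnorm x + K * (bnorm (toeplitz_bidisc f x) + bnorm ?i)" using tK(3)[OF x] by linarith
    then have "C * (bnorm (toeplitz_bidisc f x) + bnorm (zcut s x))
        \<le> C * (bnorm (toeplitz_bidisc f x) + (e * bnorm x + K * (bnorm (toeplitz_bidisc f x) + bnorm ?i)))"
      using sC(2) by (intro mult_left_mono add_left_mono)
    then have "bnorm x \<le> C * (bnorm (toeplitz_bidisc f x) + (e * bnorm x + K * (bnorm (toeplitz_bidisc f x) + bnorm ?i)))"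
      using sC(3)[OF x] by linarith
    also have "\<dots> = C * e * bnorm x + (C * bnorm (toeplitz_bidisc f x) + C * K * (bnorm (toeplitz_bidisc f x) + bnorm ?i))"
      by (simp add: algebra_simps)
    finally have "bnorm x \<le> C * e * bnorm x + (C * bnorm (toeplitz_bidisc f x) + C * K * (bnorm (toeplitz_bidisc f x) + bnorm ?i))" .
    moreover have "C * e * bnorm x \<le> 1 / 2 * bnorm x" by (intro mult_right_mono e) simp
    moreover have "C * bnorm (toeplitz_bidisc f x) \<le> C * (bnorm (toeplitz_bidisc f x) + bnorm ?i)" using sC(2) by (intro mult_left_mono) auto
    ultimately show ?thesis by (simp add: algebra_simps)
  qed
  with u(1) show ?thesis by blast
qed

subsection \<open>Peaking sequences\<close>

definition peaking :: "complex \<Rightarrow> (nat \<Rightarrow> complex \<Rightarrow> complex) \<Rightarrow> bool" where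
  "peaking \<zeta> h \<longleftrightarrow> (\<forall>n. h n \<in> bergman_disc \<and> dnorm (h n) = 1) \<and>
     (\<forall>r>0. (\<lambda>n. dnorm (\<lambda>z. indicator (disc - ball \<zeta> r) z * h n z)) \<longlonglongrightarrow> 0)"

lemma peakingD:
  assumes "peaking \<zeta> h"
  shows "h n \<in> bergman_disc" "dnorm (h n) = 1"
    "r > 0 \<Longrightarrow> (\<lambda>n. dnorm (\<lambda>z. indicator (disc - ball \<zeta> r) z * h n z)) \<longlonglongrightarrow> 0"
  using assms by (auto simp: peaking_def)

lemma disc_ball_sets: "disc - ball \<zeta> r \<in> sets area_disc" "disc \<inter> ball \<zeta> r \<in> sets area_disc"
  by (rule sets_area_disc; use open_disc in \<open>auto intro!: borel_open\<close>)+

text \<open>The powers of \<open>(\<zeta> + z) / 2\<close>, whose modulus on the disc is close to \<open>1\<close> only near \<open>\<zeta>\<close>.\<close>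

lemma peaking_exists:
  assumes \<zeta>: "\<zeta> \<in> sphere 0 1"
  shows "\<exists>h. peaking \<zeta> h"
proof -
  define q where "q = (\<lambda>n z. indicator disc z * ((\<zeta> + z) / 2) ^ n)"
  have n\<zeta>: "cmod \<zeta> = 1" using \<zeta> by simp
  \<comment> \<open>The parallelogram law for \<open>\<zeta>\<close> and \<open>z\<close> quantifies
    that the midpoint is well inside the disc unless \<open>z\<close> is close to
    \<open>\<zeta>\<close>.\<close>
  have sq: "(cmod ((\<zeta> + z) / 2))\<^sup>2 \<le> 1 - (dist \<zeta> z)\<^sup>2 / 4" if "z \<in> disc" for z
  proof -
    have "(cmod z)\<^sup>2 \<le> 1" using that by (simp add: disc_def power_le_one)
    moreover have "(cmod (\<zeta> + z))\<^sup>2 + (cmod (\<zeta> - z))\<^sup>2 = 2 * (cmod \<zeta>)\<^sup>2 + 2 * (cmod z)\<^sup>2"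
      unfolding cmod_power2 by (simp add: algebra_simps power2_eq_square)
    ultimately show ?thesis by (simp add: n\<zeta> norm_divide power_divide dist_norm)
  qed
  have le1: "cmod ((\<zeta> + z) / 2) \<le> 1" if "z \<in> disc" for z
  proof -
    have "(cmod ((\<zeta> + z) / 2))\<^sup>2 \<le> 1\<^sup>2"
      using sq[OF that] zero_le_power2[of "dist \<zeta> z"] unfolding one_power2 by linarith
    then show ?thesis by (rule power2_le_imp_le) simp
  qed
  have qb: "q n \<in> bergman_disc" for n
  proof -
    have hol: "q n holomorphic_on disc"
    proof (rule holomorphic_transform)
      show "(\<lambda>z. ((\<zeta> + z) / 2) ^ n) holomorphic_on disc" by (intro holomorphic_intros) simp
    qed (simp add: q_def)
    have "q n \<in> L2_space area_disc"
    proof (rule L2_space_dominated[OF _ L2_one[of 1]])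
      show "q n \<in> borel_measurable area_disc"
        by (rule measurable_area_discI[OF holomorphic_on_imp_continuous_on[OF hol]])
      show "cmod (q n z) \<le> 1 * cmod 1" if "z \<in> space area_disc" for z
        using le1[of z] that by (simp add: q_def norm_power power_le_one)
    qed
    then show ?thesis using hol by (simp add: bergman_disc_def q_def)
  qed
  \<comment> \<open>Evaluation at the point \<open>x * \<zeta>\<close> bounds the norm of the power
    from below, because the midpoint of \<open>\<zeta>\<close> and \<open>x * \<zeta>\<close> has
    modulus \<open>(1 + x) / 2\<close>.\<close>
  have lower: "\<exists>C>0. \<forall>n. ((1 + x) / 2) ^ n \<le> C * dnorm (q n)" if x: "0 \<le> x" "x < 1" for x
  proof -
    have xd: "of_real x * \<zeta> \<in> disc" using x by (simp add: disc_def norm_mult n\<zeta>)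
    obtain C where C: "C > 0" "\<forall>g\<in>bergman_disc. cmod (g (of_real x * \<zeta>)) \<le> C * dnorm g"
      using bergman_disc_eval[OF xd] by blast
    have "((1 + x) / 2) ^ n \<le> C * dnorm (q n)" for n
    proof -
      have "(\<zeta> + of_real x * \<zeta>) / 2 = of_real ((1 + x) / 2) * \<zeta>" by (simp add: algebra_simps add_divide_distrib)
      then have "cmod ((\<zeta> + of_real x * \<zeta>) / 2) = (1 + x) / 2"
        using x by (simp only: norm_mult n\<zeta> norm_of_real) simp
      then have "cmod (q n (of_real x * \<zeta>)) = ((1 + x) / 2) ^ n" using xd by (simp add: q_def norm_mult norm_power)
      then show ?thesis using bspec[OF C(2) qb[of n]] by simp
    qed
    then show ?thesis using C(1) by blast
  qed
  have pos: "dnorm (q n) > 0" for n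
  proof -
    obtain C where C: "C > 0" "\<forall>n. ((1 + 0) / 2) ^ n \<le> C * dnorm (q n)" using lower[of 0] by auto
    have "(0::real) < ((1 + 0) / 2) ^ n" by simp
    also have "\<dots> \<le> C * dnorm (q n)" using C(2) by blast
    finally show ?thesis using C(1) by (simp add: zero_less_mult_iff)
  qed
  define h where "h = (\<lambda>n z. of_real (1 / dnorm (q n)) * q n z)"
  have "(\<lambda>n. dnorm (\<lambda>z. indicator (disc - ball \<zeta> r) z * h n z)) \<longlonglongrightarrow> 0" if r: "r > 0" for r
  proof -
    define a where "a = sqrt (max 0 (1 - r\<^sup>2 / 4))"
    have a: "0 \<le> a" "a < 1" using r by (auto simp: a_def)
    have far: "cmod ((\<zeta> + z) / 2) \<le> a" if z: "z \<in> disc" "z \<notin> ball \<zeta> r" for z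
    proof -
      have "r\<^sup>2 \<le> (dist \<zeta> z)\<^sup>2" using z(2) r by (intro power_mono) auto
      then have "(cmod ((\<zeta> + z) / 2))\<^sup>2 \<le> max 0 (1 - r\<^sup>2 / 4)" using sq[OF z(1)] by linarith
      then show ?thesis unfolding a_def by (rule real_le_rsqrt)
    qed
    \<comment> \<open>Off the ball the powers are at most \<open>a ^ n\<close>, while
      \<open>lower\<close> at \<open>x = a\<close> shows that their norms decay no faster than
      \<open>t ^ n\<close> with \<open>t > a\<close>. After normalization the tail is of order
      \<open>(a / t) ^ n\<close>.\<close>
    define t where "t = (1 + a) / 2"
    have t: "t > 0" "a < t" using a by (auto simp: t_def)
    obtain C where C: "C > 0" "\<forall>n. t ^ n \<le> C * dnorm (q n)" using lower[OF a] unfolding t_def by blast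
    have bound: "dnorm (\<lambda>z. indicator (disc - ball \<zeta> r) z * h n z) \<le> (a / t) ^ n * (C * dnorm (\<lambda>z. 1))" for n
    proof -
      have "dnorm (\<lambda>z. indicator (disc - ball \<zeta> r) z * q n z) \<le> a ^ n * dnorm (\<lambda>z. 1)"
      proof (rule L2_norm_dominated)
        show "(\<lambda>z. indicator (disc - ball \<zeta> r) z * q n z) \<in> borel_measurable area_disc"
          by (rule L2_space_measurable[OF L2_space_mult[OF bounded_symbol_indicator[OF disc_ball_sets(1)] D.L2[OF qb]]])
        show "cmod (indicator (disc - ball \<zeta> r) z * q n z) \<le> a ^ n * cmod 1" if "z \<in> space area_disc" for z
        proof (cases "z \<in> ball \<zeta> r")
          case False
          have "cmod (((\<zeta> + z) / 2) ^ n) \<le> a ^ n"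
            unfolding norm_power using far[OF _ False] that by (intro power_mono) auto
          then show ?thesis using that False by (simp add: q_def)
        qed (use a in simp)
      qed (use a L2_one in auto)
      then have "dnorm (\<lambda>z. indicator (disc - ball \<zeta> r) z * h n z) \<le> 1 / dnorm (q n) * (a ^ n * dnorm (\<lambda>z. 1))"
        unfolding h_def mult.left_commute[of "indicator _ _"] L2_norm_scale
        using pos[of n] by (simp add: norm_divide divide_right_mono)
      also have "\<dots> \<le> C / t ^ n * (a ^ n * dnorm (\<lambda>z. 1))"
      proof (rule mult_right_mono)
        show "1 / dnorm (q n) \<le> C / t ^ n" using C(2) pos[of n] t(1) by (simp add: field_simps)
      qed (use a in simp)
      finally show ?thesis by (simp add: power_divide mult_ac)
    qed
    have lim: "(\<lambda>n. (a / t) ^ n * (C * dnorm (\<lambda>z. 1))) \<longlonglongrightarrow> 0"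
      using a t by (intro tendsto_mult_left_zero LIMSEQ_realpow_zero) auto
    show ?thesis
      by (rule tendsto_sandwich[OF _ _ tendsto_const lim]; rule always_eventually; rule allI) (rule L2_norm_nonneg, rule bound)
  qed
  moreover have "h n \<in> bergman_disc" for n unfolding h_def by (rule D.scale[OF qb])
  moreover have "dnorm (h n) = 1" for n unfolding h_def L2_norm_scale using pos[of n] by (simp add: norm_divide)
  ultimately have "peaking \<zeta> h" unfolding peaking_def by simp
  then show ?thesis by (rule exI[of "peaking \<zeta>" h])
qed

text \<open>A fixed \<open>h n\<close> has little mass in a small ball about \<open>\<zeta>\<close>,
  whereas a late \<open>h m\<close> has little mass outside it. The inner product is then at most
  \<open>1 / 2\<close> in modulus, and the squared distance of the unit vectors is at least
  \<open>2 - 1\<close>.\<close>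

lemma peaking_separated:
  assumes h: "peaking \<zeta> h" and \<zeta>: "\<zeta> \<in> sphere 0 1"
  shows "\<exists>N. \<forall>m\<ge>N. 1 \<le> dnorm (\<lambda>z. h n z - h m z)"
proof -
  note hB = peakingD(1)[OF h] and h1 = peakingD(2)[OF h]
  note hL = D.L2[OF hB]
  \<comment> \<open>The balls shrink to \<open>\<zeta>\<close>, which is not in the open disc, so
    every point of the disc leaves them eventually.\<close>
  have "(\<lambda>k. dnorm (\<lambda>z. indicator (disc \<inter> ball \<zeta> (inverse (real (Suc k)))) z * h n z)) \<longlonglongrightarrow> 0"
  proof (rule L2_norm_tail_tendsto[OF hL disc_ball_sets(2)])
    fix z assume "z \<in> space area_disc"
    then have "dist \<zeta> z > 0" using \<zeta> by (auto simp: disc_def)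
    from order_tendstoD(2)[OF LIMSEQ_inverse_real_of_nat this]
    show "\<forall>\<^sub>F k in sequentially. z \<notin> disc \<inter> ball \<zeta> (inverse (real (Suc k)))"
      by eventually_elim simp
  qed
  then have "\<forall>\<^sub>F k in sequentially. dnorm (\<lambda>z. indicator (disc \<inter> ball \<zeta> (inverse (real (Suc k)))) z * h n z) < 1 / 4"
    by (rule order_tendstoD) simp
  then obtain k where k: "dnorm (\<lambda>z. indicator (disc \<inter> ball \<zeta> (inverse (real (Suc k)))) z * h n z) < 1 / 4"
    by (auto simp: eventually_sequentially)
  define r where "r = inverse (real (Suc k))"
  have r: "r > 0" by (simp add: r_def)
  have "\<forall>\<^sub>F m in sequentially. dnorm (\<lambda>z. indicator (disc - ball \<zeta> r) z * h m z) < 1 / 4"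
    by (rule order_tendstoD(2)[OF peakingD(3)[OF h r]]) simp
  then obtain N where N: "\<And>m. m \<ge> N \<Longrightarrow> dnorm (\<lambda>z. indicator (disc - ball \<zeta> r) z * h m z) < 1 / 4"
    by (auto simp: eventually_sequentially)
  have "1 \<le> dnorm (\<lambda>z. h n z - h m z)" if m: "m \<ge> N" for m
  proof (rule power2_le_imp_le)
    let ?a = "\<lambda>z. indicator (disc \<inter> ball \<zeta> r) z * h n z" and ?b = "\<lambda>z. indicator (disc - ball \<zeta> r) z * h m z"
    note aL = L2_space_mult[OF bounded_symbol_indicator[OF disc_ball_sets(2)] hL[of n], of \<zeta> r]
    note bL = L2_space_mult[OF bounded_symbol_indicator[OF disc_ball_sets(1)] hL[of m], of \<zeta> r]
    note cL = L2_space_mult[OF bounded_symbol_indicator[OF disc_ball_sets(1)] hL[of n], of \<zeta> r]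
    have "L2_inner area_disc (h n) (h m) = L2_inner area_disc (\<lambda>z. ?a z + indicator (disc - ball \<zeta> r) z * h n z) (h m)"
      by (rule L2_inner_cong) (auto simp: indicator_def)
    also have "\<dots> = L2_inner area_disc ?a (h m) + L2_inner area_disc (h n) ?b"
      unfolding L2_inner_add_left[OF aL cL hL] using L2_inner_mult_cnj[of area_disc "indicator (disc - ball \<zeta> r)" "h n" "h m"] by simp
    finally have "cmod (L2_inner area_disc (h n) (h m)) \<le> cmod (L2_inner area_disc ?a (h m)) + cmod (L2_inner area_disc (h n) ?b)"
      by (simp only: norm_triangle_ineq)
    also have "\<dots> \<le> dnorm ?a * dnorm (h m) + dnorm (h n) * dnorm ?b"
      by (intro add_mono L2_Cauchy_Schwarz aL bL hL)
    also have "\<dots> \<le> 1 / 2" using k N[OF m] by (simp add: h1 r_def)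
    finally have "Re (L2_inner area_disc (h n) (h m)) \<le> 1 / 2" using complex_Re_le_cmod order_trans by blast
    then show "1\<^sup>2 \<le> (dnorm (\<lambda>z. h n z - h m z))\<^sup>2" unfolding L2_norm_diff_sq[OF hL hL] h1 by simp
  qed simp
  then show ?thesis by blast
qed

subsection \<open>Necessity\<close>

text \<open>Freezing the first variable at \<open>\<zeta>\<close> gives a product symbol
  \<open>F\<close>, for which the operator acts on \<open>tensor (h n) g\<close> exactly as the
  slice operator acts on \<open>g\<close>. The error symbol \<open>G\<close> is small near
  \<open>\<zeta>\<close>, and merely bounded elsewhere, where \<open>h n\<close> carries little
  mass.\<close>

lemma peaking_slice:
  assumes f: "continuous_on (closure bidisc) f" and \<zeta>: "\<zeta> \<in> sphere 0 1" and h: "peaking \<zeta> h"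
    and g: "g \<in> bergman_disc" and e: "e > 0"
  shows "\<exists>N. \<forall>n\<ge>N. bnorm (\<lambda>p. toeplitz_bidisc f (tensor (h n) g) p - tensor (h n) (toeplitz_disc (\<lambda>w. f (\<zeta>, w)) g) p) < e"
proof -
  note hB = peakingD(1)[OF h] and h1 = peakingD(2)[OF h]
  note hL = D.L2[OF hB] and gL = D.L2[OF g]
  have \<zeta>c: "\<zeta> \<in> closure disc" using \<zeta> by (simp add: disc_def)
  obtain B where B: "bounded_symbol area_bidisc B f" using bounded_symbol_bidiscI[OF f] by blast
  obtain b where b: "bounded_symbol area_disc b (\<lambda>w. f (\<zeta>, w))" using slice_symbol[OF f \<zeta>c] by blast
  note one = bounded_symbol_const[of area_disc 1]
  define F where "F = tensor (\<lambda>z. 1) (\<lambda>w. f (\<zeta>, w))"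
  have F: "bounded_symbol area_bidisc (cmod 1 * b) F" unfolding F_def by (rule bounded_symbol_tensor[OF one b])
  define G where "G = (\<lambda>p. f p - F p)"
  define M where "M = B + cmod 1 * b"
  have G: "bounded_symbol area_bidisc M G" unfolding G_def M_def by (rule bounded_symbol_diff[OF B F])
  have M: "0 \<le> M" "\<And>p. p \<in> bidisc \<Longrightarrow> cmod (G p) \<le> M" using G by (auto simp: bounded_symbol_def)
  \<comment> \<open>The part near \<open>\<zeta>\<close> is to contribute less than
    \<open>e / 2\<close>, the tail of \<open>h n\<close> the other half.\<close>
  define \<epsilon> where "\<epsilon> = e / (2 * (dnorm g + 1))"
  have gp: "dnorm g + 1 > 0" using L2_norm_nonneg[of area_disc g] by linarith
  have \<epsilon>: "\<epsilon> > 0" using e gp by (simp add: \<epsilon>_def)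
  have \<epsilon>g: "\<epsilon> * dnorm g < e / 2"
    using e gp by (simp add: \<epsilon>_def divide_simps)
  obtain d where d: "d > 0" "\<And>z w. z \<in> closure disc \<Longrightarrow> dist z \<zeta> < d \<Longrightarrow> w \<in> closure disc \<Longrightarrow> cmod (f (z, w) - f (\<zeta>, w)) < \<epsilon>"
    using slice_close[OF f \<epsilon>] \<zeta>c by blast
  have "(\<lambda>n. M * (dnorm (\<lambda>z. indicator (disc - ball \<zeta> d) z * h n z) * dnorm g)) \<longlonglongrightarrow> 0"
    using peakingD(3)[OF h d(1)] by (intro tendsto_mult_right_zero tendsto_mult_left_zero)
  moreover have "0 < e / 2" using e by simp
  ultimately have "\<forall>\<^sub>F n in sequentially. M * (dnorm (\<lambda>z. indicator (disc - ball \<zeta> d) z * h n z) * dnorm g) < e / 2"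
    by (rule order_tendstoD)
  then obtain N where N: "\<And>n. n \<ge> N \<Longrightarrow> M * (dnorm (\<lambda>z. indicator (disc - ball \<zeta> d) z * h n z) * dnorm g) < e / 2"
    by (auto simp: eventually_sequentially)
  have "bnorm (\<lambda>p. toeplitz_bidisc f (tensor (h n) g) p - tensor (h n) (toeplitz_disc (\<lambda>w. f (\<zeta>, w)) g) p) < e" if n: "n \<ge> N" for n
  proof -
    define u where "u = tensor (h n) g"
    have u: "u \<in> bergman_bidisc" unfolding u_def by (rule tensor_bergman[OF hB g])
    have un: "bnorm u = dnorm g" unfolding u_def tensor_norm[OF hL gL] h1 by simp
    have GuL: "(\<lambda>p. G p * u p) \<in> L2_space area_bidisc" by (rule L2_space_mult[OF G B.L2[OF u]])
    have "toeplitz_bidisc F u = tensor (toeplitz_disc (\<lambda>z. 1) (h n)) (toeplitz_disc (\<lambda>w. f (\<zeta>, w)) g)"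
      unfolding F_def u_def by (rule toeplitz_tensor[OF one b hB g])
    also have "toeplitz_disc (\<lambda>z. 1) (h n) = h n" unfolding D.toeplitz_const[OF hB] by simp
    finally have "(\<lambda>p. toeplitz_bidisc f (tensor (h n) g) p - tensor (h n) (toeplitz_disc (\<lambda>w. f (\<zeta>, w)) g) p) = toeplitz_bidisc G u"
      unfolding G_def B.toeplitz_diff[OF B F u] u_def[symmetric] by (simp only:)
    moreover have "bnorm (toeplitz_bidisc G u) \<le> bnorm (\<lambda>p. G p * u p)"
      unfolding B.toeplitz_apply[OF u] by (rule B.proj_norm[OF GuL])
    moreover have "bnorm (\<lambda>p. G p * u p) < e"
    proof -
      define X where "X = (\<lambda>p. tensor (indicator (disc \<inter> ball \<zeta> d)) (\<lambda>w. 1) p * (G p * u p))"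
      define Y where "Y = (\<lambda>p. tensor (indicator (disc - ball \<zeta> d)) (\<lambda>w. 1) p * (G p * u p))"
      have XL: "X \<in> L2_space area_bidisc" unfolding X_def
        by (rule L2_space_mult[OF bounded_symbol_tensor[OF bounded_symbol_indicator[OF disc_ball_sets(2)] one] GuL])
      have YL: "Y \<in> L2_space area_bidisc" unfolding Y_def
        by (rule L2_space_mult[OF bounded_symbol_tensor[OF bounded_symbol_indicator[OF disc_ball_sets(1)] one] GuL])
      have X: "bnorm X \<le> \<epsilon> * bnorm u"
      proof (rule L2_norm_dominated[OF L2_space_measurable[OF XL] B.L2[OF u]])
        fix p assume "p \<in> space area_bidisc"
        then obtain z w where p: "p = (z, w)" "z \<in> disc" "w \<in> disc" by (cases p) (auto simp: bidisc_def)
        show "cmod (X p) \<le> \<epsilon> * cmod (u p)"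
        proof (cases "z \<in> ball \<zeta> d")
          case True
          have "cmod (f (z, w) - f (\<zeta>, w)) < \<epsilon>" using p closure_subset[of disc] True by (intro d(2)) (auto simp: dist_commute)
          then have "cmod (G p) * cmod (u p) \<le> \<epsilon> * cmod (u p)" by (intro mult_right_mono) (simp_all add: G_def F_def p)
          then show ?thesis using True p by (simp add: X_def norm_mult)
        next
          case False
          then show ?thesis using \<epsilon> by (simp add: X_def p)
        qed
      qed (use \<epsilon> in simp)
      have tL: "(\<lambda>z. indicator (disc - ball \<zeta> d) z * h n z) \<in> L2_space area_disc"
        by (rule L2_space_mult[OF bounded_symbol_indicator[OF disc_ball_sets(1)] hL])
      have "bnorm Y \<le> M * bnorm (tensor (\<lambda>z. indicator (disc - ball \<zeta> d) z * h n z) g)"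
      proof (rule L2_norm_dominated[OF L2_space_measurable[OF YL] tensor_L2[OF tL gL] _ M(1)])
        fix p assume "p \<in> space area_bidisc"
        then have "cmod (G p) * cmod (u p) \<le> M * cmod (u p)" using M(2) by (intro mult_right_mono) auto
        then show "cmod (Y p) \<le> M * cmod (tensor (\<lambda>z. indicator (disc - ball \<zeta> d) z * h n z) g p)"
          by (cases "fst p \<in> disc - ball \<zeta> d") (auto simp: Y_def tensor_def u_def norm_mult)
      qed
      then have Y: "bnorm Y < e / 2" unfolding tensor_norm[OF tL gL] using N[OF n] by linarith
      have "bnorm (\<lambda>p. G p * u p) = bnorm (\<lambda>p. X p + Y p)"
        by (rule L2_norm_cong) (auto simp: X_def Y_def bidisc_def tensor_def indicator_def)
      then show ?thesis using L2_norm_triangle[OF XL YL] X Y \<epsilon>g unfolding un by linarith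
    qed
    ultimately show ?thesis by simp
  qed
  then show ?thesis by blast
qed

text \<open>Compactness of \<open>K\<close> is exploited on differences: along a subsequence the
  images of \<open>tensor (h n) g\<close> are Cauchy, so \<open>K\<close> is small on differences of
  far members. By \<open>peaking_separated\<close> such differences still have norm at least that of
  \<open>g\<close>, and on them the operator acts like the slice operator up to
  \<open>2 * e\<close>.\<close>

lemma slice_bounded_below:
  assumes f: "continuous_on (closure bidisc) f" and K: "K \<in> compact_operators area_bidisc bergman_bidisc"
    and est: "\<And>x. x \<in> bergman_bidisc \<Longrightarrow> bnorm x \<le> C * bnorm (toeplitz_bidisc f x) + bnorm (K x)"
    and \<zeta>: "\<zeta> \<in> sphere 0 1"
  shows "D.bounded_below (toeplitz_disc (\<lambda>w. f (\<zeta>, w)))"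
proof (rule D.bounded_belowI)
  fix g assume g: "g \<in> bergman_disc"
  obtain B where B: "bounded_symbol area_bidisc B f" using bounded_symbol_bidiscI[OF f] by blast
  have Kb: "K \<in> bounded_operators area_bidisc bergman_bidisc" using K by (simp add: compact_operators_def)
  have \<zeta>c: "\<zeta> \<in> closure disc" using \<zeta> by (simp add: disc_def)
  obtain b where b: "bounded_symbol area_disc b (\<lambda>w. f (\<zeta>, w))" using slice_symbol[OF f \<zeta>c] by blast
  obtain h where h: "peaking \<zeta> h" using peaking_exists[OF \<zeta>] by blast
  note hB = peakingD(1)[OF h] and h1 = peakingD(2)[OF h]
  note hL = D.L2[OF hB] and gL = D.L2[OF g]
  define k where "k = toeplitz_disc (\<lambda>w. f (\<zeta>, w)) g"
  have kL: "k \<in> L2_space area_disc" unfolding k_def by (rule D.L2[OF D.toeplitz_in[OF b g]])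
  define u where "u = (\<lambda>n. tensor (h n) g)"
  have u: "u n \<in> bergman_bidisc" "bnorm (u n) \<le> dnorm g" for n
    unfolding u_def using tensor_bergman[OF hB g] tensor_norm[OF hL gL] by (simp_all add: h1)
  from B.compact_operatorD[OF K, where u=u, OF u]
  obtain r :: "nat \<Rightarrow> nat" where r: "strict_mono r" "L2_Cauchy area_bidisc (\<lambda>n. K (u (r n)))" by (elim exE conjE)
  have "dnorm g - \<bar>C\<bar> * dnorm k \<le> (2 * \<bar>C\<bar> + 1) * e" if e: "e > 0" for e
  proof -
    define E where "E = (\<lambda>n p. toeplitz_bidisc f (u n) p - tensor (h n) k p)"
    have EL: "E n \<in> L2_space area_bidisc" for n
      unfolding E_def by (intro L2_space_diff B.L2 B.toeplitz_in[OF B] u tensor_L2 hL kL)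
    obtain N where N: "\<And>n. n \<ge> N \<Longrightarrow> bnorm (E n) < e"
      using peaking_slice[OF f \<zeta> h g e] unfolding E_def u_def k_def by blast
    obtain N' where N': "\<And>m n. m \<ge> N' \<Longrightarrow> n \<ge> N' \<Longrightarrow> bnorm (\<lambda>p. K (u (r m)) p - K (u (r n)) p) < e"
      using r(2) e unfolding L2_Cauchy_def by blast
    define n where "n = max N N'"
    obtain N'' where N'': "\<And>m. m \<ge> N'' \<Longrightarrow> 1 \<le> dnorm (\<lambda>z. h (r n) z - h m z)" using peaking_separated[OF h \<zeta>] by blast
    define m where "m = max N'' n"
    \<comment> \<open>The first factor of the test function. Since its norm is at least 1, the
      estimate for \<open>tensor c g\<close> can be reduced to one for \<open>g\<close>.\<close>
    define c where "c = (\<lambda>z. h (r n) z - h (r m) z)"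
    have cL: "c \<in> L2_space area_disc" unfolding c_def by (intro L2_space_diff hL)
    have ge: "N \<le> r n" "N \<le> r m" "N'' \<le> r m"
      using seq_suble[OF r(1), of n] seq_suble[OF r(1), of m] by (auto simp: n_def m_def)
    have c1: "1 \<le> dnorm c" unfolding c_def by (rule N''[OF ge(3)])
    define x where "x = (\<lambda>p. u (r n) p - u (r m) p)"
    have x: "x \<in> bergman_bidisc" unfolding x_def by (intro B.diff u)
    have "x = tensor c g" unfolding x_def c_def u_def tensor_def by (simp add: algebra_simps)
    then have xn: "bnorm x = dnorm c * dnorm g" by (simp only: tensor_norm[OF cL gL])
    have "toeplitz_bidisc f x = (\<lambda>p. tensor c k p + (E (r n) p - E (r m) p))"
      unfolding x_def B.op_diff[OF B.toeplitz_bounded[OF B] u(1) u(1)] E_def c_def tensor_def by (simp add: algebra_simps)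
    then have "bnorm (toeplitz_bidisc f x) \<le> bnorm (tensor c k) + (bnorm (E (r n)) + bnorm (E (r m)))"
      using L2_norm_triangle[OF tensor_L2[OF cL kL] L2_space_diff[OF EL EL], of "r n" "r m"] L2_norm_triangle_diff[OF EL EL, of "r n" "r m"] by simp
    then have Tx: "bnorm (toeplitz_bidisc f x) \<le> dnorm c * dnorm k + 2 * e"
      using N[OF ge(1)] N[OF ge(2)] unfolding tensor_norm[OF cL kL] by linarith
    have "bnorm (K x) < e" unfolding x_def B.op_diff[OF Kb u(1) u(1)] by (rule N') (auto simp: n_def m_def)
    moreover have "C * bnorm (toeplitz_bidisc f x) \<le> \<bar>C\<bar> * (dnorm c * dnorm k + 2 * e)"
      using Tx by (intro mult_mono) auto
    ultimately have "dnorm c * dnorm g \<le> \<bar>C\<bar> * (dnorm c * dnorm k + 2 * e) + e" using est[OF x] unfolding xn by linarith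
    then have *: "dnorm c * (dnorm g - \<bar>C\<bar> * dnorm k) \<le> (2 * \<bar>C\<bar> + 1) * e" by (simp add: algebra_simps)
    \<comment> \<open>The factor \<open>dnorm c \<ge> 1\<close> may be dropped when the bracket is
      nonnegative; otherwise the claim is immediate.\<close>
    show ?thesis
    proof (cases "dnorm g - \<bar>C\<bar> * dnorm k \<ge> 0")
      case True
      have "dnorm g - \<bar>C\<bar> * dnorm k \<le> dnorm c * (dnorm g - \<bar>C\<bar> * dnorm k)"
        using mult_right_mono[OF c1 True] by (simp only: mult_1)
      then show ?thesis using * by (rule order_trans)
    next
      case False
      then have "dnorm g - \<bar>C\<bar> * dnorm k \<le> 0" by simp
      also have "0 \<le> (2 * \<bar>C\<bar> + 1) * e" using e by simp
      finally show ?thesis .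
    qed
  qed
  note le = this
  have "dnorm g \<le> \<bar>C\<bar> * dnorm k + e" if e: "e > 0" for e
  proof -
    have "2 * \<bar>C\<bar> + 1 > 0" by linarith
    then show ?thesis using le[of "e / (2 * \<bar>C\<bar> + 1)"] e by simp
  qed
  then show "dnorm g \<le> \<bar>C\<bar> * dnorm (toeplitz_disc (\<lambda>w. f (\<zeta>, w)) g)" unfolding k_def by (rule field_le_epsilon)
qed

lemma swp_compact:
  assumes K: "K \<in> compact_operators area_bidisc bergman_bidisc"
  shows "(\<lambda>x\<in>bergman_bidisc. swp (K (swp x))) \<in> compact_operators area_bidisc bergman_bidisc"
  unfolding B.compact_operators_iff
proof (intro conjI allI impI)
  have Kb: "K \<in> bounded_operators area_bidisc bergman_bidisc" using K by (simp add: compact_operators_def)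
  obtain C where C: "B.bounded_by C K" using B.bounded_operatorsE[OF Kb] by blast
  show "(\<lambda>x\<in>bergman_bidisc. swp (K (swp x))) \<in> bounded_operators area_bidisc bergman_bidisc"
  proof (rule B.bounded_operatorsI)
    fix x assume x: "x \<in> bergman_bidisc"
    show "(\<lambda>x\<in>bergman_bidisc. swp (K (swp x))) x \<in> bergman_bidisc"
      using x by (simp add: swp_bergman B.op_in[OF Kb])
    show "bnorm ((\<lambda>x\<in>bergman_bidisc. swp (K (swp x))) x) \<le> C * bnorm x"
      using B.bounded_byD(3)[OF C swp_bergman[OF x]] x
      by (simp add: swp_norm B.L2 swp_bergman B.op_in[OF Kb])
  next
    fix x y a b assume xy: "x \<in> bergman_bidisc" "y \<in> bergman_bidisc"
    have "swp (\<lambda>p. a * x p + b * y p) = (\<lambda>p. a * swp x p + b * swp y p)" by (simp add: swp_def)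
    then have "swp (K (swp (\<lambda>p. a * x p + b * y p))) = swp (\<lambda>p. a * K (swp x) p + b * K (swp y) p)"
      by (simp only: B.op_lin[OF Kb swp_bergman[OF xy(1)] swp_bergman[OF xy(2)]])
    then show "(\<lambda>x\<in>bergman_bidisc. swp (K (swp x))) (\<lambda>p. a * x p + b * y p) =
        (\<lambda>p. a * (\<lambda>x\<in>bergman_bidisc. swp (K (swp x))) x p + b * (\<lambda>x\<in>bergman_bidisc. swp (K (swp x))) y p)"
      using xy by (simp add: B.lin swp_def)
  qed simp
  fix u :: "nat \<Rightarrow> complex \<times> complex \<Rightarrow> complex"
  assume u: "\<forall>n. u n \<in> bergman_bidisc \<and> bnorm (u n) \<le> 1"
  have "swp (u n) \<in> bergman_bidisc" "bnorm (swp (u n)) \<le> 1" for n using u by (simp_all add: swp_bergman swp_norm B.L2)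
  from B.compact_operatorD[OF K, where u="\<lambda>n. swp (u n)", OF this]
  obtain r :: "nat \<Rightarrow> nat" where r: "strict_mono r" "L2_Cauchy area_bidisc (\<lambda>n. K (swp (u (r n))))" by (elim exE conjE)
  have "L2_Cauchy area_bidisc (\<lambda>n. swp (K (swp (u (r n)))))"
  proof (rule L2_Cauchy_dominated[OF r(2)])
    fix m n
    have L: "K (swp (u i)) \<in> L2_space area_bidisc" for i using u by (intro B.op_L2[OF Kb] swp_bergman) simp
    have "(\<lambda>p. swp (K (swp (u (r m)))) p - swp (K (swp (u (r n)))) p) = swp (\<lambda>p. K (swp (u (r m))) p - K (swp (u (r n))) p)"
      by (simp add: swp_def)
    then show "bnorm (\<lambda>p. swp (K (swp (u (r m)))) p - swp (K (swp (u (r n)))) p)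
        \<le> 1 * bnorm (\<lambda>p. K (swp (u (r m))) p - K (swp (u (r n))) p)"
      by (simp only: swp_norm[OF L2_space_diff[OF L L]])
  qed simp
  moreover have "(\<lambda>n. (\<lambda>x\<in>bergman_bidisc. swp (K (swp x))) (u (r n))) = (\<lambda>n. swp (K (swp (u (r n)))))" using u by simp
  ultimately show "\<exists>r::nat \<Rightarrow> nat. strict_mono r \<and> L2_Cauchy area_bidisc (\<lambda>n. (\<lambda>x\<in>bergman_bidisc. swp (K (swp x))) (u (r n)))"
    using r(1) by (intro exI[of _ r]) simp
qed

lemma slice_bounded_below_snd:
  assumes f: "continuous_on (closure bidisc) f" and K: "K \<in> compact_operators area_bidisc bergman_bidisc"
    and est: "\<And>x. x \<in> bergman_bidisc \<Longrightarrow> bnorm x \<le> C * bnorm (toeplitz_bidisc f x) + bnorm (K x)"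
    and \<zeta>: "\<zeta> \<in> sphere 0 1"
  shows "D.bounded_below (toeplitz_disc (\<lambda>z. f (z, \<zeta>)))"
proof -
  obtain B where B: "bounded_symbol area_bidisc B f" using bounded_symbol_bidiscI[OF f] by blast
  have Kb: "K \<in> bounded_operators area_bidisc bergman_bidisc" using K by (simp add: compact_operators_def)
  have "D.bounded_below (toeplitz_disc (\<lambda>w. swp f (\<zeta>, w)))"
  proof (rule slice_bounded_below[OF continuous_swp[OF f] swp_compact[OF K] _ \<zeta>])
    fix x assume x: "x \<in> bergman_bidisc"
    note sx = swp_bergman[OF x]
    have "toeplitz_bidisc (swp f) x = swp (toeplitz_bidisc f (swp x))" using toeplitz_swp[OF B sx] by simp
    then show "bnorm x \<le> C * bnorm (toeplitz_bidisc (swp f) x) + bnorm ((\<lambda>x\<in>bergman_bidisc. swp (K (swp x))) x)"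
      using est[OF sx] x by (simp add: swp_norm B.L2 B.op_in[OF Kb] B.toeplitz_in[OF B] sx)
  qed
  then show ?thesis by simp
qed

text \<open>Both implications are run for the continuous symbols \<open>f - c\<close> and its
  conjugate, which stand for the operator and its adjoint. The two closed bidiscs arising in the
  second implication may have different radii, which \<open>B.not_essential_spectrumI\<close>
  permits.\<close>

lemma essential_spectrum_iff_slices:
  assumes f: "continuous_on (closure bidisc) f"
  shows "c \<notin> essential_spectrum area_bidisc bergman_bidisc (toeplitz_bidisc f) \<longleftrightarrow>
    (\<forall>\<zeta>\<in>sphere 0 1. c \<notin> op_spectrum area_disc bergman_disc (toeplitz_disc (\<lambda>w. f (\<zeta>, w)))) \<and>
    (\<forall>\<zeta>\<in>sphere 0 1. c \<notin> op_spectrum area_disc bergman_disc (toeplitz_disc (\<lambda>z. f (z, \<zeta>))))"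
proof -
  obtain B where B: "bounded_symbol area_bidisc B f" using bounded_symbol_bidiscI[OF f] by blast
  have f1: "continuous_on (closure bidisc) (\<lambda>p. f p - c)" and f2: "continuous_on (closure bidisc) (\<lambda>p. cnj (f p - c))"
    by (intro continuous_intros f)+
  have fst_iff: "c \<notin> op_spectrum area_disc bergman_disc (toeplitz_disc (\<lambda>w. f (\<zeta>, w))) \<longleftrightarrow>
    D.bounded_below (toeplitz_disc (\<lambda>w. f (\<zeta>, w) - c)) \<and> D.bounded_below (toeplitz_disc (\<lambda>w. cnj (f (\<zeta>, w) - c)))"
    if "\<zeta> \<in> sphere 0 1" for \<zeta>
  proof -
    have "\<zeta> \<in> closure disc" using that by (simp add: disc_def)
    then obtain b where "bounded_symbol area_disc b (\<lambda>w. f (\<zeta>, w))" using slice_symbol[OF f] by blast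
    then show ?thesis by (rule D.op_spectrum_toeplitz_iff)
  qed
  have snd_iff: "c \<notin> op_spectrum area_disc bergman_disc (toeplitz_disc (\<lambda>z. f (z, \<zeta>))) \<longleftrightarrow>
    D.bounded_below (toeplitz_disc (\<lambda>z. f (z, \<zeta>) - c)) \<and> D.bounded_below (toeplitz_disc (\<lambda>z. cnj (f (z, \<zeta>) - c)))"
    if "\<zeta> \<in> sphere 0 1" for \<zeta>
  proof -
    have "\<zeta> \<in> closure disc" using that by (simp add: disc_def)
    then obtain b where "bounded_symbol area_disc b (\<lambda>w. swp f (\<zeta>, w))" using slice_symbol[OF continuous_swp[OF f]] by blast
    then have "bounded_symbol area_disc b (\<lambda>z. f (z, \<zeta>))" by simp
    then show ?thesis by (rule D.op_spectrum_toeplitz_iff)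
  qed
  show ?thesis
  proof
    assume c: "c \<notin> essential_spectrum area_bidisc bergman_bidisc (toeplitz_bidisc f)"
    obtain C1 K1 where 1: "K1 \<in> compact_operators area_bidisc bergman_bidisc"
      "\<And>x. x \<in> bergman_bidisc \<Longrightarrow> bnorm x \<le> C1 * bnorm (toeplitz_bidisc (\<lambda>p. f p - c) x) + bnorm (K1 x)"
      using B.fredholm_estimate(1)[OF B c] by blast
    obtain C2 K2 where 2: "K2 \<in> compact_operators area_bidisc bergman_bidisc"
      "\<And>x. x \<in> bergman_bidisc \<Longrightarrow> bnorm x \<le> C2 * bnorm (toeplitz_bidisc (\<lambda>p. cnj (f p - c)) x) + bnorm (K2 x)"
      using B.fredholm_estimate(2)[OF B c] by blast
    show "(\<forall>\<zeta>\<in>sphere 0 1. c \<notin> op_spectrum area_disc bergman_disc (toeplitz_disc (\<lambda>w. f (\<zeta>, w)))) \<and>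
        (\<forall>\<zeta>\<in>sphere 0 1. c \<notin> op_spectrum area_disc bergman_disc (toeplitz_disc (\<lambda>z. f (z, \<zeta>))))"
    proof (intro conjI ballI)
      fix \<zeta> :: complex assume \<zeta>: "\<zeta> \<in> sphere 0 1"
      show "c \<notin> op_spectrum area_disc bergman_disc (toeplitz_disc (\<lambda>w. f (\<zeta>, w)))"
        unfolding fst_iff[OF \<zeta>] by (intro conjI slice_bounded_below[OF f1 1 \<zeta>] slice_bounded_below[OF f2 2 \<zeta>])
      show "c \<notin> op_spectrum area_disc bergman_disc (toeplitz_disc (\<lambda>z. f (z, \<zeta>)))"
        unfolding snd_iff[OF \<zeta>] by (intro conjI slice_bounded_below_snd[OF f1 1 \<zeta>] slice_bounded_below_snd[OF f2 2 \<zeta>])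
    qed
  next
    assume "(\<forall>\<zeta>\<in>sphere 0 1. c \<notin> op_spectrum area_disc bergman_disc (toeplitz_disc (\<lambda>w. f (\<zeta>, w)))) \<and>
        (\<forall>\<zeta>\<in>sphere 0 1. c \<notin> op_spectrum area_disc bergman_disc (toeplitz_disc (\<lambda>z. f (z, \<zeta>))))"
    then have b1: "D.bounded_below (toeplitz_disc (\<lambda>w. f (\<zeta>, w) - c)) \<and> D.bounded_below (toeplitz_disc (\<lambda>w. cnj (f (\<zeta>, w) - c)))"
      and b2: "D.bounded_below (toeplitz_disc (\<lambda>z. f (z, \<zeta>) - c)) \<and> D.bounded_below (toeplitz_disc (\<lambda>z. cnj (f (z, \<zeta>) - c)))"
      if "\<zeta> \<in> sphere 0 1" for \<zeta>
      using that fst_iff[OF that] snd_iff[OF that] by simp_all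
    obtain s C where s: "s < 1" "\<And>x. x \<in> bergman_bidisc \<Longrightarrow> bnorm x \<le> C *
        (bnorm (toeplitz_bidisc (\<lambda>p. f p - c) x) + bnorm (\<lambda>p. indicator (cball 0 s \<times> cball 0 s) p * x p))"
      using two_sided_estimate[OF f1 conjunct1[OF b1] conjunct1[OF b2]] by blast
    obtain s' C' where s': "s' < 1" "\<And>x. x \<in> bergman_bidisc \<Longrightarrow> bnorm x \<le> C' *
        (bnorm (toeplitz_bidisc (\<lambda>p. cnj (f p - c)) x) + bnorm (\<lambda>p. indicator (cball 0 s' \<times> cball 0 s') p * x p))"
      using two_sided_estimate[OF f2 conjunct2[OF b1] conjunct2[OF b2]] by blast
    show "c \<notin> essential_spectrum area_bidisc bergman_bidisc (toeplitz_bidisc f)"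
      by (rule B.not_essential_spectrumI[OF B cball_times_sets[OF s(1) s(1)] cball_times_sets[OF s'(1) s'(1)]
            toeplitz_cball_compact[OF s(1)] toeplitz_cball_compact[OF s'(1)] s(2) s'(2)])
  qed
qed

theorem mainTheorem1:
  fixes f :: "complex \<times> complex \<Rightarrow> complex"
  assumes "continuous_on (closure bidisc) f"
  shows "essential_spectrum area_bidisc bergman_bidisc (toeplitz_bidisc f) =
    (\<Union>\<zeta>\<^sub>1\<in>sphere 0 1. op_spectrum area_disc bergman_disc (toeplitz_disc (\<lambda>w. f (\<zeta>\<^sub>1, w)))) \<union>
    (\<Union>\<zeta>\<^sub>2\<in>sphere 0 1. op_spectrum area_disc bergman_disc (toeplitz_disc (\<lambda>z. f (z, \<zeta>\<^sub>2))))"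
proof (rule Set.set_eqI)
  fix c
  show "c \<in> essential_spectrum area_bidisc bergman_bidisc (toeplitz_bidisc f) \<longleftrightarrow> c \<in>
    (\<Union>\<zeta>\<^sub>1\<in>sphere 0 1. op_spectrum area_disc bergman_disc (toeplitz_disc (\<lambda>w. f (\<zeta>\<^sub>1, w)))) \<union>
    (\<Union>\<zeta>\<^sub>2\<in>sphere 0 1. op_spectrum area_disc bergman_disc (toeplitz_disc (\<lambda>z. f (z, \<zeta>\<^sub>2))))"
    unfolding Un_iff UN_iff by (use essential_spectrum_iff_slices[OF assms, of c] in blast)
qed

end
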